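(* Let $1<p<\infty$ and $a<b$ real. If $\gamma^n\rightharpoonup^*\gamma$ in $\mathcal M^+_{\rm loc}(\mathbb R^d)$, $\mu_0^n\rightharpoonup^*\mu_0$ and $\mu_1^n\rightharpoonup^*\mu_1$ in $\mathcal M_{\rm loc}(\mathbb R^d)$, and $\phi^n,\phi\in\mathcal A_p(a,b)$ are such that $\phi^n\le\phi^{n+1}$ for all $n$ and $\phi^n$ converges pointwise to $\phi$, then $$\liminf_{n\to+\infty}\mathcal W_{\phi^n,\gamma^n}(\mu_0^n,\mu_1^n)\ge\mathcal W_{\phi,\gamma}(\mu_0,\mu_1).$$
   Context: Notation. $\mathcal M_{\rm loc}(\mathbb R^d)$, $\mathcal M^+_{\rm loc}(\mathbb R^d)$, $\mathcal M_{\rm loc}(\mathbb R^d;\mathbb R^d)$ are the signed, non-negative, and $\mathbb R^d$-valued Radon measures on $\mathbb R^d$, with the weak* topology (duality with $C_c$); $\rightharpoonup^*$ denotes weak* convergence. Admissible densities: for $1<p<\infty$, $\mathcal A_p$ is the set of l.s.c. proper convex functions $\phi:\mathbb R\times\mathbb R^d\to[0,+\infty]$ such that (F1) for every $\rho$ with $(\{\rho\}\times\mathbb R^d)\cap\mathrm{dom}(\phi)\neq\emptyset$ one has $\phi(\rho,0)=0$ and $\phi(\rho,\lambda w)=|\lambda|^p\phi(\rho,w)$ for all $\lambda\ne0$, $w\in\mathbb R^d$; (F2) there is $\rho_0\in\mathbb R$ with $\{\rho_0\}\times\mathbb R^d\subseteq\mathrm{dom}(\phi)$ and $\phi(\rho_0,w)>0$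 for all $w\neq0$. Here $\mathrm{dom}(\phi)=\{\phi<+\infty\}$. For real $a<b$, $\mathcal A_p(a,b)$ is the set of $\phi\in\mathcal A_p$ with $\mathrm{int}(\mathrm{dom}(\phi))=(a,b)\times\mathbb R^d$. Action functional: the recession function of $\phi$ is $\phi^\infty(y):=\sup\{\phi(x+y)-\phi(x):x\in\mathrm{dom}(\phi)\}$, $y\in\mathbb R\times\mathbb R^d$. Given $\gamma\in\mathcal M^+_{\rm loc}(\mathbb R^d)$, $\mu\in\mathcal M_{\rm loc}(\mathbb R^d)$, $\nu\in\mathcal M_{\rm loc}(\mathbb R^d;\mathbb R^d)$ with supports contained in $\mathrm{supp}(\gamma)$, write the Lebesgue decompositions $\mu=\rho\gamma+\mu^\perp$, $\nu=w\gamma+\nu^\perp$, choose $\sigma\in\mathcal M^+_{\rm loc}(\mathbb R^d)$, singular to $\gamma$, with $\mu^\perp=\rho^\perp\sigma$, $\nu^\perp=w^\perp\sigma$, and set $\Phi(\mu,\nu|\gamma):=\int\phi(\rho,w)\,d\gamma+\int\phi^\infty(\rho^\perp,w^\perp)\,d\sigma$ (independent of $\sigma$). Continuity equation: $\mathcal{CE}(0,T)$ is the set of families $(\mu_t,\nu_t)_{t\in[0,T]}$ with $t\mapsto\mu_t\in\mathcal M_{\rm loc}(\mathbb R^d)$ weakly* continuous on $[0,T]$, $(\nu_t)$ a Borel family in $\mathcal M_{\rm loc}(\mathbb R^d;\mathbb R^d)$, $\int_0^T|\mu_t|(B(0,R))\,dt<\infty$ and $\int_0^T|\nu_t|(B(0,R))\,dt<\infty$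 for all $R>0$, and $\partial_t\mu_t+\mathrm{div}\,\nu_t=0$ in the sense of distributions on $\mathbb R^d\times(0,T)$, i.e. $\int_0^T\int\partial_t\zeta\,d\mu_t\,dt+\int_0^T\int\nabla_x\zeta\cdot d\nu_t\,dt=0$ for all $\zeta\in C^1_c(\mathbb R^d\times(0,T))$. $\mathcal{CE}_{\phi,\gamma}(0,1;\mu^0\to\mu^1)$ is the set of $(\mu,\nu)\in\mathcal{CE}(0,1)$ with $\mu_{t=0}=\mu^0$, $\mu_{t=1}=\mu^1$, supports of $\mu_t,\nu_t$ in $\mathrm{supp}(\gamma)$ for a.e. $t$, and $\int_0^1\Phi(\mu_t,\nu_t|\gamma)\,dt<+\infty$. Distance: $\mathcal W_{\phi,\gamma}(\mu^0,\mu^1):=\inf\big\{\big(\int_0^1\Phi(\mu_t,\nu_t|\gamma)\,dt\big)^{1/p}:(\mu,\nu)\in\mathcal{CE}_{\phi,\gamma}(0,1;\mu^0\to\mu^1)\big\}$, equal to $+\infty$ if this set is empty. *)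

theory Defs
  imports "HOL-Analysis.Analysis"
begin

section \<open>Radon measures\<close>

definition pos_radon :: "'a::euclidean_space measure \<Rightarrow> bool" where
  "pos_radon \<gamma> \<longleftrightarrow> sets \<gamma> = sets borel \<and> (\<forall>K. compact K \<longrightarrow> emeasure \<gamma> K < \<infinity>)"

abbreviation bdd_borel :: "'a::euclidean_space set \<Rightarrow> bool" where
  "bdd_borel A \<equiv> A \<in> sets borel \<and> bounded A"

text \<open>
  A signed or vector-valued Radon measure on the whole space need not have a value on unbounded
  sets. It is therefore a set function on the bounded Borel sets, countably additive there. The
  value \<open>0\<close> elsewhere is only a normalisation: it makes equality of Radon measures the equality
  of HOL functions.
\<close>

definition radon :: "('a::euclidean_space set \<Rightarrow> 'b::euclidean_space) \<Rightarrow> bool" where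
  "radon \<mu> \<longleftrightarrow>
     (\<forall>A. (\<forall>i. A i \<in> sets borel) \<longrightarrow> disjoint_family A \<longrightarrow> bounded (\<Union>i::nat. A i) \<longrightarrow>
        (\<lambda>i. \<mu> (A i)) sums \<mu> (\<Union>i. A i)) \<and>
     (\<forall>A. \<not> bdd_borel A \<longrightarrow> \<mu> A = 0)"

definition total_variation :: "('a::euclidean_space set \<Rightarrow> 'b::euclidean_space) \<Rightarrow> 'a measure" where
  "total_variation \<mu> = measure_of UNIV (sets borel)
     (\<lambda>A. SUP P\<in>{P. finite P \<and> disjoint P \<and> (\<forall>B\<in>P. bdd_borel B \<and> B \<subseteq> A)}.
            \<Sum>B\<in>P. ennreal (norm (\<mu> B)))"

text \<open>
  Positive part of the Jordan decomposition; the negative part is the positive part of \<open>-\<mu>\<close>.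
  Truncation by \<^const>\<open>ennreal\<close> is harmless, as \<open>B = {}\<close> contributes \<open>0\<close> to the supremum.
\<close>

definition jordan_pos :: "('a::euclidean_space set \<Rightarrow> real) \<Rightarrow> 'a measure" where
  "jordan_pos \<mu> = measure_of UNIV (sets borel)
     (\<lambda>A. SUP B\<in>{B. bdd_borel B \<and> B \<subseteq> A}. ennreal (\<mu> B))"

definition signed_integral :: "('a::euclidean_space set \<Rightarrow> real) \<Rightarrow> ('a \<Rightarrow> real) \<Rightarrow> real" where
  "signed_integral \<mu> f = (\<integral>x. f x \<partial>jordan_pos \<mu>) - (\<integral>x. f x \<partial>jordan_pos (\<lambda>A. - \<mu> A))"

definition vector_integral ::
    "('a::euclidean_space set \<Rightarrow> 'b::euclidean_space) \<Rightarrow> ('a \<Rightarrow> 'b) \<Rightarrow> real" where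
  "vector_integral \<nu> F = (\<Sum>i\<in>Basis. signed_integral (\<lambda>A. \<nu> A \<bullet> i) (\<lambda>x. F x \<bullet> i))"

definition msupp :: "'a::euclidean_space measure \<Rightarrow> 'a set" where
  "msupp \<gamma> = {x. \<forall>r>0. emeasure \<gamma> (ball x r) > 0}"

definition Cc :: "('a::euclidean_space \<Rightarrow> real) set" where
  "Cc = {f. continuous_on UNIV f \<and> compact (closure {x. f x \<noteq> 0})}"

definition weak_star_pos :: "(nat \<Rightarrow> 'a::euclidean_space measure) \<Rightarrow> 'a measure \<Rightarrow> bool" where
  "weak_star_pos \<gamma>n \<gamma> \<longleftrightarrow>
     (\<forall>f\<in>Cc. (\<lambda>n. \<integral>x. f x \<partial>\<gamma>n n) \<longlonglongrightarrow> (\<integral>x. f x \<partial>\<gamma>))"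

definition weak_star ::
    "(nat \<Rightarrow> 'a::euclidean_space set \<Rightarrow> real) \<Rightarrow> ('a set \<Rightarrow> real) \<Rightarrow> bool" where
  "weak_star \<mu>n \<mu> \<longleftrightarrow>
     (\<forall>f\<in>Cc. (\<lambda>n. signed_integral (\<mu>n n) f) \<longlonglongrightarrow> signed_integral \<mu> f)"

section \<open>Admissible densities\<close>

definition eff_dom :: "('c \<Rightarrow> ennreal) \<Rightarrow> 'c set" where
  "eff_dom \<phi> = {x. \<phi> x < \<infinity>}"

definition lsc :: "('c::topological_space \<Rightarrow> ennreal) \<Rightarrow> bool" where
  "lsc \<phi> \<longleftrightarrow> (\<forall>x. \<phi> x \<le> Liminf (at x) \<phi>)"

definition convex_fun :: "('c::real_vector \<Rightarrow> ennreal) \<Rightarrow> bool" where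
  "convex_fun \<phi> \<longleftrightarrow> (\<forall>x y. \<forall>t\<in>{0..1}.
     \<phi> ((1 - t) *\<^sub>R x + t *\<^sub>R y) \<le> ennreal (1 - t) * \<phi> x + ennreal t * \<phi> y)"

definition admissible :: "real \<Rightarrow> (real \<times> 'a::euclidean_space \<Rightarrow> ennreal) set" where
  "admissible p = {\<phi>. lsc \<phi> \<and> eff_dom \<phi> \<noteq> {} \<and> convex_fun \<phi> \<and>
     (\<forall>\<rho>. ({\<rho>} \<times> UNIV) \<inter> eff_dom \<phi> \<noteq> {} \<longrightarrow>
        \<phi> (\<rho>, 0) = 0 \<and>
        (\<forall>l w. l \<noteq> 0 \<longrightarrow> \<phi> (\<rho>, l *\<^sub>R w) = ennreal (\<bar>l\<bar> powr p) * \<phi> (\<rho>, w))) \<and>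
     (\<exists>\<rho>0. {\<rho>0} \<times> UNIV \<subseteq> eff_dom \<phi> \<and> (\<forall>w. w \<noteq> 0 \<longrightarrow> \<phi> (\<rho>0, w) > 0))}"

definition admissible_on ::
    "real \<Rightarrow> real \<Rightarrow> real \<Rightarrow> (real \<times> 'a::euclidean_space \<Rightarrow> ennreal) set" where
  "admissible_on p a b = {\<phi> \<in> admissible p. interior (eff_dom \<phi>) = {a<..<b} \<times> UNIV}"

section \<open>Action functional\<close>

definition recession :: "('c::real_vector \<Rightarrow> ennreal) \<Rightarrow> 'c \<Rightarrow> ereal" where
  "recession \<phi> y = (SUP x\<in>eff_dom \<phi>. enn2ereal (\<phi> (x + y)) - enn2ereal (\<phi> x))"

definition locally_integrable ::
    "'a::euclidean_space measure \<Rightarrow> ('a \<Rightarrow> 'b::euclidean_space) \<Rightarrow> bool" where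
  "locally_integrable \<gamma> f \<longleftrightarrow>
     f \<in> borel_measurable borel \<and> (\<forall>K. compact K \<longrightarrow> set_integrable \<gamma> K f)"

definition radon_density ::
    "'a::euclidean_space measure \<Rightarrow> ('a \<Rightarrow> 'b::euclidean_space) \<Rightarrow> 'a set \<Rightarrow> 'b" where
  "radon_density \<gamma> f A = (if bdd_borel A then (LINT x:A|\<gamma>. f x) else 0)"

definition singular_pos ::
    "'a::euclidean_space measure \<Rightarrow> 'a measure \<Rightarrow> bool" where
  "singular_pos \<sigma> \<gamma> \<longleftrightarrow>
     (\<exists>N\<in>sets borel. emeasure \<gamma> N = 0 \<and> emeasure \<sigma> (- N) = 0)"

definition singular_radon ::
    "('a::euclidean_space set \<Rightarrow> 'b::euclidean_space) \<Rightarrow> 'a measure \<Rightarrow> bool" where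
  "singular_radon \<mu> \<gamma> \<longleftrightarrow> singular_pos (total_variation \<mu>) \<gamma>"

definition lebesgue_decomposition ::
    "'a::euclidean_space measure \<Rightarrow> ('a set \<Rightarrow> 'b::euclidean_space) \<Rightarrow>
     ('a \<Rightarrow> 'b) \<Rightarrow> ('a set \<Rightarrow> 'b) \<Rightarrow> bool" where
  "lebesgue_decomposition \<gamma> \<mu> \<rho> \<mu>s \<longleftrightarrow>
     locally_integrable \<gamma> \<rho> \<and> radon \<mu>s \<and> singular_radon \<mu>s \<gamma> \<and>
     \<mu> = (\<lambda>A. radon_density \<gamma> \<rho> A + \<mu>s A)"

definition action_data ::
    "'a::euclidean_space measure \<Rightarrow> ('a set \<Rightarrow> real) \<Rightarrow> ('a set \<Rightarrow> 'a) \<Rightarrow>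
     ('a \<Rightarrow> real) \<Rightarrow> ('a \<Rightarrow> 'a) \<Rightarrow> 'a measure \<Rightarrow> ('a \<Rightarrow> real) \<Rightarrow> ('a \<Rightarrow> 'a) \<Rightarrow> bool" where
  "action_data \<gamma> \<mu> \<nu> \<rho> w \<sigma> \<rho>s ws \<longleftrightarrow>
     (\<exists>\<mu>s \<nu>s. lebesgue_decomposition \<gamma> \<mu> \<rho> \<mu>s \<and> lebesgue_decomposition \<gamma> \<nu> w \<nu>s \<and>
        pos_radon \<sigma> \<and> singular_pos \<sigma> \<gamma> \<and>
        locally_integrable \<sigma> \<rho>s \<and> \<mu>s = radon_density \<sigma> \<rho>s \<and>
        locally_integrable \<sigma> ws \<and> \<nu>s = radon_density \<sigma> ws)"

text \<open>
  The recession function of a nonnegative convex function is nonnegative, so \<^const>\<open>e2ennreal\<close>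
  loses nothing. The value of the action does not depend on the chosen data.
\<close>

definition action ::
    "(real \<times> 'a::euclidean_space \<Rightarrow> ennreal) \<Rightarrow> ('a set \<Rightarrow> real) \<Rightarrow> ('a set \<Rightarrow> 'a) \<Rightarrow>
     'a measure \<Rightarrow> ennreal" where
  "action \<phi> \<mu> \<nu> \<gamma> =
     (let (\<rho>, w, \<sigma>, \<rho>s, ws) = (SOME (\<rho>, w, \<sigma>, \<rho>s, ws). action_data \<gamma> \<mu> \<nu> \<rho> w \<sigma> \<rho>s ws)
      in (\<integral>\<^sup>+x. \<phi> (\<rho> x, w x) \<partial>\<gamma>) + (\<integral>\<^sup>+x. e2ennreal (recession \<phi> (\<rho>s x, ws x)) \<partial>\<sigma>))"

section \<open>Continuity equation and distance\<close>

text \<open>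
  Test functions in \<open>C\<^sup>1\<^sub>c\<close> are extended by \<open>0\<close> to all times; \<open>g\<close> is the spatial gradient and \<open>h\<close>
  the time derivative of \<open>\<zeta>\<close>.
\<close>

definition C1c_test ::
    "real \<Rightarrow> ('a::euclidean_space \<times> real \<Rightarrow> real) \<Rightarrow> ('a \<times> real \<Rightarrow> 'a) \<Rightarrow> ('a \<times> real \<Rightarrow> real) \<Rightarrow> bool"
  where
  "C1c_test T \<zeta> g h \<longleftrightarrow>
     (\<forall>z. (\<zeta> has_derivative (\<lambda>(y, s). g z \<bullet> y + h z * s)) (at z)) \<and>
     continuous_on UNIV g \<and> continuous_on UNIV h \<and>
     compact (closure {z. \<zeta> z \<noteq> 0}) \<and> closure {z. \<zeta> z \<noteq> 0} \<subseteq> UNIV \<times> {0<..<T}"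

definition borel_family :: "real \<Rightarrow> (real \<Rightarrow> 'a::euclidean_space set \<Rightarrow> 'b::euclidean_space) \<Rightarrow> bool"
  where
  "borel_family T \<nu> \<longleftrightarrow>
     (\<forall>A. bdd_borel A \<longrightarrow> (\<lambda>t. \<nu> t A) \<in> borel_measurable (restrict_space borel {0..T}))"

definition CE ::
    "real \<Rightarrow> ((real \<Rightarrow> 'a::euclidean_space set \<Rightarrow> real) \<times> (real \<Rightarrow> 'a set \<Rightarrow> 'a)) set" where
  "CE T = {(\<mu>, \<nu>).
     (\<forall>t\<in>{0..T}. radon (\<mu> t) \<and> radon (\<nu> t)) \<and>
     (\<forall>f\<in>Cc. continuous_on {0..T} (\<lambda>t. signed_integral (\<mu> t) f)) \<and>
     borel_family T \<nu> \<and>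
     (\<forall>R>0. (\<integral>\<^sup>+t\<in>{0..T}. emeasure (total_variation (\<mu> t)) (ball 0 R) \<partial>lborel) < \<infinity>) \<and>
     (\<forall>R>0. (\<integral>\<^sup>+t\<in>{0..T}. emeasure (total_variation (\<nu> t)) (ball 0 R) \<partial>lborel) < \<infinity>) \<and>
     (\<forall>\<zeta> g h. C1c_test T \<zeta> g h \<longrightarrow>
        (LINT t:{0..T}|lborel. signed_integral (\<mu> t) (\<lambda>x. h (x, t))) +
        (LINT t:{0..T}|lborel. vector_integral (\<nu> t) (\<lambda>x. g (x, t))) = 0)}"

definition CE_act ::
    "(real \<times> 'a::euclidean_space \<Rightarrow> ennreal) \<Rightarrow> 'a measure \<Rightarrow> ('a set \<Rightarrow> real) \<Rightarrow> ('a set \<Rightarrow> real) \<Rightarrow>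
     ((real \<Rightarrow> 'a set \<Rightarrow> real) \<times> (real \<Rightarrow> 'a set \<Rightarrow> 'a)) set" where
  "CE_act \<phi> \<gamma> \<mu>0 \<mu>1 = {(\<mu>, \<nu>) \<in> CE 1.
     \<mu> 0 = \<mu>0 \<and> \<mu> 1 = \<mu>1 \<and>
     (AE t in lborel. t \<in> {0..1} \<longrightarrow>
        msupp (total_variation (\<mu> t)) \<subseteq> msupp \<gamma> \<and> msupp (total_variation (\<nu> t)) \<subseteq> msupp \<gamma>) \<and>
     (\<integral>\<^sup>+t\<in>{0..1}. action \<phi> (\<mu> t) (\<nu> t) \<gamma> \<partial>lborel) < \<infinity>}"

text \<open>
  The time integral is finite on \<^const>\<open>CE_act\<close>, so the \<open>p\<close>-th root may be taken in the reals;
  the infimum of the empty set in \<^typ>\<open>ennreal\<close> is \<open>\<infinity>\<close>.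
\<close>

definition W_dist ::
    "real \<Rightarrow> (real \<times> 'a::euclidean_space \<Rightarrow> ennreal) \<Rightarrow> 'a measure \<Rightarrow> ('a set \<Rightarrow> real) \<Rightarrow>
     ('a set \<Rightarrow> real) \<Rightarrow> ennreal" where
  "W_dist p \<phi> \<gamma> \<mu>0 \<mu>1 =
     (INF (\<mu>, \<nu>)\<in>CE_act \<phi> \<gamma> \<mu>0 \<mu>1.
        ennreal (enn2real (\<integral>\<^sup>+t\<in>{0..1}. action \<phi> (\<mu> t) (\<nu> t) \<gamma> \<partial>lborel) powr (1 / p)))"

end

theory Submission
  imports Defs "HOL-Real_Asymp.Real_Asymp"
begin

text \<open>
  A curve of finite \<open>\<phi>\<^sup>n\<close>-action has densities with respect to \<open>\<gamma>\<^sup>n\<close>, because the domain of \<open>\<phi>\<^sup>n\<close> is a bounded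
  strip in \<open>\<rho>\<close> and the recession function is infinite away from \<open>0\<close>. Averaging these densities over the
  cells of a fine partition of unity turns the curve into functions of \<open>(t, x)\<close> that are integrated
  against the fixed measure \<open>\<gamma>\<close>. By Jensen's inequality this raises the action by a factor close to
  \<open>1\<close>, and it changes the pairing with a test function by an error that vanishes in the limit.

  By superlinear growth of \<open>\<phi>\<^sup>0\<close> and a Komlos-type argument, forward convex combinations of the
  averaged densities converge almost everywhere and in \<open>L\<^sup>1\<close>. The continuity equation is linear, hence
  survives; convexity and Fatou's lemma for fixed \<open>\<phi>\<^sup>m\<close>, followed by monotone convergence in \<open>m\<close>, bound
  the action of the limit. The limit is only determined at almost every time. A modulus of continuity of
  \<open>t \<mapsto> \<integral> f d\<mu>\<^sub>t\<close> that is uniform along the sequence makes it weakly* continuous on \<open>[0, 1]\<close>.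
\<close>

section \<open>Convex densities\<close>

text \<open>The densities of different curves refer to different measures
  \<open>\<gamma>n n\<close>, so they can be neither compared pointwise nor combined; only after the
  transfer to \<open>\<gamma>\<close> do convex combinations and almost everywhere limits make
  sense. On cells that \<open>\<gamma>\<close> does not charge there is no usable ratio of masses.
  There, and outside the ball covered by the partition, the constant \<open>(r1, 0)\<close> with a <
  r1 < b is used, at which every \<open>\<phi>n n\<close> vanishes. Strong convergence of
  combinations takes the place of weak compactness: lower semicontinuity of one fixed density then
  passes to the limit by Fatou alone. Combinations of stage k use only indices \<ge> k, so the
  energy and error bounds of stage k survive. The strong convergence itself comes from
  near-minimisers of the integral of \<open>norm (1, u)\<close>, whose strict convexity is made
  quantitative, while superlinear growth excludes concentration. A second obstacle is time: the
  action of a curve is not known to be a measurable function of t, so each estimate in time passes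
  through a measurable minorant of it or through continuity in t.\<close>

definition epi :: "('c::euclidean_space \<Rightarrow> ennreal) \<Rightarrow> ('c \<times> real) set" where
  "epi \<phi> = {(y, r). 0 \<le> r \<and> \<phi> y \<le> ennreal r}"

text \<open>\<open>lsc\<close> is phrased with the punctured filter \<open>at x\<close>; the strict
  inequality at x itself supplies the missing point.\<close>

lemma lsc_eventually:
  assumes "lsc \<phi>" "y < \<phi> x"
  shows "eventually (\<lambda>z. y < \<phi> z) (nhds x)"
proof -
  have "y < Liminf (at x) \<phi>"
    using assms unfolding lsc_def by (meson less_le_trans)
  then have "eventually (\<lambda>z. y < \<phi> z) (at x)"
    by (rule less_LiminfD)
  then show ?thesis
    using assms(2) unfolding eventually_at_filter
    by (auto elim!: eventually_mono)
qed

lemma lsc_liminf: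
  assumes "lsc \<phi>" "(x \<longlongrightarrow> l) F"
  shows "\<phi> l \<le> Liminf F (\<lambda>k. \<phi> (x k))"
  unfolding le_Liminf_iff
proof (intro allI impI)
  fix y assume "y < \<phi> l"
  then have "eventually (\<lambda>z. y < \<phi> z) (nhds l)"
    using assms(1) by (rule lsc_eventually[rotated])
  then show "eventually (\<lambda>k. y < \<phi> (x k)) F"
    using assms(2) by (auto simp: filterlim_iff)
qed

lemma lsc_borel_measurable:
  fixes \<phi> :: "'c::euclidean_space \<Rightarrow> ennreal"
  assumes "lsc \<phi>"
  shows "\<phi> \<in> borel_measurable borel"
proof (rule borel_measurableI_greater)
  fix y
  have "open {x. y < \<phi> x}"
  proof (subst open_subopen, intro ballI)
    fix x assume "x \<in> {x. y < \<phi> x}"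
    then have "eventually (\<lambda>z. y < \<phi> z) (nhds x)" using lsc_eventually[OF assms] by blast
    then show "\<exists>T. open T \<and> x \<in> T \<and> T \<subseteq> {x. y < \<phi> x}"
      unfolding eventually_nhds by (metis mem_Collect_eq subsetI)
  qed
  then show "{x \<in> space borel. y < \<phi> x} \<in> sets borel"
    by simp
qed

lemma closed_epi:
  assumes "lsc \<phi>"
  shows "closed (epi \<phi>)"
  unfolding closed_sequential_limits
proof (intro allI impI, elim conjE)
  fix x l assume x: "\<forall>n. x n \<in> epi \<phi>" and lim: "x \<longlonglongrightarrow> l"
  have f: "(\<lambda>n. fst (x n)) \<longlonglongrightarrow> fst l" and s: "(\<lambda>n. snd (x n)) \<longlonglongrightarrow> snd l"
    using lim by (auto intro: tendsto_intros)
  have nn: "0 \<le> snd (x n)" and le: "\<phi> (fst (x n)) \<le> ennreal (snd (x n))" for n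
    using x[rule_format, of n] by (auto simp: epi_def split: prod.splits)
  have "0 \<le> snd l"
    using s nn by (meson LIMSEQ_le_const)
  moreover have "\<phi> (fst l) \<le> ennreal (snd l)"
  proof -
    have "\<phi> (fst l) \<le> liminf (\<lambda>n. \<phi> (fst (x n)))"
      by (rule lsc_liminf[OF assms f])
    also have "\<dots> \<le> liminf (\<lambda>n. ennreal (snd (x n)))"
      by (intro Liminf_mono) (auto simp: le)
    also have "\<dots> = ennreal (snd l)"
      by (intro lim_imp_Liminf tendsto_ennrealI s) auto
    finally show ?thesis .
  qed
  ultimately show "l \<in> epi \<phi>"
    by (auto simp: epi_def split: prod.splits)
qed

text \<open>The clause \<open>0 \<le> r\<close> in \<open>epi\<close> matters here:
  \<open>ennreal\<close> sends every negative r to 0, so without it negative half-lines over the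
  zeros of \<open>\<phi>\<close> would enter the set and convexity could fail.\<close>

lemma convex_epi:
  assumes "convex_fun \<phi>"
  shows "convex (epi \<phi>)"
  unfolding convex_alt
proof (intro ballI allI impI)
  fix x y and u :: real assume xy: "x \<in> epi \<phi>" "y \<in> epi \<phi>" and u: "0 \<le> u \<and> u \<le> 1"
  have nn: "0 \<le> snd x" "0 \<le> snd y" and le: "\<phi> (fst x) \<le> ennreal (snd x)" "\<phi> (fst y) \<le> ennreal (snd y)"
    using xy by (auto simp: epi_def)
  have "\<phi> ((1 - u) *\<^sub>R fst x + u *\<^sub>R fst y) \<le> ennreal (1 - u) * \<phi> (fst x) + ennreal u * \<phi> (fst y)"
    using assms u by (auto simp: convex_fun_def)
  also have "\<dots> \<le> ennreal (1 - u) * ennreal (snd x) + ennreal u * ennreal (snd y)"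
    by (intro add_mono mult_left_mono le) auto
  also have "\<dots> = ennreal ((1 - u) * snd x + u * snd y)"
    using u nn by (simp add: ennreal_mult ennreal_plus)
  finally show "(1 - u) *\<^sub>R x + u *\<^sub>R y \<in> epi \<phi>"
    using u nn by (simp add: epi_def case_prod_beta)
qed

text \<open>Two-point convexity becomes convexity of the set \<open>epi \<phi>\<close>, where finite
  combinations are available. The detour needs finite values, so an infinite value with positive
  weight is treated first.\<close>

lemma convex_fun_sum:
  fixes \<phi> :: "'c::euclidean_space \<Rightarrow> ennreal"
  assumes "convex_fun \<phi>" "finite J" "\<And>j. j \<in> J \<Longrightarrow> 0 \<le> l j" "sum l J = 1"
  shows "\<phi> (\<Sum>j\<in>J. l j *\<^sub>R c j) \<le> (\<Sum>j\<in>J. ennreal (l j) * \<phi> (c j))"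
proof (cases "\<exists>j\<in>J. 0 < l j \<and> \<phi> (c j) = \<infinity>")
  case True
  then obtain j where j: "j \<in> J" "0 < l j" "\<phi> (c j) = \<infinity>" by blast
  then have "ennreal (l j) * \<phi> (c j) = \<infinity>"
    by (simp add: ennreal_mult_top)
  then have "(\<Sum>j\<in>J. ennreal (l j) * \<phi> (c j)) = \<infinity>"
    using member_le_sum[of j J "\<lambda>j. ennreal (l j) * \<phi> (c j)"] j(1) assms(2)
    by (simp add: top_unique)
  then show ?thesis by simp
next
  case False
  \<comment> \<open>Indices of weight 0 are dropped: their value may be infinite, which gives no
    point of \<open>epi \<phi>\<close>, while 0 times infinity is 0 in
    \<open>ennreal\<close>.\<close>
  define J' where "J' = {j\<in>J. 0 < l j}"
  have J': "finite J'" "J' \<subseteq> J" "\<And>j. j \<in> J - J' \<Longrightarrow> l j = 0"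
    using assms by (auto simp: J'_def less_eq_real_def)
  have fin: "\<phi> (c j) = ennreal (enn2real (\<phi> (c j)))" if "j \<in> J'" for j
    using False that by (auto simp: J'_def less_top)
  have s1: "sum l J' = 1"
    using assms J' by (metis sum.mono_neutral_right)
  have "(\<Sum>j\<in>J'. l j *\<^sub>R (c j, enn2real (\<phi> (c j)))) \<in> epi \<phi>"
  proof (rule convex_sum[OF J'(1) convex_epi[OF assms(1)] s1])
    fix j assume "j \<in> J'"
    then show "0 \<le> l j" "(c j, enn2real (\<phi> (c j))) \<in> epi \<phi>"
      using fin[of j] by (auto simp: J'_def epi_def)
  qed
  then have "\<phi> (\<Sum>j\<in>J'. l j *\<^sub>R c j) \<le> ennreal (\<Sum>j\<in>J'. l j * enn2real (\<phi> (c j)))"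
    by (auto simp: epi_def sum_prod)
  also have "\<dots> = (\<Sum>j\<in>J'. ennreal (l j * enn2real (\<phi> (c j))))"
    by (rule sum_ennreal[symmetric]) (auto simp: J'_def)
  also have "\<dots> = (\<Sum>j\<in>J'. ennreal (l j) * \<phi> (c j))"
    by (intro sum.cong refl) (use fin in \<open>auto simp: ennreal_mult' J'_def\<close>)
  also have "\<dots> = (\<Sum>j\<in>J. ennreal (l j) * \<phi> (c j))"
    using J' assms(2) by (intro sum.mono_neutral_left) auto
  also have "(\<Sum>j\<in>J'. l j *\<^sub>R c j) = (\<Sum>j\<in>J. l j *\<^sub>R c j)"
    using J' assms(2) by (intro sum.mono_neutral_left) auto
  finally show ?thesis .
qed

text \<open>The weighted mean of the pairs \<open>(u x, \<phi> (u x))\<close> lies in the closed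
  convex set \<open>epi \<phi>\<close>: otherwise a hyperplane separates it strictly, and
  integrating the separating inequality against \<theta> gives a contradiction. The total weight
  stays as a factor because it becomes the mass of a cell.\<close>

lemma Jensen_weighted:
  fixes \<phi> :: "'c::euclidean_space \<Rightarrow> ennreal" and u :: "'x \<Rightarrow> 'c"
  assumes \<phi>: "lsc \<phi>" "convex_fun \<phi>"
    and \<theta>: "integrable M \<theta>" "\<And>x. 0 \<le> \<theta> x" and g: "0 < (\<integral>x. \<theta> x \<partial>M)"
    and u: "u \<in> borel_measurable M" "integrable M (\<lambda>x. \<theta> x *\<^sub>R u x)"
  shows "ennreal (\<integral>x. \<theta> x \<partial>M) * \<phi> ((1 / (\<integral>x. \<theta> x \<partial>M)) *\<^sub>R (\<integral>x. \<theta> x *\<^sub>R u x \<partial>M))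
    \<le> (\<integral>\<^sup>+x. ennreal (\<theta> x) * \<phi> (u x) \<partial>M)"
proof (cases "(\<integral>\<^sup>+x. ennreal (\<theta> x) * \<phi> (u x) \<partial>M) = \<infinity>")
  case False
  note [measurable] = lsc_borel_measurable[OF \<phi>(1)] u(1) borel_measurable_integrable[OF \<theta>(1)]
  let ?g = "\<integral>x. \<theta> x \<partial>M"
  define r where "r x = enn2real (\<phi> (u x))" for x
  have "AE x in M. ennreal (\<theta> x) * \<phi> (u x) \<noteq> \<infinity>"
    using False by (intro nn_integral_PInf_AE) auto
  then have ae: "AE x in M. 0 < \<theta> x \<longrightarrow> \<phi> (u x) = ennreal (r x)"
    by eventually_elim (auto simp: r_def ennreal_mult_eq_top_iff less_top)
  have eq: "(\<integral>\<^sup>+x. ennreal (\<theta> x) * \<phi> (u x) \<partial>M) = (\<integral>\<^sup>+x. ennreal (\<theta> x * r x) \<partial>M)"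
  proof (intro nn_integral_cong_AE, use ae in eventually_elim)
    fix x assume "0 < \<theta> x \<longrightarrow> \<phi> (u x) = ennreal (r x)"
    then show "ennreal (\<theta> x) * \<phi> (u x) = ennreal (\<theta> x * r x)"
      using \<theta>(2)[of x] by (cases "\<theta> x = 0") (auto simp: ennreal_mult r_def)
  qed
  have [measurable]: "r \<in> borel_measurable M" unfolding r_def by measurable
  have rn: "0 \<le> r x" for x by (simp add: r_def)
  have int: "integrable M (\<lambda>x. \<theta> x * r x)"
    by (rule integrableI_nonneg) (use False \<theta>(2) eq in \<open>auto simp: less_top r_def\<close>)
  have eq2: "(\<integral>\<^sup>+x. ennreal (\<theta> x) * \<phi> (u x) \<partial>M) = ennreal (\<integral>x. \<theta> x * r x \<partial>M)"
    unfolding eq by (intro nn_integral_eq_integral int) (auto simp: \<theta>(2) rn)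
  define m where "m = ((1 / ?g) *\<^sub>R (\<integral>x. \<theta> x *\<^sub>R u x \<partial>M), (1 / ?g) * (\<integral>x. \<theta> x * r x \<partial>M))"
  have "m \<in> epi \<phi>"
  proof (rule ccontr)
    assume "m \<notin> epi \<phi>"
    then obtain a b where ab: "a \<bullet> m < b" "\<And>s. s \<in> epi \<phi> \<Longrightarrow> b < a \<bullet> s"
      using separating_hyperplane_closed_point[OF convex_epi[OF \<phi>(2)] closed_epi[OF \<phi>(1)]] by metis
    obtain a1 a2 where a: "a = (a1, a2)" by fastforce
    \<comment> \<open>The separating inequality at \<open>(u x, r x)\<close>, multiplied by
      \<open>\<theta> x\<close> and integrated. Where \<theta> vanishes \<open>\<phi> (u x)\<close>
      may be infinite, but the integrand is 0.\<close>
    have "0 \<le> (\<integral>x. a1 \<bullet> (\<theta> x *\<^sub>R u x) + a2 * (\<theta> x * r x) - b * \<theta> x \<partial>M)"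
    proof (rule integral_nonneg_AE, use ae in eventually_elim)
      fix x assume x: "0 < \<theta> x \<longrightarrow> \<phi> (u x) = ennreal (r x)"
      show "0 \<le> a1 \<bullet> (\<theta> x *\<^sub>R u x) + a2 * (\<theta> x * r x) - b * \<theta> x"
      proof (cases "0 < \<theta> x")
        case True
        then have "(u x, r x) \<in> epi \<phi>" using x rn by (auto simp: epi_def)
        then have "b < a1 \<bullet> u x + a2 * r x" using ab(2) a by fastforce
        then have "0 \<le> \<theta> x * (a1 \<bullet> u x + a2 * r x - b)" using True by simp
        then show ?thesis by (simp add: algebra_simps)
      qed (use \<theta>(2)[of x] in auto)
    qed
    also have "\<dots> = a1 \<bullet> (\<integral>x. \<theta> x *\<^sub>R u x \<partial>M) + a2 * (\<integral>x. \<theta> x * r x \<partial>M) - b * ?g"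
      using u(2) int \<theta>(1) integrable_inner_right[of a1, OF u(2)] integral_inner_right[of a1, OF u(2)]
      by (subst Bochner_Integration.integral_diff, force, force,
          subst Bochner_Integration.integral_add) auto
    also have "\<dots> = ?g * (a \<bullet> m - b)"
      using g by (simp add: m_def a algebra_simps)
    finally show False using ab(1) g by (simp add: zero_le_mult_iff)
  qed
  then have "\<phi> ((1 / ?g) *\<^sub>R (\<integral>x. \<theta> x *\<^sub>R u x \<partial>M)) \<le> ennreal ((1 / ?g) * (\<integral>x. \<theta> x * r x \<partial>M))"
    by (auto simp: epi_def m_def)
  then have "ennreal ?g * \<phi> ((1 / ?g) *\<^sub>R (\<integral>x. \<theta> x *\<^sub>R u x \<partial>M))
      \<le> ennreal ?g * ennreal ((1 / ?g) * (\<integral>x. \<theta> x * r x \<partial>M))"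
    by (rule mult_left_mono) simp
  also have "\<dots> = (\<integral>\<^sup>+x. ennreal (\<theta> x) * \<phi> (u x) \<partial>M)"
    using g unfolding eq2 by (subst ennreal_mult'[symmetric]) auto
  finally show ?thesis .
qed simp

section \<open>Growth and recession function of admissible densities\<close>

lemma admissible_onD:
  assumes "\<phi> \<in> admissible_on p a b"
  shows "lsc \<phi>" "convex_fun \<phi>" "interior (eff_dom \<phi>) = {a<..<b} \<times> UNIV"
    "\<And>r v l. \<phi> (r, v) < \<infinity> \<Longrightarrow> l \<noteq> 0 \<Longrightarrow> \<phi> (r, l *\<^sub>R v) = ennreal (\<bar>l\<bar> powr p) * \<phi> (r, v)"
    "\<And>r v. \<phi> (r, v) < \<infinity> \<Longrightarrow> \<phi> (r, 0) = 0"
proof -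
  show "lsc \<phi>" "convex_fun \<phi>" "interior (eff_dom \<phi>) = {a<..<b} \<times> UNIV"
    using assms by (auto simp: admissible_on_def admissible_def)
  have *: "\<phi> (r, 0) = 0 \<and> (\<forall>l w. l \<noteq> 0 \<longrightarrow> \<phi> (r, l *\<^sub>R w) = ennreal (\<bar>l\<bar> powr p) * \<phi> (r, w))"
    if "\<phi> (r, v) < \<infinity>" for r v
  proof -
    have "({r} \<times> UNIV) \<inter> eff_dom \<phi> \<noteq> {}" using that by (auto simp: eff_dom_def)
    then show ?thesis using assms unfolding admissible_on_def admissible_def by blast
  qed
  show "\<phi> (r, 0) = 0" if "\<phi> (r, v) < \<infinity>" for r v using *[OF that] by blast
  show "\<phi> (r, l *\<^sub>R v) = ennreal (\<bar>l\<bar> powr p) * \<phi> (r, v)"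
    if "\<phi> (r, v) < \<infinity>" "l \<noteq> 0" for r v l using *[OF that(1)] that(2) by blast
qed

lemma convex_eff_dom:
  assumes "convex_fun \<phi>"
  shows "convex (eff_dom \<phi>)"
  unfolding convex_alt
proof (intro ballI allI impI)
  fix x y and u :: real assume "x \<in> eff_dom \<phi>" "y \<in> eff_dom \<phi>" "0 \<le> u \<and> u \<le> 1"
  then have "\<phi> ((1 - u) *\<^sub>R x + u *\<^sub>R y) \<le> ennreal (1 - u) * \<phi> x + ennreal u * \<phi> y"
    "ennreal (1 - u) * \<phi> x + ennreal u * \<phi> y < \<infinity>"
    using assms by (auto simp: convex_fun_def eff_dom_def ennreal_mult_less_top)
  then show "(1 - u) *\<^sub>R x + u *\<^sub>R y \<in> eff_dom \<phi>"
    by (auto simp: eff_dom_def intro: le_less_trans)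
qed

context
  fixes \<phi> :: "real \<times> 'a::euclidean_space \<Rightarrow> ennreal" and p a b :: real
  assumes adm: "\<phi> \<in> admissible_on p a b" and p: "1 < p" and ab: "a < b"
begin

text \<open>A convex set with nonempty interior has the same closure as its interior, so knowing the
  interior already confines the whole domain to the closed strip.\<close>

lemma eff_dom_subset: "eff_dom \<phi> \<subseteq> {a..b} \<times> UNIV"
proof -
  have "interior (eff_dom \<phi>) \<noteq> {}"
    using ab by (simp add: admissible_onD(3)[OF adm])
  then have "closure (interior (eff_dom \<phi>)) = closure (eff_dom \<phi>)"
    using convex_closure_interior convex_eff_dom admissible_onD(2)[OF adm] by blast
  then have "closure (eff_dom \<phi>) = {a..b} \<times> UNIV"
    using ab by (simp add: admissible_onD(3)[OF adm] closure_Times)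
  then show ?thesis using closure_subset by blast
qed

lemma admissible_interior:
  assumes "a < r" "r < b"
  shows "\<phi> (r, v) < \<infinity>" "\<phi> (r, 0) = 0"
proof -
  have "(r, v) \<in> interior (eff_dom \<phi>)"
    using assms by (simp add: admissible_onD(3)[OF adm])
  then show *: "\<phi> (r, v) < \<infinity>"
    using interior_subset by (fastforce simp: eff_dom_def)
  then show "\<phi> (r, 0) = 0"
    by (rule admissible_onD(5)[OF adm])
qed

text \<open>Positivity is assumed at a single \<open>r0\<close> only. A zero (r, w) with w \<noteq>
  0 would spread by homogeneity to all multiples of w, by convexity to points (r0 + t (r - r0), w)
  with t > 0, and by lower semicontinuity as t tends to 0 to (r0, w).\<close>

lemma admissible_pos:
  assumes r: "a < r" "r < b" and w: "w \<noteq> 0"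
  shows "0 < \<phi> (r, w)"
proof (rule ccontr)
  assume "\<not> 0 < \<phi> (r, w)"
  then have 0: "\<phi> (r, w) = 0" by (simp add: zero_less_iff_neq_zero)
  obtain r0 where r0: "{r0} \<times> UNIV \<subseteq> eff_dom \<phi>" "\<And>w. w \<noteq> 0 \<Longrightarrow> 0 < \<phi> (r0, w)"
    using adm unfolding admissible_on_def admissible_def by blast
  have r00: "\<phi> (r0, 0) = 0"
    using r0(1) admissible_onD(5)[OF adm, of r0 0] by (auto simp: eff_dom_def)
  define t where "t k = 1 / (real k + 1)" for k :: nat
  have t: "0 < t k" "t k \<le> 1" "t k \<noteq> 0" for k by (auto simp: t_def)
  have le: "\<phi> (r0 + t k * (r - r0), w) \<le> 0" for k
  proof -
    \<comment> \<open>Stretching w by \<open>1 / t k\<close> keeps the second component of the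
      combination equal to w for every k.\<close>
    have e: "(r0 + t k * (r - r0), w) = (1 - t k) *\<^sub>R (r0, 0) + t k *\<^sub>R (r, (1 / t k) *\<^sub>R w)"
      using t(3)[of k] by (simp add: algebra_simps)
    have "\<phi> (r0 + t k * (r - r0), w) \<le> ennreal (1 - t k) * \<phi> (r0, 0) + ennreal (t k) * \<phi> (r, (1 / t k) *\<^sub>R w)"
      unfolding e using admissible_onD(2)[OF adm] t[of k] unfolding convex_fun_def
      by (meson atLeastAtMost_iff less_imp_le)
    also have "\<phi> (r, (1 / t k) *\<^sub>R w) = 0"
      by (subst admissible_onD(4)[OF adm]) (use t(3)[of k] 0 in auto)
    finally show ?thesis by (simp add: r00)
  qed
  have "(\<lambda>k. (r0 + t k * (r - r0), w)) \<longlonglongrightarrow> (r0 + 0 * (r - r0), w)"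
    unfolding t_def using LIMSEQ_inverse_real_of_nat
    by (intro tendsto_intros) (simp add: inverse_eq_divide add.commute)
  then have "\<phi> (r0 + 0 * (r - r0), w) \<le> liminf (\<lambda>k. \<phi> (r0 + t k * (r - r0), w))"
    by (rule lsc_liminf[OF admissible_onD(1)[OF adm]])
  also have "\<dots> \<le> 0"
    using le by (intro Liminf_le) auto
  finally show False using r0(2)[OF w] by simp
qed

text \<open>At the midpoint r1 the bound follows from positivity, lower semicontinuity and
  compactness of the unit sphere. Any other r is compared with r1 by convexity along a segment whose
  far end (r2, 0) is a zero of \<open>\<phi>\<close>.\<close>

lemma admissible_growth: "\<exists>c>0. \<forall>r v. ennreal (c * norm v powr p) \<le> \<phi> (r, v)"
proof -
  define r1 where "r1 = (a + b) / 2"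
  have r1: "a < r1" "r1 < b" using ab by (auto simp: r1_def)
  have "\<exists>c>0. \<forall>w. norm w = 1 \<longrightarrow> ennreal c \<le> \<phi> (r1, w)"
  proof (rule ccontr)
    assume "\<not> ?thesis"
    then have "\<exists>w. norm w = 1 \<and> \<phi> (r1, w) < ennreal (1 / (real k + 1))" for k :: nat
      by (metis add_nonneg_pos not_le of_nat_0_le_iff zero_less_divide_1_iff zero_less_one)
    then obtain w where w: "\<And>k. norm (w k) = 1" "\<And>k. \<phi> (r1, w k) < ennreal (1 / (real k + 1))"
      by metis
    have "compact (sphere 0 1 :: 'a set)" by simp
    then obtain l s where l: "l \<in> sphere 0 1" and s: "strict_mono s" "(w \<circ> s) \<longlonglongrightarrow> l"
      unfolding compact_def using w(1) by (metis mem_sphere_0)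
    have "(\<lambda>k. (r1, w (s k))) \<longlonglongrightarrow> (r1, l)"
      using s(2) by (intro tendsto_intros) (simp add: o_def)
    then have "\<phi> (r1, l) \<le> liminf (\<lambda>k. \<phi> (r1, w (s k)))"
      by (rule lsc_liminf[OF admissible_onD(1)[OF adm]])
    also have "\<dots> \<le> liminf (\<lambda>k. ennreal (1 / (real (s k) + 1)))"
      by (intro Liminf_mono always_eventually allI less_imp_le w(2))
    also have "\<dots> = ennreal 0"
    proof (intro lim_imp_Liminf tendsto_ennrealI)
      have "(\<lambda>k. 1 / (real k + 1)) \<longlonglongrightarrow> 0"
        using LIMSEQ_inverse_real_of_nat by (simp add: inverse_eq_divide add.commute)
      then show "(\<lambda>k. 1 / (real (s k) + 1)) \<longlonglongrightarrow> 0"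
        using LIMSEQ_subseq_LIMSEQ[OF _ s(1)] by (fastforce simp: o_def)
    qed auto
    finally show False using admissible_pos[OF r1, of l] l by fastforce
  qed
  then obtain c where c: "c > 0" "\<And>w. norm w = 1 \<Longrightarrow> ennreal c \<le> \<phi> (r1, w)" by blast
  \<comment> \<open>Obtained from \<open>\<phi> (r1, v / 3) \<le> \<phi> (r, v) / 3\<close> and
    \<open>\<phi> (r1, v / 3) \<ge> c * (norm v / 3) powr p\<close>.\<close>
  define d where "d = 3 * (1 / 3) powr p * c"
  have "ennreal (d * norm v powr p) \<le> \<phi> (r, v)" for r v
  proof (cases "v = 0 \<or> \<phi> (r, v) = \<infinity>")
    case False
    then have v: "v \<noteq> 0" and fin: "\<phi> (r, v) < \<infinity>" by (auto simp: less_top)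
    have r: "a \<le> r" "r \<le> b" using eff_dom_subset fin by (auto simp: eff_dom_def)
    \<comment> \<open>The solution of r1 = r / 3 + 2 r2 / 3. Its distance from r1 is half that of r,
      so it lies in the open interval even when r is an end point.\<close>
    define r2 where "r2 = (3 * r1 - r) / 2"
    have r2: "a < r2" "r2 < b" using r ab by (auto simp: r2_def r1_def field_simps)
    have e: "(r1, (1 / 3) *\<^sub>R v) = (1 - 2/3) *\<^sub>R (r, v) + (2/3) *\<^sub>R (r2, 0)"
      by (simp add: r2_def field_simps)
    have "\<phi> (r1, (1 / 3) *\<^sub>R v) \<le> ennreal (1 - 2/3) * \<phi> (r, v) + ennreal (2/3) * \<phi> (r2, 0)"
      unfolding e using admissible_onD(2)[OF adm] unfolding convex_fun_def
      by (elim allE[of _ "(r, v)"] allE[of _ "(r2, 0)"] ballE[of _ _ "2/3"]) simp_all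
    then have 1: "\<phi> (r1, (1 / 3) *\<^sub>R v) \<le> ennreal (1/3) * \<phi> (r, v)"
      using admissible_interior(2)[OF r2] by simp
    define n where "n = norm v"
    have n: "n > 0" using v by (simp add: n_def)
    have e2: "(1 / 3) *\<^sub>R v = (n / 3) *\<^sub>R ((1 / n) *\<^sub>R v)" using n by simp
    have "ennreal ((n / 3) powr p * c) \<le> ennreal (\<bar>n / 3\<bar> powr p) * \<phi> (r1, (1 / n) *\<^sub>R v)"
      using n v c by (subst ennreal_mult) (auto intro!: mult_left_mono c(2) simp: n_def)
    also have "\<dots> = \<phi> (r1, (1 / 3) *\<^sub>R v)"
      unfolding e2 using n admissible_interior(1)[OF r1]
      by (intro admissible_onD(4)[OF adm, symmetric]) auto
    finally have "ennreal 3 * ennreal ((n / 3) powr p * c) \<le> ennreal 3 * (ennreal (1/3) * \<phi> (r, v))"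
      using 1 by (intro mult_left_mono) auto
    also have "\<dots> = \<phi> (r, v)"
      by (simp add: mult.assoc[symmetric] ennreal_mult'[symmetric] flip: ennreal_numeral)
    also have "ennreal 3 * ennreal ((n / 3) powr p * c) = ennreal (d * n powr p)"
      using n c by (subst ennreal_mult[symmetric]) (auto simp: d_def powr_divide)
    finally show ?thesis by (simp add: n_def)
  qed auto
  moreover have "d > 0" using c by (simp add: d_def)
  ultimately show ?thesis by blast
qed

text \<open>In the second variable p > 1 gives superlinear growth, and the first variable is bounded
  on the domain. This plays the role of uniform integrability in all compactness arguments
  below.\<close>

lemma admissible_superlinear:
  assumes e: "0 < e"
  shows "\<exists>K\<ge>0. \<forall>z. ennreal (norm z) \<le> ennreal e * \<phi> z + ennreal K"
proof -
  obtain c where c: "c > 0" "\<And>r v. ennreal (c * norm v powr p) \<le> \<phi> (r, v)"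
    using admissible_growth by blast
  \<comment> \<open>V solves \<open>e * c * V powr (p - 1) = 1\<close>; beyond V the power term
    dominates the norm.\<close>
  define V where "V = (1 / (e * c)) powr (1 / (p - 1))"
  define K where "K = max \<bar>a\<bar> \<bar>b\<bar> + V"
  have K: "0 \<le> K" by (auto simp: K_def V_def intro!: add_nonneg_nonneg)
  have small: "n \<le> e * (c * n powr p) + V" if "0 \<le> n" for n
  proof (cases "n \<le> V")
    case True
    then show ?thesis using e c by (simp add: add_increasing)
  next
    case False
    have V: "0 < V" using e c by (simp add: V_def)
    have "1 / (e * c) = V powr (p - 1)"
      using p e c by (simp add: V_def powr_powr)
    also have "\<dots> \<le> n powr (p - 1)"
      using False p V by (intro powr_mono2) auto
    finally have "1 \<le> e * c * n powr (p - 1)"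
      using e c by (simp add: field_simps)
    then have "n * 1 \<le> n * (e * c * n powr (p - 1))"
      using that by (rule mult_left_mono)
    also have "\<dots> = e * (c * n powr p)"
      using False V by (simp add: powr_diff field_simps)
    finally show ?thesis using V by simp
  qed
  have "ennreal (norm (r, v)) \<le> ennreal e * \<phi> (r, v) + ennreal K" for r v
  proof (cases "\<phi> (r, v) = \<infinity>")
    case True
    then show ?thesis using e by (simp add: ennreal_mult_top)
  next
    case False
    then have "a \<le> r" "r \<le> b" using eff_dom_subset by (auto simp: eff_dom_def less_top)
    then have "norm (r, v) \<le> max \<bar>a\<bar> \<bar>b\<bar> + norm v"
      using norm_Pair_le[of r v] by simp
    also have "\<dots> \<le> e * (c * norm v powr p) + K"
      using small[of "norm v"] by (simp add: K_def)
    finally have "ennreal (norm (r, v)) \<le> ennreal (e * (c * norm v powr p) + K)"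
      by (rule ennreal_leI)
    also have "\<dots> = ennreal e * ennreal (c * norm v powr p) + ennreal K"
      using e c K by (simp add: ennreal_mult ennreal_plus)
    also have "\<dots> \<le> ennreal e * \<phi> (r, v) + ennreal K"
      by (intro add_mono mult_left_mono c(2)) auto
    finally show ?thesis .
  qed
  then show ?thesis using K by (intro exI[of _ K]) auto
qed

lemma recession_zero: "recession \<phi> 0 = 0"
proof -
  have "eff_dom \<phi> \<noteq> {}" using adm by (auto simp: admissible_on_def admissible_def)
  moreover have "enn2ereal (\<phi> x) - enn2ereal (\<phi> x) = 0" if "x \<in> eff_dom \<phi>" for x
    using that by (cases "\<phi> x") (auto simp: eff_dom_def enn2ereal_ennreal)
  ultimately show ?thesis by (simp add: recession_def)
qed

text \<open>Bounded densities together with \<open>p > 1\<close> make the recession function degenerate, so finite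
  action forces absolute continuity.\<close>

lemma recession_infinite:
  assumes "y \<noteq> 0"
  shows "recession \<phi> y = \<infinity>"
proof -
  obtain s v where y: "y = (s, v)" by fastforce
  define r1 where "r1 = (a + b) / 2"
  have r1: "a < r1" "r1 < b" using ab by (auto simp: r1_def)
  show ?thesis
  proof (cases "s = 0")
    case False
    \<comment> \<open>A base point within |s| / 2 of the end of the strip towards which s points, so
      that r + s leaves the closed strip.\<close>
    define r where "r = (if s > 0 then max r1 (b - s / 2) else min r1 (a - s / 2))"
    have r: "a < r" "r < b" "r + s < a \<or> b < r + s"
      using r1 False by (auto simp: r_def)
    have "(r, 0) \<in> eff_dom \<phi>" using admissible_interior[OF r(1,2)] by (auto simp: eff_dom_def)
    moreover have "\<phi> ((r, 0) + y) = \<infinity>"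
      using eff_dom_subset r(3) by (auto simp: y eff_dom_def less_top)
    moreover have "\<phi> (r, 0) = 0" using admissible_interior[OF r(1,2)] by simp
    ultimately have "enn2ereal \<infinity> - enn2ereal 0 \<le> recession \<phi> y"
      unfolding recession_def by (metis (mono_tags, lifting) SUP_upper)
    then show ?thesis by simp
  next
    case True
    then have v: "v \<noteq> 0" using assms y by (simp add: zero_prod_def)
    obtain f where f: "\<phi> (r1, v) = ennreal f" "0 < f"
      using admissible_pos[OF r1 v] admissible_interior(1)[OF r1, of v]
      by (cases "\<phi> (r1, v)") (auto simp: ennreal_less_zero_iff)
    have hom: "\<phi> (r1, l *\<^sub>R v) = ennreal (l powr p * f)" if "l > 0" for l
      using admissible_onD(4)[OF adm admissible_interior(1)[OF r1], of l v] that f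
      by (simp add: ennreal_mult')
    \<comment> \<open>Along the ray through v the increment of \<open>\<phi>\<close> from l to l + 1
      is at least \<open>l powr (p - 1) * f\<close>, which exceeds B once l is large.\<close>
    have "ereal B \<le> recession \<phi> y" for B
    proof -
      define l where "l = max 1 ((\<bar>B\<bar> / f) powr (1 / (p - 1)))"
      have l: "1 \<le> l" by (simp add: l_def)
      have "\<bar>B\<bar> / f = ((\<bar>B\<bar> / f) powr (1 / (p - 1))) powr (p - 1)"
        using p f by (cases "B = 0") (auto simp: powr_powr)
      also have "\<dots> \<le> l powr (p - 1)"
        using p by (intro powr_mono2) (auto simp: l_def)
      finally have B: "B \<le> l powr (p - 1) * f" using f by (simp add: field_simps)
      have "l powr p + l powr (p - 1) = (l + 1) * l powr (p - 1)"
        using l by (simp add: powr_diff field_simps)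
      also have "\<dots> \<le> (l + 1) * (l + 1) powr (p - 1)"
        using l p by (intro mult_left_mono powr_mono2) auto
      also have "\<dots> = (l + 1) powr p" using l by (simp add: powr_diff field_simps)
      finally have "B \<le> (l + 1) powr p * f - l powr p * f"
        using B f by (smt (verit) mult_right_mono distrib_right)
      then have "ereal B \<le> enn2ereal (\<phi> ((r1, l *\<^sub>R v) + y)) - enn2ereal (\<phi> (r1, l *\<^sub>R v))"
        using hom[of "l + 1"] hom[of l] l f
        by (simp add: y True algebra_simps enn2ereal_ennreal)
      also have "\<dots> \<le> recession \<phi> y"
        unfolding recession_def using admissible_interior(1)[OF r1]
        by (intro SUP_upper) (auto simp: eff_dom_def)
      finally show ?thesis .
    qed
    then show ?thesis by (rule ereal_top)
  qed
qed

end

section \<open>Radon measures\<close>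

text \<open>The class of integrands for set functions that know bounded sets only. It contains the
  indicators of bounded Borel sets as well as \<open>Cc\<close>, so measurability proofs and test
  functions share one theory.\<close>

definition bbs :: "('a::euclidean_space \<Rightarrow> 'b::euclidean_space) \<Rightarrow> bool" where
  "bbs f \<longleftrightarrow> f \<in> borel_measurable borel \<and> bounded (range f) \<and> (\<exists>R. \<forall>x. R < norm x \<longrightarrow> f x = 0)"

lemma bdd_borel_subset:
  "bdd_borel A \<Longrightarrow> B \<in> sets borel \<Longrightarrow> B \<subseteq> A \<Longrightarrow> bdd_borel B"
  using bounded_subset by blast

lemma bounded_subset_cball0:
  fixes A :: "'a::real_normed_vector set"
  assumes "bounded A"
  shows "\<exists>R>0. A \<subseteq> cball 0 R"
  using assms bounded_pos[of A] by auto

lemma radon_empty: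
  assumes "radon \<mu>"
  shows "\<mu> {} = 0"
proof -
  have "(\<lambda>i::nat. \<mu> {}) sums \<mu> (\<Union>i::nat. {})"
    using assms unfolding radon_def
    by (elim conjE allE[of _ "\<lambda>_. {}"]) (auto simp: disjoint_family_on_def)
  then show ?thesis by (simp add: sums_iff summable_const_iff)
qed

lemma radon_outside: "radon \<mu> \<Longrightarrow> \<not> bdd_borel A \<Longrightarrow> \<mu> A = 0"
  unfolding radon_def by blast

lemma radon_sums:
  "radon \<mu> \<Longrightarrow> (\<And>i. A i \<in> sets borel) \<Longrightarrow> disjoint_family A \<Longrightarrow> bounded (\<Union>i::nat. A i) \<Longrightarrow>
    (\<lambda>i. \<mu> (A i)) sums \<mu> (\<Union>i. A i)"
  unfolding radon_def by blast

lemma radon_Un: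
  assumes \<mu>: "radon \<mu>" and A: "bdd_borel A" and B: "bdd_borel B" and disj: "A \<inter> B = {}"
  shows "\<mu> (A \<union> B) = \<mu> A + \<mu> B"
proof -
  define X where "X i = (if i = 0 then A else if i = 1 then B else {})" for i :: nat
  have U: "(\<Union>i. X i) = A \<union> B" by (auto simp: X_def split: if_splits)
  have "(\<lambda>i. \<mu> (X i)) sums \<mu> (\<Union>i. X i)"
    using A B disj U by (intro radon_sums[OF \<mu>]) (auto simp: X_def disjoint_family_on_def)
  moreover have "(\<lambda>i. \<mu> (X i)) sums (\<Sum>i\<in>{0,1}. \<mu> (X i))"
    by (rule sums_finite) (auto simp: X_def radon_empty[OF \<mu>])
  ultimately have "\<mu> (\<Union>i. X i) = (\<Sum>i\<in>{0,1}. \<mu> (X i))" by (rule sums_unique2)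
  then show ?thesis unfolding U by (simp add: X_def)
qed

lemma radon_Diff:
  assumes \<mu>: "radon \<mu>" and A: "bdd_borel A" and B: "B \<in> sets borel" "B \<subseteq> A"
  shows "\<mu> (A - B) = \<mu> A - \<mu> B"
proof -
  have "\<mu> (B \<union> (A - B)) = \<mu> B + \<mu> (A - B)"
    using A B bdd_borel_subset[OF A] by (intro radon_Un[OF \<mu>]) auto
  moreover have "B \<union> (A - B) = A" using B by auto
  ultimately show ?thesis by simp
qed

lemma radon_bounded_linear:
  fixes \<mu> :: "'a::euclidean_space set \<Rightarrow> 'b::euclidean_space" and L :: "'b \<Rightarrow> 'c::euclidean_space"
  assumes "radon \<mu>" "bounded_linear L"
  shows "radon (\<lambda>A. L (\<mu> A))"
  using assms bounded_linear.sums[OF assms(2)] linear_0[OF bounded_linear.linear[OF assms(2)]]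
  unfolding radon_def by auto

lemma radon_uminus: "radon \<mu> \<Longrightarrow> radon (\<lambda>A. - \<mu> A)"
  by (rule radon_bounded_linear[of _ uminus]) (auto intro: bounded_linear_minus bounded_linear_ident)

lemma radon_inner: "radon \<mu> \<Longrightarrow> radon (\<lambda>A. \<mu> A \<bullet> i)"
  by (rule radon_bounded_linear[of _ "\<lambda>x. x \<bullet> i"]) (auto intro: bounded_linear_inner_left)

lemma pos_radonD:
  assumes "pos_radon \<gamma>"
  shows "sets \<gamma> = sets borel" "space \<gamma> = UNIV" "bounded A \<Longrightarrow> emeasure \<gamma> A < \<infinity>"
proof -
  show s: "sets \<gamma> = sets borel" "space \<gamma> = UNIV"
    using assms sets_eq_imp_space_eq[of \<gamma> borel] by (auto simp: pos_radon_def)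
  assume "bounded A"
  then obtain R where "A \<subseteq> cball 0 R" using bounded_subset_cball0 by blast
  then have "emeasure \<gamma> A \<le> emeasure \<gamma> (cball 0 R)" by (intro emeasure_mono) (auto simp: s)
  also have "\<dots> < \<infinity>" using assms by (auto simp: pos_radon_def)
  finally show "emeasure \<gamma> A < \<infinity>" .
qed

lemma pos_radonI:
  assumes "sets \<gamma> = sets borel" "\<And>A. bdd_borel A \<Longrightarrow> emeasure \<gamma> A < \<infinity>"
  shows "pos_radon \<gamma>"
  using assms by (auto simp: pos_radon_def compact_imp_bounded borel_compact)

lemma pos_radon_sigma_finite:
  assumes "pos_radon \<gamma>"
  shows "sigma_finite_measure \<gamma>"
proof
  show "\<exists>A. countable A \<and> A \<subseteq> sets \<gamma> \<and> \<Union> A = space \<gamma> \<and> (\<forall>a\<in>A. emeasure \<gamma> a \<noteq> \<infinity>)"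
  proof (intro exI[of _ "range (\<lambda>n::nat. cball 0 (real n))"] conjI ballI)
    show "\<Union> (range (\<lambda>n::nat. cball (0::'a) (real n))) = space \<gamma>"
      using real_arch_simple by (auto simp: pos_radonD(2)[OF assms])
  next
    fix a assume "a \<in> range (\<lambda>n::nat. cball (0::'a) (real n))"
    then show "emeasure \<gamma> a \<noteq> \<infinity>" using pos_radonD(3)[OF assms, of a] by auto
  qed (auto simp: pos_radonD(1)[OF assms])
qed

text \<open>A subset C with |\<mu> C| > 1 + |\<mu> A| has a complement in A whose value also exceeds
  1 in modulus. On one of the two halves \<mu> is still unbounded; that half is B.\<close>

lemma Jordan_unbounded_step:
  fixes \<mu> :: "'a::euclidean_space set \<Rightarrow> real"
  assumes \<mu>: "radon \<mu>" and A: "bdd_borel A"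
    and unb: "\<And>M. \<exists>B. B \<in> sets borel \<and> B \<subseteq> A \<and> M < \<bar>\<mu> B\<bar>"
  shows "\<exists>B. B \<in> sets borel \<and> B \<subseteq> A \<and> (\<forall>M. \<exists>C. C \<in> sets borel \<and> C \<subseteq> B \<and> M < \<bar>\<mu> C\<bar>) \<and> 1 < \<bar>\<mu> (A - B)\<bar>"
proof -
  obtain C where C: "C \<in> sets borel" "C \<subseteq> A" "1 + \<bar>\<mu> A\<bar> < \<bar>\<mu> C\<bar>"
    using unb by blast
  have d: "\<mu> (A - C) = \<mu> A - \<mu> C" by (rule radon_Diff[OF \<mu> A C(1,2)])
  have big: "1 < \<bar>\<mu> (A - C)\<bar>" "1 < \<bar>\<mu> C\<bar>" using C(3) d by auto
  have AAC: "A - (A - C) = C" using C by auto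
  show ?thesis
  proof (cases "\<forall>M. \<exists>D. D \<in> sets borel \<and> D \<subseteq> C \<and> M < \<bar>\<mu> D\<bar>")
    case True
    then show ?thesis using C big by blast
  next
    case False
    then obtain M1 where M1: "\<And>D. D \<in> sets borel \<Longrightarrow> D \<subseteq> C \<Longrightarrow> \<bar>\<mu> D\<bar> \<le> M1"
      by (meson not_le)
    have "\<exists>D. D \<in> sets borel \<and> D \<subseteq> A - C \<and> M < \<bar>\<mu> D\<bar>" for M
    proof (rule ccontr)
      assume "\<not> ?thesis"
      then have M2: "\<And>D. D \<in> sets borel \<Longrightarrow> D \<subseteq> A - C \<Longrightarrow> \<bar>\<mu> D\<bar> \<le> M" by (meson not_le)
      obtain D where D: "D \<in> sets borel" "D \<subseteq> A" "M1 + M < \<bar>\<mu> D\<bar>" using unb by blast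
      have "\<mu> ((D \<inter> C) \<union> (D - C)) = \<mu> (D \<inter> C) + \<mu> (D - C)"
        using bdd_borel_subset[OF A] D C by (intro radon_Un[OF \<mu>]) blast+
      moreover have "(D \<inter> C) \<union> (D - C) = D" by auto
      moreover have "\<bar>\<mu> (D \<inter> C)\<bar> \<le> M1" "\<bar>\<mu> (D - C)\<bar> \<le> M"
        using D C by (auto intro!: M1 M2)
      ultimately show False using D(3) by auto
    qed
    then show ?thesis using C big A AAC by (intro exI[of _ "A - C"]) auto
  qed
qed

text \<open>If \<mu> were unbounded on subsets of A, repeated splitting would leave behind disjoint
  sets of value above 1 in modulus inside A, and their series could not converge as countable
  additivity demands.\<close>

lemma radon_bounded_below:
  fixes \<mu> :: "'a::euclidean_space set \<Rightarrow> real"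
  assumes \<mu>: "radon \<mu>" and A: "bdd_borel A"
  shows "\<exists>M. \<forall>B. B \<in> sets borel \<longrightarrow> B \<subseteq> A \<longrightarrow> \<bar>\<mu> B\<bar> \<le> M"
proof (rule ccontr)
  assume neg: "\<not> ?thesis"
  define P where "P B \<longleftrightarrow> B \<in> sets borel \<and> B \<subseteq> A \<and> (\<forall>M. \<exists>C. C \<in> sets borel \<and> C \<subseteq> B \<and> M < \<bar>\<mu> C\<bar>)" for B
  have P0: "P A" using A neg unfolding P_def by (meson not_le subset_refl)
  have "\<exists>B'. P B' \<and> B' \<subseteq> B \<and> 1 < \<bar>\<mu> (B - B')\<bar>" if "P B" for B
    using Jordan_unbounded_step[OF \<mu>, of B] that bdd_borel_subset[OF A] unfolding P_def
    by (meson order.trans)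
  then obtain S where S: "\<And>B. P B \<Longrightarrow> P (S B)" "\<And>B. P B \<Longrightarrow> S B \<subseteq> B" "\<And>B. P B \<Longrightarrow> 1 < \<bar>\<mu> (B - S B)\<bar>"
    by metis
  define X where "X n = (S ^^ n) A" for n
  have PX: "P (X n)" for n by (induction n) (auto simp: X_def P0 S)
  have dec: "decseq X" by (rule decseq_SucI) (use PX S(2) in \<open>simp add: X_def\<close>)
  define D where "D n = X n - X (Suc n)" for n
  have "disjoint_family D"
  proof -
    have "D m \<inter> D n = {}" if "m < n" for m n
      using decseqD[OF dec, of "Suc m" n] that by (auto simp: D_def)
    then show ?thesis unfolding disjoint_family_on_def by (metis Int_commute linorder_neqE_nat)
  qed
  moreover have "D n \<in> sets borel" "D n \<subseteq> A" for n
    using PX[of n] PX[of "Suc n"] by (auto simp: D_def P_def)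
  ultimately have "(\<lambda>n. \<mu> (D n)) sums \<mu> (\<Union>n. D n)"
    using A by (intro radon_sums[OF \<mu>]) (auto intro: bounded_subset)
  then have "(\<lambda>n. \<mu> (D n)) \<longlonglongrightarrow> 0" using sums_summable summable_LIMSEQ_zero by blast
  then have "eventually (\<lambda>n. \<bar>\<mu> (D n)\<bar> < 1) sequentially"
    unfolding tendsto_iff by (auto elim!: allE[of _ 1])
  moreover have "1 < \<bar>\<mu> (D n)\<bar>" for n
    using S(3)[OF PX[of n]] by (simp add: D_def X_def)
  ultimately show False by (auto simp: eventually_sequentially not_less less_imp_le intro: less_asym)
qed

lemma ennreal_le_suminf_sums:
  assumes "x sums s"
  shows "ennreal s \<le> (\<Sum>i. ennreal (x i))"
proof (rule LIMSEQ_le_const2)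
  show "(\<lambda>n. ennreal (\<Sum>i<n. x i)) \<longlonglongrightarrow> ennreal s"
    using assms unfolding sums_def by (rule tendsto_ennrealI)
  have "ennreal (\<Sum>i<n. x i) \<le> (\<Sum>i<n. ennreal (x i))" for n
  proof (induction n)
    case (Suc n)
    have "ennreal (s + t) \<le> ennreal s + ennreal t" for s t :: real
      by (cases "0 \<le> s"; cases "0 \<le> t")
        (auto simp: ennreal_neg not_le intro!: ennreal_leI simp flip: ennreal_plus)
    then have "ennreal (\<Sum>i<Suc n. x i) \<le> ennreal (\<Sum>i<n. x i) + ennreal (x n)" by simp
    then show ?case using Suc by (simp add: add_right_mono order.trans)
  qed simp
  also have "(\<Sum>i<n. ennreal (x i)) \<le> (\<Sum>i. ennreal (x i))" for n
    by (rule sum_le_suminf) auto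
  finally show "\<exists>N. \<forall>n\<ge>N. ennreal (\<Sum>i<n. x i) \<le> (\<Sum>i. ennreal (x i))" by blast
qed

text \<open>The set function inside \<open>jordan_pos\<close>, named so that its countable
  additivity can be established before a measure is built from it.\<close>

definition jvar :: "('a::euclidean_space set \<Rightarrow> real) \<Rightarrow> 'a set \<Rightarrow> ennreal" where
  "jvar \<mu> A = (SUP B\<in>{B. bdd_borel B \<and> B \<subseteq> A}. ennreal (\<mu> B))"

lemma jvar_upper: "bdd_borel B \<Longrightarrow> B \<subseteq> A \<Longrightarrow> ennreal (\<mu> B) \<le> jvar \<mu> A"
  unfolding jvar_def by (rule SUP_upper) auto

lemma jvar_mono: "A \<subseteq> B \<Longrightarrow> jvar \<mu> A \<le> jvar \<mu> B"
  unfolding jvar_def by (rule SUP_subset_mono) auto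

lemma jvar_least: "(\<And>B. bdd_borel B \<Longrightarrow> B \<subseteq> A \<Longrightarrow> ennreal (\<mu> B) \<le> c) \<Longrightarrow> jvar \<mu> A \<le> c"
  unfolding jvar_def by (rule SUP_least) auto

lemma jvar_superadditive:
  assumes \<mu>: "radon \<mu>" and disj: "A \<inter> B = {}"
  shows "jvar \<mu> A + jvar \<mu> B \<le> jvar \<mu> (A \<union> B)"
proof -
  have "ennreal (\<mu> C) + ennreal (\<mu> D) \<le> jvar \<mu> (A \<union> B)"
    if C: "bdd_borel C" "C \<subseteq> A" and D: "bdd_borel D" "D \<subseteq> B" for C D
  proof -
    consider "\<mu> C < 0" | "\<mu> D < 0" | "0 \<le> \<mu> C" "0 \<le> \<mu> D" by linarith
    then show ?thesis
    proof cases
      case 1 then show ?thesis using D by (auto simp: ennreal_neg intro!: jvar_upper)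
    next
      case 2 then show ?thesis using C by (auto simp: ennreal_neg intro!: jvar_upper)
    next
      case 3
      then have "ennreal (\<mu> C) + ennreal (\<mu> D) = ennreal (\<mu> (C \<union> D))"
        using C D disj by (subst radon_Un[OF \<mu>]) auto
      also have "\<dots> \<le> jvar \<mu> (A \<union> B)" using C D by (intro jvar_upper) auto
      finally show ?thesis .
    qed
  qed
  moreover have "{} \<in> {B. bdd_borel B \<and> B \<subseteq> A}" for A :: "'a set" by auto
  then have "{B. bdd_borel B \<and> B \<subseteq> A} \<noteq> {}" for A :: "'a set" by blast
  ultimately show ?thesis
    unfolding jvar_def[of _ A] jvar_def[of _ B]
    by (subst ennreal_SUP_add_left[symmetric], blast, intro SUP_least,
        subst ennreal_SUP_add_right, blast, intro SUP_least, blast)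
qed

text \<open>Superadditivity on finite unions gives one inequality. For the other, a bounded B inside
  the union is cut into the pieces \<open>B \<inter> A i\<close>, whose values sum to
  \<open>\<mu> B\<close> and lie below the variations of the \<open>A i\<close>.\<close>

lemma jvar_countably_additive:
  assumes \<mu>: "radon \<mu>"
  shows "countably_additive (sets borel) (jvar \<mu>)"
proof (intro countably_additiveI antisym)
  fix A :: "nat \<Rightarrow> 'a set" assume A: "range A \<subseteq> sets borel" and disj: "disjoint_family A"
  have "(\<Sum>i<n. jvar \<mu> (A i)) \<le> jvar \<mu> (\<Union>i<n. A i)" for n
  proof (induction n)
    case (Suc n)
    have "A n \<inter> A i = {}" if "i < n" for i
      using disjoint_family_onD[OF disj, of n i] that by simp
    then have "(\<Union>i<n. A i) \<inter> A n = {}" by blast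
    from jvar_superadditive[OF \<mu> this] Suc
    have "(\<Sum>i<n. jvar \<mu> (A i)) + jvar \<mu> (A n) \<le> jvar \<mu> ((\<Union>i<n. A i) \<union> A n)"
      by (meson add_right_mono order.trans)
    then show ?case by (simp add: lessThan_Suc Un_commute add.commute)
  qed simp
  also have "jvar \<mu> (\<Union>i<n. A i) \<le> jvar \<mu> (\<Union>i. A i)" for n
    by (rule jvar_mono) auto
  finally show "(\<Sum>i. jvar \<mu> (A i)) \<le> jvar \<mu> (\<Union>i. A i)"
    by (intro suminf_le_const) auto
  show "jvar \<mu> (\<Union>i. A i) \<le> (\<Sum>i. jvar \<mu> (A i))"
  proof (rule jvar_least)
    fix B assume B: "bdd_borel B" "B \<subseteq> (\<Union>i. A i)"
    have "(\<lambda>i. \<mu> (B \<inter> A i)) sums \<mu> (\<Union>i. B \<inter> A i)"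
    proof (rule radon_sums[OF \<mu>])
      show "disjoint_family (\<lambda>i. B \<inter> A i)" using disj by (auto simp: disjoint_family_on_def)
      show "bounded (\<Union>i. B \<inter> A i)" using B by (auto intro: bounded_subset)
    qed (use A B in auto)
    moreover have "(\<Union>i. B \<inter> A i) = B" using B by auto
    ultimately have "ennreal (\<mu> B) \<le> (\<Sum>i. ennreal (\<mu> (B \<inter> A i)))"
      using ennreal_le_suminf_sums by metis
    also have "\<dots> \<le> (\<Sum>i. jvar \<mu> (A i))"
      using A B by (intro suminf_le jvar_upper) (auto intro: bdd_borel_subset[of B])
    finally show "ennreal (\<mu> B) \<le> (\<Sum>i. jvar \<mu> (A i))" .
  qed
qed

lemma sets_jordan_pos [measurable_cong, simp]: "sets (jordan_pos \<mu>) = sets borel"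
  using sets.sigma_sets_eq[of "borel :: 'a measure"] by (simp add: jordan_pos_def sets_measure_of)

lemma emeasure_jordan_pos:
  assumes "radon \<mu>" "A \<in> sets borel"
  shows "emeasure (jordan_pos \<mu>) A = jvar \<mu> A"
proof -
  have "emeasure (jordan_pos \<mu>) A = (\<lambda>A. SUP B\<in>{B. bdd_borel B \<and> B \<subseteq> A}. ennreal (\<mu> B)) A"
  proof (rule emeasure_measure_of[OF jordan_pos_def])
    show "countably_additive (sets (jordan_pos \<mu>)) (\<lambda>A. SUP B\<in>{B. bdd_borel B \<and> B \<subseteq> A}. ennreal (\<mu> B))"
      using jvar_countably_additive[OF assms(1)] by (simp add: jvar_def[abs_def])
    show "positive (sets (jordan_pos \<mu>)) (\<lambda>A. SUP B\<in>{B. bdd_borel B \<and> B \<subseteq> A}. ennreal (\<mu> B))"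
      by (auto simp: positive_def radon_empty[OF assms(1)] cong: SUP_cong_simp)
  qed (use assms(2) in auto)
  then show ?thesis by (simp add: jvar_def)
qed

lemma pos_radon_jordan_pos:
  assumes \<mu>: "radon \<mu>"
  shows "pos_radon (jordan_pos \<mu>)"
proof (rule pos_radonI)
  fix A :: "'a set" assume A: "bdd_borel A"
  obtain M where M: "\<And>B. B \<in> sets borel \<Longrightarrow> B \<subseteq> A \<Longrightarrow> \<bar>\<mu> B\<bar> \<le> M"
    using radon_bounded_below[OF \<mu> A] by blast
  have "jvar \<mu> A \<le> ennreal M"
    using M by (intro jvar_least ennreal_leI) (metis abs_le_D1)
  then show "emeasure (jordan_pos \<mu>) A < \<infinity>"
    using A by (auto simp: emeasure_jordan_pos[OF \<mu>] intro: le_less_trans)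
qed simp

text \<open>For B inside A, \<open>\<mu> B = \<mu> A - \<mu> (A - B)\<close>, and the last value is
  at least minus the negative variation of A. The same bound for \<open>- \<mu>\<close> gives the
  reverse inequality in \<open>jordan_decomposition\<close>.\<close>

lemma jordan_pos_le:
  assumes \<mu>: "radon \<mu>" and A: "bdd_borel A"
  shows "measure (jordan_pos \<mu>) A \<le> \<mu> A + measure (jordan_pos (\<lambda>A. - \<mu> A)) A"
proof -
  let ?n = "measure (jordan_pos (\<lambda>A. - \<mu> A)) A"
  have n: "emeasure (jordan_pos (\<lambda>A. - \<mu> A)) A = ennreal ?n"
    using pos_radonD(3)[OF pos_radon_jordan_pos[OF radon_uminus[OF \<mu>]]] A
    by (intro emeasure_eq_ennreal_measure) (auto simp: less_top)
  have le: "\<mu> B \<le> \<mu> A + ?n" if B: "bdd_borel B" "B \<subseteq> A" for B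
  proof -
    have "ennreal (- \<mu> (A - B)) \<le> ennreal ?n"
      unfolding n[symmetric] using A B
      by (subst emeasure_jordan_pos[OF radon_uminus[OF \<mu>]])
        (auto intro!: jvar_upper[where \<mu> = "\<lambda>A. - \<mu> A"] intro: bounded_subset)
    then have "- \<mu> (A - B) \<le> ?n" by (simp add: ennreal_le_iff)
    then show ?thesis using radon_Diff[OF \<mu> A, of B] B by simp
  qed
  have "0 \<le> \<mu> A + ?n" using le[of "{}"] by (simp add: radon_empty[OF \<mu>])
  moreover have "jvar \<mu> A \<le> ennreal (\<mu> A + ?n)" by (intro jvar_least ennreal_leI le)
  ultimately show ?thesis
    using A by (simp add: measure_def emeasure_jordan_pos[OF \<mu>] enn2real_leI)
qed

lemma jordan_decomposition:
  assumes \<mu>: "radon \<mu>" and A: "bdd_borel A"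
  shows "\<mu> A = measure (jordan_pos \<mu>) A - measure (jordan_pos (\<lambda>A. - \<mu> A)) A"
  using jordan_pos_le[OF \<mu> A] jordan_pos_le[OF radon_uminus[OF \<mu>] A] by simp

section \<open>Integration against Radon measures\<close>

lemma integrable_dominated_cball:
  fixes g :: "'a::euclidean_space \<Rightarrow> 'c::euclidean_space" and w :: "'a \<Rightarrow> 'b::euclidean_space"
  assumes \<gamma>: "pos_radon \<gamma>" and w: "locally_integrable \<gamma> w" and g: "g \<in> borel_measurable borel"
    and le: "\<And>x. norm (g x) \<le> C * norm (w x)" and supp: "\<And>x. R < norm x \<Longrightarrow> g x = 0"
  shows "integrable \<gamma> g"
proof -
  have "integrable \<gamma> (\<lambda>x. indicator (cball 0 R) x *\<^sub>R w x)"
    using w unfolding locally_integrable_def set_integrable_def by simp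
  then have "integrable \<gamma> (\<lambda>x. C *\<^sub>R (indicator (cball 0 R) x *\<^sub>R w x))"
    by (rule integrable_scaleR_right)
  then show ?thesis
  proof (rule Bochner_Integration.integrable_bound)
    show "g \<in> borel_measurable \<gamma>" using g by (simp add: measurable_cong_sets[OF pos_radonD(1)[OF \<gamma>] refl])
    have "norm (g x) \<le> norm (C *\<^sub>R (indicator (cball 0 R) x *\<^sub>R w x))" for x
      using le[of x] supp[of x] mult_right_mono[OF abs_ge_self[of C] norm_ge_zero[of "w x"]]
      by (cases "R < norm x") (auto simp: abs_mult)
    then show "AE x in \<gamma>. norm (g x) \<le> norm (C *\<^sub>R (indicator (cball 0 R) x *\<^sub>R w x))" by simp
  qed
qed

lemma locally_integrable_const:
  assumes "pos_radon \<gamma>"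
  shows "locally_integrable \<gamma> (\<lambda>_. c)"
  unfolding locally_integrable_def set_integrable_def
proof (intro conjI allI impI)
  fix K :: "'a set" assume "compact K"
  then have "emeasure \<gamma> K < \<infinity>" "K \<in> sets \<gamma>"
    using assms by (auto simp: pos_radon_def intro: borel_compact)
  then show "integrable \<gamma> (\<lambda>x. indicator K x *\<^sub>R c)" by (intro integrable_scaleR_left) auto
qed simp

lemma bbsD:
  assumes "bbs f"
  obtains M R where "0 \<le> M" "\<And>x. norm (f x) \<le> M" "\<And>x. R < norm x \<Longrightarrow> f x = 0" "f \<in> borel_measurable borel"
proof -
  obtain M where "\<And>x. norm (f x) \<le> M" using assms by (auto simp: bbs_def bounded_iff)
  moreover have "0 \<le> M" using calculation norm_ge_zero order.trans by blast
  ultimately show ?thesis using assms that by (auto simp: bbs_def)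
qed

lemma bbsI:
  assumes "f \<in> borel_measurable borel" "\<And>x. norm (f x) \<le> M" "\<And>x. R < norm x \<Longrightarrow> f x = 0"
  shows "bbs f"
  using assms unfolding bbs_def bounded_iff by blast

lemma bbs_measurable [measurable_dest]: "bbs f \<Longrightarrow> f \<in> borel_measurable borel"
  by (simp add: bbs_def)

lemma integrable_bbs_scaleR:
  fixes w :: "'a::euclidean_space \<Rightarrow> 'b::euclidean_space"
  assumes "pos_radon \<gamma>" "locally_integrable \<gamma> w" "bbs f"
  shows "integrable \<gamma> (\<lambda>x. f x *\<^sub>R w x)"
proof -
  obtain M R where f: "0 \<le> M" "\<And>x. norm (f x) \<le> M" "\<And>x. R < norm x \<Longrightarrow> f x = 0"
    "f \<in> borel_measurable borel" using bbsD[OF assms(3)] by metis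
  have [measurable]: "w \<in> borel_measurable borel" using assms(2) by (simp add: locally_integrable_def)
  show ?thesis
    using f by (intro integrable_dominated_cball[OF assms(1,2), where C = M and R = R])
      (auto intro: mult_right_mono)
qed

lemma integrable_bbs_inner:
  fixes w :: "'a::euclidean_space \<Rightarrow> 'b::euclidean_space"
  assumes "pos_radon \<gamma>" "locally_integrable \<gamma> w" "bbs f"
  shows "integrable \<gamma> (\<lambda>x. f x \<bullet> w x)"
proof -
  obtain M R where f: "0 \<le> M" "\<And>x. norm (f x) \<le> M" "\<And>x. R < norm x \<Longrightarrow> f x = 0"
    "f \<in> borel_measurable borel" using bbsD[OF assms(3)] by metis
  have [measurable]: "w \<in> borel_measurable borel" using assms(2) by (simp add: locally_integrable_def)
  have "norm (f x \<bullet> w x) \<le> M * norm (w x)" for x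
    using Cauchy_Schwarz_ineq2[of "f x" "w x"] mult_right_mono[OF f(2)[of x], of "norm (w x)"] by simp
  then show ?thesis
    using f by (intro integrable_dominated_cball[OF assms(1,2), where C = M and R = R]) auto
qed

lemma integrable_bbs:
  fixes f :: "'a::euclidean_space \<Rightarrow> 'b::euclidean_space"
  assumes "pos_radon \<gamma>" "bbs f"
  shows "integrable \<gamma> f"
proof -
  obtain M R where f: "0 \<le> M" "\<And>x. norm (f x) \<le> M" "\<And>x. R < norm x \<Longrightarrow> f x = 0"
    "f \<in> borel_measurable borel" using bbsD[OF assms(2)] by metis
  show ?thesis
    using f by (intro integrable_dominated_cball[OF assms(1) locally_integrable_const[OF assms(1), of "1::real"],
      where C = M and R = R]) auto
qed

lemma bbs_indicator:
  assumes "bdd_borel A"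
  shows "bbs (indicator A :: 'a::euclidean_space \<Rightarrow> real)"
proof -
  obtain R where "A \<subseteq> cball 0 R" using bounded_subset_cball0 assms by blast
  then show ?thesis using assms by (intro bbsI[where M = 1 and R = R]) (auto simp: indicator_def)
qed

lemma set_integrable_bdd_borel:
  assumes "pos_radon \<gamma>" "locally_integrable \<gamma> w" "bdd_borel A"
  shows "set_integrable \<gamma> A w"
  unfolding set_integrable_def using integrable_bbs_scaleR[OF assms(1,2) bbs_indicator[OF assms(3)]] .

lemma bbs_add: 
  assumes "bbs f" "bbs g"
  shows "bbs (\<lambda>x. f x + g x)"
proof -
  obtain M R where f: "0 \<le> M" "\<And>x. norm (f x) \<le> M" "\<And>x. R < norm x \<Longrightarrow> f x = 0"
    "f \<in> borel_measurable borel" using bbsD[OF assms(1)] by metis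
  obtain N S where g: "0 \<le> N" "\<And>x. norm (g x) \<le> N" "\<And>x. S < norm x \<Longrightarrow> g x = 0"
    "g \<in> borel_measurable borel" using bbsD[OF assms(2)] by metis
  show ?thesis
    using f g by (intro bbsI[where M = "M + N" and R = "max R S"]) (auto intro: norm_triangle_mono)
qed

lemma bbs_zero: "bbs (\<lambda>x. 0)"
  by (rule bbsI[where M = 0 and R = 0]) auto

lemma bbs_sum: "(\<And>i. i \<in> I \<Longrightarrow> bbs (f i)) \<Longrightarrow> bbs (\<lambda>x. \<Sum>i\<in>I. f i x)"
proof (induction I rule: infinite_finite_induct)
  case (insert x F)
  then show ?case by (simp add: bbs_add)
qed (simp_all add: bbs_zero)

lemma bbs_linear:
  assumes "bbs f" "bounded_linear L"
  shows "bbs (\<lambda>x. L (f x))"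
proof -
  interpret L: bounded_linear L by fact
  obtain M R where f: "0 \<le> M" "\<And>x. norm (f x) \<le> M" "\<And>x. R < norm x \<Longrightarrow> f x = 0"
    "f \<in> borel_measurable borel" using bbsD[OF assms(1)] by metis
  have [measurable]: "L \<in> borel_measurable borel"
    by (rule borel_measurable_continuous_onI[OF linear_continuous_on[OF assms(2)]])
  obtain K where K: "\<And>x. norm (L x) \<le> norm x * K" "0 \<le> K" using L.nonneg_bounded by blast
  show ?thesis
    using f order.trans[OF K(1) mult_right_mono[OF f(2) K(2)]]
    by (intro bbsI[where M = "M * K" and R = R]) (auto simp: L.zero)
qed

lemma bbs_scaleR: "bbs f \<Longrightarrow> bbs (\<lambda>x. c *\<^sub>R f x)"
  by (rule bbs_linear[of f "\<lambda>y. c *\<^sub>R y"]) (auto intro: bounded_linear_scaleR_right)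

lemma locally_integrable_zero_AE:
  fixes w :: "'a::euclidean_space \<Rightarrow> 'b::euclidean_space"
  assumes \<gamma>: "pos_radon \<gamma>" and w: "locally_integrable \<gamma> w"
    and z: "\<And>A. bdd_borel A \<Longrightarrow> (LINT x:A|\<gamma>. w x) = 0"
  shows "AE x in \<gamma>. w x = 0"
proof -
  interpret sigma_finite_measure \<gamma> by (rule pos_radon_sigma_finite[OF \<gamma>])
  have "AE x in \<gamma>. indicator (cball 0 (real n)) x *\<^sub>R w x = 0" for n :: nat
  proof (rule density_zero)
    show "integrable \<gamma> (\<lambda>x. indicator (cball 0 (real n)) x *\<^sub>R w x)"
      using set_integrable_bdd_borel[OF \<gamma> w, of "cball 0 (real n)"] by (simp add: set_integrable_def)
    fix A assume A: "A \<in> sets \<gamma>"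
    have "(LINT x:A|\<gamma>. indicator (cball 0 (real n)) x *\<^sub>R w x) = (LINT x:(A \<inter> cball 0 (real n))|\<gamma>. w x)"
      by (simp add: set_lebesgue_integral_def indicator_inter_arith)
    also have "\<dots> = 0" using A by (intro z) (auto simp: pos_radonD(1)[OF \<gamma>])
    finally show "(LINT x:A|\<gamma>. indicator (cball 0 (real n)) x *\<^sub>R w x) = 0" .
  qed
  then have "AE x in \<gamma>. \<forall>n::nat. indicator (cball 0 (real n)) x *\<^sub>R w x = 0"
    unfolding AE_all_countable by blast
  then show ?thesis
  proof eventually_elim
    fix x assume x: "\<forall>n::nat. indicator (cball 0 (real n)) x *\<^sub>R w x = 0"
    obtain n :: nat where "norm x \<le> real n" using real_arch_simple by blast
    then show "w x = 0" using x[rule_format, of n] by (simp add: indicator_def)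
  qed
qed

lemma locally_integrable_add:
  "locally_integrable \<gamma> f \<Longrightarrow> locally_integrable \<gamma> g \<Longrightarrow> locally_integrable \<gamma> (\<lambda>x. f x + g x)"
  unfolding locally_integrable_def by (auto intro: set_integral_add)

lemma locally_integrable_scaleR:
  "locally_integrable \<gamma> f \<Longrightarrow> locally_integrable \<gamma> (\<lambda>x. c *\<^sub>R f x)"
  unfolding locally_integrable_def by auto

lemma locally_integrable_diff:
  "locally_integrable \<gamma> f \<Longrightarrow> locally_integrable \<gamma> g \<Longrightarrow> locally_integrable \<gamma> (\<lambda>x. f x - g x)"
  using locally_integrable_add[of \<gamma> f "\<lambda>x. (-1) *\<^sub>R g x"] locally_integrable_scaleR[of \<gamma> g "-1"] by simp

text \<open>Each measure is absolutely continuous with respect to the sum, and sigma-finiteness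
  makes the Radon-Nikodym densities finite almost everywhere. Identities between measures thereby
  become identities between real functions.\<close>

lemma common_density:
  fixes M :: "'i \<Rightarrow> 'a::euclidean_space measure"
  assumes fin: "finite I" and M: "\<And>i. i \<in> I \<Longrightarrow> pos_radon (M i)"
  shows "\<exists>\<kappa> d. pos_radon \<kappa> \<and> (\<forall>i\<in>I. d i \<in> borel_measurable borel \<and> (\<forall>x. 0 \<le> d i x) \<and>
    M i = density \<kappa> (\<lambda>x. ennreal (d i x)))"
proof -
  define s where "s A = (\<Sum>i\<in>I. emeasure (M i) A)" for A
  define \<kappa> where "\<kappa> = measure_of UNIV (sets borel) s"
  have sets: "sets \<kappa> = sets borel"
    using sets.sigma_sets_eq[of "borel :: 'a measure"] by (simp add: \<kappa>_def sets_measure_of)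
  have setsM: "sets (M i) = sets borel" if "i \<in> I" for i using pos_radonD(1)[OF M[OF that]] .
  have em: "emeasure \<kappa> A = s A" if "A \<in> sets borel" for A
  proof (rule emeasure_measure_of[OF \<kappa>_def])
    show "countably_additive (sets \<kappa>) s"
    proof (rule countably_additiveI)
      fix A :: "nat \<Rightarrow> 'a set" assume "range A \<subseteq> sets \<kappa>" "disjoint_family A"
      then have "(\<Sum>n. emeasure (M i) (A n)) = emeasure (M i) (\<Union>n. A n)" if "i \<in> I" for i
        using that by (intro suminf_emeasure) (auto simp: sets setsM)
      then show "(\<Sum>n. s (A n)) = s (\<Union>n. A n)"
        unfolding s_def by (subst suminf_sum) (auto intro!: sum.cong)
    qed
  qed (use that in \<open>auto simp: positive_def s_def sets\<close>)
  have \<kappa>: "pos_radon \<kappa>"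
  proof (rule pos_radonI[OF sets])
    fix A :: "'a set" assume A: "bdd_borel A"
    then show "emeasure \<kappa> A < \<infinity>"
      using pos_radonD(3)[OF M] fin by (simp add: em s_def ennreal_sum_less_top)
  qed
  interpret \<kappa>: sigma_finite_measure \<kappa> by (rule pos_radon_sigma_finite[OF \<kappa>])
  have "\<exists>d. d \<in> borel_measurable borel \<and> (\<forall>x. 0 \<le> d x) \<and> M i = density \<kappa> (\<lambda>x. ennreal (d x))"
    if i: "i \<in> I" for i
  proof -
    have "absolutely_continuous \<kappa> (M i)"
      unfolding absolutely_continuous_def
      using i fin by (auto simp: null_sets_def em sets setsM s_def)
    then obtain f where f: "f \<in> borel_measurable \<kappa>" "density \<kappa> f = M i"
      using \<kappa>.Radon_Nikodym setsM[OF i] sets by metis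
    have "sigma_finite_measure (density \<kappa> f)"
      unfolding f(2) by (rule pos_radon_sigma_finite[OF M[OF i]])
    then have "AE x in \<kappa>. f x \<noteq> \<infinity>"
      using \<kappa>.sigma_finite_iff_density_finite[OF f(1)] by blast
    then have "AE x in \<kappa>. f x = ennreal (enn2real (f x))"
      by eventually_elim (auto simp: less_top)
    then have "density \<kappa> f = density \<kappa> (\<lambda>x. ennreal (enn2real (f x)))"
      using f(1) by (intro density_cong) auto
    then show ?thesis
      using f by (intro exI[of _ "\<lambda>x. enn2real (f x)"])
        (auto simp: measurable_cong_sets[OF sets refl])
  qed
  then show ?thesis using \<kappa> by metis
qed

lemma density_pos_radon:
  fixes d :: "'a::euclidean_space \<Rightarrow> real" and f :: "'a \<Rightarrow> 'c::euclidean_space"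
  assumes \<kappa>: "pos_radon \<kappa>" and \<alpha>: "pos_radon \<alpha>" and d: "d \<in> borel_measurable borel" "\<And>x. 0 \<le> d x"
    and eq: "\<alpha> = density \<kappa> (\<lambda>x. ennreal (d x))"
  shows "locally_integrable \<kappa> d" "bdd_borel A \<Longrightarrow> measure \<alpha> A = (LINT x:A|\<kappa>. d x)"
    "f \<in> borel_measurable borel \<Longrightarrow> (\<integral>x. f x \<partial>\<alpha>) = (\<integral>x. d x *\<^sub>R f x \<partial>\<kappa>)"
proof -
  note s = pos_radonD(1)[OF \<kappa>]
  have [measurable]: "d \<in> borel_measurable \<kappa>" using d(1) by (simp add: measurable_cong_sets[OF s refl])
  have em: "emeasure \<alpha> A = (\<integral>\<^sup>+x. ennreal (indicator A x *\<^sub>R d x) \<partial>\<kappa>)" if "A \<in> sets borel" for A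
    unfolding eq using that by (subst emeasure_density)
      (auto simp: s indicator_def intro!: nn_integral_cong)
  have int: "set_integrable \<kappa> A d" if A: "bdd_borel A" for A
    unfolding set_integrable_def
  proof (rule integrableI_nonneg)
    show "(\<integral>\<^sup>+x. ennreal (indicator A x *\<^sub>R d x) \<partial>\<kappa>) < \<infinity>"
      using em[of A] pos_radonD(3)[OF \<alpha>, of A] A by simp
    show "(\<lambda>x. indicator A x *\<^sub>R d x) \<in> borel_measurable \<kappa>"
      using A by (intro borel_measurable_scaleR borel_measurable_indicator) (auto simp: s)
  qed (use d(2) in auto)
  then show "locally_integrable \<kappa> d"
    using d(1) by (auto simp: locally_integrable_def compact_imp_bounded borel_compact)
  show "measure \<alpha> A = (LINT x:A|\<kappa>. d x)" if A: "bdd_borel A" for A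
  proof -
    have "emeasure \<alpha> A = ennreal (LINT x:A|\<kappa>. d x)"
      using int[OF A] A d(2) unfolding set_lebesgue_integral_def set_integrable_def
      by (subst em) (auto intro!: nn_integral_eq_integral AE_I2 simp: indicator_def simp del: real_scaleR_def)
    then show ?thesis using d(2)
      by (simp add: measure_def set_lebesgue_integral_def)
  qed
  show "(\<integral>x. f x \<partial>\<alpha>) = (\<integral>x. d x *\<^sub>R f x \<partial>\<kappa>)" if "f \<in> borel_measurable borel"
    unfolding eq using that d by (subst integral_density) (auto simp: measurable_cong_sets[OF s refl])
qed

text \<open>Makes the integral independent of how \<mu> is written as a difference. Over a common
  reference measure both representations have densities, and the difference of these has zero
  integral on every bounded Borel set, hence vanishes almost everywhere.\<close>

lemma signed_integral_eq:
  fixes \<mu> :: "'a::euclidean_space set \<Rightarrow> real"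
  assumes \<mu>: "radon \<mu>" and ab: "pos_radon \<alpha>" "pos_radon \<beta>"
    and eq: "\<And>A. bdd_borel A \<Longrightarrow> \<mu> A = measure \<alpha> A - measure \<beta> A" and f: "bbs f"
  shows "signed_integral \<mu> f = (\<integral>x. f x \<partial>\<alpha>) - (\<integral>x. f x \<partial>\<beta>)"
proof -
  \<comment> \<open>Indices 0 and 1 are the given representation, 2 and 3 the Jordan parts.\<close>
  define M where "M i = [\<alpha>, \<beta>, jordan_pos \<mu>, jordan_pos (\<lambda>A. - \<mu> A)] ! i" for i
  have M: "pos_radon (M i)" if "i \<in> {..<4}" for i
    using that ab pos_radon_jordan_pos[OF \<mu>] pos_radon_jordan_pos[OF radon_uminus[OF \<mu>]]
    by (auto simp: M_def less_Suc_eq numeral_eq_Suc)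
  obtain \<kappa> d where \<kappa>: "pos_radon \<kappa>" and d: "\<And>i. i < 4 \<Longrightarrow> d i \<in> borel_measurable borel"
    "\<And>i x. i < 4 \<Longrightarrow> 0 \<le> d i x" "\<And>i. i < 4 \<Longrightarrow> M i = density \<kappa> (\<lambda>x. ennreal (d i x))"
    using common_density[of "{..<4}" M] M by (metis finite_lessThan lessThan_iff)
  have den: "locally_integrable \<kappa> (d i)" "bdd_borel A \<Longrightarrow> measure (M i) A = (LINT x:A|\<kappa>. d i x)"
    "g \<in> borel_measurable borel \<Longrightarrow> (\<integral>x. g x \<partial>M i) = (\<integral>x. d i x *\<^sub>R g x \<partial>\<kappa>)"
    if "i < 4" for i A and g :: "'a \<Rightarrow> real"
    using density_pos_radon(1,2)[OF \<kappa> M d(1,2,3), of i] that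
      density_pos_radon(3)[OF \<kappa> M d(1,2,3), of i, where f = g] by auto
  have li: "locally_integrable \<kappa> (\<lambda>x. (d 0 x - d 1 x) - (d 2 x - d 3 x))"
    using den(1) by (intro locally_integrable_diff) auto
  have "(LINT x:A|\<kappa>. (d 0 x - d 1 x) - (d 2 x - d 3 x)) = 0" if A: "bdd_borel A" for A
  proof -
    have i: "set_integrable \<kappa> A (d j)" if "j < 4" for j
      using set_integrable_bdd_borel[OF \<kappa> den(1)[OF that] A] .
    have "(LINT x:A|\<kappa>. (d 0 x - d 1 x) - (d 2 x - d 3 x))
        = (measure \<alpha> A - measure \<beta> A) - (measure (M 2) A - measure (M 3) A)"
      using i den(2)[of 0 A] den(2)[of 1 A] den(2)[of 2 A] den(2)[of 3 A] A
      by (simp add: set_integral_diff M_def[of 0] M_def[of "Suc 0"])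
    also have "\<dots> = 0"
      using eq[OF A] jordan_decomposition[OF \<mu> A] by (simp add: M_def numeral_eq_Suc)
    finally show ?thesis .
  qed
  then have ae: "AE x in \<kappa>. (d 0 x - d 1 x) - (d 2 x - d 3 x) = 0"
    by (rule locally_integrable_zero_AE[OF \<kappa> li])
  have int: "integrable \<kappa> (\<lambda>x. d j x * f x)" if "j < 4" for j
    using integrable_bbs_scaleR[OF \<kappa> den(1)[OF that] f] by (simp add: mult.commute)
  have fm: "f \<in> borel_measurable borel" using f by (simp add: bbs_def)
  have "signed_integral \<mu> f - ((\<integral>x. f x \<partial>\<alpha>) - (\<integral>x. f x \<partial>\<beta>))
      = (\<integral>x. f x \<partial>M 2) - (\<integral>x. f x \<partial>M 3) - ((\<integral>x. f x \<partial>M 0) - (\<integral>x. f x \<partial>M 1))"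
    by (simp add: signed_integral_def M_def numeral_eq_Suc)
  also have "\<dots> = (\<integral>x. (d 2 x * f x - d 3 x * f x) - (d 0 x * f x - d 1 x * f x) \<partial>\<kappa>)"
    using int den(3)[OF _ fm] by simp
  also have "\<dots> = (\<integral>x. 0 \<partial>\<kappa>)"
  proof (rule integral_cong_AE)
    show "AE x in \<kappa>. (d 2 x * f x - d 3 x * f x) - (d 0 x * f x - d 1 x * f x) = 0"
    proof (use ae in eventually_elim)
      fix x assume "(d 0 x - d 1 x) - (d 2 x - d 3 x) = 0"
      then have "- f x * ((d 0 x - d 1 x) - (d 2 x - d 3 x)) = 0" by simp
      then show "(d 2 x * f x - d 3 x * f x) - (d 0 x * f x - d 1 x * f x) = 0"
        by (simp add: algebra_simps)
    qed
  qed (use int[THEN borel_measurable_integrable] in auto)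
  finally show ?thesis by simp
qed


context
  fixes \<mu> :: "'a::euclidean_space set \<Rightarrow> real"
  assumes \<mu>: "radon \<mu>"
begin

lemma pos_radon_jordan2: "pos_radon (jordan_pos \<mu>)" "pos_radon (jordan_pos (\<lambda>A. - \<mu> A))"
  by (rule pos_radon_jordan_pos[OF \<mu>], rule pos_radon_jordan_pos[OF radon_uminus[OF \<mu>]])

lemma signed_integral_add:
  assumes "bbs f" "bbs g"
  shows "signed_integral \<mu> (\<lambda>x. f x + g x) = signed_integral \<mu> f + signed_integral \<mu> g"
  using integrable_bbs[OF pos_radon_jordan2(1), of f] integrable_bbs[OF pos_radon_jordan2(2), of f]
    integrable_bbs[OF pos_radon_jordan2(1), of g] integrable_bbs[OF pos_radon_jordan2(2), of g] assms
  by (simp add: signed_integral_def)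

lemma signed_integral_cmult:
  shows "signed_integral \<mu> (\<lambda>x. c * f x) = c * signed_integral \<mu> f"
  by (simp add: signed_integral_def right_diff_distrib)

lemma signed_integral_indicator:
  assumes "bdd_borel A"
  shows "signed_integral \<mu> (indicator A) = \<mu> A"
  using assms by (simp add: signed_integral_def jordan_decomposition[OF \<mu>])

text \<open>C is the total Jordan mass of the ball, so one constant serves all integrands supported
  there. This is what permits limits of uniformly convergent integrands with a fixed
  support.\<close>

lemma signed_integral_bound:
  "\<exists>C\<ge>0. \<forall>f M. f \<in> borel_measurable borel \<longrightarrow> (\<forall>x. \<bar>f x\<bar> \<le> M) \<longrightarrow> (\<forall>x. R < norm x \<longrightarrow> f x = 0) \<longrightarrow>
    \<bar>signed_integral \<mu> f\<bar> \<le> C * M"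
proof -
  let ?p = "jordan_pos \<mu>" and ?n = "jordan_pos (\<lambda>A. - \<mu> A)"
  have bd: "\<bar>\<integral>x. f x \<partial>\<alpha>\<bar> \<le> measure \<alpha> (cball 0 R) * M"
    if "pos_radon \<alpha>" "f \<in> borel_measurable borel" "\<And>x. \<bar>f x\<bar> \<le> M" "\<And>x. R < norm x \<Longrightarrow> f x = 0" for \<alpha> f M
  proof -
    have "bbs f" using that(2-4) by (intro bbsI[where M = M and R = R]) auto
    have M: "0 \<le> M" using that(3)[of 0] abs_ge_zero order.trans by blast
    have "\<bar>\<integral>x. f x \<partial>\<alpha>\<bar> \<le> (\<integral>x. \<bar>f x\<bar> \<partial>\<alpha>)" by (rule integral_abs_bound)
    also have "\<dots> \<le> (\<integral>x. indicator (cball 0 R) x * M \<partial>\<alpha>)"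
    proof (rule integral_mono)
      show "integrable \<alpha> (\<lambda>x. indicator (cball 0 R) x * M)"
        using integrable_bbs[OF that(1) bbs_indicator[of "cball 0 R"]] by auto
      show "integrable \<alpha> (\<lambda>x. \<bar>f x\<bar>)" using integrable_bbs[OF that(1) \<open>bbs f\<close>] by auto
      show "\<bar>f x\<bar> \<le> indicator (cball 0 R) x * M" for x
        using that(3,4)[of x] M by (cases "R < norm x") auto
    qed
    also have "\<dots> = measure \<alpha> (cball 0 R) * M" by (simp add: pos_radonD(2)[OF that(1)])
    finally show ?thesis .
  qed
  show ?thesis
  proof (intro exI[of _ "measure ?p (cball 0 R) + measure ?n (cball 0 R)"] conjI allI impI)
    fix f :: "'a \<Rightarrow> real" and M
    assume f: "f \<in> borel_measurable borel" "\<forall>x. \<bar>f x\<bar> \<le> M" "\<forall>x. R < norm x \<longrightarrow> f x = 0"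
    show "\<bar>signed_integral \<mu> f\<bar> \<le> (measure ?p (cball 0 R) + measure ?n (cball 0 R)) * M"
      using bd[OF pos_radon_jordan2(1) f(1), of M] bd[OF pos_radon_jordan2(2) f(1), of M] f(2,3)
      by (simp add: signed_integral_def distrib_right)
  qed simp
qed

end

lemma radon_radon_density:
  fixes w :: "'a::euclidean_space \<Rightarrow> 'b::euclidean_space"
  assumes \<gamma>: "pos_radon \<gamma>" and w: "locally_integrable \<gamma> w"
  shows "radon (radon_density \<gamma> w)"
  unfolding radon_def
proof (intro conjI allI impI)
  fix A :: "nat \<Rightarrow> 'a set"
  assume A: "\<forall>i. A i \<in> sets borel" and disj: "disjoint_family A" and bd: "bounded (\<Union>i. A i)"
  note s = pos_radonD(1)[OF \<gamma>]
  have U: "bdd_borel (\<Union>i. A i)" using A bd by auto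
  have Ai: "bdd_borel (A i)" for i using A bd bounded_subset[OF bd, of "A i"] by auto
  have int: "set_integrable \<gamma> B w" if "bdd_borel B" for B by (rule set_integrable_bdd_borel[OF \<gamma> w that])
  have wm: "w \<in> borel_measurable \<gamma>" using w by (simp add: locally_integrable_def measurable_cong_sets[OF s refl])
  have "(\<lambda>n. \<Sum>i<n. LINT x:A i|\<gamma>. w x) \<longlonglongrightarrow> (LINT x:(\<Union>i. A i)|\<gamma>. w x)"
    unfolding set_lebesgue_integral_def
  proof (subst Bochner_Integration.integral_sum[symmetric])
    show "integrable \<gamma> (\<lambda>x. indicator (A i) x *\<^sub>R w x)" for i
      using int[OF Ai] by (simp add: set_integrable_def)
    show "(\<lambda>n. LINT x|\<gamma>. (\<Sum>i<n. indicator (A i) x *\<^sub>R w x)) \<longlonglongrightarrow> (LINT x|\<gamma>. indicator (\<Union>i. A i) x *\<^sub>R w x)"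
    proof (rule integral_dominated_convergence[where w = "\<lambda>x. norm (indicator (\<Union>i. A i) x *\<^sub>R w x)"])
      have eq: "(\<Sum>i<n. indicator (A i) x *\<^sub>R w x) = (indicator (\<Union>i<n. A i) x :: real) *\<^sub>R w x" for n x
      proof -
        have "(\<Sum>i<n. indicator (A i) x :: real) = indicator (\<Union>i<n. A i) x"
          using disj by (subst indicator_UN_disjoint) (auto simp: disjoint_family_on_def)
        then show ?thesis by (simp add: scaleR_sum_left[symmetric])
      qed
      have "(\<lambda>n. indicator (\<Union>i<n. A i) x :: real) \<longlonglongrightarrow> indicator (\<Union>i. A i) x" for x
        by (rule LIMSEQ_indicator_UN)
      then show "AE x in \<gamma>. (\<lambda>n. \<Sum>i<n. indicator (A i) x *\<^sub>R w x) \<longlonglongrightarrow> indicator (\<Union>i. A i) x *\<^sub>R w x"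
        unfolding eq by (intro AE_I2 tendsto_intros)
      show "AE x in \<gamma>. norm (\<Sum>i<n. indicator (A i) x *\<^sub>R w x) \<le> norm (indicator (\<Union>i. A i) x *\<^sub>R w x)" for n
        unfolding eq by (auto simp: indicator_def)
      show "integrable \<gamma> (\<lambda>x. norm (indicator (\<Union>i. A i) x *\<^sub>R w x))"
        using int[OF U] unfolding set_integrable_def by (rule integrable_norm)
      show "(\<lambda>x. \<Sum>i<n. indicator (A i) x *\<^sub>R w x) \<in> borel_measurable \<gamma>" for n
        using A wm by (intro borel_measurable_sum borel_measurable_scaleR borel_measurable_indicator) (auto simp: s)
      show "(\<lambda>x. indicator (\<Union>i. A i) x *\<^sub>R w x) \<in> borel_measurable \<gamma>"
        using A wm by (intro borel_measurable_scaleR borel_measurable_indicator) (auto simp: s)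
    qed
  qed
  then show "(\<lambda>i. radon_density \<gamma> w (A i)) sums radon_density \<gamma> w (\<Union>i. A i)"
    using U Ai by (simp add: radon_density_def sums_def)
qed (auto simp: radon_density_def)

lemma locally_integrable_linear:
  assumes "locally_integrable \<gamma> w" "bounded_linear L" "pos_radon \<gamma>"
  shows "locally_integrable \<gamma> (\<lambda>x. L (w x))"
proof -
  interpret L: bounded_linear L by fact
  have [measurable]: "L \<in> borel_measurable borel"
    by (rule borel_measurable_continuous_onI[OF linear_continuous_on[OF assms(2)]])
  have "set_integrable \<gamma> K (\<lambda>x. L (w x))" if "compact K" for K
    using integrable_bounded_linear[OF assms(2), of \<gamma> "\<lambda>x. indicator K x *\<^sub>R w x"] assms(1) that
    by (simp add: locally_integrable_def set_integrable_def L.scaleR)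
  then show ?thesis using assms(1) by (auto simp: locally_integrable_def)
qed

text \<open>\<open>signed_integral_eq\<close> accepts any representation as a difference of Radon
  measures; the positive and negative parts of \<rho> provide one.\<close>

lemma signed_integral_density:
  fixes \<rho> :: "'a::euclidean_space \<Rightarrow> real"
  assumes \<gamma>: "pos_radon \<gamma>" and \<rho>: "locally_integrable \<gamma> \<rho>" and f: "bbs f"
  shows "signed_integral (radon_density \<gamma> \<rho>) f = (\<integral>x. f x * \<rho> x \<partial>\<gamma>)"
proof -
  note s = pos_radonD(1)[OF \<gamma>]
  have \<rho>m[measurable]: "\<rho> \<in> borel_measurable borel" using \<rho> by (simp add: locally_integrable_def)
  have *: "pos_radon (density \<gamma> (\<lambda>x. ennreal (max 0 (c * \<rho> x))))" if "c \<in> {1, -1}" for c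
  proof (rule pos_radonI)
    fix A :: "'a set" assume A: "bdd_borel A"
    have "emeasure (density \<gamma> (\<lambda>x. ennreal (max 0 (c * \<rho> x)))) A = (\<integral>\<^sup>+x. ennreal (max 0 (c * \<rho> x)) * indicator A x \<partial>\<gamma>)"
      using A by (intro emeasure_density) (auto simp: s measurable_cong_sets[OF s refl])
    also have "\<dots> \<le> (\<integral>\<^sup>+x. ennreal (norm (indicator A x *\<^sub>R \<rho> x)) \<partial>\<gamma>)"
      using that by (intro nn_integral_mono) (auto simp: indicator_def intro!: ennreal_leI)
    also have "\<dots> < \<infinity>"
      using set_integrable_bdd_borel[OF \<gamma> \<rho> A] unfolding set_integrable_def integrable_iff_bounded by simp
    finally show "emeasure (density \<gamma> (\<lambda>x. ennreal (max 0 (c * \<rho> x)))) A < \<infinity>" .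
  qed (simp add: s)
  \<comment> \<open>\<open>d 1\<close> is the positive part of \<rho> and \<open>d (-1)\<close> the
    negative part.\<close>
  define d where "d c x = max 0 (c * \<rho> x)" for c x
  have dm: "d c \<in> borel_measurable borel" "0 \<le> d c x" for c x by (auto simp: d_def[abs_def])
  have den: "locally_integrable \<gamma> (d c)"
    "bdd_borel A \<Longrightarrow> measure (density \<gamma> (\<lambda>x. ennreal (d c x))) A = (LINT x:A|\<gamma>. d c x)"
    "(\<integral>x. f x \<partial>(density \<gamma> (\<lambda>x. ennreal (d c x)))) = (\<integral>x. d c x *\<^sub>R f x \<partial>\<gamma>)"
    if "c \<in> {1, -1}" for c A
    using density_pos_radon(1,2)[OF \<gamma> *[OF that, folded d_def] dm refl] 
      density_pos_radon(3)[OF \<gamma> *[OF that, folded d_def] dm refl, of f] f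
    by (auto simp: bbs_def)
  have sub: "d 1 x - d (-1) x = \<rho> x" for x by (auto simp: d_def)
  have "signed_integral (radon_density \<gamma> \<rho>) f = (\<integral>x. f x \<partial>(density \<gamma> (\<lambda>x. ennreal (d 1 x)))) - (\<integral>x. f x \<partial>(density \<gamma> (\<lambda>x. ennreal (d (-1) x))))"
  proof (rule signed_integral_eq[OF radon_radon_density[OF \<gamma> \<rho>] _ _ _ f])
    fix A :: "'a set" assume A: "bdd_borel A"
    have i: "set_integrable \<gamma> A (d c)" if "c \<in> {1, -1}" for c
      using set_integrable_bdd_borel[OF \<gamma> den(1)[OF that] A] .
    have "(LINT x:A|\<gamma>. d 1 x) - (LINT x:A|\<gamma>. d (-1) x) = (LINT x:A|\<gamma>. \<rho> x)"
      using i by (subst set_integral_diff(2)[symmetric]) (auto simp: sub)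
    then show "radon_density \<gamma> \<rho> A = measure (density \<gamma> (\<lambda>x. ennreal (d 1 x))) A - measure (density \<gamma> (\<lambda>x. ennreal (d (-1) x))) A"
      using A den(2)[of 1 A] den(2)[of "-1" A] by (simp add: radon_density_def)
  qed ((rule *[folded d_def], blast)+)
  also have "\<dots> = (\<integral>x. d 1 x *\<^sub>R f x - d (-1) x *\<^sub>R f x \<partial>\<gamma>)"
    using integrable_bbs_scaleR[OF \<gamma> den(1) f] den(3) by (simp add: mult.commute)
  also have "\<dots> = (\<integral>x. f x * \<rho> x \<partial>\<gamma>)"
    by (rule Bochner_Integration.integral_cong) (auto simp: mult.commute[of _ "f _"] sub right_diff_distrib[symmetric])
  finally show ?thesis .
qed

lemma radon_density_inner:
  assumes "pos_radon \<gamma>" "locally_integrable \<gamma> w"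
  shows "radon_density \<gamma> w A \<bullet> i = radon_density \<gamma> (\<lambda>x. w x \<bullet> i) A"
proof (cases "bdd_borel A")
  case True
  then have "integrable \<gamma> (\<lambda>x. indicator A x *\<^sub>R w x)"
    using set_integrable_bdd_borel[OF assms, of A] by (simp add: set_integrable_def)
  then have "(\<integral>x. (indicator A x *\<^sub>R w x) \<bullet> i \<partial>\<gamma>) = (\<integral>x. indicator A x *\<^sub>R w x \<partial>\<gamma>) \<bullet> i"
    by (intro integral_inner_left)
  then show ?thesis using True by (simp add: radon_density_def set_lebesgue_integral_def)
qed (auto simp: radon_density_def)

lemma vector_integral_density:
  fixes w :: "'a::euclidean_space \<Rightarrow> 'b::euclidean_space"
  assumes \<gamma>: "pos_radon \<gamma>" and w: "locally_integrable \<gamma> w" and F: "bbs F"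
  shows "vector_integral (radon_density \<gamma> w) F = (\<integral>x. F x \<bullet> w x \<partial>\<gamma>)"
proof -
  have b: "bbs (\<lambda>x. F x \<bullet> i)" for i
    by (rule bbs_linear[OF F, of "\<lambda>y. y \<bullet> i"]) (rule bounded_linear_inner_left)
  have l: "locally_integrable \<gamma> (\<lambda>x. w x \<bullet> i)" for i
    by (rule locally_integrable_linear[OF w _ \<gamma>, of "\<lambda>y. y \<bullet> i"]) (rule bounded_linear_inner_left)
  have "vector_integral (radon_density \<gamma> w) F = (\<Sum>i\<in>Basis. \<integral>x. (F x \<bullet> i) * (w x \<bullet> i) \<partial>\<gamma>)"
    unfolding vector_integral_def
    by (simp add: radon_density_inner[OF \<gamma> w] signed_integral_density[OF \<gamma> l b])
  also have "\<dots> = (\<integral>x. (\<Sum>i\<in>Basis. (F x \<bullet> i) * (w x \<bullet> i)) \<partial>\<gamma>)"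
    using integrable_bbs_scaleR[OF \<gamma> l b] by (subst Bochner_Integration.integral_sum) auto
  finally show ?thesis by (simp add: euclidean_inner[symmetric])
qed

section \<open>The action functional\<close>

text \<open>\<open>measure_of\<close> evaluates to the given set function or to 0, and the upper
  bound holds in both cases.\<close>

lemma total_variation_le:
  assumes "\<And>P. finite P \<Longrightarrow> disjoint P \<Longrightarrow> (\<And>B. B \<in> P \<Longrightarrow> bdd_borel B \<and> B \<subseteq> A) \<Longrightarrow>
    (\<Sum>B\<in>P. ennreal (norm (\<mu> B))) \<le> c"
  shows "emeasure (total_variation \<mu>) A \<le> c"
proof -
  have "emeasure (total_variation \<mu>) A \<le> (SUP P\<in>{P. finite P \<and> disjoint P \<and> (\<forall>B\<in>P. bdd_borel B \<and> B \<subseteq> A)}.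
            \<Sum>B\<in>P. ennreal (norm (\<mu> B)))"
    unfolding total_variation_def emeasure_measure_of_conv by auto
  also have "\<dots> \<le> c" using assms by (intro SUP_least) blast
  finally show ?thesis .
qed

lemma total_variation_density_le:
  fixes w :: "'a::euclidean_space \<Rightarrow> 'b::euclidean_space"
  assumes \<gamma>: "pos_radon \<gamma>" and w: "locally_integrable \<gamma> w" and A: "A \<in> sets borel"
  shows "emeasure (total_variation (radon_density \<gamma> w)) A \<le> (\<integral>\<^sup>+x. ennreal (norm (w x)) * indicator A x \<partial>\<gamma>)"
proof (rule total_variation_le)
  fix P assume P: "finite P" "disjoint P" "\<And>B. B \<in> P \<Longrightarrow> bdd_borel B \<and> B \<subseteq> A"
  note s = pos_radonD(1)[OF \<gamma>]
  have wm[measurable]: "w \<in> borel_measurable \<gamma>" using w by (simp add: locally_integrable_def measurable_cong_sets[OF s refl])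
  have le: "ennreal (norm (radon_density \<gamma> w B)) \<le> (\<integral>\<^sup>+x. ennreal (norm (w x)) * indicator B x \<partial>\<gamma>)"
    if "B \<in> P" for B
  proof -
    have B: "bdd_borel B" using P(3)[OF that] by blast
    have "ennreal (norm (radon_density \<gamma> w B)) = ennreal (norm (\<integral>x. indicator B x *\<^sub>R w x \<partial>\<gamma>))"
      using B by (simp add: radon_density_def set_lebesgue_integral_def)
    also have "\<dots> \<le> (\<integral>\<^sup>+x. ennreal (norm (indicator B x *\<^sub>R w x)) \<partial>\<gamma>)"
      using set_integrable_bdd_borel[OF \<gamma> w B] unfolding set_integrable_def
      by (rule integral_norm_bound_ennreal)
    also have "\<dots> = (\<integral>\<^sup>+x. ennreal (norm (w x)) * indicator B x \<partial>\<gamma>)"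
      by (intro nn_integral_cong) (auto simp: indicator_def)
    finally show ?thesis .
  qed
  have Bm: "B \<in> sets \<gamma>" if "B \<in> P" for B using P(3)[OF that] by (simp add: s)
  have "(\<Sum>B\<in>P. ennreal (norm (radon_density \<gamma> w B))) \<le> (\<Sum>B\<in>P. \<integral>\<^sup>+x. ennreal (norm (w x)) * indicator B x \<partial>\<gamma>)"
    by (intro sum_mono le)
  also have "\<dots> = (\<integral>\<^sup>+x. (\<Sum>B\<in>P. ennreal (norm (w x)) * indicator B x) \<partial>\<gamma>)"
    using Bm by (intro nn_integral_sum[symmetric] borel_measurable_times borel_measurable_indicator) auto
  also have "\<dots> \<le> (\<integral>\<^sup>+x. ennreal (norm (w x)) * indicator A x \<partial>\<gamma>)"
  proof (rule nn_integral_mono)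
    fix x
    have "disjoint_family_on (\<lambda>B. B) P" using P(2) by (auto simp: disjoint_def disjoint_family_on_def)
    then have "indicator (\<Union>((\<lambda>B. B) ` P)) x = (\<Sum>B\<in>P. indicator B x :: ennreal)"
      by (rule indicator_UN_disjoint[OF P(1)])
    then have "(\<Sum>B\<in>P. indicator B x :: ennreal) = indicator (\<Union>P) x" by simp
    also have "\<dots> \<le> indicator A x" using P(3) by (auto simp: indicator_def)
    finally show "(\<Sum>B\<in>P. ennreal (norm (w x)) * indicator B x) \<le> ennreal (norm (w x)) * indicator A x"
      by (simp add: sum_distrib_left[symmetric] mult_left_mono)
  qed
  finally show "(\<Sum>B\<in>P. ennreal (norm (radon_density \<gamma> w B))) \<le> (\<integral>\<^sup>+x. ennreal (norm (w x)) * indicator A x \<partial>\<gamma>)" .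
qed

lemma msupp_total_variation_density:
  assumes "pos_radon \<gamma>" "locally_integrable \<gamma> w"
  shows "msupp (total_variation (radon_density \<gamma> w)) \<subseteq> msupp \<gamma>"
proof
  fix x assume x: "x \<in> msupp (total_variation (radon_density \<gamma> w))"
  show "x \<in> msupp \<gamma>"
  proof (rule ccontr)
    assume "x \<notin> msupp \<gamma>"
    then obtain r where r: "r > 0" "emeasure \<gamma> (ball x r) = 0"
      by (auto simp: msupp_def zero_less_iff_neq_zero)
    have "AE y in \<gamma>. y \<notin> ball x r"
      using r(2) by (intro AE_not_in) (auto simp: null_sets_def pos_radonD(1)[OF assms(1)])
    then have "(\<integral>\<^sup>+y. ennreal (norm (w y)) * indicator (ball x r) y \<partial>\<gamma>) = (\<integral>\<^sup>+y. 0 \<partial>\<gamma>)"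
      by (intro nn_integral_cong_AE) (auto simp: indicator_def elim!: eventually_mono)
    then have "emeasure (total_variation (radon_density \<gamma> w)) (ball x r) = 0"
      using total_variation_density_le[OF assms, of "ball x r"] by simp
    then show False using x r(1) unfolding msupp_def by force
  qed
qed

text \<open>With g the density of \<open>\<gamma>\<close> with respect to \<open>\<kappa>\<close>,
  the part of \<open>\<kappa>\<close> on the zero set of g is singular to \<open>\<gamma>\<close>;
  off that set, dividing by g changes the reference measure. Since division by 0 gives 0,
  \<open>1 / g x\<close> vanishes on the zero set.\<close>

lemma density_split:
  fixes w :: "'a::euclidean_space \<Rightarrow> 'b::euclidean_space" and g :: "'a \<Rightarrow> real"
  assumes \<kappa>: "pos_radon \<kappa>" and \<gamma>: "pos_radon \<gamma>" and g: "g \<in> borel_measurable borel" "\<And>x. 0 \<le> g x"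
    and eq: "\<gamma> = density \<kappa> (\<lambda>x. ennreal (g x))" and w: "locally_integrable \<kappa> w"
    and \<sigma>: "\<sigma> = density \<kappa> (\<lambda>x. ennreal (indicator {x. g x = 0} x))"
  shows "locally_integrable \<gamma> (\<lambda>x. (1 / g x) *\<^sub>R w x)" "locally_integrable \<sigma> w"
    "radon_density \<kappa> w = (\<lambda>A. radon_density \<gamma> (\<lambda>x. (1 / g x) *\<^sub>R w x) A + radon_density \<sigma> w A)"
    "singular_radon (radon_density \<sigma> w) \<gamma>"
proof -
  note s = pos_radonD(1)[OF \<kappa>]
  note [measurable_cong] = s
  have [measurable]: "w \<in> borel_measurable borel" using w by (simp add: locally_integrable_def)
  note [measurable] = g(1)
  let ?Z = "{x. g x = 0}"
  have Z[measurable]: "?Z \<in> sets borel" by measurable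
  have fin: "integrable \<kappa> (\<lambda>x. indicator A x *\<^sub>R w x)" if "bdd_borel A" for A
    using set_integrable_bdd_borel[OF \<kappa> w that] by (simp add: set_integrable_def)
  have bd: "integrable \<kappa> (\<lambda>x. (indicator B x :: real) *\<^sub>R (indicator A x :: real) *\<^sub>R w x)"
    if "bdd_borel A" "B \<in> sets borel" for A B
    using integrable_mult_indicator[OF _ fin[OF that(1)], of B] that(2) by (simp add: s del: scaleR_scaleR)
  have gw: "g x *\<^sub>R (c *\<^sub>R (1 / g x) *\<^sub>R w x) = indicator (- ?Z) x *\<^sub>R c *\<^sub>R w x" for c x
    by (auto simp: indicator_def)
  have i1: "integrable \<gamma> (\<lambda>x. indicator A x *\<^sub>R (1 / g x) *\<^sub>R w x)" if A: "bdd_borel A" for A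
    unfolding eq
  proof (subst integrable_density)
    show "integrable \<kappa> (\<lambda>x. g x *\<^sub>R indicator A x *\<^sub>R (1 / g x) *\<^sub>R w x)"
      unfolding gw using A by (intro bd) auto
  qed (use A g(2) in auto)
  have i2: "integrable \<sigma> (\<lambda>x. indicator A x *\<^sub>R w x)" if A: "bdd_borel A" for A
    unfolding \<sigma>
  proof (subst integrable_density)
    show "integrable \<kappa> (\<lambda>x. indicator ?Z x *\<^sub>R indicator A x *\<^sub>R w x)" using A by (intro bd) auto
  qed (use A in auto)
  show l1: "locally_integrable \<gamma> (\<lambda>x. (1 / g x) *\<^sub>R w x)"
    using i1 by (auto simp: locally_integrable_def set_integrable_def compact_imp_bounded borel_compact)
  show l2: "locally_integrable \<sigma> w"
    using i2 by (auto simp: locally_integrable_def set_integrable_def compact_imp_bounded borel_compact)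
  show "radon_density \<kappa> w = (\<lambda>A. radon_density \<gamma> (\<lambda>x. (1 / g x) *\<^sub>R w x) A + radon_density \<sigma> w A)"
  proof
    fix A
    show "radon_density \<kappa> w A = radon_density \<gamma> (\<lambda>x. (1 / g x) *\<^sub>R w x) A + radon_density \<sigma> w A"
    proof (cases "bdd_borel A")
      case A: True
      have "(\<integral>x. indicator A x *\<^sub>R (1 / g x) *\<^sub>R w x \<partial>\<gamma>) = (\<integral>x. indicator (- ?Z) x *\<^sub>R indicator A x *\<^sub>R w x \<partial>\<kappa>)"
      proof -
        have "(\<integral>x. indicator A x *\<^sub>R (1 / g x) *\<^sub>R w x \<partial>\<gamma>) = (\<integral>x. g x *\<^sub>R indicator A x *\<^sub>R (1 / g x) *\<^sub>R w x \<partial>\<kappa>)"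
          unfolding eq using A g(2) by (intro integral_density) auto
        then show ?thesis unfolding gw .
      qed
      moreover have "(\<integral>x. indicator A x *\<^sub>R w x \<partial>\<sigma>) = (\<integral>x. indicator ?Z x *\<^sub>R indicator A x *\<^sub>R w x \<partial>\<kappa>)"
        unfolding \<sigma> using A by (subst integral_density) auto
      moreover have "(\<integral>x. indicator A x *\<^sub>R w x \<partial>\<kappa>) = (\<integral>x. indicator (- ?Z) x *\<^sub>R indicator A x *\<^sub>R w x
          + indicator ?Z x *\<^sub>R indicator A x *\<^sub>R w x \<partial>\<kappa>)"
        by (intro Bochner_Integration.integral_cong refl) (auto simp: indicator_def)
      ultimately show ?thesis
        using A bd[OF A, of "- ?Z"] bd[OF A, of ?Z]
        by (simp add: radon_density_def set_lebesgue_integral_def del: scaleR_scaleR)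
    qed (auto simp: radon_density_def)
  qed
  show "singular_radon (radon_density \<sigma> w) \<gamma>"
    unfolding singular_radon_def singular_pos_def
  proof (intro bexI[of _ ?Z] conjI)
    show "emeasure \<gamma> ?Z = 0"
    proof -
      have "emeasure \<gamma> ?Z = (\<integral>\<^sup>+x. ennreal (g x) * indicator ?Z x \<partial>\<kappa>)"
        unfolding eq by (rule emeasure_density) auto
      also have "\<dots> = (\<integral>\<^sup>+x. 0 \<partial>\<kappa>)" by (intro nn_integral_cong) (auto simp: indicator_def)
      finally show ?thesis by simp
    qed
    have "emeasure (total_variation (radon_density \<sigma> w)) (- ?Z) \<le> 0"
    proof (rule total_variation_le)
      fix P assume P: "\<And>B. B \<in> P \<Longrightarrow> bdd_borel B \<and> B \<subseteq> - ?Z"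
      have "radon_density \<sigma> w B = 0" if "B \<in> P" for B
      proof -
        have "(\<integral>x. indicator B x *\<^sub>R w x \<partial>\<sigma>) = (\<integral>x. indicator ?Z x *\<^sub>R indicator B x *\<^sub>R w x \<partial>\<kappa>)"
          unfolding \<sigma> using P[OF that] by (subst integral_density) auto
        also have "\<dots> = (\<integral>x. 0 \<partial>\<kappa>)"
          using P[OF that] by (intro Bochner_Integration.integral_cong) (auto simp: indicator_def)
        finally show ?thesis by (simp add: radon_density_def set_lebesgue_integral_def)
      qed
      then show "(\<Sum>B\<in>P. ennreal (norm (radon_density \<sigma> w B))) \<le> 0" by simp
    qed
    then show "emeasure (total_variation (radon_density \<sigma> w)) (- ?Z) = 0" by simp
  qed (rule Z)
qed

text \<open>Gives the \<open>SOME\<close> in \<open>action\<close> something to choose. One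
  reference measure dominates \<open>\<gamma>\<close> and the Jordan parts of \<mu> and of all
  coordinates of \<nu>; both Lebesgue decompositions are then read off from
  \<open>density_split\<close> with the same \<sigma>.\<close>

lemma action_data_exists:
  fixes \<nu> :: "'a::euclidean_space set \<Rightarrow> 'a"
  assumes \<gamma>: "pos_radon \<gamma>" and \<mu>: "radon \<mu>" and \<nu>: "radon \<nu>"
  shows "\<exists>\<rho> w \<sigma> \<rho>s ws. action_data \<gamma> \<mu> \<nu> \<rho> w \<sigma> \<rho>s ws"
proof -
  \<comment> \<open>\<open>None\<close> stands for \<mu>, \<open>Some j\<close> for the coordinate
    of \<nu> along j.\<close>
  define c where "c i A = (case i of None \<Rightarrow> \<mu> A | Some j \<Rightarrow> \<nu> A \<bullet> j)" for i A
  have c: "radon (c i)" for i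
    using \<mu> radon_inner[OF \<nu>] by (cases i) (auto simp: c_def[abs_def])
  \<comment> \<open>For every i, k = 0 is \<open>\<gamma>\<close>, while k = 1 and k = 2 are the
    Jordan parts of component i; a single application of \<open>common_density\<close> then covers
    everything.\<close>
  define M where "M = (\<lambda>(i, k). if k = (0::nat) then \<gamma> else if k = 1 then jordan_pos (c i) else jordan_pos (\<lambda>A. - c i A))"
  define I :: "('a option \<times> nat) set" where "I = ({None} \<union> Some ` Basis) \<times> {0, 1, 2}"
  have "finite I" by (simp add: I_def)
  moreover have M: "pos_radon (M i)" for i
    using \<gamma> pos_radon_jordan2[OF c] by (auto simp: M_def split: prod.splits)
  ultimately obtain \<kappa> d where \<kappa>: "pos_radon \<kappa>" and d: "\<And>i. i \<in> I \<Longrightarrow> d i \<in> borel_measurable borel"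
    "\<And>i x. i \<in> I \<Longrightarrow> 0 \<le> d i x" "\<And>i. i \<in> I \<Longrightarrow> M i = density \<kappa> (\<lambda>x. ennreal (d i x))"
    using common_density[of I M] by metis
  have den: "locally_integrable \<kappa> (d i)" "bdd_borel A \<Longrightarrow> measure (M i) A = (LINT x:A|\<kappa>. d i x)"
    if "i \<in> I" for i A
    using density_pos_radon(1,2)[OF \<kappa> M d(1,2,3), of i] that by auto
  define m where "m i x = d (i, 1) x - d (i, 2) x" for i x
  have m: "locally_integrable \<kappa> (m i)" "c i = radon_density \<kappa> (m i)" if "i \<in> {None} \<union> Some ` Basis" for i
  proof -
    have I: "(i, 1) \<in> I" "(i, 2) \<in> I" using that by (auto simp: I_def)
    show "locally_integrable \<kappa> (m i)" unfolding m_def by (intro locally_integrable_diff den I)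
    show "c i = radon_density \<kappa> (m i)"
    proof
      fix A show "c i A = radon_density \<kappa> (m i) A"
      proof (cases "bdd_borel A")
        case A: True
        have "c i A = measure (M (i, 1)) A - measure (M (i, 2)) A"
          using jordan_decomposition[OF c A, of i] by (simp add: M_def)
        also have "\<dots> = radon_density \<kappa> (m i) A"
          unfolding den(2)[OF I(1) A] den(2)[OF I(2) A]
          using set_integrable_bdd_borel[OF \<kappa> den(1)[OF I(1)] A] set_integrable_bdd_borel[OF \<kappa> den(1)[OF I(2)] A] A
          by (simp add: radon_density_def m_def[abs_def] set_integral_diff)
        finally show ?thesis .
      qed (use radon_outside[OF c] in \<open>auto simp: radon_density_def\<close>)
    qed
  qed
  define v where "v x = (\<Sum>j\<in>Basis. m (Some j) x *\<^sub>R j)" for x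
  have vj: "locally_integrable \<kappa> (\<lambda>x. m (Some j) x *\<^sub>R j)" if "j \<in> Basis" for j
    using that by (intro locally_integrable_linear[OF m(1) bounded_linear_scaleR_left \<kappa>]) auto
  have v: "locally_integrable \<kappa> v"
    unfolding v_def using finite_Basis vj
    by (induction rule: finite_induct) (auto intro: locally_integrable_add locally_integrable_const[OF \<kappa>])
  have \<nu>v: "\<nu> = radon_density \<kappa> v"
  proof
    fix A
    have "\<nu> A \<bullet> j = radon_density \<kappa> v A \<bullet> j" if j: "j \<in> Basis" for j
    proof -
      have "(\<lambda>x. v x \<bullet> j) = m (Some j)"
        using j by (auto simp: v_def inner_sum_left inner_Basis if_distrib sum.delta cong: if_cong)
      then show ?thesis
        using m(2)[of "Some j"] j radon_density_inner[OF \<kappa> v, of A j]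
        by (auto simp: c_def fun_eq_iff)
    qed
    then show "\<nu> A = radon_density \<kappa> v A" by (rule euclidean_eqI)
  qed
  let ?g = "d (None, 0)"
  have 0: "(None, 0) \<in> I" by (simp add: I_def)
  have g: "?g \<in> borel_measurable borel" "\<And>x. 0 \<le> ?g x" "\<gamma> = density \<kappa> (\<lambda>x. ennreal (?g x))"
    using d[OF 0] by (auto simp: M_def)
  define \<sigma> where "\<sigma> = density \<kappa> (\<lambda>x. ennreal (indicator {x. ?g x = 0} x))"
  have Z: "{x. ?g x = 0} \<in> sets borel" using g(1) by measurable
  note s = pos_radonD(1)[OF \<kappa>]
  have em: "emeasure \<sigma> A = (\<integral>\<^sup>+x. ennreal (indicator {x. ?g x = 0} x) * indicator A x \<partial>\<kappa>)" if "A \<in> sets borel" for A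
    unfolding \<sigma>_def using that Z by (intro emeasure_density) (auto simp: s measurable_cong_sets[OF s refl])
  have \<sigma>: "pos_radon \<sigma>"
  proof (rule pos_radonI)
    fix A :: "'a set" assume A: "bdd_borel A"
    have "emeasure \<sigma> A \<le> (\<integral>\<^sup>+x. indicator A x \<partial>\<kappa>)"
      using em[of A] A by (auto intro!: nn_integral_mono simp: indicator_def)
    also have "\<dots> < \<infinity>" using pos_radonD(3)[OF \<kappa>, of A] A by (simp add: s)
    finally show "emeasure \<sigma> A < \<infinity>" .
  qed (simp add: \<sigma>_def s)
  have "singular_pos \<sigma> \<gamma>"
    unfolding singular_pos_def
  proof (intro bexI[OF _ Z] conjI)
    show "emeasure \<gamma> {x. ?g x = 0} = 0"
    proof -
      have "emeasure \<gamma> {x. ?g x = 0} = (\<integral>\<^sup>+x. ennreal (?g x) * indicator {x. ?g x = 0} x \<partial>\<kappa>)"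
        using Z g(1) by (subst g(3), intro emeasure_density) (auto simp: s measurable_cong_sets[OF s refl])
      also have "\<dots> = (\<integral>\<^sup>+x. 0 \<partial>\<kappa>)" by (intro nn_integral_cong) (auto simp: indicator_def)
      finally show ?thesis by simp
    qed
    have "emeasure \<sigma> (- {x. ?g x = 0}) = (\<integral>\<^sup>+x. 0 \<partial>\<kappa>)"
      using Z by (subst em) (auto intro!: nn_integral_cong simp: indicator_def of_bool_def simp del: nn_integral_const)
    then show "emeasure \<sigma> (- {x. ?g x = 0}) = 0" by simp
  qed
  moreover have "\<mu> = radon_density \<kappa> (m None)" using m(2)[of None] by (simp add: c_def[abs_def])
  ultimately have "action_data \<gamma> \<mu> \<nu> (\<lambda>x. (1 / ?g x) *\<^sub>R m None x) (\<lambda>x. (1 / ?g x) *\<^sub>R v x) \<sigma> (m None) v"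
    unfolding action_data_def lebesgue_decomposition_def
    using density_split[OF \<kappa> \<gamma> g m(1)[of None] \<sigma>_def] density_split[OF \<kappa> \<gamma> g v \<sigma>_def] \<sigma> \<nu>v
      radon_radon_density[OF \<sigma>, of "m None"] radon_radon_density[OF \<sigma>, of v]
    by (intro exI[of _ "radon_density \<sigma> (m None)"] exI[of _ "radon_density \<sigma> v"]) simp
  then show ?thesis by blast
qed


lemma action_choice:
  assumes "pos_radon \<gamma>" "radon \<mu>" "radon \<nu>"
  shows "\<exists>\<rho> w \<sigma> \<rho>s ws. action_data \<gamma> \<mu> \<nu> \<rho> w \<sigma> \<rho>s ws \<and>
    action \<phi> \<mu> \<nu> \<gamma> = (\<integral>\<^sup>+x. \<phi> (\<rho> x, w x) \<partial>\<gamma>) + (\<integral>\<^sup>+x. e2ennreal (recession \<phi> (\<rho>s x, ws x)) \<partial>\<sigma>)"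
proof -
  define P where "P = (\<lambda>(\<rho>, w, \<sigma>, \<rho>s, ws). action_data \<gamma> \<mu> \<nu> \<rho> w \<sigma> \<rho>s ws)"
  have "\<exists>z. P z" using action_data_exists[OF assms] by (auto simp: P_def)
  then have "P (SOME z. P z)" by (rule someI_ex)
  then show ?thesis unfolding action_def P_def[symmetric]
    by (cases "SOME z. P z") (simp add: P_def Let_def, blast)
qed

text \<open>The set N that witnesses singularity separates the two measures: outside N only
  \<open>\<gamma>\<close> acts, inside N only \<sigma>. Testing the identity on \<open>A - N\<close>
  and on \<open>A \<inter> N\<close> isolates the two claims.\<close>

lemma singular_density_unique:
  fixes f f' fs :: "'a::euclidean_space \<Rightarrow> 'b::euclidean_space"
  assumes \<gamma>: "pos_radon \<gamma>" and \<sigma>: "pos_radon \<sigma>" and sing: "singular_pos \<sigma> \<gamma>"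
    and f: "locally_integrable \<gamma> f" "locally_integrable \<gamma> f'" "locally_integrable \<sigma> fs"
    and eq: "radon_density \<gamma> f = (\<lambda>A. radon_density \<gamma> f' A + radon_density \<sigma> fs A)"
  shows "AE x in \<gamma>. f x = f' x" "AE x in \<sigma>. fs x = 0"
proof -
  obtain N where N: "N \<in> sets borel" "emeasure \<gamma> N = 0" "emeasure \<sigma> (- N) = 0"
    using sing by (auto simp: singular_pos_def)
  have ae\<gamma>: "AE x in \<gamma>. x \<notin> N"
    using N by (intro AE_not_in) (auto simp: null_sets_def pos_radonD(1)[OF \<gamma>])
  have ae\<sigma>: "AE x in \<sigma>. x \<in> N"
    using N AE_not_in[of "- N" \<sigma>] by (auto simp: null_sets_def pos_radonD(1)[OF \<sigma>])
  have meas: "h \<in> borel_measurable \<alpha>" if "locally_integrable \<alpha> h" "pos_radon \<alpha>" for h :: "'a \<Rightarrow> 'b" and \<alpha>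
    using that by (simp add: locally_integrable_def measurable_cong_sets[OF pos_radonD(1) refl])
  have null: "(LINT x:A|\<alpha>. h x) = 0"
    if "AE x in \<alpha>. x \<notin> A" "A \<in> sets borel" "locally_integrable \<alpha> h" "pos_radon \<alpha>" for h :: "'a \<Rightarrow> 'b" and \<alpha> A
  proof -
    have "(LINT x|\<alpha>. indicator A x *\<^sub>R h x) = (LINT x|\<alpha>. 0)"
      using that(1,2) meas[OF that(3,4)] pos_radonD(1)[OF that(4)]
      by (intro integral_cong_AE borel_measurable_scaleR borel_measurable_indicator) (auto elim!: eventually_mono)
    then show ?thesis by (simp add: set_lebesgue_integral_def)
  qed
  have cong: "(LINT x:A|\<alpha>. h x) = (LINT x:B|\<alpha>. h x)"
    if "AE x in \<alpha>. x \<in> A \<longleftrightarrow> x \<in> B" "A \<in> sets borel" "B \<in> sets borel" "locally_integrable \<alpha> h" "pos_radon \<alpha>" for h :: "'a \<Rightarrow> 'b" and \<alpha> A B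
    unfolding set_lebesgue_integral_def
    using that(1,2,3) meas[OF that(4,5)] pos_radonD(1)[OF that(5)]
    by (intro integral_cong_AE borel_measurable_scaleR borel_measurable_indicator)
      (auto elim!: eventually_mono simp: indicator_def)
  have eqA: "(LINT x:A|\<gamma>. f x) = (LINT x:A|\<gamma>. f' x) + (LINT x:A|\<sigma>. fs x)" if "bdd_borel A" for A
    using fun_cong[OF eq, of A] that by (simp add: radon_density_def)
  have "AE x in \<gamma>. f x - f' x = 0"
  proof (rule locally_integrable_zero_AE[OF \<gamma> locally_integrable_diff[OF f(1,2)]])
    fix A :: "'a set" assume A: "bdd_borel A"
    then have AN: "bdd_borel (A - N)" using N by (auto intro: bounded_subset)
    have "(LINT x:(A - N)|\<sigma>. fs x) = 0"
      using AN ae\<sigma> by (intro null[OF _ _ f(3) \<sigma>]) (auto elim!: eventually_mono)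
    moreover have "(LINT x:A|\<gamma>. h x) = (LINT x:(A - N)|\<gamma>. h x)" if "locally_integrable \<gamma> h" for h :: "'a \<Rightarrow> 'b"
      using AN A ae\<gamma> by (intro cong[OF _ _ _ that \<gamma>]) (auto elim!: eventually_mono)
    ultimately have "(LINT x:A|\<gamma>. f x) = (LINT x:A|\<gamma>. f' x)"
      using eqA[OF AN] f by simp
    then show "(LINT x:A|\<gamma>. f x - f' x) = 0"
      using set_integral_diff(2)[OF set_integrable_bdd_borel[OF \<gamma> f(1) A] set_integrable_bdd_borel[OF \<gamma> f(2) A]]
      by simp
  qed
  then show "AE x in \<gamma>. f x = f' x" by simp
  show "AE x in \<sigma>. fs x = 0"
  proof (rule locally_integrable_zero_AE[OF \<sigma> f(3)])
    fix A :: "'a set" assume A: "bdd_borel A"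
    then have AN: "bdd_borel (A \<inter> N)" using N by (auto intro: bounded_subset)
    have "(LINT x:(A \<inter> N)|\<gamma>. h x) = 0" if "locally_integrable \<gamma> h" for h :: "'a \<Rightarrow> 'b"
      using AN ae\<gamma> by (intro null[OF _ _ that \<gamma>]) (auto elim!: eventually_mono)
    then have "(LINT x:(A \<inter> N)|\<sigma>. fs x) = 0" using eqA[OF AN] f by simp
    moreover have "(LINT x:A|\<sigma>. fs x) = (LINT x:(A \<inter> N)|\<sigma>. fs x)"
      using AN A ae\<sigma> by (intro cong[OF _ _ _ f(3) \<sigma>]) (auto elim!: eventually_mono)
    ultimately show "(LINT x:A|\<sigma>. fs x) = 0" by simp
  qed
qed

text \<open>Treats (\<mu>, \<nu>) as one measure with values in the product space, so that its
  density is exactly the argument of \<open>\<phi>\<close> and both terms of the continuity equation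
  are instances.\<close>

definition pairing :: "('a::euclidean_space set \<Rightarrow> real) \<Rightarrow> ('a set \<Rightarrow> 'a) \<Rightarrow> ('a \<Rightarrow> real \<times> 'a) \<Rightarrow> real" where
  "pairing \<mu> \<nu> F = signed_integral \<mu> (\<lambda>x. fst (F x)) + vector_integral \<nu> (\<lambda>x. snd (F x))"

lemma bbs_fst: "bbs F \<Longrightarrow> bbs (\<lambda>x. fst (F x))"
  by (rule bbs_linear[of F fst]) (auto intro: bounded_linear_fst)

lemma bbs_snd: "bbs F \<Longrightarrow> bbs (\<lambda>x. snd (F x))"
  by (rule bbs_linear[of F snd]) (auto intro: bounded_linear_snd)

lemma locally_integrable_Pair:
  assumes "pos_radon \<gamma>" "locally_integrable \<gamma> f" "locally_integrable \<gamma> g"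
  shows "locally_integrable \<gamma> (\<lambda>x. (f x, g x))"
proof -
  have "locally_integrable \<gamma> (\<lambda>x. (f x, 0) + (0, g x))"
  proof (rule locally_integrable_add)
    show "locally_integrable \<gamma> (\<lambda>x. (f x, 0))"
      by (rule locally_integrable_linear[OF assms(2) _ assms(1), of "\<lambda>y. (y, 0)"])
        (auto intro: bounded_linear_Pair bounded_linear_ident bounded_linear_zero)
    show "locally_integrable \<gamma> (\<lambda>x. (0, g x))"
      by (rule locally_integrable_linear[OF assms(3) _ assms(1), of "\<lambda>y. (0, y)"])
        (auto intro: bounded_linear_Pair bounded_linear_ident bounded_linear_zero)
  qed
  then show ?thesis by simp
qed

lemma pairing_density:
  assumes \<gamma>: "pos_radon \<gamma>" and l: "locally_integrable \<gamma> \<rho>" "locally_integrable \<gamma> w" and F: "bbs F"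
  shows "pairing (radon_density \<gamma> \<rho>) (radon_density \<gamma> w) F = (\<integral>x. F x \<bullet> (\<rho> x, w x) \<partial>\<gamma>)"
  using integrable_bbs_inner[OF \<gamma> l(1) bbs_fst[OF F]] integrable_bbs_inner[OF \<gamma> l(2) bbs_snd[OF F]]
  by (simp add: pairing_def signed_integral_density[OF \<gamma> l(1) bbs_fst[OF F]]
      vector_integral_density[OF \<gamma> l(2) bbs_snd[OF F]] inner_prod_def)

lemma finite_action_density:
  assumes adm: "\<phi> \<in> admissible_on p a b" "1 < p" "a < b"
    and \<gamma>: "pos_radon \<gamma>" and \<mu>: "radon \<mu>" and \<nu>: "radon \<nu>" and fin: "action \<phi> \<mu> \<nu> \<gamma> < \<infinity>"
  shows "\<exists>\<rho> w. locally_integrable \<gamma> \<rho> \<and> locally_integrable \<gamma> w \<and>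
    \<mu> = radon_density \<gamma> \<rho> \<and> \<nu> = radon_density \<gamma> w \<and> (\<integral>\<^sup>+x. \<phi> (\<rho> x, w x) \<partial>\<gamma>) \<le> action \<phi> \<mu> \<nu> \<gamma>"
proof -
  obtain \<rho> w \<sigma> \<rho>s ws where d: "action_data \<gamma> \<mu> \<nu> \<rho> w \<sigma> \<rho>s ws"
    and eq: "action \<phi> \<mu> \<nu> \<gamma> = (\<integral>\<^sup>+x. \<phi> (\<rho> x, w x) \<partial>\<gamma>) + (\<integral>\<^sup>+x. e2ennreal (recession \<phi> (\<rho>s x, ws x)) \<partial>\<sigma>)"
    using action_choice[OF \<gamma> \<mu> \<nu>] by blast
  have l: "locally_integrable \<gamma> \<rho>" "locally_integrable \<gamma> w" "locally_integrable \<sigma> \<rho>s" "locally_integrable \<sigma> ws"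
    and \<sigma>: "pos_radon \<sigma>"
    and m: "\<mu> = (\<lambda>A. radon_density \<gamma> \<rho> A + radon_density \<sigma> \<rho>s A)"
      "\<nu> = (\<lambda>A. radon_density \<gamma> w A + radon_density \<sigma> ws A)"
    using d by (auto simp: action_data_def lebesgue_decomposition_def)
  note s = pos_radonD(1)[OF \<sigma>]
  note [measurable_cong] = s
  have [measurable]: "\<rho>s \<in> borel_measurable borel" "ws \<in> borel_measurable borel"
    using l by (auto simp: locally_integrable_def)
  \<comment> \<open>The singular part of the action is thus 0 or infinite; finite action forces both
    singular densities to vanish \<sigma>-almost everywhere.\<close>
  have rec: "e2ennreal (recession \<phi> y) = (if y = 0 then 0 else \<infinity>)" for y
    using recession_zero[OF adm] recession_infinite[OF adm, of y] e2ennreal_neg[of 0] by auto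
  have "(\<integral>\<^sup>+x. (if (\<rho>s x, ws x) = 0 then 0 else \<infinity>) \<partial>\<sigma>) \<noteq> \<infinity>"
    using fin unfolding eq rec by auto
  then have "AE x in \<sigma>. (if (\<rho>s x, ws x) = 0 then 0 else \<infinity> :: ennreal) \<noteq> \<infinity>"
    by (intro nn_integral_PInf_AE) (simp_all add: zero_prod_def)
  then have z: "AE x in \<sigma>. (\<rho>s x, ws x) = 0"
    by eventually_elim (auto split: if_splits)
  have z1: "radon_density \<sigma> \<rho>s A = 0" for A
  proof (cases "bdd_borel A")
    case True
    have "AE x in \<sigma>. indicator A x *\<^sub>R \<rho>s x = 0"
      using z by eventually_elim (auto simp: zero_prod_def)
    then have "(\<integral>x. indicator A x *\<^sub>R \<rho>s x \<partial>\<sigma>) = (\<integral>x. 0 \<partial>\<sigma>)"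
      using True by (intro integral_cong_AE) auto
    then show ?thesis by (simp add: radon_density_def set_lebesgue_integral_def)
  qed (auto simp: radon_density_def)
  have z2: "radon_density \<sigma> ws A = 0" for A
  proof (cases "bdd_borel A")
    case True
    have "AE x in \<sigma>. indicator A x *\<^sub>R ws x = 0"
      using z by eventually_elim (auto simp: zero_prod_def)
    then have "(\<integral>x. indicator A x *\<^sub>R ws x \<partial>\<sigma>) = (\<integral>x. 0 \<partial>\<sigma>)"
      using True by (intro integral_cong_AE) auto
    then show ?thesis by (simp add: radon_density_def set_lebesgue_integral_def)
  qed (auto simp: radon_density_def)
  have m': "\<mu> = radon_density \<gamma> \<rho>" "\<nu> = radon_density \<gamma> w"
    using m z1 z2 by (auto simp: fun_eq_iff)
  have "(\<integral>\<^sup>+x. \<phi> (\<rho> x, w x) \<partial>\<gamma>) \<le> action \<phi> \<mu> \<nu> \<gamma>" unfolding eq by simp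
  then show ?thesis using l m' by blast
qed

text \<open>The data picked by \<open>SOME\<close> may differ from (\<rho>, w), but uniqueness of
  the decomposition makes them agree almost everywhere and makes the singular densities 0, where the
  recession function is 0.\<close>

lemma action_density_le:
  assumes adm: "\<phi> \<in> admissible_on p a b" "1 < p" "a < b"
    and \<gamma>: "pos_radon \<gamma>" and l: "locally_integrable \<gamma> \<rho>" "locally_integrable \<gamma> w"
  shows "action \<phi> (radon_density \<gamma> \<rho>) (radon_density \<gamma> w) \<gamma> \<le> (\<integral>\<^sup>+x. \<phi> (\<rho> x, w x) \<partial>\<gamma>)"
proof -
  obtain \<rho>' w' \<sigma> \<rho>s ws where d: "action_data \<gamma> (radon_density \<gamma> \<rho>) (radon_density \<gamma> w) \<rho>' w' \<sigma> \<rho>s ws"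
    and eq: "action \<phi> (radon_density \<gamma> \<rho>) (radon_density \<gamma> w) \<gamma> =
      (\<integral>\<^sup>+x. \<phi> (\<rho>' x, w' x) \<partial>\<gamma>) + (\<integral>\<^sup>+x. e2ennreal (recession \<phi> (\<rho>s x, ws x)) \<partial>\<sigma>)"
    using action_choice[OF \<gamma> radon_radon_density[OF \<gamma> l(1)] radon_radon_density[OF \<gamma> l(2)]] by blast
  have l': "locally_integrable \<gamma> \<rho>'" "locally_integrable \<gamma> w'" "locally_integrable \<sigma> \<rho>s" "locally_integrable \<sigma> ws"
    and \<sigma>: "pos_radon \<sigma>" "singular_pos \<sigma> \<gamma>"
    and m: "radon_density \<gamma> \<rho> = (\<lambda>A. radon_density \<gamma> \<rho>' A + radon_density \<sigma> \<rho>s A)"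
      "radon_density \<gamma> w = (\<lambda>A. radon_density \<gamma> w' A + radon_density \<sigma> ws A)"
    using d by (auto simp: action_data_def lebesgue_decomposition_def)
  note u1 = singular_density_unique[OF \<gamma> \<sigma> l(1) l'(1,3) m(1)]
  note u2 = singular_density_unique[OF \<gamma> \<sigma> l(2) l'(2,4) m(2)]
  have "(\<integral>\<^sup>+x. \<phi> (\<rho>' x, w' x) \<partial>\<gamma>) \<le> (\<integral>\<^sup>+x. \<phi> (\<rho> x, w x) \<partial>\<gamma>)"
    by (intro nn_integral_mono_AE, use u1(1) u2(1) in eventually_elim) simp
  moreover have "(\<integral>\<^sup>+x. e2ennreal (recession \<phi> (\<rho>s x, ws x)) \<partial>\<sigma>) \<le> (\<integral>\<^sup>+x. 0 \<partial>\<sigma>)"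
    by (intro nn_integral_mono_AE, use u1(2) u2(2) in eventually_elim)
      (simp add: zero_prod_def[symmetric] recession_zero[OF adm] e2ennreal_neg)
  ultimately show ?thesis unfolding eq by simp
qed

section \<open>Forward convex combinations\<close>

lemma norm_Pair_1_le: "norm (1::real, a) \<le> 1 + norm a"
  using norm_Pair_le[of "1::real" a] by simp

text \<open>Quantitative strict convexity of \<open>a \<mapsto> norm (1, a)\<close>, obtained from the Cauchy--Schwarz
  defect of \<open>(1, a)\<close> and \<open>(1, b)\<close>.\<close>

lemma norm_Pair_1_gap:
  fixes a b :: "'b::euclidean_space"
  assumes M: "norm a \<le> M" "norm b \<le> M"
  shows "(norm (a - b))\<^sup>2 \<le> 4 * (1 + M) ^ 3 * (norm (1::real, a) + norm (1::real, b) - norm (2::real, a + b))"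
proof -
  define s t r d where "s = norm (1::real, a)" and "t = norm (1::real, b)"
    and "r = norm (2::real, a + b)" and "d = 1 + a \<bullet> b"
  have M0: "0 \<le> M" using M norm_ge_zero order.trans by blast
  have s2: "s\<^sup>2 = 1 + (norm a)\<^sup>2" and t2: "t\<^sup>2 = 1 + (norm b)\<^sup>2" and r2: "r\<^sup>2 = s\<^sup>2 + t\<^sup>2 + 2 * d"
    by (simp_all add: s_def t_def r_def d_def power2_norm_eq_inner inner_add_left inner_add_right inner_commute)
  have st: "0 \<le> s" "0 \<le> t" "0 \<le> r" "s \<le> 1 + M" "t \<le> 1 + M"
    using norm_Pair_1_le[of a] norm_Pair_1_le[of b] M by (auto simp: s_def t_def r_def)
  have dle: "d \<le> s * t" using norm_cauchy_schwarz[of "(1::real, a)" "(1::real, b)"] by (simp add: s_def t_def d_def)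
  have r: "r \<le> s + t" using norm_triangle_ineq[of "(1::real, a)" "(1::real, b)"] by (simp add: s_def t_def r_def)
  have cs: "(a \<bullet> b)\<^sup>2 \<le> (norm a)\<^sup>2 * (norm b)\<^sup>2"
    using Cauchy_Schwarz_ineq[of a b] by (simp add: power2_norm_eq_inner)
  have "(norm (a - b))\<^sup>2 = (norm a)\<^sup>2 + (norm b)\<^sup>2 - 2 * (a \<bullet> b)"
    by (simp add: power2_norm_eq_inner inner_diff_left inner_diff_right inner_commute)
  \<comment> \<open>The right side equals
    \<open>|a - b|^2 + |a|^2 |b|^2 - (a \<bullet> b)^2\<close>, and the last difference is
    nonnegative by Cauchy-Schwarz.\<close>
  also have "\<dots> \<le> s\<^sup>2 * t\<^sup>2 - d\<^sup>2"
    unfolding s2 t2 d_def using cs by (simp add: power2_eq_square algebra_simps)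
  also have "\<dots> = (s * t - d) * (s * t + d)" by (simp add: power2_eq_square algebra_simps)
  also have "\<dots> \<le> (s * t - d) * (2 * (1 + M)\<^sup>2)"
  proof (rule mult_left_mono)
    have "s * t \<le> (1 + M) * (1 + M)" using st by (intro mult_mono) auto
    then show "s * t + d \<le> 2 * (1 + M)\<^sup>2" using dle by (simp add: power2_eq_square)
  qed (use dle in simp)
  \<comment> \<open>A difference of squares, \<open>(s + t)^2 - r^2\<close>: it turns the
    Cauchy-Schwarz defect into the triangle gap s + t - r.\<close>
  also have "2 * (s * t - d) = (s + t - r) * (s + t + r)"
    using r2 by (simp add: power2_eq_square algebra_simps)
  then have "(s * t - d) * (2 * (1 + M)\<^sup>2) = (s + t - r) * (s + t + r) * (1 + M)\<^sup>2" by simp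
  also have "\<dots> \<le> (s + t - r) * (4 * (1 + M)) * (1 + M)\<^sup>2"
    using r st by (intro mult_right_mono mult_left_mono) auto
  also have "\<dots> = 4 * (1 + M) ^ 3 * (s + t - r)" by (simp add: power2_eq_square power3_eq_cube)
  finally show ?thesis unfolding s_def t_def r_def .
qed

text \<open>If both values are below 2K, the difference is below \<eta> or controlled by the gap.
  Otherwise the larger one, c, has \<open>K < norm c / 2\<close>, so
  \<open>norm c \<le> e * \<Xi> c + K\<close> absorbs K and leaves \<open>2 * e * \<Xi> c\<close>;
  the factor 4 comes from \<open>norm (a - b) \<le> 2 * norm c\<close>.\<close>

lemma norm_diff_gap:
  fixes a b :: "'b::euclidean_space" and \<Xi> :: "'b \<Rightarrow> ennreal"
  assumes K: "0 \<le> K" "\<And>z. ennreal (norm z) \<le> ennreal e * \<Xi> z + ennreal K" and \<eta>: "0 < \<eta>" and e: "0 \<le> e"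
  shows "ennreal (norm (a - b)) \<le> ennreal \<eta> + ennreal (4 * (1 + 2 * K) ^ 3 / \<eta> *
      (norm (1::real, a) + norm (1::real, b) - norm (2::real, a + b))) + ennreal (4 * e) * (\<Xi> a + \<Xi> b)"
proof -
  let ?gap = "norm (1::real, a) + norm (1::real, b) - norm (2::real, a + b)"
  have gap: "0 \<le> ?gap" using norm_triangle_ineq[of "(1::real, a)" "(1::real, b)"] by simp
  show ?thesis
  proof (cases "norm a \<le> 2 * K \<and> norm b \<le> 2 * K")
    case True
    have "norm (a - b) \<le> \<eta> + (norm (a - b))\<^sup>2 / \<eta>"
    proof (cases "norm (a - b) \<le> \<eta>")
      case False
      then have "norm (a - b) * \<eta> \<le> norm (a - b) * norm (a - b)" by (intro mult_left_mono) auto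
      then have "norm (a - b) \<le> (norm (a - b))\<^sup>2 / \<eta>" using \<eta> by (simp add: field_simps power2_eq_square)
      then show ?thesis using \<eta> by simp
    qed (use \<eta> in \<open>simp add: add_increasing2\<close>)
    also have "\<dots> \<le> \<eta> + 4 * (1 + 2 * K) ^ 3 * ?gap / \<eta>"
      using norm_Pair_1_gap[of a "2 * K" b] True \<eta> by (intro add_left_mono divide_right_mono) auto
    finally have "ennreal (norm (a - b)) \<le> ennreal (\<eta> + 4 * (1 + 2 * K) ^ 3 / \<eta> * ?gap)"
      by (intro ennreal_leI) simp
    also have "\<dots> = ennreal \<eta> + ennreal (4 * (1 + 2 * K) ^ 3 / \<eta> * ?gap)"
      using \<eta> K gap by (intro ennreal_plus) auto
    finally show ?thesis by (simp add: add_increasing2)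
  next
    case False
    define c where "c = (if norm a \<le> norm b then b else a)"
    have c: "2 * K < norm c" "norm (a - b) \<le> 2 * norm c" "\<Xi> c \<le> \<Xi> a + \<Xi> b"
      using False norm_triangle_ineq4[of a b] by (auto simp: c_def)
    have "ennreal (norm c) \<le> ennreal (2 * e) * \<Xi> c"
    proof (cases "\<Xi> c")
      case (real x)
      have "ennreal (norm c) \<le> ennreal (e * x + K)"
        using K(2)[of c] real e K(1) by (simp add: ennreal_mult ennreal_plus)
      then have "norm c \<le> e * x + K"
        by (rule iffD1[OF ennreal_le_iff, rotated]) (use e K(1) real in simp)
      then have "norm c \<le> 2 * e * x" using c(1) by simp
      then show ?thesis using real e by (simp add: ennreal_mult[symmetric] ennreal_leI)
    next
      case top
      then show ?thesis using K(2)[of c] e by (cases "e = 0") (use c K in \<open>auto simp: ennreal_mult_top\<close>)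
    qed
    then have "ennreal 2 * ennreal (norm c) \<le> ennreal 2 * (ennreal (2 * e) * \<Xi> c)" by (rule mult_left_mono) simp
    also have "\<dots> = ennreal (4 * e) * \<Xi> c"
    proof -
      have "ennreal 2 * ennreal (2 * e) = ennreal (4 * e)" using e by (subst ennreal_mult[symmetric]) auto
      then show ?thesis by (simp add: mult.assoc[symmetric])
    qed
    also have "\<dots> \<le> ennreal (4 * e) * (\<Xi> a + \<Xi> b)" by (intro mult_left_mono c) auto
    finally have "ennreal (2 * norm c) \<le> ennreal (4 * e) * (\<Xi> a + \<Xi> b)" by (simp add: ennreal_mult)
    then have "ennreal (norm (a - b)) \<le> ennreal (4 * e) * (\<Xi> a + \<Xi> b)"
      using ennreal_leI[OF c(2)] by (rule order.trans[rotated])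
    then show ?thesis by (simp add: add_increasing)
  qed
qed

text \<open>Almost everywhere convergence is available along a subsequence, and Fatou along it
  bounds the L1 distance from every late \<open>s i\<close> to the limit, so the L1 limit holds for
  the full sequence.\<close>

lemma L1_Cauchy_convergent:
  fixes s :: "nat \<Rightarrow> 'x \<Rightarrow> 'b::euclidean_space"
  assumes int: "\<And>n. integrable M (s n)"
    and cau: "\<And>e. e > 0 \<Longrightarrow> \<exists>N. \<forall>i\<ge>N. \<forall>j\<ge>N. (\<integral>x. norm (s i x - s j x) \<partial>M) < e"
  shows "\<exists>r v. strict_mono r \<and> integrable M v \<and> (AE x in M. (\<lambda>i. s (r i) x) \<longlonglongrightarrow> v x) \<and>
    (\<lambda>i. \<integral>x. norm (s i x - v x) \<partial>M) \<longlonglongrightarrow> 0"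
proof -
  obtain r where r: "strict_mono r" "AE x in M. Cauchy (\<lambda>i. s (r i) x)"
    using cauchy_L1_AE_cauchy_subseq[OF int cau] by metis
  define v where "v x = lim (\<lambda>i. s (r i) x)" for x
  have [measurable]: "s n \<in> borel_measurable M" for n using int by auto
  have [measurable]: "v \<in> borel_measurable M" unfolding v_def by (intro borel_measurable_lim_metric) auto
  have ae: "AE x in M. (\<lambda>i. s (r i) x) \<longlonglongrightarrow> v x"
    using r(2) by eventually_elim (simp add: v_def Cauchy_convergent_iff convergent_LIMSEQ_iff)
  have le: "(\<integral>\<^sup>+x. ennreal (norm (s i x - v x)) \<partial>M) \<le> ennreal e"
    if N: "\<forall>i\<ge>N. \<forall>j\<ge>N. (\<integral>x. norm (s i x - s j x) \<partial>M) < e" and i: "N \<le> i" for N e i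
  proof -
    have "(\<integral>\<^sup>+x. ennreal (norm (s i x - v x)) \<partial>M) = (\<integral>\<^sup>+x. liminf (\<lambda>j. ennreal (norm (s i x - s (r j) x))) \<partial>M)"
    proof (intro nn_integral_cong_AE, use ae in eventually_elim)
      fix x assume "(\<lambda>i. s (r i) x) \<longlonglongrightarrow> v x"
      then have "(\<lambda>j. ennreal (norm (s i x - s (r j) x))) \<longlonglongrightarrow> ennreal (norm (s i x - v x))"
        by (intro tendsto_intros tendsto_ennrealI)
      then show "ennreal (norm (s i x - v x)) = liminf (\<lambda>j. ennreal (norm (s i x - s (r j) x)))"
        by (rule lim_imp_Liminf[symmetric, rotated]) simp
    qed
    also have "\<dots> \<le> liminf (\<lambda>j. \<integral>\<^sup>+x. ennreal (norm (s i x - s (r j) x)) \<partial>M)"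
      by (intro nn_integral_liminf) auto
    also have "\<dots> \<le> ennreal e"
    proof (rule Liminf_le)
      show "eventually (\<lambda>j. (\<integral>\<^sup>+x. ennreal (norm (s i x - s (r j) x)) \<partial>M) \<le> ennreal e) sequentially"
        using eventually_ge_at_top[of N]
      proof eventually_elim
        case (elim j)
        have "(\<integral>\<^sup>+x. ennreal (norm (s i x - s (r j) x)) \<partial>M) = ennreal (\<integral>x. norm (s i x - s (r j) x) \<partial>M)"
          using int by (intro nn_integral_eq_integral) auto
        also have "\<dots> \<le> ennreal e"
          using N i elim seq_suble[OF r(1), of j] by (intro ennreal_leI) (meson less_imp_le order.trans)
        finally show ?case .
      qed
    qed simp
    finally show ?thesis .
  qed
  have dint: "integrable M (\<lambda>x. s i x - v x)" if "N \<le> i"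
    "\<forall>i\<ge>N. \<forall>j\<ge>N. (\<integral>x. norm (s i x - s j x) \<partial>M) < 1" for i N
    using le[OF that(2,1)] by (intro integrableI_bounded) (auto intro: le_less_trans)
  obtain N where N: "\<forall>i\<ge>N. \<forall>j\<ge>N. (\<integral>x. norm (s i x - s j x) \<partial>M) < 1" using cau[of 1] by auto
  have "integrable M (\<lambda>x. s N x - (s N x - v x))"
    by (rule Bochner_Integration.integrable_diff[OF int dint[OF order_refl N]])
  then have v: "integrable M v" unfolding diff_diff_eq2 add_diff_cancel_left' .
  have "(\<lambda>i. \<integral>x. norm (s i x - v x) \<partial>M) \<longlonglongrightarrow> 0"
    unfolding tendsto_iff
  proof (intro allI impI)
    fix e :: real assume "0 < e"
    then obtain N where N: "\<forall>i\<ge>N. \<forall>j\<ge>N. (\<integral>x. norm (s i x - s j x) \<partial>M) < e / 2" using cau[of "e/2"] by auto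
    show "eventually (\<lambda>i. dist (\<integral>x. norm (s i x - v x) \<partial>M) 0 < e) sequentially"
      using eventually_ge_at_top[of N]
    proof eventually_elim
      case (elim i)
      have "ennreal (\<integral>x. norm (s i x - v x) \<partial>M) = (\<integral>\<^sup>+x. ennreal (norm (s i x - v x)) \<partial>M)"
        using int v by (intro nn_integral_eq_integral[symmetric]) auto
      then have "ennreal (\<integral>x. norm (s i x - v x) \<partial>M) \<le> ennreal (e / 2)" using le[OF N elim] by simp
      then have "(\<integral>x. norm (s i x - v x) \<partial>M) \<le> e / 2" using \<open>0 < e\<close> by (simp add: ennreal_le_iff)
      then show ?case using \<open>0 < e\<close> by (simp add: abs_of_nonneg)
    qed
  qed
  then show ?thesis using r(1) ae v by blast
qed

text \<open>The second component bounds the support, which makes a combination a finite sum. Indices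
  below k carry weight 0, so whatever holds for late indices passes to the combinations.\<close>

definition forward_weights :: "nat \<Rightarrow> ((nat \<Rightarrow> real) \<times> nat) set" where
  "forward_weights k = {(l, N). (\<forall>i. 0 \<le> l i) \<and> (\<forall>i. i < k \<or> N < i \<longrightarrow> l i = 0) \<and> (\<Sum>i\<le>N. l i) = 1}"

definition combine :: "((nat \<Rightarrow> real) \<times> nat) \<Rightarrow> (nat \<Rightarrow> 'b::real_vector) \<Rightarrow> 'b" where
  "combine c z = (\<Sum>i\<le>snd c. fst c i *\<^sub>R z i)"

lemma forward_weights_mono: "k \<le> k' \<Longrightarrow> forward_weights k' \<subseteq> forward_weights k"
  by (auto simp: forward_weights_def)

lemma forward_weights_single: "(\<lambda>i. if i = k then 1 else 0, k) \<in> forward_weights k"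
  by (auto simp: forward_weights_def)

text \<open>Lets the midpoint of two combinations compete in the same infimum, which is all that the
  minimisation argument needs from convexity of the class.\<close>

lemma forward_weights_midpoint:
  assumes "c \<in> forward_weights k" "c' \<in> forward_weights k"
  shows "\<exists>c''\<in>forward_weights k. \<forall>z :: nat \<Rightarrow> 'b::real_vector. combine c'' z = (1/2) *\<^sub>R (combine c z + combine c' z)"
proof -
  obtain l N l' N' where c: "c = (l, N)" "c' = (l', N')" by fastforce
  define M where "M = max N N'"
  have ext: "(\<Sum>i\<le>N. l i *\<^sub>R z i) = (\<Sum>i\<le>M. l i *\<^sub>R z i)" "(\<Sum>i\<le>N'. l' i *\<^sub>R z i) = (\<Sum>i\<le>M. l' i *\<^sub>R z i)"
    for z :: "nat \<Rightarrow> 'c::real_vector"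
    using assms by (auto simp: c forward_weights_def M_def not_le[symmetric] intro!: sum.mono_neutral_left)
  have "(\<lambda>i. (l i + l' i) / 2, M) \<in> forward_weights k"
    using assms ext[of "\<lambda>_. 1::real"]
    by (auto simp: c forward_weights_def M_def sum_divide_distrib[symmetric] sum.distrib)
  moreover have "combine (\<lambda>i. (l i + l' i) / 2, M) z = (1/2) *\<^sub>R (combine c z + combine c' z)" for z :: "nat \<Rightarrow> 'b"
    unfolding combine_def c fst_conv snd_conv ext sum.distrib[symmetric] scaleR_sum_right
    by (intro sum.cong refl) (simp add: scaleR_add_left[symmetric] scaleR_add_right)
  ultimately show ?thesis by blast
qed

text \<open>J, the integral of \<open>norm (1, u)\<close>, is convex, and its infimum over
  combinations starting at k is nondecreasing in k and bounded. The midpoint of near-minimisers of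
  levels i \<le> j competes at level i, so their convexity gap has small integral. The gap controls
  bounded values and the growth of \<open>\<Xi>\<close> controls large ones; together they give a
  Cauchy sequence in L1.\<close>

theorem forward_convex_combinations:
  fixes u :: "nat \<Rightarrow> 'x \<Rightarrow> 'b::euclidean_space" and \<Xi> :: "'b \<Rightarrow> ennreal"
  assumes P: "finite_measure P" and u[measurable]: "\<And>k. u k \<in> borel_measurable P"
    and \<Xi>: "convex_fun \<Xi>" and \<Xi>m[measurable]: "\<Xi> \<in> borel_measurable borel"
    and sup: "\<And>e. 0 < e \<Longrightarrow> \<exists>K\<ge>0. \<forall>z. ennreal (norm z) \<le> ennreal e * \<Xi> z + ennreal K"
    and C: "0 \<le> C" "\<And>k. (\<integral>\<^sup>+x. \<Xi> (u k x) \<partial>P) \<le> ennreal C"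
  shows "\<exists>c v. (\<forall>k. c k \<in> forward_weights k) \<and> integrable P v \<and>
    (\<forall>k. integrable P (\<lambda>x. combine (c k) (\<lambda>i. u i x))) \<and>
    (AE x in P. (\<lambda>k. combine (c k) (\<lambda>i. u i x)) \<longlonglongrightarrow> v x) \<and>
    (\<lambda>k. \<integral>x. norm (combine (c k) (\<lambda>i. u i x) - v x) \<partial>P) \<longlonglongrightarrow> 0"
proof -
  interpret finite_measure P by (rule P)
  define cu where "cu c x = combine c (\<lambda>i. u i x)" for c x
  have [measurable]: "cu c \<in> borel_measurable P" for c unfolding cu_def combine_def by measurable
  have conv: "(\<integral>\<^sup>+x. \<Xi> (cu c x) \<partial>P) \<le> ennreal C" if c: "c \<in> forward_weights k" for c k
  proof -
    have c': "0 \<le> fst c i" "(\<Sum>i\<le>snd c. fst c i) = 1" for i using c by (auto simp: forward_weights_def)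
    have "(\<integral>\<^sup>+x. \<Xi> (cu c x) \<partial>P) \<le> (\<integral>\<^sup>+x. (\<Sum>i\<le>snd c. ennreal (fst c i) * \<Xi> (u i x)) \<partial>P)"
      unfolding cu_def combine_def using c' by (intro nn_integral_mono convex_fun_sum[OF \<Xi>]) auto
    also have "\<dots> = (\<Sum>i\<le>snd c. ennreal (fst c i) * (\<integral>\<^sup>+x. \<Xi> (u i x) \<partial>P))"
      by (subst nn_integral_sum) (auto simp: nn_integral_cmult)
    also have "\<dots> \<le> (\<Sum>i\<le>snd c. ennreal (fst c i) * ennreal C)"
      by (intro sum_mono mult_left_mono C) auto
    also have "\<dots> = ennreal (\<Sum>i\<le>snd c. fst c i * C)"
      using c' C(1) by (simp add: ennreal_mult[symmetric])
    also have "\<dots> = ennreal C" using c' by (simp add: sum_distrib_right[symmetric])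
    finally show ?thesis .
  qed
  obtain K1 where K1: "K1 \<ge> 0" "\<And>z. ennreal (norm z) \<le> \<Xi> z + ennreal K1"
    using sup[of 1] by auto
  have n1: "(\<integral>\<^sup>+x. ennreal (norm (cu c x)) \<partial>P) \<le> ennreal (C + K1 * measure P (space P))"
    if "c \<in> forward_weights k" for c k
  proof -
    have "(\<integral>\<^sup>+x. ennreal (norm (cu c x)) \<partial>P) \<le> (\<integral>\<^sup>+x. \<Xi> (cu c x) + ennreal K1 \<partial>P)"
      by (intro nn_integral_mono K1)
    also have "\<dots> = (\<integral>\<^sup>+x. \<Xi> (cu c x) \<partial>P) + ennreal K1 * emeasure P (space P)"
      by (subst nn_integral_add) auto
    also have "\<dots> \<le> ennreal C + ennreal (K1 * measure P (space P))"
      using conv[OF that] K1 by (intro add_mono) (auto simp: emeasure_eq_measure ennreal_mult)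
    finally show ?thesis using C(1) K1 by (simp add: ennreal_plus)
  qed
  have int: "integrable P (cu c)" if "c \<in> forward_weights k" for c k
    using n1[OF that] by (intro integrableI_bounded) (auto intro: le_less_trans)
  define J where "J c = (\<integral>x. norm (1::real, cu c x) \<partial>P)" for c
  have Jint: "integrable P (\<lambda>x. norm (1::real, cu c x))" if "c \<in> forward_weights k" for c k
  proof (rule Bochner_Integration.integrable_bound)
    show "integrable P (\<lambda>x. 1 + norm (cu c x))" using int[OF that] by auto
  qed (use norm_Pair_1_le in \<open>auto intro!: AE_I2 simp: abs_of_nonneg\<close>)
  have J0: "0 \<le> J c" for c by (simp add: J_def)
  define B where "B = measure P (space P) + (C + K1 * measure P (space P))"
  have JB: "J c \<le> B" if c: "c \<in> forward_weights k" for c k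
  proof -
    have "J c \<le> (\<integral>x. 1 + norm (cu c x) \<partial>P)"
      unfolding J_def using int[OF c] Jint[OF c]
      by (intro integral_mono norm_Pair_1_le) auto
    also have "\<dots> = measure P (space P) + (\<integral>x. norm (cu c x) \<partial>P)"
      using int[OF c] by (subst Bochner_Integration.integral_add) auto
    also have "(\<integral>x. norm (cu c x) \<partial>P) \<le> C + K1 * measure P (space P)"
    proof (rule iffD1[OF ennreal_le_iff])
      show "ennreal (\<integral>x. norm (cu c x) \<partial>P) \<le> ennreal (C + K1 * measure P (space P))"
        using n1[OF c] int[OF c] by (subst (asm) nn_integral_eq_integral) auto
    qed (use C(1) K1 in simp)
    finally show ?thesis by (simp add: B_def)
  qed
  define s where "s k = Inf (J ` forward_weights k)" for k
  have ne: "forward_weights k \<noteq> {}" for k using forward_weights_single by blast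
  have bb: "bdd_below (J ` forward_weights k)" for k using J0 by (intro bdd_belowI[of _ 0]) auto
  have sle: "s k \<le> J c" if "c \<in> forward_weights k" for c k
    unfolding s_def using bb that by (intro cInf_lower) auto
  have smono: "s k \<le> s k'" if "k \<le> k'" for k k'
    unfolding s_def using forward_weights_mono[OF that] ne bb by (intro cInf_superset_mono) auto
  have sB: "s k \<le> B" for k using sle[OF forward_weights_single] JB[OF forward_weights_single] by (rule order.trans)
  have "\<exists>c. c \<in> forward_weights k \<and> J c < s k + 1 / (real k + 1)" for k
    using cInf_lessD[of "J ` forward_weights k" "s k + 1 / (real k + 1)"] ne by (auto simp: s_def)
  then obtain c where c: "\<And>k. c k \<in> forward_weights k" "\<And>k. J (c k) < s k + 1 / (real k + 1)" by metis
  have "Cauchy s"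
    using incseq_convergent[of s B] smono sB by (metis incseq_def LIMSEQ_imp_Cauchy)
  have cauchy: "\<exists>N. \<forall>i\<ge>N. \<forall>j\<ge>N. (\<integral>x. norm (cu (c i) x - cu (c j) x) \<partial>P) < e" if e: "0 < e" for e
  proof -
    let ?P = "measure P (space P)"
    \<comment> \<open>Shares of e: the \<eta> term and the tail term with e' contribute at most e/4
      each, and \<open>N1\<close>, \<open>N2\<close> below are chosen to keep the gap term under e/4
      as well.\<close>
    define \<eta> where "\<eta> = (e / 4) / (?P + 1)"
    define e' where "e' = (e / 32) / (C + 1)"
    have P0: "0 \<le> ?P" by simp
    have pos: "0 < \<eta>" "0 < e'"
      unfolding \<eta>_def e'_def using e C(1) P0 by (intro divide_pos_pos mult_pos_pos; linarith)+
    obtain K where K: "0 \<le> K" "\<And>z. ennreal (norm z) \<le> ennreal e' * \<Xi> z + ennreal K"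
      using sup[OF pos(2)] by blast
    define D where "D = 4 * (1 + 2 * K) ^ 3 / \<eta>"
    have D: "0 < D" using K pos by (simp add: D_def)
    obtain N1 where N1: "\<And>m n. N1 \<le> m \<Longrightarrow> N1 \<le> n \<Longrightarrow> \<bar>s m - s n\<bar> < e / (8 * D)"
      using \<open>Cauchy s\<close> e D unfolding Cauchy_def dist_real_def
      by (metis divide_pos_pos mult_pos_pos zero_less_numeral)
    obtain N2 :: nat where N2: "16 * D / e < real N2" using reals_Archimedean2 by blast
    have main: "(\<integral>x. norm (cu (c i) x - cu (c j) x) \<partial>P) < e"
      if i: "max N1 N2 \<le> i" and ij: "i \<le> j" for i j
    proof -
      \<comment> \<open>As i \<le> j, both combinations belong to level i, so their midpoint is
        compared with \<open>s i\<close>.\<close>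
      have cj: "c j \<in> forward_weights i" using c(1)[of j] forward_weights_mono[OF ij] by blast
      obtain c'' where c'': "c'' \<in> forward_weights i"
        "\<And>z :: nat \<Rightarrow> 'b. combine c'' z = (1/2) *\<^sub>R (combine (c i) z + combine (c j) z)"
        using forward_weights_midpoint[OF c(1) cj] by blast
      define gap where "gap x = norm (1::real, cu (c i) x) + norm (1::real, cu (c j) x)
        - norm (2::real, cu (c i) x + cu (c j) x)" for x
      have two: "norm (2::real, cu (c i) x + cu (c j) x) = 2 * norm (1::real, cu c'' x)" for x
      proof -
        have "(2::real, cu (c i) x + cu (c j) x) = 2 *\<^sub>R (1, cu c'' x)" by (simp add: cu_def c''(2))
        then show ?thesis by (metis norm_scaleR abs_numeral)
      qed
      have gap0: "0 \<le> gap x" for x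
        using norm_triangle_ineq[of "(1::real, cu (c i) x)" "(1::real, cu (c j) x)"] by (simp add: gap_def)
      have gapi: "integrable P gap"
        unfolding gap_def two using Jint[OF c(1), of i] Jint[OF c(1), of j] Jint[OF c''(1)] by auto
      have "(\<integral>x. gap x \<partial>P) = J (c i) + J (c j) - 2 * J c''"
        unfolding gap_def two J_def using Jint[OF c(1), of i] Jint[OF c(1), of j] Jint[OF c''(1)] by simp
      \<comment> \<open>Near-minimality bounds the first two terms from above, and the midpoint
        cannot fall below the infimum \<open>s i\<close>.\<close>
      also have "\<dots> \<le> (s i + 1 / (real i + 1)) + (s j + 1 / (real j + 1)) - 2 * s i"
        using c(2)[of i] c(2)[of j] sle[OF c''(1)] by linarith
      also have "\<dots> \<le> \<bar>s j - s i\<bar> + 2 * (1 / (real i + 1))"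
        using ij by (smt (verit) frac_le of_nat_0_le_iff of_nat_mono)
      also have "\<dots> < e / (8 * D) + 2 * (e / (16 * D))"
      proof (intro add_strict_mono mult_strict_left_mono)
        show "\<bar>s j - s i\<bar> < e / (8 * D)" using i ij by (intro N1) auto
        have "16 * D / e < real i + 1" using N2 i by linarith
        then show "1 / (real i + 1) < e / (16 * D)" using e D by (simp add: field_simps)
      qed simp
      finally have gapI: "D * (\<integral>x. gap x \<partial>P) < e / 4" using D by (simp add: field_simps)
      have "ennreal (\<integral>x. norm (cu (c i) x - cu (c j) x) \<partial>P) = (\<integral>\<^sup>+x. ennreal (norm (cu (c i) x - cu (c j) x)) \<partial>P)"
        using int[OF c(1)] by (intro nn_integral_eq_integral[symmetric]) auto
      also have "\<dots> \<le> (\<integral>\<^sup>+x. ennreal \<eta> + ennreal (D * gap x) + ennreal (4 * e') * (\<Xi> (cu (c i) x) + \<Xi> (cu (c j) x)) \<partial>P)"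
        unfolding D_def gap_def using pos by (intro nn_integral_mono norm_diff_gap K) auto
      also have "\<dots> = ennreal \<eta> * emeasure P (space P) + (\<integral>\<^sup>+x. ennreal (D * gap x) \<partial>P)
          + ennreal (4 * e') * ((\<integral>\<^sup>+x. \<Xi> (cu (c i) x) \<partial>P) + (\<integral>\<^sup>+x. \<Xi> (cu (c j) x) \<partial>P))"
        using borel_measurable_integrable[OF gapi] by (simp add: nn_integral_add nn_integral_cmult)
      also have "(\<integral>\<^sup>+x. ennreal (D * gap x) \<partial>P) = ennreal (D * (\<integral>x. gap x \<partial>P))"
        using gapi gap0 D by (subst nn_integral_eq_integral) auto
      also have "ennreal \<eta> * emeasure P (space P) + ennreal (D * (\<integral>x. gap x \<partial>P))
          + ennreal (4 * e') * ((\<integral>\<^sup>+x. \<Xi> (cu (c i) x) \<partial>P) + (\<integral>\<^sup>+x. \<Xi> (cu (c j) x) \<partial>P))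
        \<le> ennreal (\<eta> * ?P) + ennreal (e / 4) + ennreal (4 * e') * (ennreal C + ennreal C)"
        using pos gapI by (intro add_mono mult_left_mono conv[OF c(1)] ennreal_leI)
          (auto simp: emeasure_eq_measure ennreal_mult)
      also have "\<dots> = ennreal (\<eta> * ?P + e / 4 + 4 * e' * (C + C))"
      proof -
        have "ennreal (4 * e') * (ennreal C + ennreal C) = ennreal (4 * e') * ennreal (C + C)"
          using C(1) by (subst ennreal_plus) auto
        also have "\<dots> = ennreal (4 * e' * (C + C))" using pos C(1) by (intro ennreal_mult[symmetric]) auto
        finally have *: "ennreal (4 * e') * (ennreal C + ennreal C) = ennreal (4 * e' * (C + C))" .
        show ?thesis
          unfolding * using pos e C(1) P0
          by (subst ennreal_plus[symmetric], simp, simp, subst ennreal_plus[symmetric]) simp_all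
      qed
      finally have "(\<integral>x. norm (cu (c i) x - cu (c j) x) \<partial>P) \<le> \<eta> * ?P + e / 4 + 4 * e' * (C + C)"
        by (rule iffD1[OF ennreal_le_iff, rotated]) (use pos e C(1) P0 in simp)
      also have "\<dots> < e"
      proof -
        have "?P + 1 \<noteq> 0" "C + 1 \<noteq> 0" using P0 C(1) by linarith+
        then have "\<eta> * (?P + 1) = e / 4" "e' * (C + 1) = e / 32"
          unfolding \<eta>_def e'_def by (metis nonzero_eq_divide_eq)+
        then have "\<eta> * ?P \<le> e / 4" "4 * e' * (C + C) \<le> e / 4" using pos by (simp_all add: algebra_simps)
        then show ?thesis using e by linarith
      qed
      finally show ?thesis .
    qed
    show ?thesis
    proof (intro exI[of _ "max N1 N2"] allI impI)
      fix i j assume ij: "max N1 N2 \<le> i" "max N1 N2 \<le> j"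
      show "(\<integral>x. norm (cu (c i) x - cu (c j) x) \<partial>P) < e"
        using main[OF ij(1), of j] main[OF ij(2), of i] by (cases "i \<le> j") (simp_all add: norm_minus_commute)
    qed
  qed
  obtain r v where r: "strict_mono r" and v: "integrable P v" "AE x in P. (\<lambda>i. cu (c (r i)) x) \<longlonglongrightarrow> v x"
    "(\<lambda>i. \<integral>x. norm (cu (c i) x - v x) \<partial>P) \<longlonglongrightarrow> 0"
    using L1_Cauchy_convergent[OF int[OF c(1)] cauchy] by blast
  have "(\<lambda>i. \<integral>x. norm (cu (c (r i)) x - v x) \<partial>P) \<longlonglongrightarrow> 0"
    using LIMSEQ_subseq_LIMSEQ[OF v(3) r] by (simp add: o_def)
  moreover have "c (r k) \<in> forward_weights k" for k
    using c(1)[of "r k"] forward_weights_mono[OF seq_suble[OF r, of k]] by blast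
  ultimately show ?thesis
    using v int[OF c(1)] by (intro exI[of _ "\<lambda>k. c (r k)"] exI[of _ v]) (simp add: cu_def[abs_def])
qed

section \<open>Smoothing by a partition of unity\<close>

text \<open>The indices are the cell centres themselves. The sum is required to be 1 on a ball only,
  so that finitely many cells suffice; beyond it the sum may drop below 1.\<close>

definition bump_family :: "real \<Rightarrow> real \<Rightarrow> 'a::euclidean_space set \<Rightarrow> ('a \<Rightarrow> 'a \<Rightarrow> real) \<Rightarrow> bool" where
  "bump_family h R J \<theta> \<longleftrightarrow> finite J \<and>
    (\<forall>j\<in>J. continuous_on UNIV (\<theta> j) \<and> (\<forall>x. 0 \<le> \<theta> j x) \<and> (\<forall>x. \<theta> j x \<noteq> 0 \<longrightarrow> dist x j < h)) \<and>
    (\<forall>x. (\<Sum>j\<in>J. \<theta> j x) \<le> 1) \<and> (\<forall>x. norm x \<le> R \<longrightarrow> (\<Sum>j\<in>J. \<theta> j x) = 1)"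

text \<open>Cones over a finite cover are normalised by their sum S. The extra term
  \<open>max 0 (norm x - R)\<close> keeps S positive outside the ball and vanishes on it, so the
  normalised sum is exactly 1 there.\<close>

lemma bump_family_exists:
  assumes h: "0 < h"
  shows "\<exists>J \<theta>. bump_family h R (J :: 'a::euclidean_space set) \<theta>"
proof -
  have "compact (cball (0::'a) R)" by simp
  then obtain J where J: "finite J" "cball (0::'a) R \<subseteq> (\<Union>j\<in>J. ball j h)"
    by (rule compactE_image[of "cball 0 R" "cball 0 R" "\<lambda>j. ball j h"]) (use h in \<open>force+\<close>)
  define b where "b j x = max 0 (h - dist x j)" for j x :: 'a
  define S where "S x = max 0 (norm x - R) + (\<Sum>j\<in>J. b j x)" for x
  have b0: "0 \<le> b j x" for j x by (simp add: b_def)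
  have S0: "0 < S x" for x
  proof (cases "norm x \<le> R")
    case True
    then obtain j where "j \<in> J" "dist x j < h" using J(2) by (auto simp: dist_commute subset_iff)
    then have "0 < b j x" "b j x \<le> (\<Sum>j\<in>J. b j x)"
      using J(1) b0 by (simp add: b_def, intro member_le_sum) auto
    then show ?thesis by (auto simp: S_def)
  next
    case False
    then show ?thesis using b0 by (auto simp: S_def intro!: add_pos_nonneg sum_nonneg)
  qed
  have sum: "(\<Sum>j\<in>J. b j x / S x) = (\<Sum>j\<in>J. b j x) / S x" for x by (simp add: sum_divide_distrib)
  have "bump_family h R J (\<lambda>j x. b j x / S x)"
    unfolding bump_family_def sum
  proof (intro conjI ballI allI impI J(1))
    fix j assume "j \<in> J"
    have "continuous_on UNIV S" unfolding S_def b_def by (intro continuous_intros)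
    then show "continuous_on UNIV (\<lambda>x. b j x / S x)"
      using S0 unfolding b_def by (intro continuous_intros) (auto simp: less_imp_neq[symmetric] dest: less_imp_neq)
    show "0 \<le> b j x / S x" for x using b0 S0 by (simp add: less_imp_le)
    show "dist x j < h" if "b j x / S x \<noteq> 0" for x using that by (auto simp: b_def max_def split: if_splits)
  next
    fix x show "(\<Sum>j\<in>J. b j x) / S x \<le> 1" using S0[of x] by (simp add: S_def)
  next
    fix x :: 'a assume "norm x \<le> R"
    then have "S x = (\<Sum>j\<in>J. b j x)" by (simp add: S_def)
    then show "(\<Sum>j\<in>J. b j x) / S x = 1" using S0[of x] by simp
  qed
  then show ?thesis by blast
qed

lemma bump_familyD:
  assumes "bump_family h R J \<theta>"
  shows "finite J" "j \<in> J \<Longrightarrow> continuous_on UNIV (\<theta> j)" "j \<in> J \<Longrightarrow> 0 \<le> \<theta> j x"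
    "j \<in> J \<Longrightarrow> \<theta> j x \<noteq> 0 \<Longrightarrow> dist x j < h" "(\<Sum>j\<in>J. \<theta> j x) \<le> 1"
    "norm x \<le> R \<Longrightarrow> (\<Sum>j\<in>J. \<theta> j x) = 1"
  using assms unfolding bump_family_def by blast+

lemma bump_le_1:
  assumes "bump_family h R J \<theta>" "j \<in> J"
  shows "\<theta> j x \<le> 1"
proof -
  have "\<theta> j x \<le> (\<Sum>j\<in>J. \<theta> j x)"
    using bump_familyD[OF assms(1)] assms(2) by (intro member_le_sum) auto
  then show ?thesis using bump_familyD(5)[OF assms(1), of x] by simp
qed

lemma bump_bbs:
  assumes "bump_family h R J \<theta>" "j \<in> J"
  shows "bbs (\<theta> j)"
proof (rule bbsI)
  show "\<theta> j \<in> borel_measurable borel"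
    using bump_familyD(2)[OF assms] by (rule borel_measurable_continuous_onI)
  show "norm (\<theta> j x) \<le> 1" for x
    using bump_le_1[OF assms] bump_familyD(3)[OF assms, of x] by simp
  show "\<theta> j x = 0" if "norm j + h < norm x" for x
  proof (rule ccontr)
    assume "\<theta> j x \<noteq> 0"
    then have "dist x j < h" by (rule bump_familyD(4)[OF assms])
    then show False using that norm_triangle_sub[of x j] by (simp add: dist_norm)
  qed
qed

text \<open>The defect of the partition is filled with c0, which makes every value a convex
  combination of the c j and c0; c0 will be a zero of the energy density.\<close>

definition smoothing :: "'a set \<Rightarrow> ('a \<Rightarrow> 'a \<Rightarrow> real) \<Rightarrow> 'b::real_vector \<Rightarrow> ('a \<Rightarrow> 'b) \<Rightarrow> 'a \<Rightarrow> 'b" where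
  "smoothing J \<theta> c0 c x = (\<Sum>j\<in>J. \<theta> j x *\<^sub>R c j) + (1 - (\<Sum>j\<in>J. \<theta> j x)) *\<^sub>R c0"

lemma smoothing_convex:
  fixes \<phi> :: "'b::euclidean_space \<Rightarrow> ennreal"
  assumes \<theta>: "bump_family h R J \<theta>" and \<phi>: "convex_fun \<phi>"
  shows "\<phi> (smoothing J \<theta> c0 c x) \<le> (\<Sum>j\<in>J. ennreal (\<theta> j x) * \<phi> (c j)) + ennreal (1 - (\<Sum>j\<in>J. \<theta> j x)) * \<phi> c0"
proof -
  \<comment> \<open>The defect of the partition becomes one more convex weight, indexed by
    \<open>None\<close>.\<close>
  define l where "l i = (case i of None \<Rightarrow> 1 - (\<Sum>j\<in>J. \<theta> j x) | Some j \<Rightarrow> \<theta> j x)" for i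
  define d where "d i = (case i of None \<Rightarrow> c0 | Some j \<Rightarrow> c j)" for i
  note D = bump_familyD[OF \<theta>]
  have split: "(\<Sum>i\<in>insert None (Some ` J). f i) = f None + (\<Sum>j\<in>J. f (Some j))" for f :: "_ \<Rightarrow> 'c::comm_monoid_add"
    using D(1) by (simp add: sum.reindex)
  have "\<phi> (\<Sum>i\<in>insert None (Some ` J). l i *\<^sub>R d i) \<le> (\<Sum>i\<in>insert None (Some ` J). ennreal (l i) * \<phi> (d i))"
  proof (rule convex_fun_sum[OF \<phi>])
    show "sum l (insert None (Some ` J)) = 1" unfolding split by (simp add: l_def)
    show "0 \<le> l i" if "i \<in> insert None (Some ` J)" for i
      using that D(3)[of _ x] D(5)[of x] by (auto simp: l_def)
  qed (use D(1) in simp)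
  then show ?thesis unfolding split by (simp add: l_def d_def smoothing_def add.commute)
qed

text \<open>Convexity moves \<open>\<phi>\<close> onto the coefficients, the ratio of masses
  exchanges the \<open>\<gamma>\<close>-mass of a cell for its \<open>\<gamma>'\<close>-mass at the
  price 1 + \<eta>, and Jensen on the cell leads back to u. Cells outside \<open>J1\<close> carry c0
  at no cost.\<close>

lemma smoothing_energy:
  fixes \<phi> :: "'b::euclidean_space \<Rightarrow> ennreal" and u :: "'a::euclidean_space \<Rightarrow> 'b"
  assumes \<theta>: "bump_family h R J \<theta>" and \<phi>: "lsc \<phi>" "convex_fun \<phi>" "\<phi> c0 = 0"
    and \<gamma>: "pos_radon \<gamma>" "pos_radon \<gamma>'" and u: "locally_integrable \<gamma>' u" and \<eta>: "0 \<le> \<eta>"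
    and J1: "\<And>j. j \<in> J \<Longrightarrow> j \<notin> J1 \<Longrightarrow> c j = c0"
    and g: "\<And>j. j \<in> J \<Longrightarrow> j \<in> J1 \<Longrightarrow> 0 < (\<integral>x. \<theta> j x \<partial>\<gamma>')"
      "\<And>j. j \<in> J \<Longrightarrow> j \<in> J1 \<Longrightarrow> (\<integral>x. \<theta> j x \<partial>\<gamma>) \<le> (1 + \<eta>) * (\<integral>x. \<theta> j x \<partial>\<gamma>')"
    and c: "\<And>j. j \<in> J \<Longrightarrow> j \<in> J1 \<Longrightarrow> c j = (1 / (\<integral>x. \<theta> j x \<partial>\<gamma>')) *\<^sub>R (\<integral>x. \<theta> j x *\<^sub>R u x \<partial>\<gamma>')"
  shows "(\<integral>\<^sup>+x. \<phi> (smoothing J \<theta> c0 c x) \<partial>\<gamma>) \<le> ennreal (1 + \<eta>) * (\<integral>\<^sup>+x. \<phi> (u x) \<partial>\<gamma>')"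
proof -
  note D = bump_familyD[OF \<theta>]
  note [measurable_cong] = pos_radonD(1)[OF \<gamma>(1)] pos_radonD(1)[OF \<gamma>(2)]
  note [measurable] = lsc_borel_measurable[OF \<phi>(1)]
  have [measurable]: "u \<in> borel_measurable borel" using u by (simp add: locally_integrable_def)
  have [measurable]: "\<theta> j \<in> borel_measurable borel" if "j \<in> J" for j using bump_bbs[OF \<theta> that] by (simp add: bbs_def)
  have int: "(\<integral>\<^sup>+x. ennreal (\<theta> j x) \<partial>\<alpha>) = ennreal (\<integral>x. \<theta> j x \<partial>\<alpha>)" if "j \<in> J" "pos_radon \<alpha>" for j \<alpha>
    using integrable_bbs[OF that(2) bump_bbs[OF \<theta> that(1)]] D(3)[OF that(1)]
    by (intro nn_integral_eq_integral) auto
  have "(\<integral>\<^sup>+x. \<phi> (smoothing J \<theta> c0 c x) \<partial>\<gamma>) \<le> (\<integral>\<^sup>+x. (\<Sum>j\<in>J. ennreal (\<theta> j x) * \<phi> (c j)) \<partial>\<gamma>)"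
    using smoothing_convex[OF \<theta> \<phi>(2), of c0 c] \<phi>(3) by (intro nn_integral_mono) simp
  also have "\<dots> = (\<Sum>j\<in>J. ennreal (\<integral>x. \<theta> j x \<partial>\<gamma>) * \<phi> (c j))"
    by (subst nn_integral_sum) (auto simp: nn_integral_multc int[OF _ \<gamma>(1)])
  also have "\<dots> \<le> (\<Sum>j\<in>J. ennreal (1 + \<eta>) * (\<integral>\<^sup>+x. ennreal (\<theta> j x) * \<phi> (u x) \<partial>\<gamma>'))"
  proof (rule sum_mono)
    fix j assume j: "j \<in> J"
    show "ennreal (\<integral>x. \<theta> j x \<partial>\<gamma>) * \<phi> (c j) \<le> ennreal (1 + \<eta>) * (\<integral>\<^sup>+x. ennreal (\<theta> j x) * \<phi> (u x) \<partial>\<gamma>')"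
    proof (cases "j \<in> J1")
      case True
      have "ennreal (\<integral>x. \<theta> j x \<partial>\<gamma>) * \<phi> (c j) \<le> ennreal ((1 + \<eta>) * (\<integral>x. \<theta> j x \<partial>\<gamma>')) * \<phi> (c j)"
        using g(2)[OF j True] by (intro mult_right_mono ennreal_leI) auto
      also have "\<dots> = ennreal (1 + \<eta>) * (ennreal (\<integral>x. \<theta> j x \<partial>\<gamma>') * \<phi> (c j))"
        using \<eta> g(1)[OF j True] by (simp add: ennreal_mult mult.assoc)
      also have "\<dots> \<le> ennreal (1 + \<eta>) * (\<integral>\<^sup>+x. ennreal (\<theta> j x) * \<phi> (u x) \<partial>\<gamma>')"
        unfolding c[OF j True]
        using integrable_bbs[OF \<gamma>(2) bump_bbs[OF \<theta> j]] D(3)[OF j] g(1)[OF j True]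
          integrable_bbs_scaleR[OF \<gamma>(2) u bump_bbs[OF \<theta> j]]
        by (intro mult_left_mono Jensen_weighted \<phi>) auto
      finally show ?thesis .
    next
      case False
      then show ?thesis using J1[OF j] \<phi>(3) by simp
    qed
  qed
  also have "\<dots> = ennreal (1 + \<eta>) * (\<integral>\<^sup>+x. (\<Sum>j\<in>J. ennreal (\<theta> j x) * \<phi> (u x)) \<partial>\<gamma>')"
    by (subst nn_integral_sum) (auto simp: sum_distrib_left)
  also have "\<dots> \<le> ennreal (1 + \<eta>) * (\<integral>\<^sup>+x. \<phi> (u x) \<partial>\<gamma>')"
  proof (intro mult_left_mono nn_integral_mono)
    fix x
    have "(\<Sum>j\<in>J. ennreal (\<theta> j x) * \<phi> (u x)) = ennreal (\<Sum>j\<in>J. \<theta> j x) * \<phi> (u x)"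
      using D(3) by (simp add: sum_distrib_right[symmetric])
    also have "\<dots> \<le> ennreal 1 * \<phi> (u x)"
      using D(5)[of x] by (intro mult_right_mono ennreal_leI) auto
    finally show "(\<Sum>j\<in>J. ennreal (\<theta> j x) * \<phi> (u x)) \<le> \<phi> (u x)" by simp
  qed simp
  finally show ?thesis .
qed

text \<open>Replacing u by cell means hardly matters when F hardly varies on a cell. \<delta>
  measures that oscillation, \<open>M * \<eta>\<close> the mismatch of the masses of a cell, and the
  last sum the part of u on cells that \<open>\<gamma>\<close> does not see.\<close>

lemma smoothing_error:
  fixes u F :: "'a::euclidean_space \<Rightarrow> 'b::euclidean_space"
  assumes \<theta>: "bump_family h R J \<theta>" and \<gamma>: "pos_radon \<gamma>" "pos_radon \<gamma>'" and u: "locally_integrable \<gamma>' u"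
    and \<eta>: "0 \<le> \<eta>" "\<eta> \<le> 1"
    and J1: "\<And>j. j \<in> J \<Longrightarrow> j \<notin> J1 \<Longrightarrow> (\<integral>x. \<theta> j x \<partial>\<gamma>) = 0"
    and g: "\<And>j. j \<in> J \<Longrightarrow> j \<in> J1 \<Longrightarrow> 0 < (\<integral>x. \<theta> j x \<partial>\<gamma>')"
      "\<And>j. j \<in> J \<Longrightarrow> j \<in> J1 \<Longrightarrow> \<bar>(\<integral>x. \<theta> j x \<partial>\<gamma>) - (\<integral>x. \<theta> j x \<partial>\<gamma>')\<bar> \<le> \<eta> * (\<integral>x. \<theta> j x \<partial>\<gamma>')"
    and c: "\<And>j. j \<in> J \<Longrightarrow> j \<in> J1 \<Longrightarrow> c j = (1 / (\<integral>x. \<theta> j x \<partial>\<gamma>')) *\<^sub>R (\<integral>x. \<theta> j x *\<^sub>R u x \<partial>\<gamma>')"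
    and F: "F \<in> borel_measurable borel" "\<And>x. norm (F x) \<le> M" "\<And>x. R0 < norm x \<Longrightarrow> F x = 0"
      "\<And>x y. dist x y < h \<Longrightarrow> norm (F x - F y) \<le> \<delta>" and \<delta>0: "0 \<le> \<delta>" and R0: "R0 \<le> R"
  shows "\<bar>(\<integral>x. F x \<bullet> u x \<partial>\<gamma>') - (\<integral>x. F x \<bullet> smoothing J \<theta> c0 c x \<partial>\<gamma>)\<bar>
    \<le> (3 * \<delta> + M * \<eta>) * (\<integral>x. indicator (cball 0 (R0 + 2 * h)) x * norm (u x) \<partial>\<gamma>')
      + M * (\<Sum>j\<in>J - J1. \<integral>x. \<theta> j x * norm (u x) \<partial>\<gamma>')"
proof -
  note D = bump_familyD[OF \<theta>]
  let ?B = "cball (0::'a) (R0 + 2 * h)"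
  note [measurable_cong] = pos_radonD(1)[OF \<gamma>(1)] pos_radonD(1)[OF \<gamma>(2)]
  have um[measurable]: "u \<in> borel_measurable borel" using u by (simp add: locally_integrable_def)
  note F(1)[measurable]
  have \<theta>m[measurable]: "\<theta> j \<in> borel_measurable borel" if "j \<in> J" for j using bump_bbs[OF \<theta> that] by (simp add: bbs_def)
  have bF: "bbs F" using F by (intro bbsI[where M = M and R = R0]) auto
  have M0: "0 \<le> M" using F(2) norm_ge_zero order.trans by blast
  have \<theta>F: "bbs (\<lambda>x. \<theta> j x *\<^sub>R F x)" if j: "j \<in> J" for j
  proof (rule bbsI[where M = M and R = R0])
    show "(\<lambda>x. \<theta> j x *\<^sub>R F x) \<in> borel_measurable borel" using j by measurable
    show "norm (\<theta> j x *\<^sub>R F x) \<le> M" for x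
      using mult_mono[OF bump_le_1[OF \<theta> j] F(2), of x x] D(3)[OF j, of x] M0 by simp
  qed (use F(3) in simp)
  have iu: "integrable \<gamma>' (\<lambda>x. \<theta> j x *\<^sub>R u x)" if "j \<in> J" for j
    by (rule integrable_bbs_scaleR[OF \<gamma>(2) u bump_bbs[OF \<theta> that]])
  have iun: "integrable \<gamma>' (\<lambda>x. \<theta> j x * norm (u x))" if j: "j \<in> J" for j
    using integrable_norm[OF iu[OF j]] D(3)[OF j] by simp
  have iB: "integrable \<gamma>' (\<lambda>x. indicator ?B x * norm (u x))"
    using integrable_norm[OF integrable_bbs_scaleR[OF \<gamma>(2) u bbs_indicator[of ?B]]] by simp
  have iB\<theta>: "integrable \<gamma>' (\<lambda>x. \<theta> j x * (indicator ?B x * norm (u x)))" if j: "j \<in> J" for j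
    using j by (intro Bochner_Integration.integrable_bound[OF iun[OF j]] AE_I2)
      (auto simp: indicator_def intro: measurable_If)
  have dec: "F x = (\<Sum>j\<in>J. \<theta> j x *\<^sub>R F x)" for x
    using D(6)[of x] F(3)[of x] R0 by (cases "norm x \<le> R0") (auto simp: scaleR_sum_left[symmetric])
  \<comment> \<open>The error splits over the cells. On \<open>J1\<close> it is bounded by
    oscillation and mass ratio, elsewhere by the \<open>\<gamma>'\<close>-integral of u over the
    cell.\<close>
  define T where "T j = (\<integral>x. (\<theta> j x *\<^sub>R F x) \<bullet> u x \<partial>\<gamma>') - (\<integral>x. \<theta> j x *\<^sub>R F x \<partial>\<gamma>) \<bullet> c j" for j
  have "(\<integral>x. F x \<bullet> u x \<partial>\<gamma>') = (\<integral>x. (\<Sum>j\<in>J. (\<theta> j x *\<^sub>R F x) \<bullet> u x) \<partial>\<gamma>')"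
    by (intro Bochner_Integration.integral_cong refl) (subst dec, simp add: inner_sum_left)
  also have "\<dots> = (\<Sum>j\<in>J. \<integral>x. (\<theta> j x *\<^sub>R F x) \<bullet> u x \<partial>\<gamma>')"
    by (intro Bochner_Integration.integral_sum integrable_bbs_inner[OF \<gamma>(2) u] \<theta>F)
  moreover have "(\<integral>x. F x \<bullet> smoothing J \<theta> c0 c x \<partial>\<gamma>) = (\<integral>x. (\<Sum>j\<in>J. (\<theta> j x *\<^sub>R F x) \<bullet> c j) \<partial>\<gamma>)"
  proof (intro Bochner_Integration.integral_cong refl)
    fix x
    have "(1 - (\<Sum>j\<in>J. \<theta> j x)) *\<^sub>R F x = 0" using D(6)[of x] F(3)[of x] R0 by (cases "norm x \<le> R0") auto
    then have "(1 - (\<Sum>j\<in>J. \<theta> j x)) * (F x \<bullet> c0) = 0" by auto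
    then show "F x \<bullet> smoothing J \<theta> c0 c x = (\<Sum>j\<in>J. (\<theta> j x *\<^sub>R F x) \<bullet> c j)"
      by (simp add: smoothing_def inner_add_right inner_sum_right)
  qed
  moreover have "\<dots> = (\<Sum>j\<in>J. (\<integral>x. \<theta> j x *\<^sub>R F x \<partial>\<gamma>) \<bullet> c j)"
    using integrable_bbs[OF \<gamma>(1) \<theta>F]
    by (subst Bochner_Integration.integral_sum) (auto simp: integral_inner_left simp del: inner_scaleR_left)
  ultimately have eq: "(\<integral>x. F x \<bullet> u x \<partial>\<gamma>') - (\<integral>x. F x \<bullet> smoothing J \<theta> c0 c x \<partial>\<gamma>) = (\<Sum>j\<in>J. T j)"
    by (simp add: T_def sum_subtractf)
  have T1: "\<bar>T j\<bar> \<le> (3 * \<delta> + M * \<eta>) * (\<integral>x. \<theta> j x * (indicator ?B x * norm (u x)) \<partial>\<gamma>')"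
    if j: "j \<in> J" "j \<in> J1" for j
  proof (cases "\<exists>x. \<theta> j x *\<^sub>R F x \<noteq> 0")
    case False
    then have z: "\<theta> j x *\<^sub>R F x = 0" for x by blast
    show ?thesis
      unfolding T_def z using M0 \<eta> \<delta>0 D(3)[OF j(1)]
      by (auto intro!: mult_nonneg_nonneg add_nonneg_nonneg integral_nonneg)
  next
    case True
    then obtain z where z: "\<theta> j z \<noteq> 0" "F z \<noteq> 0" by auto
    have nz: "norm z \<le> R0" using F(3)[of z] z by force
    \<comment> \<open>A cell that meets the support of F has diameter below 2h and so stays in the
      ball of radius R0 + 2h.\<close>
    have inB: "x \<in> ?B" if "\<theta> j x \<noteq> 0" for x
    proof -
      have "dist x j < h" "dist z j < h" using D(4)[OF j(1)] that z by auto
      then have "dist x z < 2 * h" using dist_triangle2[of x z j] by simp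
      then show ?thesis using nz norm_triangle_sub[of x z] by (simp add: dist_norm)
    qed
    let ?g = "\<integral>x. \<theta> j x \<partial>\<gamma>" and ?g' = "\<integral>x. \<theta> j x \<partial>\<gamma>'"
    note gp = g(1)[OF j] and gg = g(2)[OF j]
    \<comment> \<open>The \<open>\<gamma>\<close>-integral of F over the cell, normalised by the
      \<open>\<gamma>'\<close>-mass. With this choice \<open>T j\<close> becomes the single
      \<open>\<gamma>'\<close>-integral of
      \<open>\<theta> j x * ((F x - A) \<bullet> u x)\<close>.\<close>
    define A where "A = (1 / ?g') *\<^sub>R (\<integral>x. \<theta> j x *\<^sub>R F x \<partial>\<gamma>)"
    have g0: "0 \<le> ?g" using D(3)[OF j(1)] by simp
    have i\<theta>: "integrable \<gamma> (\<theta> j)" by (rule integrable_bbs[OF \<gamma>(1) bump_bbs[OF \<theta> j(1)]])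
    have "norm ((\<integral>x. \<theta> j x *\<^sub>R F x \<partial>\<gamma>) - ?g *\<^sub>R F j) = norm (\<integral>x. \<theta> j x *\<^sub>R (F x - F j) \<partial>\<gamma>)"
      using integrable_bbs[OF \<gamma>(1) \<theta>F[OF j(1)]] i\<theta> by (simp add: scaleR_diff_right)
    also have "\<dots> \<le> (\<integral>x. \<theta> j x * \<delta> \<partial>\<gamma>)"
    proof (rule order.trans[OF integral_norm_bound integral_mono])
      show "integrable \<gamma> (\<lambda>x. norm (\<theta> j x *\<^sub>R (F x - F j)))"
        using integrable_bbs[OF \<gamma>(1) \<theta>F[OF j(1)]] i\<theta> by (simp add: scaleR_diff_right del: norm_scaleR)
      show "norm (\<theta> j x *\<^sub>R (F x - F j)) \<le> \<theta> j x * \<delta>" for x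
        using F(4)[of x j] D(3,4)[OF j(1), of x] by (cases "\<theta> j x = 0") (auto intro: mult_left_mono)
    qed (use i\<theta> in auto)
    also have "\<dots> = ?g * \<delta>" by simp
    finally have A1: "norm ((\<integral>x. \<theta> j x *\<^sub>R F x \<partial>\<gamma>) - ?g *\<^sub>R F j) \<le> ?g * \<delta>" .
    \<comment> \<open>Here \<open>\<eta> \<le> 1\<close> keeps the mass ratio at most 2. This is the
      source of 2\<delta> below, and of 3\<delta> once the oscillation between x and the centre j is
      added.\<close>
    have gle: "?g \<le> 2 * ?g'" using gg \<eta> gp mult_right_mono[OF \<eta>(2), of ?g'] by linarith
    have "norm ((\<integral>x. \<theta> j x *\<^sub>R F x \<partial>\<gamma>) - ?g' *\<^sub>R F j) \<le> ?g * \<delta> + \<bar>?g - ?g'\<bar> * norm (F j)"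
      using A1 norm_triangle_ineq[of "(\<integral>x. \<theta> j x *\<^sub>R F x \<partial>\<gamma>) - ?g *\<^sub>R F j" "(?g - ?g') *\<^sub>R F j"]
        norm_scaleR[of "?g - ?g'" "F j", unfolded scaleR_diff_left]
      by (simp add: scaleR_diff_left)
    also have "\<dots> \<le> 2 * ?g' * \<delta> + \<eta> * ?g' * M"
      using gle \<delta>0 gg F(2)[of j] gp \<eta> by (intro add_mono mult_mono) auto
    finally have "norm ((\<integral>x. \<theta> j x *\<^sub>R F x \<partial>\<gamma>) - ?g' *\<^sub>R F j) \<le> ?g' * (2 * \<delta> + M * \<eta>)"
      by (simp add: algebra_simps)
    moreover have "(\<integral>x. \<theta> j x *\<^sub>R F x \<partial>\<gamma>) = ?g' *\<^sub>R A" using gp by (simp add: A_def)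
    ultimately have "norm (?g' *\<^sub>R (A - F j)) \<le> ?g' * (2 * \<delta> + M * \<eta>)" by (simp add: scaleR_diff_right)
    then have A2: "norm (A - F j) \<le> 2 * \<delta> + M * \<eta>" using gp by simp
    have A3: "norm (F x - A) \<le> 3 * \<delta> + M * \<eta>" if "\<theta> j x \<noteq> 0" for x
      using F(4)[of x j] D(4)[OF j(1) that] A2 norm_triangle_ineq[of "F x - F j" "F j - A"]
      by (simp add: norm_minus_commute)
    have iA: "integrable \<gamma>' (\<lambda>x. A \<bullet> (\<theta> j x *\<^sub>R u x))"
      using iu[OF j(1)] by (intro integrable_inner_right)
    have "T j = (\<integral>x. (\<theta> j x *\<^sub>R F x) \<bullet> u x \<partial>\<gamma>') - A \<bullet> (\<integral>x. \<theta> j x *\<^sub>R u x \<partial>\<gamma>')"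
      by (simp add: T_def c[OF j] A_def)
    also have "\<dots> = (\<integral>x. (\<theta> j x *\<^sub>R F x) \<bullet> u x - A \<bullet> (\<theta> j x *\<^sub>R u x) \<partial>\<gamma>')"
      by (subst Bochner_Integration.integral_diff[OF integrable_bbs_inner[OF \<gamma>(2) u \<theta>F[OF j(1)]] iA],
          subst integral_inner_right[OF iu[OF j(1)]]) simp
    finally have "\<bar>T j\<bar> \<le> (\<integral>x. \<bar>(\<theta> j x *\<^sub>R F x) \<bullet> u x - A \<bullet> (\<theta> j x *\<^sub>R u x)\<bar> \<partial>\<gamma>')"
      using integral_abs_bound by metis
    also have "\<dots> \<le> (\<integral>x. (3 * \<delta> + M * \<eta>) * (\<theta> j x * (indicator ?B x * norm (u x))) \<partial>\<gamma>')"
    proof (rule integral_mono)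
      show "integrable \<gamma>' (\<lambda>x. \<bar>(\<theta> j x *\<^sub>R F x) \<bullet> u x - A \<bullet> (\<theta> j x *\<^sub>R u x)\<bar>)"
        by (intro integrable_abs Bochner_Integration.integrable_diff[OF integrable_bbs_inner[OF \<gamma>(2) u \<theta>F[OF j(1)]] iA])
      show "integrable \<gamma>' (\<lambda>x. (3 * \<delta> + M * \<eta>) * (\<theta> j x * (indicator ?B x * norm (u x))))"
        using iB\<theta>[OF j(1)] by simp
      fix x
      show "\<bar>(\<theta> j x *\<^sub>R F x) \<bullet> u x - A \<bullet> (\<theta> j x *\<^sub>R u x)\<bar> \<le> (3 * \<delta> + M * \<eta>) * (\<theta> j x * (indicator ?B x * norm (u x)))"
      proof (cases "\<theta> j x = 0")
        case False
        have "\<bar>(\<theta> j x *\<^sub>R F x) \<bullet> u x - A \<bullet> (\<theta> j x *\<^sub>R u x)\<bar> = \<theta> j x * \<bar>(F x - A) \<bullet> u x\<bar>"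
          using D(3)[OF j(1), of x] by (simp add: inner_diff_left abs_mult right_diff_distrib[symmetric])
        also have "\<dots> \<le> \<theta> j x * ((3 * \<delta> + M * \<eta>) * norm (u x))"
          using D(3)[OF j(1), of x] A3[OF False]
          by (intro mult_left_mono order.trans[OF Cauchy_Schwarz_ineq2] mult_right_mono) auto
        finally show ?thesis using inB[OF False] by (simp add: algebra_simps)
      qed simp
    qed
    also have "\<dots> = (3 * \<delta> + M * \<eta>) * (\<integral>x. \<theta> j x * (indicator ?B x * norm (u x)) \<partial>\<gamma>')" by simp
    finally show ?thesis .
  qed
  have T2: "\<bar>T j\<bar> \<le> M * (\<integral>x. \<theta> j x * norm (u x) \<partial>\<gamma>')" if j: "j \<in> J" "j \<notin> J1" for j
  proof -
    \<comment> \<open>On such a cell \<open>\<theta> j\<close> is 0 almost everywhere for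
      \<open>\<gamma>\<close>, so the smoothed side contributes nothing and only the
      \<open>\<gamma>'\<close> side remains.\<close>
    have "integrable \<gamma> (\<theta> j)" by (rule integrable_bbs[OF \<gamma>(1) bump_bbs[OF \<theta> j(1)]])
    then have "AE x in \<gamma>. \<theta> j x = 0"
      using J1[OF j] D(3)[OF j(1)] by (subst (asm) integral_nonneg_eq_0_iff_AE) auto
    then have "AE x in \<gamma>. \<theta> j x *\<^sub>R F x = 0" by eventually_elim simp
    then have "(\<integral>x. \<theta> j x *\<^sub>R F x \<partial>\<gamma>) = (\<integral>x. 0 \<partial>\<gamma>)" using j by (intro integral_cong_AE) auto
    then have "\<bar>T j\<bar> \<le> (\<integral>x. \<bar>(\<theta> j x *\<^sub>R F x) \<bullet> u x\<bar> \<partial>\<gamma>')" by (simp add: T_def)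
    also have "\<dots> \<le> (\<integral>x. M * (\<theta> j x * norm (u x)) \<partial>\<gamma>')"
    proof (rule integral_mono)
      show "integrable \<gamma>' (\<lambda>x. \<bar>(\<theta> j x *\<^sub>R F x) \<bullet> u x\<bar>)"
        using integrable_bbs_inner[OF \<gamma>(2) u \<theta>F[OF j(1)]] by (rule integrable_abs)
      show "integrable \<gamma>' (\<lambda>x. M * (\<theta> j x * norm (u x)))" using iun[OF j(1)] by simp
      fix x
      have "\<bar>(\<theta> j x *\<^sub>R F x) \<bullet> u x\<bar> = \<theta> j x * \<bar>F x \<bullet> u x\<bar>" using D(3)[OF j(1), of x] by (simp add: abs_mult)
      also have "\<dots> \<le> \<theta> j x * (M * norm (u x))"
        using D(3)[OF j(1), of x] F(2)[of x]
        by (intro mult_left_mono order.trans[OF Cauchy_Schwarz_ineq2] mult_right_mono) auto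
      finally show "\<bar>(\<theta> j x *\<^sub>R F x) \<bullet> u x\<bar> \<le> M * (\<theta> j x * norm (u x))" by (simp add: algebra_simps)
    qed
    finally show ?thesis by simp
  qed
  have "\<bar>\<Sum>j\<in>J. T j\<bar> \<le> (\<Sum>j\<in>J. \<bar>T j\<bar>)" by (rule sum_abs)
  also have "\<dots> = (\<Sum>j\<in>J \<inter> J1. \<bar>T j\<bar>) + (\<Sum>j\<in>J - J1. \<bar>T j\<bar>)"
    using D(1) by (subst sum.Int_Diff[of J _ J1]) auto
  also have "\<dots> \<le> (\<Sum>j\<in>J \<inter> J1. (3 * \<delta> + M * \<eta>) * (\<integral>x. \<theta> j x * (indicator ?B x * norm (u x)) \<partial>\<gamma>'))
      + (\<Sum>j\<in>J - J1. M * (\<integral>x. \<theta> j x * norm (u x) \<partial>\<gamma>'))"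
    by (intro add_mono sum_mono T1 T2) auto
  also have "(\<Sum>j\<in>J \<inter> J1. (3 * \<delta> + M * \<eta>) * (\<integral>x. \<theta> j x * (indicator ?B x * norm (u x)) \<partial>\<gamma>'))
      = (3 * \<delta> + M * \<eta>) * (\<integral>x. (\<Sum>j\<in>J \<inter> J1. \<theta> j x * (indicator ?B x * norm (u x))) \<partial>\<gamma>')"
    using iB\<theta> by (subst Bochner_Integration.integral_sum) (auto simp: sum_distrib_left)
  also have "\<dots> \<le> (3 * \<delta> + M * \<eta>) * (\<integral>x. indicator ?B x * norm (u x) \<partial>\<gamma>')"
  proof (intro mult_left_mono integral_mono iB)
    show "integrable \<gamma>' (\<lambda>x. \<Sum>j\<in>J \<inter> J1. \<theta> j x * (indicator ?B x * norm (u x)))"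
      using iB\<theta> by (intro Bochner_Integration.integrable_sum) auto
    fix x
    have "(\<Sum>j\<in>J \<inter> J1. \<theta> j x) \<le> (\<Sum>j\<in>J. \<theta> j x)" using D(1,3) by (intro sum_mono2) auto
    then have "(\<Sum>j\<in>J \<inter> J1. \<theta> j x) \<le> 1" using D(5)[of x] by linarith
    then have "(\<Sum>j\<in>J \<inter> J1. \<theta> j x) * (indicator ?B x * norm (u x)) \<le> 1 * (indicator ?B x * norm (u x))"
      by (intro mult_right_mono) auto
    then show "(\<Sum>j\<in>J \<inter> J1. \<theta> j x * (indicator ?B x * norm (u x))) \<le> indicator ?B x * norm (u x)"
      by (simp add: sum_distrib_right)
  qed (use M0 \<eta> \<delta>0 in simp)
  finally show ?thesis unfolding eq by (simp add: sum_distrib_left)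
qed

section \<open>Pairing a curve with test functions\<close>

lemma vector_integral_bound:
  fixes \<nu> :: "'a::euclidean_space set \<Rightarrow> 'b::euclidean_space"
  assumes \<nu>: "radon \<nu>"
  shows "\<exists>C\<ge>0. \<forall>F M. F \<in> borel_measurable borel \<longrightarrow> (\<forall>x. norm (F x) \<le> M) \<longrightarrow> (\<forall>x. R < norm x \<longrightarrow> F x = 0) \<longrightarrow>
    \<bar>vector_integral \<nu> F\<bar> \<le> C * M"
proof -
  have "\<forall>i\<in>Basis. \<exists>C\<ge>0. \<forall>f M. f \<in> borel_measurable borel \<longrightarrow> (\<forall>x. \<bar>f x\<bar> \<le> M) \<longrightarrow> (\<forall>x. R < norm x \<longrightarrow> f x = 0) \<longrightarrow>
    \<bar>signed_integral (\<lambda>A. \<nu> A \<bullet> i) f\<bar> \<le> C * M"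
    using signed_integral_bound[OF radon_inner[OF \<nu>]] by blast
  then obtain C where C: "\<And>i. i \<in> Basis \<Longrightarrow> 0 \<le> C i"
    "\<And>i f M. i \<in> Basis \<Longrightarrow> f \<in> borel_measurable borel \<Longrightarrow> (\<And>x. \<bar>f x\<bar> \<le> M) \<Longrightarrow> (\<And>x. R < norm x \<Longrightarrow> f x = 0) \<Longrightarrow>
      \<bar>signed_integral (\<lambda>A. \<nu> A \<bullet> i) f\<bar> \<le> C i * M"
    by metis
  show ?thesis
  proof (intro exI[of _ "\<Sum>i\<in>Basis. C i"] conjI allI impI)
    show "0 \<le> (\<Sum>i\<in>Basis. C i)" by (intro sum_nonneg C)
    fix F :: "'a \<Rightarrow> 'b" and M
    assume F: "F \<in> borel_measurable borel" "\<forall>x. norm (F x) \<le> M" "\<forall>x. R < norm x \<longrightarrow> F x = 0"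
    have "\<bar>vector_integral \<nu> F\<bar> \<le> (\<Sum>i\<in>Basis. \<bar>signed_integral (\<lambda>A. \<nu> A \<bullet> i) (\<lambda>x. F x \<bullet> i)\<bar>)"
      unfolding vector_integral_def by (rule sum_abs)
    also have "\<dots> \<le> (\<Sum>i\<in>Basis. C i * M)"
    proof (intro sum_mono C(2))
      fix i :: 'b and x assume "i \<in> Basis"
      then show "\<bar>F x \<bullet> i\<bar> \<le> M" using F(2) Basis_le_norm order.trans by blast
    qed (use F in auto)
    finally show "\<bar>vector_integral \<nu> F\<bar> \<le> (\<Sum>i\<in>Basis. C i) * M" by (simp add: sum_distrib_right)
  qed
qed

context
  fixes \<mu> :: "'a::euclidean_space set \<Rightarrow> real" and \<nu> :: "'a set \<Rightarrow> 'a"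
  assumes \<mu>: "radon \<mu>" and \<nu>: "radon \<nu>"
begin

lemma pairing_bound:
  "\<exists>C\<ge>0. \<forall>F M. F \<in> borel_measurable borel \<longrightarrow> (\<forall>x. norm (F x) \<le> M) \<longrightarrow> (\<forall>x. R < norm x \<longrightarrow> F x = 0) \<longrightarrow>
    \<bar>pairing \<mu> \<nu> F\<bar> \<le> C * M"
proof -
  obtain C where C: "C \<ge> 0" "\<And>f M. f \<in> borel_measurable borel \<Longrightarrow> (\<And>x. \<bar>f x\<bar> \<le> M) \<Longrightarrow> (\<And>x. R < norm x \<Longrightarrow> f x = 0) \<Longrightarrow>
      \<bar>signed_integral \<mu> f\<bar> \<le> C * M"
    using signed_integral_bound[OF \<mu>, of R] by metis
  obtain D where D: "D \<ge> 0" "\<And>f M. f \<in> borel_measurable borel \<Longrightarrow> (\<And>x. norm (f x) \<le> M) \<Longrightarrow> (\<And>x. R < norm x \<Longrightarrow> f x = 0) \<Longrightarrow>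
      \<bar>vector_integral \<nu> f\<bar> \<le> D * M"
    using vector_integral_bound[OF \<nu>, of R] by metis
  show ?thesis
  proof (intro exI[of _ "C + D"] conjI allI impI)
    fix F :: "'a \<Rightarrow> real \<times> 'a" and M
    assume F: "F \<in> borel_measurable borel" "\<forall>x. norm (F x) \<le> M" "\<forall>x. R < norm x \<longrightarrow> F x = 0"
    have [measurable]: "F \<in> borel \<rightarrow>\<^sub>M borel \<Otimes>\<^sub>M borel" using F(1) by (simp add: borel_prod)
    have "\<bar>signed_integral \<mu> (\<lambda>x. fst (F x))\<bar> \<le> C * M"
    proof (rule C(2))
      show "\<bar>fst (F x)\<bar> \<le> M" for x using norm_fst_le[of "fst (F x)" "snd (F x)"] F(2)[rule_format, of x] by simp
    qed (use F(3) in auto)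
    moreover have "\<bar>vector_integral \<nu> (\<lambda>x. snd (F x))\<bar> \<le> D * M"
    proof (rule D(2))
      show "norm (snd (F x)) \<le> M" for x using norm_snd_le[of "snd (F x)" "fst (F x)"] F(2)[rule_format, of x] by simp
    qed (use F(3) in auto)
    ultimately show "\<bar>pairing \<mu> \<nu> F\<bar> \<le> (C + D) * M" by (simp add: pairing_def distrib_right)
  qed (use C D in simp)
qed

lemma vector_integral_add:
  assumes "bbs F" "bbs G"
  shows "vector_integral \<nu> (\<lambda>x. F x + G x) = vector_integral \<nu> F + vector_integral \<nu> G"
proof -
  have b: "bbs (\<lambda>x. H x \<bullet> i)" if "bbs H" for H :: "'a \<Rightarrow> 'a" and i
    by (rule bbs_linear[OF that, of "\<lambda>y. y \<bullet> i"]) (rule bounded_linear_inner_left)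
  show ?thesis
    by (simp add: vector_integral_def inner_add_left signed_integral_add[OF radon_inner[OF \<nu>] b b] assms sum.distrib)
qed

lemma vector_integral_scaleR: "vector_integral \<nu> (\<lambda>x. c *\<^sub>R F x) = c * vector_integral \<nu> F"
  by (simp add: vector_integral_def signed_integral_cmult[OF radon_inner[OF \<nu>]] sum_distrib_left)

lemma pairing_add:
  assumes "bbs F" "bbs G"
  shows "pairing \<mu> \<nu> (\<lambda>x. F x + G x) = pairing \<mu> \<nu> F + pairing \<mu> \<nu> G"
  using signed_integral_add[OF \<mu> bbs_fst[OF assms(1)] bbs_fst[OF assms(2)]]
    vector_integral_add[OF bbs_snd[OF assms(1)] bbs_snd[OF assms(2)]]
  by (simp add: pairing_def)

lemma pairing_scaleR: "pairing \<mu> \<nu> (\<lambda>x. c *\<^sub>R F x) = c * pairing \<mu> \<nu> F"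
  using signed_integral_cmult[OF \<mu>, of c "\<lambda>x. fst (F x)"] vector_integral_scaleR[of c "\<lambda>x. snd (F x)"]
  by (simp add: pairing_def distrib_left)

lemma pairing_diff:
  assumes "bbs F" "bbs G"
  shows "pairing \<mu> \<nu> (\<lambda>x. F x - G x) = pairing \<mu> \<nu> F - pairing \<mu> \<nu> G"
  using pairing_add[OF assms(1) bbs_scaleR[OF assms(2), of "-1"]] pairing_scaleR[of "-1" G] by simp

text \<open>Uniform convergence with a common bounded support suffices, through the constant of
  \<open>pairing_bound\<close>.\<close>

lemma pairing_tendsto:
  assumes F: "\<And>k. F k \<in> borel_measurable borel" "G \<in> borel_measurable borel"
    "\<And>k x. R < norm x \<Longrightarrow> F k x = 0" "\<And>x. R < norm x \<Longrightarrow> G x = 0"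
    and G: "\<And>x. norm (G x) \<le> B"
    and e: "\<And>k x. norm (F k x - G x) \<le> e k" "e \<longlonglongrightarrow> 0"
  shows "(\<lambda>k. pairing \<mu> \<nu> (F k)) \<longlonglongrightarrow> pairing \<mu> \<nu> G"
proof -
  obtain C where C: "C \<ge> 0" "\<And>F M. F \<in> borel_measurable borel \<Longrightarrow> (\<And>x. norm (F x) \<le> M) \<Longrightarrow> (\<And>x. R < norm x \<Longrightarrow> F x = 0) \<Longrightarrow>
      \<bar>pairing \<mu> \<nu> F\<bar> \<le> C * M"
    using pairing_bound[of R] by metis
  have bG: "bbs G" using F G by (intro bbsI[where M = B and R = R]) auto
  have bF: "bbs (F k)" for k
  proof (rule bbsI[where M = "B + e k" and R = R])
    show "norm (F k x) \<le> B + e k" for x using e(1)[of k x] G[of x] norm_triangle_sub[of "F k x" "G x"] by linarith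
  qed (use F in auto)
  have le: "\<bar>pairing \<mu> \<nu> (F k) - pairing \<mu> \<nu> G\<bar> \<le> C * e k" for k
    unfolding pairing_diff[OF bF bG, symmetric] using F e by (intro C(2)) auto
  have "(\<lambda>k. pairing \<mu> \<nu> (F k) - pairing \<mu> \<nu> G) \<longlonglongrightarrow> 0"
  proof (rule Lim_null_comparison[OF always_eventually[OF allI]])
    show "(\<lambda>k. C * e k) \<longlonglongrightarrow> 0" by (rule tendsto_mult_right_zero[OF e(2)])
  qed (simp add: le)
  then show ?thesis by (rule LIM_zero_cancel)
qed

end

text \<open>Extends \<open>Cc\<close> to vector-valued functions, with the support condition in the
  form used by the estimates.\<close>

definition cc :: "('a::euclidean_space \<Rightarrow> 'b::real_normed_vector) \<Rightarrow> bool" where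
  "cc F \<longleftrightarrow> continuous_on UNIV F \<and> (\<exists>R. \<forall>x. R < norm x \<longrightarrow> F x = 0)"

lemma cc_Cc: "f \<in> Cc \<longleftrightarrow> cc f"
proof
  assume f: "f \<in> Cc"
  then have "bounded (closure {x. f x \<noteq> 0})" by (auto simp: Cc_def compact_imp_bounded)
  then obtain R where "closure {x. f x \<noteq> 0} \<subseteq> cball 0 R" using bounded_subset_cball0 by blast
  then have "\<forall>x. R < norm x \<longrightarrow> f x = 0" using closure_subset[of "{x. f x \<noteq> 0}"] by fastforce
  then show "cc f" using f by (auto simp: cc_def Cc_def)
next
  assume "cc f"
  then obtain R where f: "continuous_on UNIV f" "\<forall>x. R < norm x \<longrightarrow> f x = 0" by (auto simp: cc_def)
  then have "{x. f x \<noteq> 0} \<subseteq> cball 0 R" by force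
  then have "bounded {x. f x \<noteq> 0}" using bounded_subset bounded_cball by blast
  then show "f \<in> Cc" using f(1) by (simp add: Cc_def compact_eq_bounded_closed bounded_closure)
qed

lemma cc_bounded:
  assumes "cc F"
  obtains M where "0 \<le> M" "\<And>x. norm (F x) \<le> M"
proof -
  obtain R where F: "continuous_on UNIV F" "\<And>x. R < norm x \<Longrightarrow> F x = 0" using assms by (auto simp: cc_def)
  have "compact (F ` cball 0 R)" using F(1) by (intro compact_continuous_image) (auto intro: continuous_on_subset)
  then obtain M where "M > 0" "\<And>x. x \<in> cball 0 R \<Longrightarrow> norm (F x) \<le> M"
    using bounded_pos[of "F ` cball 0 R"] by (auto dest: compact_imp_bounded)
  then show ?thesis using F(2) by (intro that[of M]) (auto, metis norm_zero less_imp_le not_le)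
qed

lemma cc_bbs:
  assumes "cc F"
  shows "bbs F"
proof -
  obtain M where "\<And>x. norm (F x) \<le> M" using cc_bounded[OF assms] by metis
  then show ?thesis using assms unfolding cc_def by (metis bbsI borel_measurable_continuous_onI)
qed

lemma cc_uniform:
  fixes F :: "'a::euclidean_space \<Rightarrow> 'b::real_normed_vector"
  assumes "cc F" "0 < e"
  shows "\<exists>d>0. \<forall>x y. dist x y < d \<longrightarrow> norm (F x - F y) \<le> e"
proof -
  obtain R where F: "continuous_on UNIV F" "\<And>x. R < norm x \<Longrightarrow> F x = 0" using assms by (auto simp: cc_def)
  have "uniformly_continuous_on (cball 0 (R + 1)) F"
    using F(1) by (intro compact_uniformly_continuous) (auto intro: continuous_on_subset)
  then obtain d where d: "d > 0" "\<And>x y. x \<in> cball 0 (R + 1) \<Longrightarrow> y \<in> cball 0 (R + 1) \<Longrightarrow> dist x y < d \<Longrightarrow> norm (F x - F y) < e"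
    unfolding uniformly_continuous_on_def dist_norm using assms(2) by (metis norm_minus_commute)
  show ?thesis
  proof (intro exI[of _ "min d 1"] conjI allI impI)
    fix x y :: 'a assume xy: "dist x y < min d 1"
    then have n: "norm x \<le> norm y + 1" "norm y \<le> norm x + 1"
      using norm_triangle_sub[of x y] norm_triangle_sub[of y x] by (auto simp: dist_norm norm_minus_commute)
    show "norm (F x - F y) \<le> e"
    proof (cases "norm x \<le> R + 1 \<and> norm y \<le> R + 1")
      case True then show ?thesis using d(2)[of x y] xy by simp
    next
      case False
      then have "F x = 0" "F y = 0" using n F(2) by auto
      then show ?thesis using assms(2) by simp
    qed
  qed (use d in simp)
qed

lemma cc_section:
  fixes F :: "'a::euclidean_space \<times> real \<Rightarrow> 'b::real_normed_vector"
  assumes "cc F"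
  shows "cc (\<lambda>x. F (x, t))"
proof -
  obtain R where F: "continuous_on UNIV F" "\<And>x. R < norm x \<Longrightarrow> F x = 0" using assms by (auto simp: cc_def)
  have "F (x, t) = 0" if "R < norm x" for x using F(2)[of "(x, t)"] that norm_fst_le[of x t] by simp
  moreover have "continuous_on UNIV (\<lambda>x. F (x, t))"
    by (rule continuous_on_compose2[OF F(1)]) (auto intro!: continuous_intros)
  ultimately show ?thesis unfolding cc_def by blast
qed

lemma CE_D:
  assumes "(\<mu>, \<nu>) \<in> CE 1"
  shows "\<And>t. t \<in> {0..1} \<Longrightarrow> radon (\<mu> t)" "\<And>t. t \<in> {0..1} \<Longrightarrow> radon (\<nu> t)"
    "\<And>f. cc f \<Longrightarrow> continuous_on {0..1} (\<lambda>t. signed_integral (\<mu> t) f)"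
    "borel_family 1 \<nu>"
    "\<And>\<zeta> g h. C1c_test 1 \<zeta> g h \<Longrightarrow>
        (LINT t:{0..1}|lborel. signed_integral (\<mu> t) (\<lambda>x. h (x, t))) +
        (LINT t:{0..1}|lborel. vector_integral (\<nu> t) (\<lambda>x. g (x, t))) = 0"
proof -
  note C = assms[unfolded CE_def mem_Collect_eq prod.case]
  show "radon (\<mu> t)" "radon (\<nu> t)" if "t \<in> {0..1}" for t using C that by blast+
  show "continuous_on {0..1} (\<lambda>t. signed_integral (\<mu> t) f)" if "cc f" for f
    using C that unfolding cc_Cc[symmetric] by blast
  show "borel_family 1 \<nu>" using C by blast
  show "(LINT t:{0..1}|lborel. signed_integral (\<mu> t) (\<lambda>x. h (x, t))) +
        (LINT t:{0..1}|lborel. vector_integral (\<nu> t) (\<lambda>x. g (x, t))) = 0"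
    if "C1c_test 1 \<zeta> g h" for \<zeta> g h using C that by blast
qed

section \<open>Measurability in time of integrals along a curve\<close>

lemma floor_approx: "0 < k \<Longrightarrow> \<bar>y - of_int \<lfloor>real k * y\<rfloor> / real k\<bar> \<le> 1 / real k"
proof -
  assume k: "0 < k"
  have "of_int \<lfloor>real k * y\<rfloor> / real k \<le> y" using k by (simp add: divide_le_eq mult.commute)
  moreover have "y \<le> (of_int \<lfloor>real k * y\<rfloor> + 1) / real k" using k
    by (simp add: le_divide_eq mult.commute)
  ultimately show ?thesis by (simp add: add_divide_distrib abs_le_iff)
qed

text \<open>Measurability is known only for the values on bounded Borel sets. Rounding f down to
  multiples of \<open>1 / Suc k\<close> leaves finitely many values, hence a finite linear
  combination of such set values, with an error uniform on a fixed ball.\<close>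

lemma borel_family_signed_integral:
  fixes \<mu> :: "real \<Rightarrow> 'a::euclidean_space set \<Rightarrow> real"
  assumes rad: "\<And>t. t \<in> {0..T} \<Longrightarrow> radon (\<mu> t)"
    and meas: "\<And>A. bdd_borel A \<Longrightarrow> (\<lambda>t. \<mu> t A) \<in> borel_measurable (restrict_space borel {0..T})" and f: "bbs f"
  shows "(\<lambda>t. signed_integral (\<mu> t) f) \<in> borel_measurable (restrict_space borel {0..T})"
proof -
  obtain M R where fb: "0 \<le> M" "\<And>x. norm (f x) \<le> M" "\<And>x. R < norm x \<Longrightarrow> f x = 0"
    and [measurable]: "f \<in> borel_measurable borel" using bbsD[OF f] by metis
  define fk where "fk k x = (\<Sum>m\<in>{- \<lceil>real (Suc k) * M\<rceil> - 1..\<lceil>real (Suc k) * M\<rceil>}.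
    (of_int m / real (Suc k)) * indicator ({x. \<lfloor>real (Suc k) * f x\<rfloor> = m} \<inter> cball 0 R) x)" for k and x :: 'a
  have fk: "fk k x = (if x \<in> cball 0 R then of_int \<lfloor>real (Suc k) * f x\<rfloor> / real (Suc k) else 0)" for k x
  proof (cases "x \<in> cball 0 R")
    case True
    let ?m = "\<lfloor>real (Suc k) * f x\<rfloor>"
    have "\<bar>real (Suc k) * f x\<bar> \<le> real (Suc k) * M"
      using mult_left_mono[OF fb(2)[of x], of "real (Suc k)"] by (simp add: abs_mult)
    then have "?m \<in> {- \<lceil>real (Suc k) * M\<rceil> - 1..\<lceil>real (Suc k) * M\<rceil>}" unfolding atLeastAtMost_iff by linarith
    then have "fk k x = (of_int ?m / real (Suc k)) * indicator ({x. \<lfloor>real (Suc k) * f x\<rfloor> = ?m} \<inter> cball 0 R) x"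
      unfolding fk_def by (subst sum.remove[of _ ?m]) (auto intro!: sum.neutral simp: indicator_def)
    then show ?thesis using True by simp
  qed (simp add: fk_def)
  have set: "bdd_borel ({x. \<lfloor>real (Suc k) * f x\<rfloor> = m} \<inter> cball 0 R)" for k m
  proof
    have "{x. \<lfloor>real (Suc k) * f x\<rfloor> = m} \<in> sets borel" by measurable
    then show "{x. \<lfloor>real (Suc k) * f x\<rfloor> = m} \<inter> cball 0 R \<in> sets borel" by auto
  qed (auto intro: bounded_subset)
  have fkm: "fk k \<in> borel_measurable borel" for k
    unfolding fk_def using set by (intro borel_measurable_sum borel_measurable_times borel_measurable_indicator) auto
  have sum_si: "signed_integral (\<mu> t) (fk k) = (\<Sum>m\<in>{- \<lceil>real (Suc k) * M\<rceil> - 1..\<lceil>real (Suc k) * M\<rceil>}.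
     (of_int m / real (Suc k)) * \<mu> t ({x. \<lfloor>real (Suc k) * f x\<rfloor> = m} \<inter> cball 0 R))" if t: "t \<in> {0..T}" for t k
  proof -
    have S: "signed_integral (\<mu> t) (\<lambda>x. \<Sum>m\<in>I. q m * indicator (X m) x) = (\<Sum>m\<in>I. q m * \<mu> t (X m))"
      if "finite I" "\<And>m. bdd_borel (X m)" for I :: "int set" and q :: "int \<Rightarrow> real" and X
      using that(1)
    proof (induction I rule: finite_induct)
      case (insert m I)
      have b: "bbs (\<lambda>x. q m * indicator (X m) x)" for m
        using bbs_scaleR[OF bbs_indicator[OF that(2)], of "q m"] by simp
      show ?case
        using insert signed_integral_add[OF rad[OF t] b bbs_sum[where I = I and f = "\<lambda>m x. q m * indicator (X m) x", OF b], of m]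
        by (simp add: signed_integral_cmult[OF rad[OF t]] signed_integral_indicator[OF rad[OF t] that(2)]
          del: sum_mult_indicator sum_indicator_mult)
    qed (simp add: signed_integral_def)
    show ?thesis unfolding fk_def by (rule S) (use set in auto)
  qed
  have "(\<lambda>t. signed_integral (\<mu> t) (fk k)) \<in> borel_measurable (restrict_space borel {0..T})" for k
  proof -
    have "(\<lambda>t. \<Sum>m\<in>{- \<lceil>real (Suc k) * M\<rceil> - 1..\<lceil>real (Suc k) * M\<rceil>}.
     (of_int m / real (Suc k)) * \<mu> t ({x. \<lfloor>real (Suc k) * f x\<rfloor> = m} \<inter> cball 0 R)) \<in> borel_measurable (restrict_space borel {0..T})"
      by (intro borel_measurable_sum borel_measurable_times meas set) auto
    then show ?thesis by (subst measurable_cong[OF sum_si]) (auto simp: space_restrict_space)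
  qed
  moreover have "(\<lambda>k. signed_integral (\<mu> t) (fk k)) \<longlonglongrightarrow> signed_integral (\<mu> t) f" if t: "t \<in> {0..T}" for t
  proof -
    obtain C where C: "C \<ge> 0" "\<And>f M. f \<in> borel_measurable borel \<Longrightarrow> (\<And>x. \<bar>f x\<bar> \<le> M) \<Longrightarrow> (\<And>x. R < norm x \<Longrightarrow> f x = 0) \<Longrightarrow>
      \<bar>signed_integral (\<mu> t) f\<bar> \<le> C * M"
      using signed_integral_bound[OF rad[OF t], of R] by metis
    have near: "\<bar>fk k x - f x\<bar> \<le> 1 / real (Suc k)" for k x
      unfolding fk using floor_approx[of "Suc k" "f x"] fb(3)[of x] by (auto simp: abs_minus_commute)
    have bfk: "bbs (fk k)" for k
    proof (rule bbsI[OF fkm, where M = "M + 1" and R = R])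
      have "1 / real (Suc k) \<le> 1" by simp
      then show "norm (fk k x) \<le> M + 1" for x using near[of k x] fb(2)[of x] unfolding real_norm_def by linarith
    qed (simp add: fk)
    have "signed_integral (\<mu> t) (fk k) - signed_integral (\<mu> t) f = signed_integral (\<mu> t) (\<lambda>x. fk k x - f x)" for k
      using signed_integral_add[OF rad[OF t] bfk bbs_scaleR[OF f, of "-1"], of k] signed_integral_cmult[OF rad[OF t], of "-1" f]
      by simp
    then have le: "\<bar>signed_integral (\<mu> t) (fk k) - signed_integral (\<mu> t) f\<bar> \<le> C * (1 / real (Suc k))" for k
      using near fkm fb(3) by (simp only:) (intro C(2), auto simp: fk)
    have "(\<lambda>k. signed_integral (\<mu> t) (fk k) - signed_integral (\<mu> t) f) \<longlonglongrightarrow> 0"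
    proof (rule Lim_null_comparison[OF always_eventually[OF allI]])
      show "(\<lambda>k. C * (1 / real (Suc k))) \<longlonglongrightarrow> 0"
        using tendsto_mult_right_zero[OF LIMSEQ_inverse_real_of_nat, of C] by (simp add: inverse_eq_divide)
    qed (use le in simp)
    then show ?thesis by (rule LIM_zero_cancel)
  qed
  ultimately show ?thesis
    by (rule borel_measurable_LIMSEQ_real[where u = "\<lambda>k t. signed_integral (\<mu> t) (fk k)", rotated])
      (simp add: space_restrict_space)
qed

text \<open>The two components are measurable for different reasons: weak* continuity in the case of
  \<mu>, the Borel family in the case of \<nu>.\<close>

lemma pairing_curve_measurable_const:
  assumes \<mu>: "\<And>t. t \<in> {0..1} \<Longrightarrow> radon (\<mu> t)" and \<nu>: "\<And>t. t \<in> {0..1} \<Longrightarrow> radon (\<nu> t)"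
    and cont: "\<And>f. cc f \<Longrightarrow> continuous_on {0..1} (\<lambda>t. signed_integral (\<mu> t) f)"
    and fam: "borel_family 1 \<nu>" and F: "cc F"
  shows "(\<lambda>t. if t \<in> {0..1} then pairing (\<mu> t) (\<nu> t) F else 0) \<in> borel_measurable borel"
proof -
  have "(\<lambda>t. signed_integral (\<mu> t) (\<lambda>x. fst (F x))) \<in> borel_measurable (restrict_space borel {0..1})"
  proof (rule borel_measurable_continuous_on_restrict[OF cont])
    obtain R where R: "continuous_on UNIV F" "\<forall>x. R < norm x \<longrightarrow> F x = 0" using F by (auto simp: cc_def)
    then have "continuous_on UNIV (\<lambda>x. fst (F x))" "\<forall>x. R < norm x \<longrightarrow> fst (F x) = 0"
      by (auto intro!: continuous_intros)
    then show "cc (\<lambda>x. fst (F x))" unfolding cc_def by blast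
  qed
  moreover have "(\<lambda>t. signed_integral (\<lambda>A. \<nu> t A \<bullet> i) (\<lambda>x. snd (F x) \<bullet> i)) \<in> borel_measurable (restrict_space borel {0..1})" for i
  proof (rule borel_family_signed_integral)
    show "radon (\<lambda>A. \<nu> t A \<bullet> i)" if "t \<in> {0..1}" for t using \<nu>[OF that] by (rule radon_inner)
    show "(\<lambda>t. \<nu> t A \<bullet> i) \<in> borel_measurable (restrict_space borel {0..1})" if "bdd_borel A" for A
      using fam that unfolding borel_family_def by (intro borel_measurable_inner) auto
    show "bbs (\<lambda>x. snd (F x) \<bullet> i)"
      by (rule bbs_linear[OF bbs_snd[OF cc_bbs[OF F]], of "\<lambda>y. y \<bullet> i"]) (rule bounded_linear_inner_left)
  qed
  ultimately have "(\<lambda>t. pairing (\<mu> t) (\<nu> t) F) \<in> borel_measurable (restrict_space borel {0..1})"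
    unfolding pairing_def vector_integral_def by (intro borel_measurable_add borel_measurable_sum)
  then have "(\<lambda>t. indicator {0..1} t *\<^sub>R pairing (\<mu> t) (\<nu> t) F) \<in> borel_measurable borel"
    by (subst (asm) borel_measurable_restrict_space_iff) auto
  then show ?thesis by (rule measurable_cong[THEN iffD1, rotated]) auto
qed

text \<open>Time enters both the measures and the integrand. Freezing the integrand at a grid point
  of step \<open>1 / Suc k\<close> leaves countably many measurable pieces, and uniform continuity
  of F removes the freezing in the limit.\<close>

lemma pairing_curve_measurable:
  fixes F :: "'a::euclidean_space \<times> real \<Rightarrow> real \<times> 'a"
  assumes \<mu>: "\<And>t. t \<in> {0..1} \<Longrightarrow> radon (\<mu> t)" and \<nu>: "\<And>t. t \<in> {0..1} \<Longrightarrow> radon (\<nu> t)"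
    and cont: "\<And>f. cc f \<Longrightarrow> continuous_on {0..1} (\<lambda>t. signed_integral (\<mu> t) f)"
    and fam: "borel_family 1 \<nu>" and F: "cc F"
  shows "(\<lambda>t. if t \<in> {0..1} then pairing (\<mu> t) (\<nu> t) (\<lambda>x. F (x, t)) else 0) \<in> borel_measurable borel"
proof -
  define q where "q k t = (if t \<in> {0..1} then pairing (\<mu> t) (\<nu> t) (\<lambda>x. F (x, of_int \<lfloor>real (Suc k) * t\<rfloor> / real (Suc k))) else 0)" for k t
  obtain R where F': "continuous_on UNIV F" "\<And>z. R < norm z \<Longrightarrow> F z = 0" using F by (auto simp: cc_def)
  have supp: "F (x, t) = 0" if "R < norm x" for x t using F'(2)[of "(x, t)"] that norm_fst_le[of x t] by simp
  obtain M where M: "0 \<le> M" "\<And>z. norm (F z) \<le> M" using cc_bounded[OF F] by metis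
  have "q k \<in> borel_measurable borel" for k
    unfolding q_def
  proof (rule measurable_compose_countable[where g = "\<lambda>t. \<lfloor>real (Suc k) * t\<rfloor>" and
        f = "\<lambda>i t. if t \<in> {0..1} then pairing (\<mu> t) (\<nu> t) (\<lambda>x. F (x, of_int i / real (Suc k))) else 0"])
    show "(\<lambda>t. \<lfloor>real (Suc k) * t\<rfloor>) \<in> borel \<rightarrow>\<^sub>M count_space UNIV" by measurable
  qed (rule pairing_curve_measurable_const[OF \<mu> \<nu> cont fam cc_section[OF F]])
  moreover have "(\<lambda>k. q k t) \<longlonglongrightarrow> (if t \<in> {0..1} then pairing (\<mu> t) (\<nu> t) (\<lambda>x. F (x, t)) else 0)" for t
  proof (cases "t \<in> {0..1}")
    case t: True
    define e where "e k = (SUP x. norm (F (x, of_int \<lfloor>real (Suc k) * t\<rfloor> / real (Suc k)) - F (x, t)))" for k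
    have bd: "norm (F z - F z') \<le> 2 * M" for z z' using norm_triangle_ineq4[of "F z" "F z'"] M(2)[of z] M(2)[of z'] by linarith
    have up: "norm (F (x, of_int \<lfloor>real (Suc k) * t\<rfloor> / real (Suc k)) - F (x, t)) \<le> e k" for k x
      unfolding e_def using bd by (intro cSUP_upper) (auto intro!: bdd_aboveI[of _ "2 * M"])
    have "e \<longlonglongrightarrow> 0"
      unfolding tendsto_iff
    proof (intro allI impI)
      fix \<epsilon> :: real assume \<epsilon>: "0 < \<epsilon>"
      obtain d where d: "d > 0" "\<And>z z'. dist z z' < d \<Longrightarrow> norm (F z - F z') \<le> \<epsilon> / 2"
        using cc_uniform[OF F, of "\<epsilon> / 2"] \<epsilon> by auto
      obtain N :: nat where N: "1 / d < real N" using reals_Archimedean2 by blast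
      show "eventually (\<lambda>k. dist (e k) 0 < \<epsilon>) sequentially"
        using eventually_ge_at_top[of N]
      proof eventually_elim
        case (elim k)
        have "1 / d < real (Suc k)" using N elim by simp
        then have "1 / real (Suc k) < d" using d(1) by (simp add: field_simps)
        then have "dist (x, of_int \<lfloor>real (Suc k) * t\<rfloor> / real (Suc k)) (x, t) < d" for x :: 'a
          using floor_approx[of "Suc k" t] by (simp add: dist_Pair_Pair dist_real_def abs_minus_commute)
        then have "e k \<le> \<epsilon> / 2" unfolding e_def by (intro cSUP_least d) auto
        moreover have "0 \<le> e k" using up order.trans norm_ge_zero by blast
        ultimately show ?case using \<epsilon> by simp
      qed
    qed
    then have "(\<lambda>k. pairing (\<mu> t) (\<nu> t) (\<lambda>x. F (x, of_int \<lfloor>real (Suc k) * t\<rfloor> / real (Suc k)))) \<longlonglongrightarrow> pairing (\<mu> t) (\<nu> t) (\<lambda>x. F (x, t))"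
    proof (rule pairing_tendsto[OF \<mu>[OF t] \<nu>[OF t], rotated -1])
      show "norm (F (x, of_int \<lfloor>real (Suc k) * t\<rfloor> / real (Suc k)) - F (x, t)) \<le> e k" for k x
        by (rule up)
      show "(\<lambda>x. F (x, s)) \<in> borel_measurable borel" for s
        using cc_bbs[OF cc_section[OF F, of s]] by (simp add: bbs_def)
      show "(\<lambda>x. F (x, t)) \<in> borel_measurable borel"
        using cc_bbs[OF cc_section[OF F, of t]] by (simp add: bbs_def)
      show "norm (F (x, t)) \<le> M" for x by (rule M)
    qed (use supp in auto)
    then show ?thesis unfolding q_def if_P[OF t] .
  next
    case False
    show ?thesis unfolding q_def if_not_P[OF False] by simp
  qed
  ultimately show ?thesis by (rule borel_measurable_LIMSEQ_real[rotated])
qed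

lemma CE_pairing_measurable_const:
  assumes "(\<mu>, \<nu>) \<in> CE 1" and "cc F"
  shows "(\<lambda>t. if t \<in> {0..1} then pairing (\<mu> t) (\<nu> t) F else 0) \<in> borel_measurable borel"
  by (rule pairing_curve_measurable_const[OF CE_D(1-4)[OF assms(1)] assms(2)])

lemma CE_pairing_measurable:
  assumes "(\<mu>, \<nu>) \<in> CE 1" and "cc F"
  shows "(\<lambda>t. if t \<in> {0..1} then pairing (\<mu> t) (\<nu> t) (\<lambda>x. F (x, t)) else 0) \<in> borel_measurable borel"
  by (rule pairing_curve_measurable[OF CE_D(1-4)[OF assms(1)] assms(2)])

section \<open>Increments along the continuity equation\<close>

definition ramp :: "real \<Rightarrow> real" where "ramp x = max 0 x"

text \<open>A tent on [0, 1] of height 2 and integral 1. \<open>step\<close> is its primitive, a C1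
  transition from 0 to 1.\<close>

definition hat :: "real \<Rightarrow> real" where "hat x = 4 * (ramp x - 2 * ramp (x - 1/2) + ramp (x - 1))"

definition step :: "real \<Rightarrow> real" where
  "step x = 2 * (ramp x)\<^sup>2 - 4 * (ramp (x - 1/2))\<^sup>2 + 2 * (ramp (x - 1))\<^sup>2"

lemma ramp_square_deriv: "((\<lambda>x. (ramp x)\<^sup>2) has_real_derivative 2 * ramp x) (at x)"
proof (cases x "0::real" rule: linorder_cases)
  case less
  have "((\<lambda>x. 0) has_real_derivative 2 * ramp x) (at x)" using less by (simp add: ramp_def)
  then show ?thesis
    by (rule has_field_derivative_transform_within_open[where S = "{..<0}"]) (use less in \<open>auto simp: ramp_def\<close>)
next
  case greater
  have "((\<lambda>x. x\<^sup>2) has_real_derivative 2 * ramp x) (at x)"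
    using greater by (auto intro!: derivative_eq_intros simp: ramp_def)
  then show ?thesis
    by (rule has_field_derivative_transform_within_open[where S = "{0<..}"]) (use greater in \<open>auto simp: ramp_def\<close>)
next
  case equal
  have "((\<lambda>y. (ramp y)\<^sup>2 / y) \<longlongrightarrow> 0) (at 0)"
  proof (rule Lim_null_comparison)
    show "eventually (\<lambda>y. norm ((ramp y)\<^sup>2 / y) \<le> \<bar>y\<bar>) (at (0::real))"
      by (intro always_eventually allI) (auto simp: ramp_def max_def power2_eq_square)
    show "((\<lambda>y. \<bar>y\<bar>) \<longlongrightarrow> 0) (at (0::real))" by (rule tendsto_eq_intros | simp)+
  qed
  then show ?thesis
    by (simp add: equal has_field_derivative_iff ramp_def)
qed

lemma step_deriv: "(step has_real_derivative hat x) (at x)"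
proof -
  have shift: "((\<lambda>x. (ramp (x - c))\<^sup>2) has_real_derivative 2 * ramp (x - c)) (at x)" for c
    by (rule DERIV_chain2[where g = "\<lambda>x. x - c" and f = "\<lambda>y. (ramp y)\<^sup>2", OF ramp_square_deriv, THEN DERIV_cong])
      (auto intro!: derivative_eq_intros)
  show ?thesis
    unfolding step_def[abs_def] hat_def
    by (rule derivative_eq_intros shift shift[of 0, simplified] refl | simp)+
qed

lemma hat_props: "0 \<le> hat x" "x \<le> 0 \<or> 1 \<le> x \<Longrightarrow> hat x = 0" "continuous_on UNIV hat"
  "x \<le> 0 \<Longrightarrow> step x = 0" "1 \<le> x \<Longrightarrow> step x = 1"
proof -
  show "0 \<le> hat x" "x \<le> 0 \<or> 1 \<le> x \<Longrightarrow> hat x = 0" by (auto simp: hat_def ramp_def max_def)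
  show "continuous_on UNIV hat" unfolding hat_def[abs_def] ramp_def by (intro continuous_intros)
  show "x \<le> 0 \<Longrightarrow> step x = 0" by (auto simp: step_def ramp_def)
  show "1 \<le> x \<Longrightarrow> step x = 1" by (auto simp: step_def ramp_def power2_eq_square algebra_simps)
qed

lemma step_mono: "x \<le> y \<Longrightarrow> step x \<le> step y"
  by (rule DERIV_nonneg_imp_nondecreasing) (use step_deriv hat_props(1) in blast)+

lemma step_bounds: "0 \<le> step x" "step x \<le> 1"
  using step_mono[of "min x 0" x] step_mono[of x "max x 1"] hat_props(4)[of "min x 0"] hat_props(5)[of "max x 1"]
  by auto

text \<open>The tent transported to \<open>{s..s + k}\<close> with unit mass: an averaging kernel
  that looks forward from s.\<close>

definition bump :: "real \<Rightarrow> real \<Rightarrow> real \<Rightarrow> real" where "bump k s r = hat ((r - s) / k) / k"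

lemma bump_average:
  assumes k: "0 < k" and s: "0 < s" "s + k < 1"
    and F: "continuous_on {0..1} F" and e: "\<And>r. r \<in> {s..s + k} \<Longrightarrow> \<bar>F r - F s\<bar> \<le> e"
  shows "set_integrable lborel {0..1} (\<lambda>r. bump k s r * F r)"
    "\<bar>(LINT r:{0..1}|lborel. bump k s r * F r) - F s\<bar> \<le> e"
proof -
  have bc: "continuous_on UNIV (bump k s)" unfolding bump_def[abs_def] divide_inverse
    by (intro continuous_intros continuous_on_compose2[OF hat_props(3)]) auto
  then have bc': "continuous_on {0..1} (bump k s)" by (rule continuous_on_subset) simp
  have b0: "0 \<le> bump k s r" for r using k hat_props(1) by (simp add: bump_def)
  have supp: "bump k s r = 0" if "r \<notin> {s..s + k}" for r
    using that k hat_props(2)[of "(r - s) / k"] by (auto simp: bump_def field_simps)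
  have "(LINT r:{0..1}|lborel. bump k s r) = step ((1 - s) / k) - step ((0 - s) / k)"
    unfolding set_lebesgue_integral_def
  proof (rule integral_FTC_Icc)
    fix x :: real
    have "((\<lambda>r. step ((r - s) / k)) has_real_derivative hat ((x - s) / k) * (1 / k)) (at x)"
      using k by (intro DERIV_chain2[OF step_deriv]) (auto intro!: derivative_eq_intros)
    then show "((\<lambda>r. step ((r - s) / k)) has_vector_derivative bump k s x) (at x within {0..1})"
      unfolding has_real_derivative_iff_has_vector_derivative bump_def
      by (auto intro: has_vector_derivative_at_within)
  qed (use bc' in auto)
  also have "\<dots> = 1" using k s by (simp add: hat_props(4,5))
  finally have one: "(LINT r:{0..1}|lborel. bump k s r) = 1" .
  have ib: "set_integrable lborel {0..1} (bump k s)" by (rule borel_integrable_atLeastAtMost'[OF bc'])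
  show ibF: "set_integrable lborel {0..1} (\<lambda>r. bump k s r * F r)"
    by (intro borel_integrable_atLeastAtMost' continuous_on_mult bc' F)
  have "(LINT r:{0..1}|lborel. bump k s r * F r) - F s = (LINT r:{0..1}|lborel. bump k s r * F r) - (LINT r:{0..1}|lborel. bump k s r) * F s"
    by (simp add: one)
  also have "\<dots> = (LINT r:{0..1}|lborel. bump k s r * F r - bump k s r * F s)"
    using ib ibF by (subst set_integral_diff(2)) auto
  finally have "\<bar>(LINT r:{0..1}|lborel. bump k s r * F r) - F s\<bar> \<le> (LINT r:{0..1}|lborel. norm (bump k s r * F r - bump k s r * F s))"
    using set_integral_norm_bound[OF set_integral_diff(1)[OF ibF set_integrable_mult_left[OF ib, of "F s"]]] by simp
  also have "\<dots> \<le> (LINT r:{0..1}|lborel. bump k s r * e)"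
  proof (rule set_integral_mono)
    show "set_integrable lborel {0..1} (\<lambda>r. norm (bump k s r * F r - bump k s r * F s))"
      by (intro set_integrable_norm set_integral_diff(1) ibF set_integrable_mult_left ib)
    show "norm (bump k s r * F r - bump k s r * F s) \<le> bump k s r * e" for r
      using e[of r] supp[of r] b0[of r]
      by (cases "r \<in> {s..s + k}") (auto simp: right_diff_distrib[symmetric] abs_mult intro!: mult_left_mono)
  qed (use ib in auto)
  also have "\<dots> = e" by (simp add: one)
  finally show "\<bar>(LINT r:{0..1}|lborel. bump k s r * F r) - F s\<bar> \<le> e" .
qed

text \<open>Tested with a C1 function that rises just after s and falls just after t: its derivative
  is a difference of two averaging kernels, so the first integral is close to F s - F t. Test
  functions must vanish near 0 and 1, hence the end points are reached by continuity of F.\<close>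

lemma weak_increment:
  fixes F G :: "real \<Rightarrow> real"
  assumes F: "continuous_on {0..1} F" and G: "(\<lambda>r. if r \<in> {0..1} then G r else 0) \<in> borel_measurable borel"
    and eq: "\<And>s t \<eta> \<eta>'. 0 < s \<Longrightarrow> t < 1 \<Longrightarrow> (\<And>r. (\<eta> has_real_derivative \<eta>' r) (at r)) \<Longrightarrow> continuous_on UNIV \<eta>' \<Longrightarrow>
      (\<And>r. r \<notin> {s..t} \<Longrightarrow> \<eta> r = 0) \<Longrightarrow>
      (LINT r:{0..1}|lborel. \<eta>' r * F r) + (LINT r:{0..1}|lborel. \<eta> r * G r) = 0"
    and bd: "\<And>s t. 0 < s \<Longrightarrow> s \<le> t \<Longrightarrow> t < 1 \<Longrightarrow> (\<integral>\<^sup>+r\<in>{s..t}. ennreal \<bar>G r\<bar> \<partial>lborel) \<le> ennreal (c + d * (t - s))"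
    and cd: "0 \<le> c" "0 \<le> d" and st: "0 \<le> s" "s \<le> t" "t \<le> 1"
  shows "\<bar>F t - F s\<bar> \<le> c + d * (t - s)"
proof -
  have inner: "\<bar>F t - F s\<bar> \<le> c + d * (t - s)" if st: "0 < s" "s \<le> t" "t < 1" for s t
  proof (rule field_le_epsilon)
    fix e :: real assume e: "0 < e"
    define e' where "e' = e / 3"
    have e': "0 < e'" using e by (simp add: e'_def)
    have "uniformly_continuous_on {0..1} F" using F by (rule compact_uniformly_continuous) simp
    then obtain m where m: "m > 0" "\<And>x y. x \<in> {0..1} \<Longrightarrow> y \<in> {0..1} \<Longrightarrow> \<bar>x - y\<bar> < m \<Longrightarrow> \<bar>F x - F y\<bar> < e'"
      unfolding uniformly_continuous_on_def dist_real_def using e' by metis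
    \<comment> \<open>Short enough for F to vary by at most e' on both transition intervals, for the
      support of \<eta> to stay inside (0, 1), and for \<open>d * k \<le> e'\<close>; the three
      errors e' add up to e.\<close>
    define k where "k = min (min (m / 2) ((1 - t) / 2)) (e' / (d + 1))"
    have k: "0 < k" "k < m" "t + k < 1" "d * k \<le> e'"
    proof -
      show "0 < k" "k < m" using m st e' cd by (auto simp: k_def)
      have "k \<le> (1 - t) / 2" unfolding k_def by linarith
      then have "2 * k \<le> 1 - t" by simp
      then show "t + k < 1" using st by argo
      have "k \<le> e' / (d + 1)" unfolding k_def by linarith
      then have "k * (d + 1) \<le> e'" using cd by (simp add: pos_le_divide_eq)
      then show "d * k \<le> e'" using \<open>0 < k\<close> by (simp add: algebra_simps)
    qed
    define \<eta> where "\<eta> r = step ((r - s) / k) - step ((r - t) / k)" for r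
    define \<eta>' where "\<eta>' r = bump k s r - bump k t r" for r
    have bs: "\<bar>F r - F s\<bar> \<le> e'" if "r \<in> {s..s + k}" for r using m(2)[of r s] that st k by auto
    have bt: "\<bar>F r - F t\<bar> \<le> e'" if "r \<in> {t..t + k}" for r using m(2)[of r t] that st k by auto
    have sk: "s + k < 1" using st k by linarith
    note As = bump_average[OF k(1) st(1) sk F bs]
    have t0: "0 < t" using st by linarith
    note At = bump_average[OF k(1) t0 k(3) F bt]
    have \<eta>1: "\<bar>\<eta> r\<bar> \<le> indicator {s..t + k} r" for r
    proof (cases "r \<in> {s..t + k}")
      case True
      then show ?thesis using step_bounds[of "(r - s) / k"] step_bounds[of "(r - t) / k"] by (simp add: \<eta>_def abs_le_iff)
    next
      case False
      then consider "r < s" | "t + k < r" by force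
      then have "\<eta> r = 0"
        using k st by cases (auto simp: \<eta>_def hat_props(4,5) divide_le_0_iff le_divide_eq)
      then show ?thesis by simp
    qed
    have "(LINT r:{0..1}|lborel. \<eta>' r * F r) + (LINT r:{0..1}|lborel. \<eta> r * G r) = 0"
    proof (rule eq[of s "t + k"])
      have "((\<lambda>r. step ((r - x) / k)) has_real_derivative bump k x r) (at r)" for r x
      proof -
        have "((\<lambda>r. step ((r - x) / k)) has_real_derivative hat ((r - x) / k) * (1 / k)) (at r)"
          using k by (intro DERIV_chain2[OF step_deriv]) (auto intro!: derivative_eq_intros)
        then show ?thesis by (simp add: bump_def)
      qed
      then show "(\<eta> has_real_derivative \<eta>' r) (at r)" for r
        unfolding \<eta>_def[abs_def] \<eta>'_def by (intro DERIV_diff)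
      show "continuous_on UNIV \<eta>'" unfolding \<eta>'_def[abs_def] bump_def divide_inverse
        by (intro continuous_intros continuous_on_compose2[OF hat_props(3)]) auto
      show "\<eta> r = 0" if "r \<notin> {s..t + k}" for r using \<eta>1[of r] that by simp
    qed (use st k in auto)
    moreover have "(LINT r:{0..1}|lborel. \<eta>' r * F r) = (LINT r:{0..1}|lborel. bump k s r * F r) - (LINT r:{0..1}|lborel. bump k t r * F r)"
      unfolding \<eta>'_def left_diff_distrib using As(1) At(1) by (intro set_integral_diff(2))
    moreover have "\<bar>LINT r:{0..1}|lborel. \<eta> r * G r\<bar> \<le> c + d * (t + k - s)"
    proof -
      have G': "(\<lambda>r. indicator {0..1} r *\<^sub>R (\<eta> r * G r)) \<in> borel_measurable borel"
      proof -
        have "continuous_on UNIV step" using step_deriv DERIV_isCont continuous_at_imp_continuous_on by blast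
        then have [measurable]: "step \<in> borel_measurable borel" by (rule borel_measurable_continuous_onI)
        have "\<eta> \<in> borel_measurable borel" unfolding \<eta>_def[abs_def] by measurable
        then have "(\<lambda>r. \<eta> r * (if r \<in> {0..1} then G r else 0)) \<in> borel_measurable borel"
          using G by (rule borel_measurable_times)
        then show ?thesis by (rule measurable_cong[THEN iffD1, rotated]) (auto simp: indicator_def)
      qed
      have "(\<integral>\<^sup>+r. ennreal (norm (indicator {0..1} r *\<^sub>R (\<eta> r * G r))) \<partial>lborel) \<le> (\<integral>\<^sup>+r\<in>{s..t + k}. ennreal \<bar>G r\<bar> \<partial>lborel)"
      proof (rule nn_integral_mono)
        fix r :: real
        have "norm (indicator {0..1} r *\<^sub>R (\<eta> r * G r)) \<le> \<bar>\<eta> r\<bar> * \<bar>G r\<bar>" by (auto simp: indicator_def abs_mult)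
        also have "\<dots> \<le> indicator {s..t + k} r * \<bar>G r\<bar>" by (intro mult_right_mono \<eta>1) auto
        finally show "ennreal (norm (indicator {0..1} r *\<^sub>R (\<eta> r * G r))) \<le> ennreal \<bar>G r\<bar> * indicator {s..t + k} r"
          by (cases "r \<in> {s..t + k}") (auto intro: ennreal_leI)
      qed
      also have "\<dots> \<le> ennreal (c + d * (t + k - s))" using st k by (intro bd) auto
      finally have n: "(\<integral>\<^sup>+r. ennreal (norm (indicator {0..1} r *\<^sub>R (\<eta> r * G r))) \<partial>lborel) \<le> ennreal (c + d * (t + k - s))" .
      then have "integrable lborel (\<lambda>r. indicator {0..1} r *\<^sub>R (\<eta> r * G r))"
        using G' by (intro integrableI_bounded) (auto intro: le_less_trans)
      from integral_norm_bound_ennreal[OF this] n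
      have "ennreal \<bar>LINT r:{0..1}|lborel. \<eta> r * G r\<bar> \<le> ennreal (c + d * (t + k - s))"
        unfolding set_lebesgue_integral_def by simp
      then show ?thesis using cd st k by (subst (asm) ennreal_le_iff) auto
    qed
    ultimately have "\<bar>F t - F s\<bar> \<le> c + d * (t + k - s) + 2 * e'" using As(2) At(2) by linarith
    then show "\<bar>F t - F s\<bar> \<le> c + d * (t - s) + e" using k(4) by (simp add: e'_def algebra_simps)
  qed
  show ?thesis
  proof (cases "s = t")
    case False
    \<comment> \<open>The 3 guarantees \<open>S n \<le> T n\<close>: each end moves inwards by at
      most a third of t - s.\<close>
    define S where "S n = s + (t - s) / (real n + 3)" for n :: nat
    define T where "T n = t - (t - s) / (real n + 3)" for n :: nat
    have z: "(\<lambda>n. (t - s) / (real n + 3)) \<longlonglongrightarrow> 0" by real_asymp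
    have ST: "0 < S n" "S n \<le> T n" "T n < 1" "S n \<in> {0..1}" "T n \<in> {0..1}" "T n - S n \<le> t - s" for n
    proof -
      have p: "0 < (t - s) / (real n + 3)" using False st by simp
      have "(t - s) / (real n + 3) \<le> (t - s) / 3" using False st by (intro divide_left_mono) auto
      then show "0 < S n" "S n \<le> T n" "T n < 1" "S n \<in> {0..1}" "T n \<in> {0..1}" "T n - S n \<le> t - s"
        using p st False unfolding S_def T_def atLeastAtMost_iff by argo+
    qed
    have lim: "S \<longlonglongrightarrow> s" "T \<longlonglongrightarrow> t"
      unfolding S_def T_def using tendsto_add[OF tendsto_const[of s] z] tendsto_diff[OF tendsto_const[of t] z] by simp_all
    have "(\<lambda>n. F (S n)) \<longlonglongrightarrow> F s" "(\<lambda>n. F (T n)) \<longlonglongrightarrow> F t"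
      using F st lim ST(4,5) unfolding continuous_on_sequentially o_def by auto
    then have "(\<lambda>n. \<bar>F (T n) - F (S n)\<bar>) \<longlonglongrightarrow> \<bar>F t - F s\<bar>" by (intro tendsto_intros)
    moreover have "\<bar>F (T n) - F (S n)\<bar> \<le> c + d * (t - s)" for n
      using inner[OF ST(1-3)] mult_left_mono[OF ST(6) cd(2), of n] by (meson add_left_mono order.trans)
    ultimately show ?thesis by (meson LIMSEQ_le_const2)
  qed (use cd in simp)
qed

section \<open>Curves of finite action\<close>

text \<open>Only an upper bound A of the action is carried, so that one A can serve all curves of a
  sequence.\<close>

locale action_curve =
  fixes p a b A :: real and \<phi> :: "real \<times> 'a::euclidean_space \<Rightarrow> ennreal" and \<gamma> :: "'a measure"
    and \<mu> :: "real \<Rightarrow> 'a set \<Rightarrow> real" and \<nu> :: "real \<Rightarrow> 'a set \<Rightarrow> 'a"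
  assumes adm: "\<phi> \<in> admissible_on p a b" and p: "1 < p" and ab: "a < b" and \<gamma>: "pos_radon \<gamma>"
    and CE: "(\<mu>, \<nu>) \<in> CE 1" and A0: "0 \<le> A"
    and fin: "(\<integral>\<^sup>+t\<in>{0..1}. action \<phi> (\<mu> t) (\<nu> t) \<gamma> \<partial>lborel) \<le> ennreal A"
begin

abbreviation "\<Lambda> t \<equiv> pairing (\<mu> t) (\<nu> t)"
abbreviation "\<Phi> t \<equiv> action \<phi> (\<mu> t) (\<nu> t) \<gamma>"

lemmas rad\<mu> = CE_D(1)[OF CE] and rad\<nu> = CE_D(2)[OF CE] and cont\<mu> = CE_D(3)[OF CE]

lemma density_at:
  assumes "t \<in> {0..1}" "\<Phi> t < \<infinity>"
  obtains \<rho> w where "locally_integrable \<gamma> \<rho>" "locally_integrable \<gamma> w" "\<mu> t = radon_density \<gamma> \<rho>"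
    "\<nu> t = radon_density \<gamma> w" "(\<integral>\<^sup>+x. \<phi> (\<rho> x, w x) \<partial>\<gamma>) \<le> \<Phi> t"
    "\<forall>F. bbs F \<longrightarrow> \<Lambda> t F = (\<integral>x. F x \<bullet> (\<rho> x, w x) \<partial>\<gamma>)"
proof -
  obtain \<rho> w where d: "locally_integrable \<gamma> \<rho>" "locally_integrable \<gamma> w" "\<mu> t = radon_density \<gamma> \<rho>"
    "\<nu> t = radon_density \<gamma> w" "(\<integral>\<^sup>+x. \<phi> (\<rho> x, w x) \<partial>\<gamma>) \<le> \<Phi> t"
    using finite_action_density[OF adm p ab \<gamma> rad\<mu> rad\<nu> assms(2)] assms(1) by blast
  show ?thesis using that[OF d] pairing_density[OF \<gamma> d(1,2)] d(3,4) by simp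
qed

text \<open>The action need not be measurable in time. All estimates are therefore stated for a measurable
  function that is bounded by the action where the latter is finite, and bounds of continuous
  functions are extended from the dense set of times of finite action.\<close>

lemma time_bound_affine:
  assumes c: "0 < c" "0 \<le> d" and q: "(\<lambda>t. if t \<in> {0..1} then q t else 0) \<in> borel_measurable borel"
    and le: "\<And>t. t \<in> {0..1} \<Longrightarrow> \<Phi> t < \<infinity> \<Longrightarrow> ennreal \<bar>q t\<bar> \<le> ennreal c * \<Phi> t + ennreal d"
    and st: "0 \<le> s" "s \<le> t" "t \<le> 1"
  shows "(\<integral>\<^sup>+r\<in>{s..t}. ennreal \<bar>q r\<bar> \<partial>lborel) \<le> ennreal (c * A + d * (t - s))"
proof -
  \<comment> \<open>The hypothesis \<open>le\<close> solved for the action: this quotient is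
    measurable and lies below the action at every time in [0, 1].\<close>
  define q' where "q' r = (max 0 (\<bar>if r \<in> {0..1} then q r else 0\<bar> - d)) / c" for r
  have [measurable]: "q' \<in> borel_measurable borel" unfolding q'_def using q by measurable
  have q'0: "0 \<le> q' r" for r using c by (simp add: q'_def)
  have le': "ennreal (q' r) \<le> \<Phi> r" if r: "r \<in> {0..1}" for r
  proof (cases "\<Phi> r < \<infinity>")
    case True
    then obtain y where y: "\<Phi> r = ennreal y" "0 \<le> y" by (cases "\<Phi> r") auto
    have "ennreal \<bar>q r\<bar> \<le> ennreal (c * y + d)" using le[OF r True] y c by (simp add: ennreal_mult ennreal_plus)
    then have "\<bar>q r\<bar> \<le> c * y + d" by (rule iffD1[OF ennreal_le_iff, rotated]) (use y c in simp)
    then have "max 0 (\<bar>q r\<bar> - d) \<le> y * c" using y c by (simp add: mult.commute)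
    then show ?thesis using r y c by (auto simp: q'_def pos_divide_le_eq intro!: ennreal_leI)
  qed (simp add: less_top[symmetric])
  have "(\<integral>\<^sup>+r\<in>{s..t}. ennreal \<bar>q r\<bar> \<partial>lborel) \<le> (\<integral>\<^sup>+r. ennreal d * indicator {s..t} r + ennreal c * (ennreal (q' r) * indicator {0..1} r) \<partial>lborel)"
  proof (rule nn_integral_mono)
    fix r
    have "\<bar>q r\<bar> \<le> d + c * q' r" if "r \<in> {s..t}" using that st c by (simp add: q'_def)
    then show "ennreal \<bar>q r\<bar> * indicator {s..t} r \<le> ennreal d * indicator {s..t} r + ennreal c * (ennreal (q' r) * indicator {0..1} r)"
      using st c q'0[of r] by (cases "r \<in> {s..t}") (auto simp: ennreal_mult[symmetric] ennreal_plus[symmetric] simp del: ennreal_plus intro!: ennreal_leI)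
  qed
  also have "\<dots> = ennreal d * ennreal (t - s) + ennreal c * (\<integral>\<^sup>+r\<in>{0..1}. ennreal (q' r) \<partial>lborel)"
    using st by (simp add: nn_integral_add nn_integral_cmult)
  also have "(\<integral>\<^sup>+r\<in>{0..1}. ennreal (q' r) \<partial>lborel) \<le> (\<integral>\<^sup>+t\<in>{0..1}. \<Phi> t \<partial>lborel)"
    by (intro nn_integral_mono) (auto simp: indicator_def le')
  also have "\<dots> \<le> ennreal A" by (rule fin)
  finally have "(\<integral>\<^sup>+r\<in>{s..t}. ennreal \<bar>q r\<bar> \<partial>lborel) \<le> ennreal d * ennreal (t - s) + ennreal c * ennreal A"
    by (simp add: mult_left_mono)
  also have "\<dots> = ennreal (c * A + d * (t - s))"
    using st c A0 by (simp add: ennreal_mult[symmetric] ennreal_plus[symmetric] add.commute del: ennreal_plus)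
  finally show ?thesis .
qed

text \<open>Times of infinite action cannot fill an interval, since the action integral would then
  be infinite, whereas a continuous function exceeding c at t exceeds it on a whole
  interval.\<close>

lemma dense_le:
  assumes q: "continuous_on {0..1} q" and le: "\<And>t. t \<in> {0..1} \<Longrightarrow> \<Phi> t < \<infinity> \<Longrightarrow> q t \<le> (c::real)"
    and t: "t \<in> {0..1}"
  shows "q t \<le> c"
proof (rule ccontr)
  assume "\<not> q t \<le> c"
  then have e: "0 < q t - c" by simp
  obtain d where d: "d > 0" "\<And>s. s \<in> {0..1} \<Longrightarrow> \<bar>s - t\<bar> < d \<Longrightarrow> \<bar>q s - q t\<bar> < q t - c"
    using q[unfolded continuous_on_iff dist_real_def, rule_format, OF t e] by auto
  define l where "l = max 0 (t - d / 2)"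
  define u where "u = min 1 (t + d / 2)"
  have lu: "l < u" "{l..u} \<subseteq> {0..1}" "\<And>s. s \<in> {l..u} \<Longrightarrow> \<bar>s - t\<bar> < d"
    using t d(1) by (auto simp: l_def u_def max_def min_def abs_less_iff split: if_splits)
  have "\<Phi> s = \<infinity>" if "s \<in> {l..u}" for s
  proof (rule ccontr)
    have s: "s \<in> {0..1}" using lu(2) that by blast
    assume "\<Phi> s \<noteq> \<infinity>"
    then have "q s \<le> c" using le[OF s] by (simp add: less_top)
    then show False using d(2)[OF s lu(3)[OF that]] by linarith
  qed
  then have "(\<integral>\<^sup>+s. \<infinity> * indicator {l..u} s \<partial>lborel) \<le> (\<integral>\<^sup>+t\<in>{0..1}. \<Phi> t \<partial>lborel)"
    using lu(2) by (intro nn_integral_mono) (auto simp: indicator_def)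
  then have "(\<infinity>::ennreal) * ennreal (u - l) \<le> ennreal A"
    using fin lu(1) by (simp add: nn_integral_cmult)
  then show False using lu(1) by (simp add: ennreal_top_mult top_unique)
qed

definition "C\<rho> = max \<bar>a\<bar> \<bar>b\<bar>"

lemma density_bounded:
  assumes "(\<integral>\<^sup>+x. \<phi> (\<rho> x, w x) \<partial>\<gamma>) < \<infinity>" "locally_integrable \<gamma> \<rho>" "locally_integrable \<gamma> w"
  shows "AE x in \<gamma>. \<bar>\<rho> x\<bar> \<le> C\<rho>"
proof -
  note [measurable_cong] = pos_radonD(1)[OF \<gamma>]
  have [measurable]: "\<rho> \<in> borel_measurable borel" "w \<in> borel_measurable borel"
    using assms by (auto simp: locally_integrable_def)
  note [measurable] = lsc_borel_measurable[OF admissible_onD(1)[OF adm]]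
  have "AE x in \<gamma>. \<phi> (\<rho> x, w x) \<noteq> \<infinity>"
    using assms(1) by (intro nn_integral_PInf_AE) auto
  then show ?thesis
  proof eventually_elim
    fix x assume "\<phi> (\<rho> x, w x) \<noteq> \<infinity>"
    then have "(\<rho> x, w x) \<in> eff_dom \<phi>" by (simp add: eff_dom_def less_top)
    then have "a \<le> \<rho> x" "\<rho> x \<le> b" using eff_dom_subset[OF adm p ab] by auto
    then show "\<bar>\<rho> x\<bar> \<le> C\<rho>" by (auto simp: C\<rho>_def)
  qed
qed

text \<open>At times of finite action the density takes values in the strip; continuity carries the
  bound to all other times, where \<mu> may have no known density.\<close>

lemma \<mu>_bound:
  assumes f: "cc f" and t: "t \<in> {0..1}"
  shows "\<bar>signed_integral (\<mu> t) f\<bar> \<le> C\<rho> * (\<integral>x. \<bar>f x\<bar> \<partial>\<gamma>)"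
proof (rule dense_le[OF _ _ t])
  show "continuous_on {0..1} (\<lambda>t. \<bar>signed_integral (\<mu> t) f\<bar>)" by (intro continuous_intros cont\<mu> f)
  fix t :: real assume t: "t \<in> {0..1}" "\<Phi> t < \<infinity>"
  obtain \<rho> w where d: "locally_integrable \<gamma> \<rho>" "locally_integrable \<gamma> w" "\<mu> t = radon_density \<gamma> \<rho>"
    "(\<integral>\<^sup>+x. \<phi> (\<rho> x, w x) \<partial>\<gamma>) \<le> \<Phi> t" using density_at[OF t] by metis
  have ae: "AE x in \<gamma>. \<bar>\<rho> x\<bar> \<le> C\<rho>"
    by (rule density_bounded[OF le_less_trans[OF d(4) t(2)] d(1,2)])
  have "\<bar>signed_integral (\<mu> t) f\<bar> \<le> (\<integral>x. \<bar>f x * \<rho> x\<bar> \<partial>\<gamma>)"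
    unfolding d(3) signed_integral_density[OF \<gamma> d(1) cc_bbs[OF f]] by (rule integral_abs_bound)
  also have "\<dots> \<le> (\<integral>x. C\<rho> * \<bar>f x\<bar> \<partial>\<gamma>)"
  proof (rule integral_mono_AE)
    show "integrable \<gamma> (\<lambda>x. \<bar>f x * \<rho> x\<bar>)" using integrable_bbs_scaleR[OF \<gamma> d(1) cc_bbs[OF f]] by auto
    show "integrable \<gamma> (\<lambda>x. C\<rho> * \<bar>f x\<bar>)" using integrable_bbs[OF \<gamma> cc_bbs[OF f]] by auto
    show "AE x in \<gamma>. \<bar>f x * \<rho> x\<bar> \<le> C\<rho> * \<bar>f x\<bar>"
      using ae by eventually_elim (simp add: abs_mult mult.commute[of C\<rho>] mult_left_mono)
  qed
  finally show "\<bar>signed_integral (\<mu> t) f\<bar> \<le> C\<rho> * (\<integral>x. \<bar>f x\<bar> \<partial>\<gamma>)" by simp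
qed

text \<open>The weight h allows one estimate for two uses: indicators of balls, and the part of the
  partition over uncharged cells, where the small mass compensates a large K.\<close>

lemma weighted_norm_bound:
  fixes u :: "'a \<Rightarrow> real \<times> 'a"
  assumes u: "locally_integrable \<gamma> u" and h: "bbs h" "\<And>x. 0 \<le> h x" "\<And>x. h x \<le> (1::real)"
    and e: "0 \<le> e" and K: "0 \<le> K" "\<And>z. ennreal (norm z) \<le> ennreal e * \<phi> z + ennreal K"
  shows "ennreal (\<integral>x. h x * norm (u x) \<partial>\<gamma>) \<le> ennreal e * (\<integral>\<^sup>+x. \<phi> (u x) \<partial>\<gamma>) + ennreal (K * (\<integral>x. h x \<partial>\<gamma>))"
proof -
  note [measurable_cong] = pos_radonD(1)[OF \<gamma>]
  have [measurable]: "u \<in> borel_measurable borel" "h \<in> borel_measurable borel"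
    using u h by (auto simp: locally_integrable_def bbs_def)
  note [measurable] = lsc_borel_measurable[OF admissible_onD(1)[OF adm]]
  have "integrable \<gamma> (\<lambda>x. h x * norm (u x))"
    using integrable_norm[OF integrable_bbs_scaleR[OF \<gamma> u h(1)]] h(2) by simp
  then have "ennreal (\<integral>x. h x * norm (u x) \<partial>\<gamma>) = (\<integral>\<^sup>+x. ennreal (h x * norm (u x)) \<partial>\<gamma>)"
    using h(2) by (intro nn_integral_eq_integral[symmetric]) auto
  also have "\<dots> \<le> (\<integral>\<^sup>+x. ennreal e * \<phi> (u x) + ennreal K * ennreal (h x) \<partial>\<gamma>)"
  proof (rule nn_integral_mono)
    fix x
    have "ennreal (h x * norm (u x)) = ennreal (h x) * ennreal (norm (u x))" using h(2) by (simp add: ennreal_mult)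
    also have "\<dots> \<le> ennreal (h x) * (ennreal e * \<phi> (u x) + ennreal K)" by (intro mult_left_mono K) simp
    also have "\<dots> = ennreal (h x) * (ennreal e * \<phi> (u x)) + ennreal K * ennreal (h x)" by (simp add: distrib_left mult.commute)
    also have "ennreal (h x) * (ennreal e * \<phi> (u x)) \<le> ennreal 1 * (ennreal e * \<phi> (u x))"
      using h(3) by (intro mult_right_mono ennreal_leI) auto
    finally show "ennreal (h x * norm (u x)) \<le> ennreal e * \<phi> (u x) + ennreal K * ennreal (h x)" by (simp add: add_right_mono)
  qed
  also have "\<dots> = ennreal e * (\<integral>\<^sup>+x. \<phi> (u x) \<partial>\<gamma>) + ennreal K * (\<integral>\<^sup>+x. ennreal (h x) \<partial>\<gamma>)"
    by (simp add: nn_integral_add nn_integral_cmult)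
  also have "(\<integral>\<^sup>+x. ennreal (h x) \<partial>\<gamma>) = ennreal (\<integral>x. h x \<partial>\<gamma>)"
    using h(2) by (intro nn_integral_eq_integral integrable_bbs[OF \<gamma> h(1)]) auto
  finally show ?thesis using K(1) h(2) by (simp add: ennreal_mult)
qed

text \<open>Superlinear growth splits the flux through the gradient g into a part
  \<open>M * e * A\<close> independent of the time step and a part proportional to it. Choosing e
  first yields a modulus of continuity that depends only on A, M, K and the mass of a ball, hence
  uniform along a sequence.\<close>

lemma increment:
  assumes f: "cc f" and df: "\<And>x. (f has_derivative (\<lambda>y. g x \<bullet> y)) (at x)" and g: "continuous_on UNIV g"
    and supp: "\<And>x. R < norm x \<Longrightarrow> f x = 0" "\<And>x. R < norm x \<Longrightarrow> g x = 0" and M: "0 < M" "\<And>x. norm (g x) \<le> M"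
    and e: "0 < e" and K: "0 \<le> K" "\<And>z. ennreal (norm z) \<le> ennreal e * \<phi> z + ennreal K"
    and st: "0 \<le> s" "s \<le> t" "t \<le> 1"
  shows "\<bar>signed_integral (\<mu> t) f - signed_integral (\<mu> s) f\<bar>
    \<le> M * e * A + M * K * measure \<gamma> (cball 0 R) * (t - s)"
proof -
  define G where "G r = \<Lambda> r (\<lambda>x. (0, g x))" for r
  have ccg: "cc g" using g supp by (auto simp: cc_def)
  have ccF: "cc (\<lambda>x. (0::real, g x))"
  proof -
    have "continuous_on UNIV (\<lambda>x. (0::real, g x))" by (rule continuous_on_Pair[OF continuous_on_const g])
    moreover have "\<forall>x. R < norm x \<longrightarrow> (0::real, g x) = 0" using supp(2) by (simp add: zero_prod_def)
    ultimately show ?thesis unfolding cc_def by blast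
  qed
  have Gv: "G r = vector_integral (\<nu> r) g" for r by (simp add: G_def pairing_def signed_integral_def)
  have Gm: "(\<lambda>r. if r \<in> {0..1} then G r else 0) \<in> borel_measurable borel"
    unfolding G_def by (rule CE_pairing_measurable_const[OF CE ccF])
  have Gle: "ennreal \<bar>G r\<bar> \<le> ennreal (M * e) * \<Phi> r + ennreal (M * K * measure \<gamma> (cball 0 R))"
    if r: "r \<in> {0..1}" "\<Phi> r < \<infinity>" for r
  proof -
    obtain \<rho> w where d: "locally_integrable \<gamma> \<rho>" "locally_integrable \<gamma> w" "\<mu> r = radon_density \<gamma> \<rho>"
      "\<nu> r = radon_density \<gamma> w" "(\<integral>\<^sup>+x. \<phi> (\<rho> x, w x) \<partial>\<gamma>) \<le> \<Phi> r"
      "\<forall>F. bbs F \<longrightarrow> \<Lambda> r F = (\<integral>x. F x \<bullet> (\<rho> x, w x) \<partial>\<gamma>)"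
      by (rule density_at[OF r])
    have u: "locally_integrable \<gamma> (\<lambda>x. (\<rho> x, w x))" by (rule locally_integrable_Pair[OF \<gamma> d(1,2)])
    let ?I = "\<integral>x. indicator (cball 0 R) x * norm (\<rho> x, w x) \<partial>\<gamma>"
    have I: "ennreal ?I \<le> ennreal e * (\<integral>\<^sup>+x. \<phi> (\<rho> x, w x) \<partial>\<gamma>) + ennreal (K * (\<integral>x. indicator (cball 0 R) x \<partial>\<gamma>))"
      using e K by (intro weighted_norm_bound[OF u bbs_indicator]) (auto simp: indicator_def)
    have "\<bar>G r\<bar> \<le> (\<integral>x. \<bar>(0, g x) \<bullet> (\<rho> x, w x)\<bar> \<partial>\<gamma>)"
      unfolding G_def d(6)[rule_format, OF cc_bbs[OF ccF]] by (rule integral_abs_bound)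
    also have "\<dots> \<le> (\<integral>x. M * (indicator (cball 0 R) x * norm (\<rho> x, w x)) \<partial>\<gamma>)"
    proof (rule integral_mono)
      show "integrable \<gamma> (\<lambda>x. \<bar>(0, g x) \<bullet> (\<rho> x, w x)\<bar>)"
        by (intro integrable_abs integrable_bbs_inner[OF \<gamma> u cc_bbs[OF ccF]])
      show "integrable \<gamma> (\<lambda>x. M * (indicator (cball 0 R) x * norm (\<rho> x, w x)))"
        using integrable_norm[OF integrable_bbs_scaleR[OF \<gamma> u bbs_indicator[of "cball 0 R"]]]
        unfolding norm_scaleR by (intro integrable_mult_right) simp
      fix x
      have "\<bar>(0, g x) \<bullet> (\<rho> x, w x)\<bar> \<le> norm (0::real, g x) * norm (\<rho> x, w x)" by (rule Cauchy_Schwarz_ineq2)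
      also have "\<dots> \<le> M * indicator (cball 0 R) x * norm (\<rho> x, w x)"
        using M supp(2)[of x] by (intro mult_right_mono) (auto simp: norm_Pair indicator_def)
      finally show "\<bar>(0, g x) \<bullet> (\<rho> x, w x)\<bar> \<le> M * (indicator (cball 0 R) x * norm (\<rho> x, w x))" by (simp add: mult.assoc)
    qed
    finally have "\<bar>G r\<bar> \<le> M * ?I" by simp
    then have "ennreal \<bar>G r\<bar> \<le> ennreal M * ennreal ?I" using M by (simp add: ennreal_mult[symmetric] ennreal_leI)
    also have "\<dots> \<le> ennreal M * (ennreal e * \<Phi> r + ennreal (K * measure \<gamma> (cball 0 R)))"
    proof (rule mult_left_mono)
      show "ennreal ?I \<le> ennreal e * \<Phi> r + ennreal (K * measure \<gamma> (cball 0 R))"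
        using I d(5) by (simp add: pos_radonD(2)[OF \<gamma>]) (meson add_right_mono mult_left_mono order.trans zero_le)
    qed simp
    also have "\<dots> = ennreal (M * e) * \<Phi> r + ennreal (M * K * measure \<gamma> (cball 0 R))"
      using M e K by (simp add: distrib_left ennreal_mult mult.assoc)
    finally show ?thesis .
  qed
  show ?thesis
  proof (rule weak_increment[where G = G, OF cont\<mu>[OF f] Gm _ _ _ _ st])
    show "0 \<le> M * e * A" "0 \<le> M * K * measure \<gamma> (cball 0 R)" using M e K A0 by auto
    show "(\<integral>\<^sup>+r\<in>{s..t}. ennreal \<bar>G r\<bar> \<partial>lborel) \<le> ennreal (M * e * A + M * K * measure \<gamma> (cball 0 R) * (t - s))"
      if "0 < s" "s \<le> t" "t < 1" for s t
      using that M e K by (intro time_bound_affine[OF _ _ Gm Gle]) auto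
    fix s t :: real and \<eta> \<eta>' :: "real \<Rightarrow> real"
    assume st: "0 < s" "t < 1" and \<eta>: "\<And>r. (\<eta> has_real_derivative \<eta>' r) (at r)" "continuous_on UNIV \<eta>'"
      "\<And>r. r \<notin> {s..t} \<Longrightarrow> \<eta> r = 0"
    have c\<eta>: "continuous_on UNIV \<eta>" using \<eta>(1) DERIV_isCont continuous_at_imp_continuous_on by blast
    have cf: "continuous_on UNIV f" using f by (simp add: cc_def)
    \<comment> \<open>A test function with separated variables: its gradient pairs with \<nu> to
      give \<eta> G, its time derivative pairs with \<mu> to give \<eta>' F.\<close>
    have "C1c_test 1 (\<lambda>z. f (fst z) * \<eta> (snd z)) (\<lambda>z. \<eta> (snd z) *\<^sub>R g (fst z)) (\<lambda>z. f (fst z) * \<eta>' (snd z))"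
      unfolding C1c_test_def
    proof (intro conjI allI)
      fix z :: "'a \<times> real"
      have "((\<lambda>z. f (fst z)) has_derivative (\<lambda>y. g (fst z) \<bullet> fst y)) (at z)"
        by (rule has_derivative_compose[OF _ df, of fst]) (auto intro!: derivative_eq_intros)
      moreover have "((\<lambda>z. \<eta> (snd z)) has_derivative (\<lambda>y. \<eta>' (snd z) * snd y)) (at z)"
        using has_derivative_compose[OF bounded_linear_imp_has_derivative[OF bounded_linear_snd], of \<eta> "(*) (\<eta>' (snd z))" z UNIV] \<eta>(1)[of "snd z"]
        by (simp add: has_field_derivative_def)
      ultimately have "((\<lambda>z. f (fst z) * \<eta> (snd z)) has_derivative
          (\<lambda>y. f (fst z) * (\<eta>' (snd z) * snd y) + (g (fst z) \<bullet> fst y) * \<eta> (snd z))) (at z)"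
        by (rule has_derivative_mult)
      then show "((\<lambda>z. f (fst z) * \<eta> (snd z)) has_derivative
          (\<lambda>(y, s). (\<eta> (snd z) *\<^sub>R g (fst z)) \<bullet> y + f (fst z) * \<eta>' (snd z) * s)) (at z)"
        by (rule has_derivative_eq_rhs) (auto simp: fun_eq_iff algebra_simps)
      show "continuous_on UNIV (\<lambda>z::'a \<times> real. \<eta> (snd z) *\<^sub>R g (fst z))"
        by (intro continuous_intros continuous_on_compose2[OF c\<eta>] continuous_on_compose2[OF g]) auto
      show "continuous_on UNIV (\<lambda>z::'a \<times> real. f (fst z) * \<eta>' (snd z))"
        by (intro continuous_intros continuous_on_compose2[OF cf] continuous_on_compose2[OF \<eta>(2)]) auto
      have "{z. f (fst z) * \<eta> (snd z) \<noteq> 0} \<subseteq> cball 0 R \<times> {s..t}"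
        using supp(1) \<eta>(3) by force
      moreover have "closed (cball (0::'a) R \<times> {s..t})" by (intro closed_Times) auto
      ultimately have cl: "closure {z. f (fst z) * \<eta> (snd z) \<noteq> 0} \<subseteq> cball 0 R \<times> {s..t}" by (rule closure_minimal)
      moreover have "compact (cball (0::'a) R \<times> {s..t})" by (intro compact_Times) auto
      ultimately show "compact (closure {z. f (fst z) * \<eta> (snd z) \<noteq> 0})"
        using compact_Int_closed[of "cball (0::'a) R \<times> {s..t}" "closure {z. f (fst z) * \<eta> (snd z) \<noteq> 0}"]
        by (simp add: inf.absorb2)
      show "closure {z. f (fst z) * \<eta> (snd z) \<noteq> 0} \<subseteq> UNIV \<times> {0<..<1}" using cl st by auto
    qed
    from CE_D(5)[OF CE this]
    have "(LINT r:{0..1}|lborel. signed_integral (\<mu> r) (\<lambda>x. f x * \<eta>' r)) + (LINT r:{0..1}|lborel. vector_integral (\<nu> r) (\<lambda>x. \<eta> r *\<^sub>R g x)) = 0"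
      by simp
    moreover have "(LINT r:{0..1}|lborel. signed_integral (\<mu> r) (\<lambda>x. f x * \<eta>' r)) = (LINT r:{0..1}|lborel. \<eta>' r * signed_integral (\<mu> r) f)"
    proof (rule set_lebesgue_integral_cong)
      show "\<forall>r. r \<in> {0..1} \<longrightarrow> signed_integral (\<mu> r) (\<lambda>x. f x * \<eta>' r) = \<eta>' r * signed_integral (\<mu> r) f"
        using signed_integral_cmult[OF rad\<mu>] by (simp add: mult.commute)
    qed simp
    moreover have "(LINT r:{0..1}|lborel. vector_integral (\<nu> r) (\<lambda>x. \<eta> r *\<^sub>R g x)) = (LINT r:{0..1}|lborel. \<eta> r * G r)"
    proof (rule set_lebesgue_integral_cong)
      show "\<forall>r. r \<in> {0..1} \<longrightarrow> vector_integral (\<nu> r) (\<lambda>x. \<eta> r *\<^sub>R g x) = \<eta> r * G r"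
        using vector_integral_scaleR[OF rad\<mu> rad\<nu>] by (simp add: Gv)
    qed simp
    ultimately show "(LINT r:{0..1}|lborel. \<eta>' r * signed_integral (\<mu> r) f) + (LINT r:{0..1}|lborel. \<eta> r * G r) = 0" by simp
  qed
qed

end

section \<open>Smoothing a whole curve\<close>

lemma bump_cc:
  assumes \<theta>: "bump_family h R J \<theta>" and j: "j \<in> J"
  shows "cc (\<theta> j)"
proof -
  have "\<exists>R. \<forall>x. R < norm x \<longrightarrow> \<theta> j x = 0" using bump_bbs[OF \<theta> j] unfolding bbs_def by blast
  then show ?thesis unfolding cc_def using bump_familyD(2)[OF \<theta> j] by blast
qed

text \<open>\<open>\<gamma>\<close> is the reference measure of the curve and
  \<open>\<gamma>0\<close> the common measure to which it is transferred. \<open>J1\<close> collects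
  the cells whose masses under both are comparable; the remaining ones are null for
  \<open>\<gamma>0\<close>.\<close>

locale smoothed_curve = action_curve +
  fixes \<gamma>0 :: "'a::euclidean_space measure" and J J1 :: "'a set" and \<theta> :: "'a \<Rightarrow> 'a \<Rightarrow> real" and h R \<eta> r1 :: real
  assumes \<gamma>0: "pos_radon \<gamma>0" and \<theta>: "bump_family h R J \<theta>" and \<eta>: "0 \<le> \<eta>" "\<eta> \<le> 1" and r1: "a < r1" "r1 < b"
    and J1: "\<And>j. j \<in> J \<Longrightarrow> j \<notin> J1 \<Longrightarrow> (\<integral>x. \<theta> j x \<partial>\<gamma>0) = 0"
    and g: "\<And>j. j \<in> J \<Longrightarrow> j \<in> J1 \<Longrightarrow> 0 < (\<integral>x. \<theta> j x \<partial>\<gamma>)"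
      "\<And>j. j \<in> J \<Longrightarrow> j \<in> J1 \<Longrightarrow> \<bar>(\<integral>x. \<theta> j x \<partial>\<gamma>0) - (\<integral>x. \<theta> j x \<partial>\<gamma>)\<bar> \<le> \<eta> * (\<integral>x. \<theta> j x \<partial>\<gamma>)"
begin

text \<open>Cell means written through the measures themselves and not through densities. This makes
  them measurable in t without a measurable choice of densities; at times of finite action
  \<open>coef_density\<close> identifies them with the means of the densities.\<close>

definition "coef j t = (if j \<in> J1 \<and> t \<in> {0..1} then (1 / (\<integral>x. \<theta> j x \<partial>\<gamma>)) *\<^sub>R
    (signed_integral (\<mu> t) (\<theta> j), \<Sum>i\<in>Basis. signed_integral (\<lambda>A. \<nu> t A \<bullet> i) (\<theta> j) *\<^sub>R i) else (r1, 0))"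

definition "U x t = smoothing J \<theta> (r1, 0) (\<lambda>j. coef j t) x"

lemma \<theta>_cc: "j \<in> J \<Longrightarrow> cc (\<theta> j)"
  by (rule bump_cc[OF \<theta>])

lemma coef_density:
  assumes j: "j \<in> J" "j \<in> J1" and t: "t \<in> {0..1}" and l: "locally_integrable \<gamma> \<rho>" "locally_integrable \<gamma> w"
    and eq: "\<mu> t = radon_density \<gamma> \<rho>" "\<nu> t = radon_density \<gamma> w"
  shows "coef j t = (1 / (\<integral>x. \<theta> j x \<partial>\<gamma>)) *\<^sub>R (\<integral>x. \<theta> j x *\<^sub>R (\<rho> x, w x) \<partial>\<gamma>)"
proof -
  note b = bump_bbs[OF \<theta> j(1)]
  have u: "locally_integrable \<gamma> (\<lambda>x. (\<rho> x, w x))" by (rule locally_integrable_Pair[OF \<gamma> l])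
  have iu: "integrable \<gamma> (\<lambda>x. \<theta> j x *\<^sub>R (\<rho> x, w x))" by (rule integrable_bbs_scaleR[OF \<gamma> u b])
  have iw: "integrable \<gamma> (\<lambda>x. \<theta> j x *\<^sub>R w x)" by (rule integrable_bbs_scaleR[OF \<gamma> l(2) b])
  have "fst (\<integral>x. \<theta> j x *\<^sub>R (\<rho> x, w x) \<partial>\<gamma>) = (\<integral>x. fst (\<theta> j x *\<^sub>R (\<rho> x, w x)) \<partial>\<gamma>)"
    by (rule integral_bounded_linear[OF bounded_linear_fst iu, symmetric])
  then have 1: "fst (\<integral>x. \<theta> j x *\<^sub>R (\<rho> x, w x) \<partial>\<gamma>) = signed_integral (\<mu> t) (\<theta> j)"
    by (simp add: eq signed_integral_density[OF \<gamma> l(1) b])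
  have "snd (\<integral>x. \<theta> j x *\<^sub>R (\<rho> x, w x) \<partial>\<gamma>) = (\<integral>x. snd (\<theta> j x *\<^sub>R (\<rho> x, w x)) \<partial>\<gamma>)"
    by (rule integral_bounded_linear[OF bounded_linear_snd iu, symmetric])
  then have "snd (\<integral>x. \<theta> j x *\<^sub>R (\<rho> x, w x) \<partial>\<gamma>) = (\<integral>x. \<theta> j x *\<^sub>R w x \<partial>\<gamma>)" by simp
  also have "\<dots> = (\<Sum>i\<in>Basis. ((\<integral>x. \<theta> j x *\<^sub>R w x \<partial>\<gamma>) \<bullet> i) *\<^sub>R i)" by (rule euclidean_representation[symmetric])
  also have "\<dots> = (\<Sum>i\<in>Basis. signed_integral (\<lambda>A. \<nu> t A \<bullet> i) (\<theta> j) *\<^sub>R i)"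
  proof (intro sum.cong refl)
    fix i :: 'a
    have li: "locally_integrable \<gamma> (\<lambda>x. w x \<bullet> i)"
      by (rule locally_integrable_linear[OF l(2) _ \<gamma>, of "\<lambda>y. y \<bullet> i"]) (rule bounded_linear_inner_left)
    have "(\<integral>x. \<theta> j x *\<^sub>R w x \<partial>\<gamma>) \<bullet> i = (\<integral>x. (\<theta> j x *\<^sub>R w x) \<bullet> i \<partial>\<gamma>)" by (rule integral_inner_left[OF iw, symmetric])
    then show "((\<integral>x. \<theta> j x *\<^sub>R w x \<partial>\<gamma>) \<bullet> i) *\<^sub>R i = signed_integral (\<lambda>A. \<nu> t A \<bullet> i) (\<theta> j) *\<^sub>R i"
      by (simp add: eq radon_density_inner[OF \<gamma> l(2)] signed_integral_density[OF \<gamma> li b])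
  qed
  finally have 2: "snd (\<integral>x. \<theta> j x *\<^sub>R (\<rho> x, w x) \<partial>\<gamma>) = (\<Sum>i\<in>Basis. signed_integral (\<lambda>A. \<nu> t A \<bullet> i) (\<theta> j) *\<^sub>R i)" .
  show ?thesis using j t unfolding coef_def 1[symmetric] 2[symmetric] by simp
qed

lemma coef_measurable: "j \<in> J \<Longrightarrow> coef j \<in> borel_measurable borel"
proof -
  assume j: "j \<in> J"
  have m: "(\<lambda>t. indicator {0..1} t *\<^sub>R q t) \<in> borel_measurable borel" if "q \<in> borel_measurable (restrict_space borel {0..1})" for q :: "real \<Rightarrow> real"
    using that by (subst (asm) borel_measurable_restrict_space_iff) auto
  have m1: "(\<lambda>t. indicator {0..1} t *\<^sub>R signed_integral (\<mu> t) (\<theta> j)) \<in> borel_measurable borel"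
    by (intro m borel_measurable_continuous_on_restrict cont\<mu> \<theta>_cc j)
  have m2: "(\<lambda>t. indicator {0..1} t *\<^sub>R signed_integral (\<lambda>A. \<nu> t A \<bullet> i) (\<theta> j)) \<in> borel_measurable borel" for i
  proof (rule m, rule borel_family_signed_integral[OF _ _ bump_bbs[OF \<theta> j]])
    show "radon (\<lambda>A. \<nu> t A \<bullet> i)" if "t \<in> {0..1}" for t using rad\<nu>[OF that] by (rule radon_inner)
    show "(\<lambda>t. \<nu> t A \<bullet> i) \<in> borel_measurable (restrict_space borel {0..1})" if "bdd_borel A" for A
      using CE_D(4)[OF CE] that unfolding borel_family_def by (intro borel_measurable_inner) auto
  qed
  have eq: "coef j = (\<lambda>t. if j \<in> J1 \<and> t \<in> {0..1} then (1 / (\<integral>x. \<theta> j x \<partial>\<gamma>)) *\<^sub>R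
    (indicator {0..1} t *\<^sub>R signed_integral (\<mu> t) (\<theta> j), \<Sum>i\<in>Basis. (indicator {0..1} t *\<^sub>R signed_integral (\<lambda>A. \<nu> t A \<bullet> i) (\<theta> j)) *\<^sub>R i) else (r1, 0))"
    unfolding coef_def by (intro ext if_cong refl) simp
  have "(\<lambda>t. (indicator {0..1} t *\<^sub>R signed_integral (\<mu> t) (\<theta> j), \<Sum>i\<in>Basis. (indicator {0..1} t *\<^sub>R signed_integral (\<lambda>A. \<nu> t A \<bullet> i) (\<theta> j)) *\<^sub>R i)) \<in> borel_measurable borel"
    unfolding borel_prod[symmetric] by (intro measurable_Pair m1 borel_measurable_sum borel_measurable_scaleR m2) auto
  then show ?thesis
    unfolding eq by (intro measurable_If borel_measurable_scaleR) auto
qed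

lemma U_measurable: "(\<lambda>(x, t). U x t) \<in> borel_measurable (borel \<Otimes>\<^sub>M borel)"
proof -
  have m1: "(\<lambda>z. coef j (snd z)) \<in> borel_measurable (borel \<Otimes>\<^sub>M borel)" if "j \<in> J" for j
    using coef_measurable[OF that] by measurable
  have m2: "(\<lambda>z. \<theta> j (fst z)) \<in> borel_measurable (borel \<Otimes>\<^sub>M borel)" if "j \<in> J" for j
  proof -
    have [measurable]: "\<theta> j \<in> borel_measurable borel" using bump_bbs[OF \<theta> that] by (simp add: bbs_def)
    show ?thesis by measurable
  qed
  show ?thesis
    unfolding U_def smoothing_def split_beta'
    by (intro borel_measurable_add borel_measurable_sum borel_measurable_scaleR borel_measurable_diff m1 m2) auto
qed

lemma U_energy:
  assumes t: "t \<in> {0..1}"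
  shows "(\<integral>\<^sup>+x. \<phi> (U x t) \<partial>\<gamma>0) \<le> ennreal (1 + \<eta>) * \<Phi> t"
proof (cases "\<Phi> t < \<infinity>")
  case True
  obtain \<rho> w where d: "locally_integrable \<gamma> \<rho>" "locally_integrable \<gamma> w" "\<mu> t = radon_density \<gamma> \<rho>"
      "\<nu> t = radon_density \<gamma> w" "(\<integral>\<^sup>+x. \<phi> (\<rho> x, w x) \<partial>\<gamma>) \<le> \<Phi> t"
    using density_at[OF t True] by blast
  have "(\<integral>\<^sup>+x. \<phi> (U x t) \<partial>\<gamma>0) \<le> ennreal (1 + \<eta>) * (\<integral>\<^sup>+x. \<phi> (\<rho> x, w x) \<partial>\<gamma>)"
    unfolding U_def
  proof (rule smoothing_energy[OF \<theta> admissible_onD(1,2)[OF adm] _ \<gamma>0 \<gamma> locally_integrable_Pair[OF \<gamma> d(1,2)] \<eta>(1), where ?J1.0 = J1])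
    show "\<phi> (r1, 0) = 0" using admissible_interior(2)[OF adm p ab] r1 by blast
    show "(\<integral>x. \<theta> j x \<partial>\<gamma>0) \<le> (1 + \<eta>) * (\<integral>x. \<theta> j x \<partial>\<gamma>)" if "j \<in> J" "j \<in> J1" for j
      using g(2)[OF that] by (simp add: distrib_right)
  qed (use g coef_density[OF _ _ t d(1,2,3,4)] in \<open>auto simp: coef_def\<close>)
  also have "\<dots> \<le> ennreal (1 + \<eta>) * \<Phi> t" by (intro mult_left_mono d) auto
  finally show ?thesis .
next
  case False
  then show ?thesis using \<eta> by (simp add: less_top[symmetric] ennreal_mult_top)
qed

text \<open>The factor 1 + \<eta> is first divided out: \<open>?q\<close> is measurable and lies
  below the action, while pulling a constant out of the integral of the action would presuppose its
  measurability. \<psi> is left free so that an early \<open>\<phi>n m\<close> can be used along the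
  curve of a later one.\<close>

lemma U_energy_integral:
  assumes \<psi>: "\<psi> \<in> borel_measurable borel" "\<And>z. \<psi> z \<le> \<phi> z"
  shows "(\<integral>\<^sup>+t\<in>{0..1}. (\<integral>\<^sup>+x. \<psi> (U x t) \<partial>\<gamma>0) \<partial>lborel) \<le> ennreal ((1 + \<eta>) * A)"
proof -
  interpret \<gamma>0: sigma_finite_measure \<gamma>0 by (rule pos_radon_sigma_finite[OF \<gamma>0])
  note [measurable_cong] = pos_radonD(1)[OF \<gamma>0]
  note \<psi>(1)[measurable] U_measurable[measurable]
  have [measurable]: "(\<lambda>t. \<integral>\<^sup>+x. \<psi> (U x t) \<partial>\<gamma>0) \<in> borel_measurable borel" by measurable
  let ?q = "\<lambda>t. ennreal (1 / (1 + \<eta>)) * (\<integral>\<^sup>+x. \<psi> (U x t) \<partial>\<gamma>0)"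
  have one: "ennreal (1 + \<eta>) * (ennreal (1 / (1 + \<eta>)) * y) = y" "ennreal (1 / (1 + \<eta>)) * (ennreal (1 + \<eta>) * y) = y" for y
    using \<eta> by (simp_all add: mult.assoc[symmetric] ennreal_mult[symmetric] del: ennreal_plus)
  have le: "?q t \<le> \<Phi> t" if t: "t \<in> {0..1}" for t
  proof -
    have "(\<integral>\<^sup>+x. \<psi> (U x t) \<partial>\<gamma>0) \<le> ennreal (1 + \<eta>) * \<Phi> t"
      using U_energy[OF t] nn_integral_mono[of \<gamma>0 "\<lambda>x. \<psi> (U x t)" "\<lambda>x. \<phi> (U x t)"] \<psi>(2) by (meson order.trans)
    then have "?q t \<le> ennreal (1 / (1 + \<eta>)) * (ennreal (1 + \<eta>) * \<Phi> t)" by (intro mult_left_mono) auto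
    then show ?thesis unfolding one .
  qed
  have "(\<integral>\<^sup>+t\<in>{0..1}. (\<integral>\<^sup>+x. \<psi> (U x t) \<partial>\<gamma>0) \<partial>lborel) = (\<integral>\<^sup>+t. ennreal (1 + \<eta>) * (?q t * indicator {0..1} t) \<partial>lborel)"
    by (intro nn_integral_cong) (simp only: mult.assoc one)
  also have "\<dots> = ennreal (1 + \<eta>) * (\<integral>\<^sup>+t\<in>{0..1}. ?q t \<partial>lborel)" by (intro nn_integral_cmult) measurable
  also have "\<dots> \<le> ennreal (1 + \<eta>) * (\<integral>\<^sup>+t\<in>{0..1}. \<Phi> t \<partial>lborel)"
    by (intro mult_left_mono nn_integral_mono) (auto simp: indicator_def le)
  also have "\<dots> \<le> ennreal (1 + \<eta>) * ennreal A" by (intro mult_left_mono fin) auto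
  finally show ?thesis using \<eta> A0 by (simp add: ennreal_mult del: ennreal_plus)
qed

lemma fst_coef_bound: "j \<in> J \<Longrightarrow> \<bar>fst (coef j t)\<bar> \<le> C\<rho>"
proof -
  assume j: "j \<in> J"
  show ?thesis
  proof (cases "j \<in> J1 \<and> t \<in> {0..1}")
    case True
    have "\<bar>signed_integral (\<mu> t) (\<theta> j)\<bar> \<le> C\<rho> * (\<integral>x. \<theta> j x \<partial>\<gamma>)"
      using \<mu>_bound[OF \<theta>_cc[OF j], of t] True bump_familyD(3)[OF \<theta> j] by simp
    then show ?thesis using True g(1)[OF j] by (simp add: coef_def pos_divide_le_eq)
  next
    case False
    then show ?thesis using r1 by (auto simp: coef_def C\<rho>_def)
  qed
qed

lemma fst_U: "fst (U x t) = smoothing J \<theta> r1 (\<lambda>j. fst (coef j t)) x"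
  by (simp add: U_def smoothing_def fst_sum)

lemma fst_U_bound: "\<bar>fst (U x t)\<bar> \<le> C\<rho>"
proof -
  note D = bump_familyD[OF \<theta>]
  have r1C: "\<bar>r1\<bar> \<le> C\<rho>" using r1 by (auto simp: C\<rho>_def)
  have "\<bar>fst (U x t)\<bar> \<le> (\<Sum>j\<in>J. \<bar>\<theta> j x * fst (coef j t)\<bar>) + \<bar>(1 - (\<Sum>j\<in>J. \<theta> j x)) * r1\<bar>"
    unfolding fst_U smoothing_def real_scaleR_def by (intro order.trans[OF abs_triangle_ineq] add_right_mono sum_abs)
  also have "\<dots> \<le> (\<Sum>j\<in>J. \<theta> j x * C\<rho>) + (1 - (\<Sum>j\<in>J. \<theta> j x)) * C\<rho>"
    using D(3)[of _ x] D(5)[of x] fst_coef_bound r1C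
    by (intro add_mono sum_mono) (auto simp: abs_mult intro!: mult_left_mono)
  also have "\<dots> = C\<rho>" unfolding sum_distrib_right[symmetric] by (simp add: algebra_simps)
  finally show ?thesis .
qed

text \<open>Affine in the action, as \<open>time_bound_affine\<close> expects. Two growth bounds
  enter: the main error already has a small prefactor and uses \<open>K1\<close>, whereas uncharged
  cells need the small e, whose possibly large K is compensated by their small mass.\<close>

lemma U_error_const:
  assumes F: "cc F" "\<And>x. norm (F x) \<le> M" "\<And>x. R0 < norm x \<Longrightarrow> F x = 0" "R0 \<le> R"
      "\<And>x y. dist x y < h \<Longrightarrow> norm (F x - F y) \<le> \<delta>" "0 \<le> \<delta>"
    and e: "0 < e" "0 \<le> K" "\<And>z. ennreal (norm z) \<le> ennreal e * \<phi> z + ennreal K"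
      "0 \<le> K1" "\<And>z. ennreal (norm z) \<le> \<phi> z + ennreal K1"
    and t: "t \<in> {0..1}" "\<Phi> t < \<infinity>"
  shows "ennreal \<bar>\<Lambda> t F - (\<integral>x. F x \<bullet> U x t \<partial>\<gamma>0)\<bar> \<le> ennreal (3 * \<delta> + M * \<eta> + M * e) * \<Phi> t
    + ennreal ((3 * \<delta> + M * \<eta>) * K1 * measure \<gamma> (cball 0 (R0 + 2 * h)) + M * K * (\<Sum>j\<in>J - J1. \<integral>x. \<theta> j x \<partial>\<gamma>))"
proof -
  let ?B = "cball (0::'a) (R0 + 2 * h)"
  note D = bump_familyD[OF \<theta>]
  have M0: "0 \<le> M" using F(2) norm_ge_zero order.trans by blast
  obtain \<rho> w where d: "locally_integrable \<gamma> \<rho>" "locally_integrable \<gamma> w" "\<mu> t = radon_density \<gamma> \<rho>"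
      "\<nu> t = radon_density \<gamma> w" "(\<integral>\<^sup>+x. \<phi> (\<rho> x, w x) \<partial>\<gamma>) \<le> \<Phi> t"
      "\<forall>F. bbs F \<longrightarrow> \<Lambda> t F = (\<integral>x. F x \<bullet> (\<rho> x, w x) \<partial>\<gamma>)"
    using density_at[OF t] by blast
  define u where "u x = (\<rho> x, w x)" for x
  have u: "locally_integrable \<gamma> u" unfolding u_def by (rule locally_integrable_Pair[OF \<gamma> d(1,2)])
  have Fm: "F \<in> borel_measurable borel" using cc_bbs[OF F(1)] by (simp add: bbs_def)
  have err: "\<bar>\<Lambda> t F - (\<integral>x. F x \<bullet> U x t \<partial>\<gamma>0)\<bar>
    \<le> (3 * \<delta> + M * \<eta>) * (\<integral>x. indicator ?B x * norm (u x) \<partial>\<gamma>) + M * (\<Sum>j\<in>J - J1. \<integral>x. \<theta> j x * norm (u x) \<partial>\<gamma>)"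
    unfolding d(6)[rule_format, OF cc_bbs[OF F(1)]] U_def u_def[symmetric]
    by (rule smoothing_error[OF \<theta> \<gamma>0 \<gamma> u \<eta> J1 g _ Fm F(2,3,5,6,4)])
      (auto simp: u_def coef_density[OF _ _ t(1) d(1,2,3,4)])
  have bn: "bbs (\<lambda>x. \<Sum>j\<in>J - J1. \<theta> j x)" by (intro bbs_sum bump_bbs[OF \<theta>]) auto
  have iu: "integrable \<gamma> (\<lambda>x. \<theta> j x * norm (u x))" if "j \<in> J" for j
    using integrable_norm[OF integrable_bbs_scaleR[OF \<gamma> u bump_bbs[OF \<theta> that]]] D(3)[OF that] by simp
  have E: "ennreal (\<integral>x. indicator ?B x * norm (u x) \<partial>\<gamma>) \<le> ennreal 1 * \<Phi> t + ennreal (K1 * measure \<gamma> ?B)"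
  proof -
    have "ennreal (\<integral>x. indicator ?B x * norm (u x) \<partial>\<gamma>) \<le> ennreal 1 * (\<integral>\<^sup>+x. \<phi> (u x) \<partial>\<gamma>) + ennreal (K1 * (\<integral>x. indicator ?B x \<partial>\<gamma>))"
      using e by (intro weighted_norm_bound[OF u bbs_indicator]) (auto simp: indicator_def)
    also have "\<dots> \<le> ennreal 1 * \<Phi> t + ennreal (K1 * measure \<gamma> ?B)"
      using d(5) by (intro add_mono mult_left_mono) (auto simp: u_def pos_radonD(2)[OF \<gamma>])
    finally show ?thesis .
  qed
  have "(\<Sum>j\<in>J - J1. \<integral>x. \<theta> j x * norm (u x) \<partial>\<gamma>) = (\<integral>x. (\<Sum>j\<in>J - J1. \<theta> j x) * norm (u x) \<partial>\<gamma>)"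
    using iu by (subst Bochner_Integration.integral_sum[symmetric]) (auto simp: sum_distrib_right)
  also have "ennreal \<dots> \<le> ennreal e * (\<integral>\<^sup>+x. \<phi> (u x) \<partial>\<gamma>) + ennreal (K * (\<integral>x. (\<Sum>j\<in>J - J1. \<theta> j x) \<partial>\<gamma>))"
  proof (rule weighted_norm_bound[OF u bn])
    show "0 \<le> (\<Sum>j\<in>J - J1. \<theta> j x)" for x using D(3) by (intro sum_nonneg) auto
    show "(\<Sum>j\<in>J - J1. \<theta> j x) \<le> 1" for x
      using D(1,3) by (intro order.trans[OF sum_mono2[of J "J - J1"] D(5)[of x]]) auto
  qed (use e in auto)
  also have "(\<integral>x. (\<Sum>j\<in>J - J1. \<theta> j x) \<partial>\<gamma>) = (\<Sum>j\<in>J - J1. \<integral>x. \<theta> j x \<partial>\<gamma>)"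
    using integrable_bbs[OF \<gamma> bump_bbs[OF \<theta>]] by (intro Bochner_Integration.integral_sum) auto
  also have "ennreal e * (\<integral>\<^sup>+x. \<phi> (u x) \<partial>\<gamma>) \<le> ennreal e * \<Phi> t"
    using d(5) by (intro mult_left_mono) (auto simp: u_def)
  finally have N: "ennreal (\<Sum>j\<in>J - J1. \<integral>x. \<theta> j x * norm (u x) \<partial>\<gamma>) \<le> ennreal e * \<Phi> t + ennreal (K * (\<Sum>j\<in>J - J1. \<integral>x. \<theta> j x \<partial>\<gamma>))"
    by (simp add: add_right_mono)
  obtain y where y: "\<Phi> t = ennreal y" "0 \<le> y" using t(2) by (cases "\<Phi> t") auto
  let ?S = "\<Sum>j\<in>J - J1. \<integral>x. \<theta> j x \<partial>\<gamma>"
  have S0: "0 \<le> ?S" using D(3) by (intro sum_nonneg integral_nonneg) auto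
  have E': "(\<integral>x. indicator ?B x * norm (u x) \<partial>\<gamma>) \<le> y + K1 * measure \<gamma> ?B"
    using E y e by (subst ennreal_le_iff[symmetric]) (simp_all add: ennreal_plus)
  have N': "(\<Sum>j\<in>J - J1. \<integral>x. \<theta> j x * norm (u x) \<partial>\<gamma>) \<le> e * y + K * ?S"
    using N y e S0 by (subst ennreal_le_iff[symmetric]) (simp_all add: ennreal_plus ennreal_mult)
  have "\<bar>\<Lambda> t F - (\<integral>x. F x \<bullet> U x t \<partial>\<gamma>0)\<bar> \<le> (3 * \<delta> + M * \<eta>) * (y + K1 * measure \<gamma> ?B) + M * (e * y + K * ?S)"
    using M0 \<eta> F(6) by (intro order.trans[OF err] add_mono mult_left_mono E' N') auto
  also have "\<dots> = (3 * \<delta> + M * \<eta> + M * e) * y + ((3 * \<delta> + M * \<eta>) * K1 * measure \<gamma> ?B + M * K * ?S)"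
    by (simp add: algebra_simps)
  finally have "ennreal \<bar>\<Lambda> t F - (\<integral>x. F x \<bullet> U x t \<partial>\<gamma>0)\<bar> \<le> ennreal \<dots>" by (rule ennreal_leI)
  also have "\<dots> = ennreal (3 * \<delta> + M * \<eta> + M * e) * \<Phi> t + ennreal ((3 * \<delta> + M * \<eta>) * K1 * measure \<gamma> ?B + M * K * ?S)"
  proof -
    have "0 \<le> 3 * \<delta> + M * \<eta> + M * e" "0 \<le> (3 * \<delta> + M * \<eta>) * K1 * measure \<gamma> ?B + M * K * ?S"
      using M0 \<eta> F(6) e S0 by auto
    then show ?thesis unfolding y(1) using y(2) by (subst ennreal_plus) (simp_all only: ennreal_mult mult_nonneg_nonneg)
  qed
  finally show ?thesis .
qed

lemma U_error_integral:
  fixes F :: "'a \<times> real \<Rightarrow> real \<times> 'a"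
  assumes F: "cc F" "\<And>z. norm (F z) \<le> M" "\<And>x t. R0 < norm x \<Longrightarrow> F (x, t) = 0" "R0 \<le> R"
      "\<And>x y t. dist x y < h \<Longrightarrow> norm (F (x, t) - F (y, t)) \<le> \<delta>" "0 \<le> \<delta>" "0 < M"
    and e: "0 < e" "0 \<le> K" "\<And>z. ennreal (norm z) \<le> ennreal e * \<phi> z + ennreal K"
      "0 \<le> K1" "\<And>z. ennreal (norm z) \<le> \<phi> z + ennreal K1"
  shows "(\<lambda>t. if t \<in> {0..1} then \<Lambda> t (\<lambda>x. F (x, t)) - (\<integral>x. F (x, t) \<bullet> U x t \<partial>\<gamma>0) else 0) \<in> borel_measurable borel"
    "(\<integral>\<^sup>+t\<in>{0..1}. ennreal \<bar>\<Lambda> t (\<lambda>x. F (x, t)) - (\<integral>x. F (x, t) \<bullet> U x t \<partial>\<gamma>0)\<bar> \<partial>lborel)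
      \<le> ennreal ((3 * \<delta> + M * \<eta> + M * e) * A
        + ((3 * \<delta> + M * \<eta>) * K1 * measure \<gamma> (cball 0 (R0 + 2 * h)) + M * K * (\<Sum>j\<in>J - J1. \<integral>x. \<theta> j x \<partial>\<gamma>)))"
proof -
  interpret \<gamma>0: sigma_finite_measure \<gamma>0 by (rule pos_radon_sigma_finite[OF \<gamma>0])
  note [measurable_cong] = pos_radonD(1)[OF \<gamma>0]
  note U_measurable[measurable]
  have Fm[measurable]: "F \<in> borel_measurable (borel \<Otimes>\<^sub>M borel)" using cc_bbs[OF F(1)] by (simp add: bbs_def borel_prod)
  have 1: "(\<lambda>t. \<integral>x. F (x, t) \<bullet> U x t \<partial>\<gamma>0) \<in> borel_measurable borel" by measurable
  have "(\<lambda>t. (if t \<in> {0..1} then \<Lambda> t (\<lambda>x. F (x, t)) else 0) - indicator {0..1} t * (\<integral>x. F (x, t) \<bullet> U x t \<partial>\<gamma>0)) \<in> borel_measurable borel"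
    by (intro borel_measurable_diff CE_pairing_measurable[OF CE F(1)] borel_measurable_times 1) auto
  then show m: "(\<lambda>t. if t \<in> {0..1} then \<Lambda> t (\<lambda>x. F (x, t)) - (\<integral>x. F (x, t) \<bullet> U x t \<partial>\<gamma>0) else 0) \<in> borel_measurable borel"
    by (rule measurable_cong[THEN iffD1, rotated]) auto
  have S0: "0 \<le> (\<Sum>j\<in>J - J1. \<integral>x. \<theta> j x \<partial>\<gamma>)" using bump_familyD(3)[OF \<theta>] by (intro sum_nonneg integral_nonneg) auto
  have c: "0 < 3 * \<delta> + M * \<eta> + M * e" using F(6,7) \<eta>(1) e(1) by (simp add: add_nonneg_pos)
  have d: "0 \<le> (3 * \<delta> + M * \<eta>) * K1 * measure \<gamma> (cball 0 (R0 + 2 * h)) + M * K * (\<Sum>j\<in>J - J1. \<integral>x. \<theta> j x \<partial>\<gamma>)"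
    using F(6,7) \<eta>(1) e S0 by auto
  have le: "ennreal \<bar>\<Lambda> t (\<lambda>x. F (x, t)) - (\<integral>x. F (x, t) \<bullet> U x t \<partial>\<gamma>0)\<bar> \<le> ennreal (3 * \<delta> + M * \<eta> + M * e) * \<Phi> t
    + ennreal ((3 * \<delta> + M * \<eta>) * K1 * measure \<gamma> (cball 0 (R0 + 2 * h)) + M * K * (\<Sum>j\<in>J - J1. \<integral>x. \<theta> j x \<partial>\<gamma>))"
    if t: "t \<in> {0..1}" "\<Phi> t < \<infinity>" for t
    by (rule U_error_const[OF cc_section[OF F(1)] F(2,3,4,5,6) e t])
  show "(\<integral>\<^sup>+t\<in>{0..1}. ennreal \<bar>\<Lambda> t (\<lambda>x. F (x, t)) - (\<integral>x. F (x, t) \<bullet> U x t \<partial>\<gamma>0)\<bar> \<partial>lborel)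
      \<le> ennreal ((3 * \<delta> + M * \<eta> + M * e) * A
        + ((3 * \<delta> + M * \<eta>) * K1 * measure \<gamma> (cball 0 (R0 + 2 * h)) + M * K * (\<Sum>j\<in>J - J1. \<integral>x. \<theta> j x \<partial>\<gamma>)))"
    using time_bound_affine[OF c d m le, of 0 1] by simp
qed

text \<open>The first component has a bounded density, so its error is controlled at every single
  time and not merely in the time average. Limits of \<mu> at fixed times rest on this.\<close>

lemma U_error_fst:
  assumes f: "cc f" "\<And>x. \<bar>f x\<bar> \<le> M" "\<And>x. R0 < norm x \<Longrightarrow> f x = 0" "R0 \<le> R"
      "\<And>x y. dist x y < h \<Longrightarrow> \<bar>f x - f y\<bar> \<le> \<delta>" "0 \<le> \<delta>" and t: "t \<in> {0..1}"
  shows "\<bar>signed_integral (\<mu> t) f - (\<integral>x. f x * fst (U x t) \<partial>\<gamma>0)\<bar>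
    \<le> C\<rho> * ((3 * \<delta> + M * \<eta>) * measure \<gamma> (cball 0 (R0 + 2 * h)) + M * (\<Sum>j\<in>J - J1. \<integral>x. \<theta> j x \<partial>\<gamma>))"
proof (rule dense_le[OF _ _ t])
  let ?B = "cball (0::'a) (R0 + 2 * h)"
  note D = bump_familyD[OF \<theta>]
  have M0: "0 \<le> M" using f(2)[of 0] by simp
  have fm: "f \<in> borel_measurable borel" using cc_bbs[OF f(1)] by (simp add: bbs_def)
  have int: "integrable \<gamma>0 (\<lambda>x. f x * \<theta> j x)" if "j \<in> J" for j
  proof -
    have "locally_integrable \<gamma>0 (\<theta> j)"
      using integrable_bbs[OF \<gamma>0 bump_bbs[OF \<theta> that]] bump_bbs[OF \<theta> that]
      unfolding locally_integrable_def set_integrable_def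
      by (auto intro!: integrable_mult_indicator simp: bbs_def pos_radonD(1)[OF \<gamma>0] borel_compact simp del: real_scaleR_def)
    then show ?thesis using integrable_bbs_scaleR[OF \<gamma>0 _ cc_bbs[OF f(1)]] by force
  qed
  have If: "integrable \<gamma>0 f" by (rule integrable_bbs[OF \<gamma>0 cc_bbs[OF f(1)]])
  \<comment> \<open>In this form t enters only through \<open>fst (coef j t)\<close>, hence
    continuously, so that \<open>dense_le\<close> applies.\<close>
  have expand: "(\<integral>x. f x * fst (U x t) \<partial>\<gamma>0) = (\<Sum>j\<in>J. fst (coef j t) * (\<integral>x. f x * \<theta> j x \<partial>\<gamma>0))
      + r1 * ((\<integral>x. f x \<partial>\<gamma>0) - (\<Sum>j\<in>J. \<integral>x. f x * \<theta> j x \<partial>\<gamma>0))" for t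
  proof -
    have "(\<integral>x. f x * fst (U x t) \<partial>\<gamma>0) = (\<integral>x. (\<Sum>j\<in>J. fst (coef j t) * (f x * \<theta> j x)) + r1 * (f x - (\<Sum>j\<in>J. f x * \<theta> j x)) \<partial>\<gamma>0)"
      by (intro Bochner_Integration.integral_cong refl)
        (simp add: fst_U smoothing_def algebra_simps sum_distrib_left sum_distrib_right)
    also have "\<dots> = (\<integral>x. (\<Sum>j\<in>J. fst (coef j t) * (f x * \<theta> j x)) \<partial>\<gamma>0) + (\<integral>x. r1 * (f x - (\<Sum>j\<in>J. f x * \<theta> j x)) \<partial>\<gamma>0)"
      using int If by (intro Bochner_Integration.integral_add Bochner_Integration.integrable_sum integrable_mult_right
          Bochner_Integration.integrable_diff) auto
    finally show ?thesis using int If by (simp add: Bochner_Integration.integral_sum)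
  qed
  have coefc: "continuous_on {0..1} (\<lambda>t. fst (coef j t))" if "j \<in> J" for j
  proof (cases "j \<in> J1")
    case True
    have "continuous_on {0..1} (\<lambda>t. (1 / (\<integral>x. \<theta> j x \<partial>\<gamma>)) * signed_integral (\<mu> t) (\<theta> j))"
      by (intro continuous_intros cont\<mu> \<theta>_cc that)
    then show ?thesis by (rule continuous_on_cong[THEN iffD1, rotated -1]) (auto simp: coef_def True)
  qed (simp add: coef_def)
  show "continuous_on {0..1} (\<lambda>t. \<bar>signed_integral (\<mu> t) f - (\<integral>x. f x * fst (U x t) \<partial>\<gamma>0)\<bar>)"
    unfolding expand by (intro continuous_intros cont\<mu> f coefc) auto
  fix t :: real assume t: "t \<in> {0..1}" "\<Phi> t < \<infinity>"
  obtain \<rho> w where d: "locally_integrable \<gamma> \<rho>" "locally_integrable \<gamma> w" "\<mu> t = radon_density \<gamma> \<rho>"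
      "\<nu> t = radon_density \<gamma> w" "(\<integral>\<^sup>+x. \<phi> (\<rho> x, w x) \<partial>\<gamma>) \<le> \<Phi> t"
    using density_at[OF t] by blast
  have ae: "AE x in \<gamma>. \<bar>\<rho> x\<bar> \<le> C\<rho>" by (rule density_bounded[OF le_less_trans[OF d(5) t(2)] d(1,2)])
  have cf: "fst (coef j t) = (1 / (\<integral>x. \<theta> j x \<partial>\<gamma>)) *\<^sub>R (\<integral>x. \<theta> j x *\<^sub>R \<rho> x \<partial>\<gamma>)" if "j \<in> J" "j \<in> J1" for j
    using that t(1) by (simp add: coef_def d(3) signed_integral_density[OF \<gamma> d(1) bump_bbs[OF \<theta>]])
  have bound: "(\<integral>x. q x * norm (\<rho> x) \<partial>\<gamma>) \<le> C\<rho> * (\<integral>x. q x \<partial>\<gamma>)" if q: "bbs q" "\<And>x. 0 \<le> q x" for q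
  proof -
    have "(\<integral>x. q x * norm (\<rho> x) \<partial>\<gamma>) \<le> (\<integral>x. C\<rho> * q x \<partial>\<gamma>)"
    proof (rule integral_mono_AE)
      show "integrable \<gamma> (\<lambda>x. q x * norm (\<rho> x))"
        using integrable_norm[OF integrable_bbs_scaleR[OF \<gamma> d(1) q(1)]] q(2) by (simp add: abs_mult)
      show "integrable \<gamma> (\<lambda>x. C\<rho> * q x)" using integrable_bbs[OF \<gamma> q(1)] by simp
      show "AE x in \<gamma>. q x * norm (\<rho> x) \<le> C\<rho> * q x"
        using ae by eventually_elim (simp add: mult.commute[of C\<rho>] mult_left_mono q(2))
    qed
    then show ?thesis by simp
  qed
  have "\<bar>(\<integral>x. f x \<bullet> \<rho> x \<partial>\<gamma>) - (\<integral>x. f x \<bullet> smoothing J \<theta> r1 (\<lambda>j. fst (coef j t)) x \<partial>\<gamma>0)\<bar>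
    \<le> (3 * \<delta> + M * \<eta>) * (\<integral>x. indicator ?B x * norm (\<rho> x) \<partial>\<gamma>) + M * (\<Sum>j\<in>J - J1. \<integral>x. \<theta> j x * norm (\<rho> x) \<partial>\<gamma>)"
    using f(2,5) by (intro smoothing_error[OF \<theta> \<gamma>0 \<gamma> d(1) \<eta> J1 g cf fm _ f(3) _ f(6,4)]) auto
  also have "\<dots> \<le> (3 * \<delta> + M * \<eta>) * (C\<rho> * (\<integral>x. indicator ?B x \<partial>\<gamma>)) + M * (\<Sum>j\<in>J - J1. C\<rho> * (\<integral>x. \<theta> j x \<partial>\<gamma>))"
    using M0 \<eta> f(6) D(3) by (intro add_mono mult_left_mono sum_mono bound bbs_indicator bump_bbs[OF \<theta>]) auto
  also have "\<dots> = C\<rho> * ((3 * \<delta> + M * \<eta>) * measure \<gamma> ?B + M * (\<Sum>j\<in>J - J1. \<integral>x. \<theta> j x \<partial>\<gamma>))"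
    by (simp add: pos_radonD(2)[OF \<gamma>] sum_distrib_left[symmetric] algebra_simps)
  finally show "\<bar>signed_integral (\<mu> t) f - (\<integral>x. f x * fst (U x t) \<partial>\<gamma>0)\<bar>
    \<le> C\<rho> * ((3 * \<delta> + M * \<eta>) * measure \<gamma> ?B + M * (\<Sum>j\<in>J - J1. \<integral>x. \<theta> j x \<partial>\<gamma>))"
    by (simp add: fst_U d(3) signed_integral_density[OF \<gamma> d(1) cc_bbs[OF f(1)]])
qed

end

section \<open>Tools for the limit passage\<close>

text \<open>Turns a Radon measure into a finite one with the same null sets, while the lower bound
  on balls lets integrals against the weighted measure control local integrals against
  \<open>\<gamma>\<close>.\<close>

lemma weight_exists:
  assumes \<gamma>: "pos_radon (\<gamma> :: 'a::euclidean_space measure)"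
  shows "\<exists>wt. wt \<in> borel_measurable borel \<and> (\<forall>x. 0 < wt x \<and> wt x \<le> 1) \<and>
    (\<integral>\<^sup>+x. ennreal (wt x) \<partial>\<gamma>) < \<infinity> \<and> (\<forall>R. \<exists>c>0. \<forall>x. norm x \<le> R \<longrightarrow> c \<le> wt x)"
proof -
  note [measurable_cong] = pos_radonD(1)[OF \<gamma>]
  \<comment> \<open>\<open>q m\<close> times the mass of the ball of radius m is at most 2^-m, which
    makes the series finite; q is nonincreasing, which gives the lower bound on balls.\<close>
  define q where "q m = (1/2) ^ m / (1 + measure \<gamma> (cball 0 (real m)))" for m :: nat
  have q0: "0 < q m" for m by (simp add: q_def add_pos_nonneg)
  have mono: "measure \<gamma> (cball 0 (real m)) \<le> measure \<gamma> (cball 0 (real n))" if "m \<le> n" for m n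
    using that pos_radonD(3)[OF \<gamma>, of "cball 0 (real n)"]
    by (intro measure_mono_fmeasurable fmeasurableI) (auto simp: pos_radonD(1)[OF \<gamma>])
  have qanti: "q n \<le> q m" if "m \<le> n" for m n
    unfolding q_def using that mono[OF that]
    by (intro frac_le power_decreasing) (auto simp: add_pos_nonneg)
  have q1: "q m \<le> 1" for m
  proof -
    have "q m \<le> 1 / 1" unfolding q_def by (intro frac_le) (auto simp: power_le_one)
    then show ?thesis by simp
  qed
  define wt where "wt x = q (nat \<lceil>norm x\<rceil>)" for x :: 'a
  have m: "wt \<in> borel_measurable borel"
  proof -
    have [measurable]: "(\<lambda>x::'a. nat \<lceil>norm x\<rceil>) \<in> borel \<rightarrow>\<^sub>M count_space UNIV" by measurable
    show ?thesis unfolding wt_def[abs_def] by (rule measurable_compose[where N = "count_space UNIV" and g = q]) auto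
  qed
  have "(\<integral>\<^sup>+x. ennreal (wt x) \<partial>\<gamma>) \<le> (\<integral>\<^sup>+x. (\<Sum>m. ennreal (q m) * indicator (cball 0 (real m)) x) \<partial>\<gamma>)"
  proof (rule nn_integral_mono)
    fix x :: 'a
    let ?m = "nat \<lceil>norm x\<rceil>"
    have "norm x \<le> real ?m" by linarith
    then have "ennreal (wt x) \<le> (\<Sum>m\<in>{?m}. ennreal (q m) * indicator (cball 0 (real m)) x)"
      by (simp add: wt_def)
    also have "\<dots> \<le> (\<Sum>m. ennreal (q m) * indicator (cball 0 (real m)) x)"
      by (rule sum_le_suminf) auto
    finally show "ennreal (wt x) \<le> (\<Sum>m. ennreal (q m) * indicator (cball 0 (real m)) x)" .
  qed
  also have "\<dots> = (\<Sum>m. ennreal (q m) * emeasure \<gamma> (cball 0 (real m)))"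
  proof (subst nn_integral_suminf)
    have [measurable]: "cball (0::'a) (real m) \<in> sets borel" for m by simp
    show "(\<lambda>x. ennreal (q m) * indicator (cball 0 (real m)) x) \<in> borel_measurable \<gamma>" for m by measurable
  qed (simp add: nn_integral_cmult_indicator pos_radonD(1)[OF \<gamma>])
  also have "\<dots> \<le> (\<Sum>m. ennreal ((1/2) ^ m))"
  proof (intro suminf_le)
    fix m :: nat
    let ?c = "measure \<gamma> (cball 0 (real m))"
    have "emeasure \<gamma> (cball 0 (real m)) = ennreal ?c"
      using pos_radonD(3)[OF \<gamma>, of "cball 0 (real m)"] by (intro emeasure_eq_ennreal_measure) auto
    then have "ennreal (q m) * emeasure \<gamma> (cball 0 (real m)) = ennreal (q m * ?c)"
      using q0[of m] by (simp add: ennreal_mult less_imp_le)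
    also have "q m * ?c \<le> (1/2) ^ m" unfolding q_def
      by (simp add: divide_le_eq add_pos_nonneg mult_left_mono)
    finally show "ennreal (q m) * emeasure \<gamma> (cball 0 (real m)) \<le> ennreal ((1/2) ^ m)"
      using ennreal_leI by (metis order.trans)
  qed auto
  also have "\<dots> < \<infinity>" by (subst suminf_ennreal2) (auto intro: summable_geometric)
  finally have fin: "(\<integral>\<^sup>+x. ennreal (wt x) \<partial>\<gamma>) < \<infinity>" .
  have low: "\<exists>c>0. \<forall>x. norm x \<le> R \<longrightarrow> c \<le> wt x" for R
  proof (intro exI[of _ "q (nat \<lceil>R\<rceil>)"] conjI allI impI q0)
    fix x :: 'a assume "norm x \<le> R"
    then have "nat \<lceil>norm x\<rceil> \<le> nat \<lceil>R\<rceil>" by (intro nat_mono ceiling_mono)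
    then show "q (nat \<lceil>R\<rceil>) \<le> wt x" unfolding wt_def by (rule qanti)
  qed
  show ?thesis using m q0 q1 fin low by (intro exI[of _ wt]) (auto simp: wt_def)
qed

lemma combine_linear:
  assumes "bounded_linear L"
  shows "L (combine c z) = combine c (\<lambda>i. L (z i))"
proof -
  interpret L: bounded_linear L by fact
  show ?thesis unfolding combine_def by (simp add: L.sum L.scaleR)
qed

lemma combine_diff: "combine c (\<lambda>i. x i - y i) = combine c x - combine c y"
  by (simp add: combine_def scaleR_diff_right sum_subtractf)

lemma combine_const: "c \<in> forward_weights k \<Longrightarrow> combine c (\<lambda>i. x) = x"
  by (auto simp: combine_def forward_weights_def scaleR_sum_left[symmetric])

lemma norm_combine_le:
  assumes c: "c \<in> forward_weights k" and B: "\<And>i. k \<le> i \<Longrightarrow> norm (x i) \<le> B"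
  shows "norm (combine c x) \<le> B"
proof -
  have c': "\<And>i. 0 \<le> fst c i" "(\<Sum>i\<le>snd c. fst c i) = 1" "\<And>i. i < k \<Longrightarrow> fst c i = 0"
    using c by (auto simp: forward_weights_def)
  have "norm (combine c x) \<le> (\<Sum>i\<le>snd c. norm (fst c i *\<^sub>R x i))" unfolding combine_def by (rule norm_sum)
  also have "\<dots> \<le> (\<Sum>i\<le>snd c. fst c i * B)"
  proof (rule sum_mono)
    fix i show "norm (fst c i *\<^sub>R x i) \<le> fst c i * B"
      using B[of i] c'(1)[of i] c'(3)[of i] by (cases "k \<le> i") (auto intro: mult_left_mono)
  qed
  also have "\<dots> = B" using c'(2) by (simp add: sum_distrib_right[symmetric])
  finally show ?thesis .
qed

text \<open>Only indices from k on enter the k-th combination, so a bound on the tail of x bounds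
  the combination.\<close>

lemma combine_tendsto:
  fixes x :: "nat \<Rightarrow> 'b::real_normed_vector"
  assumes c: "\<And>k. c k \<in> forward_weights k" and x: "x \<longlonglongrightarrow> l"
  shows "(\<lambda>k. combine (c k) x) \<longlonglongrightarrow> l"
  unfolding tendsto_iff
proof (intro allI impI)
  fix e :: real assume "0 < e"
  then have "eventually (\<lambda>i. dist (x i) l < e / 2) sequentially" by (intro tendstoD[OF x]) simp
  then obtain N where N: "\<And>i. N \<le> i \<Longrightarrow> norm (x i - l) \<le> e / 2"
    by (auto simp: eventually_sequentially dist_norm intro: less_imp_le)
  show "eventually (\<lambda>k. dist (combine (c k) x) l < e) sequentially"
    using eventually_ge_at_top[of N]
  proof eventually_elim
    case (elim k)
    have "combine (c k) x - l = combine (c k) (\<lambda>i. x i - l)"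
      by (simp add: combine_diff combine_const[OF c])
    moreover have "norm (combine (c k) (\<lambda>i. x i - l)) \<le> e / 2"
      using N elim by (intro norm_combine_le[OF c]) auto
    ultimately show ?case using \<open>0 < e\<close> by (simp add: dist_norm)
  qed
qed

definition C1 :: "real \<Rightarrow> ('a::euclidean_space \<Rightarrow> real) \<Rightarrow> ('a \<Rightarrow> 'a) \<Rightarrow> bool" where
  "C1 R f g \<longleftrightarrow> (\<forall>x. (f has_derivative (\<lambda>y. g x \<bullet> y)) (at x)) \<and> continuous_on UNIV g \<and>
    (\<forall>x. R < norm x \<longrightarrow> f x = 0 \<and> g x = 0)"

lemma C1_cc:
  assumes "C1 R f g"
  shows "cc f" "cc g"
proof -
  have "continuous_on UNIV f"
    using assms unfolding C1_def by (intro continuous_at_imp_continuous_on) (blast intro: has_derivative_continuous)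
  then show "cc f" "cc g" using assms unfolding cc_def C1_def by blast+
qed

lemma polynomial_gradient:
  fixes q :: "'a::euclidean_space \<Rightarrow> real"
  assumes "real_polynomial_function q"
  shows "\<exists>g. continuous_on UNIV g \<and> (\<forall>x. (q has_derivative (\<lambda>y. g x \<bullet> y)) (at x))"
  using assms
proof induction
  case (linear f)
  interpret bounded_linear f by fact
  have "f y = (\<Sum>i\<in>Basis. f i *\<^sub>R i) \<bullet> y" for y
  proof -
    have "f y = f (\<Sum>i\<in>Basis. (y \<bullet> i) *\<^sub>R i)" by (simp add: euclidean_representation)
    then show ?thesis by (simp add: sum scaleR inner_sum_left inner_commute[of y] mult.commute)
  qed
  then have "(f has_derivative (\<lambda>y. (\<Sum>i\<in>Basis. f i *\<^sub>R i) \<bullet> y)) (at x)" for x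
    using bounded_linear_imp_has_derivative[OF bounded_linear_axioms, of "at x"] by (metis (no_types, lifting) has_derivative_eq_rhs ext)
  then show ?case by (intro exI[of _ "\<lambda>_. \<Sum>i\<in>Basis. f i *\<^sub>R i"]) (auto intro: continuous_intros)
next
  case (const c)
  show ?case by (intro exI[of _ "\<lambda>_. 0"]) (auto intro!: derivative_eq_intros)
next
  case (add f g)
  then obtain F G where "continuous_on UNIV F" "\<And>x. (f has_derivative (\<lambda>y. F x \<bullet> y)) (at x)"
    "continuous_on UNIV G" "\<And>x. (g has_derivative (\<lambda>y. G x \<bullet> y)) (at x)" by blast
  then show ?case
    by (intro exI[of _ "\<lambda>x. F x + G x"]) (auto intro!: continuous_intros derivative_eq_intros simp: inner_add_left)
next
  case (mult f g)
  then obtain F G where FG: "continuous_on UNIV F" "\<And>x. (f has_derivative (\<lambda>y. F x \<bullet> y)) (at x)"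
    "continuous_on UNIV G" "\<And>x. (g has_derivative (\<lambda>y. G x \<bullet> y)) (at x)" by blast
  have "continuous_on UNIV f" "continuous_on UNIV g"
    using FG by (auto intro!: continuous_at_imp_continuous_on has_derivative_continuous)
  moreover have "((\<lambda>x. f x * g x) has_derivative (\<lambda>y. (f x *\<^sub>R G x + g x *\<^sub>R F x) \<bullet> y)) (at x)" for x
    by (rule has_derivative_eq_rhs[OF has_derivative_mult[OF FG(2,4)]]) (simp add: inner_add_left fun_eq_iff mult.commute)
  ultimately show ?case using FG by (intro exI[of _ "\<lambda>x. f x *\<^sub>R G x + g x *\<^sub>R F x"]) (auto intro!: continuous_intros)
qed

text \<open>Stone-Weierstrass gives a polynomial close to f on the larger ball, and a C1 cutoff
  bounds its support. On the transition shell f is 0, so the polynomial is already below e there and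
  cutting off costs nothing.\<close>

lemma C1_dense:
  fixes f :: "'a::euclidean_space \<Rightarrow> real"
  assumes f: "cc f" and R: "0 \<le> R" "\<And>x. R < norm x \<Longrightarrow> f x = 0" and e: "0 < e"
  shows "\<exists>f' g'. C1 (R + 1) f' g' \<and> (\<forall>x. \<bar>f x - f' x\<bar> \<le> e)"
proof -
  have "continuous_on (cball 0 (R + 1)) f" using f by (auto simp: cc_def intro: continuous_on_subset)
  then obtain q where q: "real_polynomial_function q" "\<And>x. x \<in> cball 0 (R + 1) \<Longrightarrow> \<bar>f x - q x\<bar> < e"
    using Stone_Weierstrass_real_polynomial_function[of "cball 0 (R + 1)" f e] e by auto
  obtain g where g: "continuous_on UNIV g" "\<And>x. (q has_derivative (\<lambda>y. g x \<bullet> y)) (at x)"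
    using polynomial_gradient[OF q(1)] by blast
  \<comment> \<open>2R + 1 is the difference of the squares of R + 1 and R, so s rises from 0 to 1
    across the shell; the squared norm is differentiable also at the origin.\<close>
  define s where "s x = (x \<bullet> x - R\<^sup>2) / (2 * R + 1)" for x :: 'a
  define k where "k x = 1 - step (s x)" for x
  define k' where "k' x = (- hat (s x) * 2 / (2 * R + 1)) *\<^sub>R x" for x
  have sd: "(s has_derivative (\<lambda>y. 2 / (2 * R + 1) * (x \<bullet> y))) (at x)" for x
    unfolding s_def using R(1)
    by (auto intro!: derivative_eq_intros simp: inner_commute divide_simps)
  have kd: "(k has_derivative (\<lambda>y. k' x \<bullet> y)) (at x)" for x
  proof -
    have "((\<lambda>x. step (s x)) has_derivative (\<lambda>y. hat (s x) * (2 / (2 * R + 1) * (x \<bullet> y)))) (at x)"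
      using has_derivative_compose[OF sd, of step "(*) (hat (s x))" x] step_deriv[of "s x"]
      by (simp add: has_field_derivative_def)
    then show ?thesis unfolding k_def[abs_def] k'_def by (auto intro!: derivative_eq_intros)
  qed
  have sc: "continuous_on UNIV s" unfolding s_def[abs_def] using R(1) by (intro continuous_intros) auto
  have k'c: "continuous_on UNIV k'" unfolding k'_def[abs_def] using R(1)
    by (intro continuous_intros continuous_on_compose2[OF hat_props(3) sc]) auto
  have kc: "continuous_on UNIV k" using kd by (auto intro!: continuous_at_imp_continuous_on has_derivative_continuous)
  have qc: "continuous_on UNIV q" using g by (auto intro!: continuous_at_imp_continuous_on has_derivative_continuous)
  have s1: "1 \<le> s x" if "R + 1 \<le> norm x" for x
  proof -
    have "(R + 1)\<^sup>2 \<le> (norm x)\<^sup>2" using that R(1) by (intro power_mono) auto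
    then show ?thesis using R(1) by (simp add: s_def le_divide_eq dot_square_norm power2_eq_square algebra_simps)
  qed
  have s0: "s x \<le> 0" if "norm x \<le> R" for x
  proof -
    have "(norm x)\<^sup>2 \<le> R\<^sup>2" using that by (intro power_mono) auto
    then show ?thesis using R(1) by (simp add: s_def divide_le_0_iff power2_norm_eq_inner)
  qed
  have k01: "0 \<le> k x" "k x \<le> 1" for x using step_bounds[of "s x"] by (auto simp: k_def)
  have "C1 (R + 1) (\<lambda>x. k x * q x) (\<lambda>x. k x *\<^sub>R g x + q x *\<^sub>R k' x)"
    unfolding C1_def
  proof (intro conjI allI impI)
    show "((\<lambda>x. k x * q x) has_derivative (\<lambda>y. (k x *\<^sub>R g x + q x *\<^sub>R k' x) \<bullet> y)) (at x)" for x
      by (rule has_derivative_eq_rhs[OF has_derivative_mult[OF kd g(2)]]) (simp add: inner_add_left fun_eq_iff mult.commute)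
    show "continuous_on UNIV (\<lambda>x. k x *\<^sub>R g x + q x *\<^sub>R k' x)" by (intro continuous_intros kc g qc k'c)
    fix x :: 'a assume "R + 1 < norm x"
    then have "1 \<le> s x" by (intro s1) simp
    then have "k x = 0" "k' x = 0" by (simp_all add: k_def k'_def hat_props)
    then show "k x * q x = 0" "k x *\<^sub>R g x + q x *\<^sub>R k' x = 0" by simp_all
  qed
  moreover have "\<bar>f x - k x * q x\<bar> \<le> e" for x
  proof -
    consider "norm x \<le> R" | "R < norm x" "norm x \<le> R + 1" | "R + 1 < norm x" by linarith
    then show ?thesis
    proof cases
      case 1
      then have "k x = 1" using s0 by (simp add: k_def hat_props)
      then show ?thesis using q(2)[of x] 1 by simp
    next
      case 2
      have "\<bar>k x * q x\<bar> \<le> 1 * \<bar>q x\<bar>" unfolding abs_mult using k01[of x] by (intro mult_right_mono) auto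
      then show ?thesis using q(2)[of x] 2 R(2)[of x] by simp
    next
      case 3
      then have "k x = 0" using s1[of x] by (simp add: k_def hat_props)
      then show ?thesis using 3 R(2)[of x] e by simp
    qed
  qed
  ultimately show ?thesis by blast
qed

text \<open>Makes the square admissible as \<open>\<Xi>\<close> in
  \<open>forward_convex_combinations\<close>, which is then applied to bounded scalar densities at
  fixed times.\<close>

lemma square_superlinear:
  assumes "0 < e"
  shows "\<exists>K\<ge>0. \<forall>z::real. ennreal (norm z) \<le> ennreal e * ennreal (z\<^sup>2) + ennreal K"
proof (intro exI[of _ "1 / e"] conjI allI)
  fix z :: real
  have "\<bar>z\<bar> \<le> e * z\<^sup>2 + 1 / e"
  proof -
    have "0 \<le> (e * \<bar>z\<bar> - 1)\<^sup>2 + e * \<bar>z\<bar>" using assms by simp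
    then have "e * \<bar>z\<bar> \<le> e\<^sup>2 * z\<^sup>2 + 1" by (simp add: power2_diff power_mult_distrib)
    then show ?thesis using assms by (simp add: field_simps power2_eq_square)
  qed
  then show "ennreal (norm z) \<le> ennreal e * ennreal (z\<^sup>2) + ennreal (1 / e)"
    using assms by (simp add: ennreal_mult[symmetric] ennreal_plus[symmetric] ennreal_leI del: ennreal_plus)
qed (use assms in simp)

lemma convex_fun_square: "convex_fun (\<lambda>z::real. ennreal (z\<^sup>2))"
  unfolding convex_fun_def
proof (intro allI ballI)
  fix x y t :: real assume t: "t \<in> {0..1}"
  have "((1 - t) *\<^sub>R x + t *\<^sub>R y)\<^sup>2 = (1 - t) * x\<^sup>2 + t * y\<^sup>2 - t * (1 - t) * (x - y)\<^sup>2"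
    by (simp add: power2_eq_square algebra_simps)
  moreover have "0 \<le> t * (1 - t) * (x - y)\<^sup>2" using t by simp
  ultimately have "((1 - t) *\<^sub>R x + t *\<^sub>R y)\<^sup>2 \<le> (1 - t) * x\<^sup>2 + t * y\<^sup>2" by linarith
  then show "ennreal (((1 - t) *\<^sub>R x + t *\<^sub>R y)\<^sup>2) \<le> ennreal (1 - t) * ennreal (x\<^sup>2) + ennreal t * ennreal (y\<^sup>2)"
    using t by (simp add: ennreal_mult[symmetric] ennreal_plus[symmetric] ennreal_leI del: ennreal_plus)
qed

section \<open>Limits of smoothed curves\<close>

text \<open>The index k counts a subsequence already tuned so that the mesh, the relative mass error
  on charged cells and the total mass of uncharged cells are at most
  \<open>1 / (real k + 1)\<close>, while the partition covers the ball of radius k.\<close>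

locale limit_setup =
  fixes p a b A r1 :: real and \<phi>n :: "nat \<Rightarrow> real \<times> 'a::euclidean_space \<Rightarrow> ennreal" and \<phi> :: "real \<times> 'a \<Rightarrow> ennreal"
    and \<gamma>n :: "nat \<Rightarrow> 'a measure" and \<gamma> :: "'a measure"
    and \<mu> :: "nat \<Rightarrow> real \<Rightarrow> 'a set \<Rightarrow> real" and \<nu> :: "nat \<Rightarrow> real \<Rightarrow> 'a set \<Rightarrow> 'a"
    and J J1 :: "nat \<Rightarrow> 'a set" and \<theta> :: "nat \<Rightarrow> 'a \<Rightarrow> 'a \<Rightarrow> real" and \<mu>0 \<mu>1 :: "'a set \<Rightarrow> real" and wt :: "'a \<Rightarrow> real"
  assumes sc: "\<And>k. smoothed_curve p a b A (\<phi>n k) (\<gamma>n k) (\<mu> k) (\<nu> k) \<gamma> (J k) (J1 k) (\<theta> k)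
      (1 / (real k + 1)) (real k) (1 / (real k + 1)) r1"
    and adm: "\<phi> \<in> admissible_on p a b"
    and mono: "\<And>k z. \<phi>n k z \<le> \<phi>n (Suc k) z" and lim: "\<And>z. (\<lambda>k. \<phi>n k z) \<longlonglongrightarrow> \<phi> z"
    and null: "\<And>k. (\<Sum>j\<in>J k - J1 k. \<integral>x. \<theta> k j x \<partial>\<gamma>n k) \<le> 1 / (real k + 1)"
    and mass: "\<And>R. \<exists>B. \<forall>k. measure (\<gamma>n k) (cball 0 R) \<le> B"
    and ends: "\<And>f. cc f \<Longrightarrow> (\<lambda>k. signed_integral (\<mu> k 0) f) \<longlonglongrightarrow> signed_integral \<mu>0 f"
      "\<And>f. cc f \<Longrightarrow> (\<lambda>k. signed_integral (\<mu> k 1) f) \<longlonglongrightarrow> signed_integral \<mu>1 f"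
    and rad_ends: "radon \<mu>0" "radon \<mu>1"
    and wt: "wt \<in> borel_measurable borel" "\<And>x. 0 < wt x" "\<And>x. wt x \<le> 1"
      "(\<integral>\<^sup>+x. ennreal (wt x) \<partial>\<gamma>) < \<infinity>" "\<And>R. \<exists>c>0. \<forall>x. norm x \<le> R \<longrightarrow> c \<le> wt x"
begin

sublocale sc: smoothed_curve p a b A "\<phi>n k" "\<gamma>n k" "\<mu> k" "\<nu> k" \<gamma> "J k" "J1 k" "\<theta> k"
    "1 / (real k + 1)" "real k" "1 / (real k + 1)" r1 for k
  by (rule sc)

definition U :: "nat \<Rightarrow> 'a \<Rightarrow> real \<Rightarrow> real \<times> 'a" where "U k = sc.U k"

text \<open>A finite measure equivalent to \<open>\<gamma>\<close>. Together with the time measure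
  it forms the finite measure P that the selection of convex combinations requires.\<close>

definition \<gamma>w :: "'a measure" where "\<gamma>w = density \<gamma> (\<lambda>x. ennreal (wt x))"
definition \<tau> :: "real measure" where "\<tau> = density lborel (\<lambda>t. ennreal (indicator {0..1} t))"
definition P :: "(real \<times> 'a) measure" where "P = \<tau> \<Otimes>\<^sub>M \<gamma>w"

lemma \<gamma>: "pos_radon \<gamma>" by (rule sc.\<gamma>0)

lemma sets_\<gamma> [measurable_cong, simp]: "sets \<gamma> = sets borel" by (rule pos_radonD(1)[OF \<gamma>])

lemma sets_\<gamma>w [measurable_cong, simp]: "sets \<gamma>w = sets borel" by (simp add: \<gamma>w_def)

lemma sets_\<tau> [measurable_cong, simp]: "sets \<tau> = sets borel" by (simp add: \<tau>_def)

lemma sets_P [measurable_cong, simp]: "sets P = sets (borel \<Otimes>\<^sub>M borel)"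
  unfolding P_def by (rule sets_pair_measure_cong) simp_all

lemma wt_measurable [measurable]: "wt \<in> borel_measurable borel" by (rule wt(1))

lemma nn_integral_\<tau>: "f \<in> borel_measurable borel \<Longrightarrow> (\<integral>\<^sup>+t. f t \<partial>\<tau>) = (\<integral>\<^sup>+t\<in>{0..1}. f t \<partial>lborel)"
  unfolding \<tau>_def by (subst nn_integral_density) (auto intro!: nn_integral_cong simp: indicator_def)

lemma integral_\<tau>:
  fixes f :: "real \<Rightarrow> real"
  shows "f \<in> borel_measurable borel \<Longrightarrow> (\<integral>t. f t \<partial>\<tau>) = (LINT t:{0..1}|lborel. f t)"
  unfolding \<tau>_def set_lebesgue_integral_def by (subst integral_density) auto

lemma AE_\<tau>: "(AE t in \<tau>. Q t) \<longleftrightarrow> (AE t in lborel. t \<in> {0..1} \<longrightarrow> Q t)"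
  unfolding \<tau>_def by (subst AE_density) (auto simp: indicator_def)

lemma nn_integral_\<gamma>w: "f \<in> borel_measurable borel \<Longrightarrow> (\<integral>\<^sup>+x. f x \<partial>\<gamma>w) = (\<integral>\<^sup>+x. ennreal (wt x) * f x \<partial>\<gamma>)"
  unfolding \<gamma>w_def by (subst nn_integral_density) auto

lemma AE_\<gamma>w: "(AE x in \<gamma>w. Q x) \<longleftrightarrow> (AE x in \<gamma>. Q x)"
  unfolding \<gamma>w_def using wt(2) by (subst AE_density) auto

lemma finite_\<gamma>w: "finite_measure \<gamma>w"
proof
  have "emeasure \<gamma>w (space \<gamma>w) = (\<integral>\<^sup>+x. 1 \<partial>\<gamma>w)" by simp
  also have "\<dots> = (\<integral>\<^sup>+x. ennreal (wt x) \<partial>\<gamma>)" by (subst nn_integral_\<gamma>w) auto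
  finally show "emeasure \<gamma>w (space \<gamma>w) \<noteq> \<infinity>" using wt(4) by auto
qed

lemma finite_\<tau>: "finite_measure \<tau>"
proof
  have "emeasure \<tau> (space \<tau>) = (\<integral>\<^sup>+x. 1 \<partial>\<tau>)" by simp
  also have "\<dots> = (\<integral>\<^sup>+t. 1 * indicator {0..1} t \<partial>(lborel :: real measure))"
    by (rule nn_integral_\<tau>[of "\<lambda>_. 1"]) simp
  finally show "emeasure \<tau> (space \<tau>) \<noteq> \<infinity>" by simp
qed

sublocale \<gamma>w: finite_measure \<gamma>w by (rule finite_\<gamma>w)
sublocale \<tau>: finite_measure \<tau> by (rule finite_\<tau>)
sublocale P: pair_sigma_finite \<tau> \<gamma>w ..

lemma finite_P: "finite_measure P"
  unfolding P_def by (rule finite_measure_pair_measure) (rule finite_\<tau> finite_\<gamma>w)+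

lemma \<phi>n_mono: "k \<le> m \<Longrightarrow> \<phi>n k z \<le> \<phi>n m z"
  using mono by (rule lift_Suc_mono_le)

lemma \<phi>n_measurable [measurable]: "\<phi>n k \<in> borel_measurable borel"
  by (rule lsc_borel_measurable[OF admissible_onD(1)[OF sc.adm]])

text \<open>\<open>\<phi>n 0\<close> lies below all later densities, so its growth constant serves
  every k; here monotonicity of the sequence provides uniformity.\<close>

lemma superlinear:
  assumes "0 < e"
  shows "\<exists>K\<ge>0. \<forall>z k. ennreal (norm z) \<le> ennreal e * \<phi>n k z + ennreal K"
proof -
  obtain K where K: "0 \<le> K" "\<And>z. ennreal (norm z) \<le> ennreal e * \<phi>n 0 z + ennreal K"
    using admissible_superlinear[OF sc.adm[of 0] sc.p sc.ab assms] by blast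
  have "ennreal (norm z) \<le> ennreal e * \<phi>n k z + ennreal K" for z k
    by (rule order.trans[OF K(2) add_right_mono[OF mult_left_mono[OF \<phi>n_mono]]]) auto
  then show ?thesis using K(1) by blast
qed

lemma U_measurable [measurable]: "(\<lambda>z. U k (snd z) (fst z)) \<in> borel_measurable (borel \<Otimes>\<^sub>M borel)"
proof -
  have "(\<lambda>(x, t). U k x t) \<circ> (\<lambda>z. (snd z, fst z)) \<in> borel_measurable (borel \<Otimes>\<^sub>M borel)"
    unfolding U_def by (rule measurable_comp[OF _ sc.U_measurable]) measurable
  then show ?thesis by (simp add: o_def)
qed

lemma U_measurable_x [measurable]: "(\<lambda>x. U k x t) \<in> borel_measurable borel"
proof -
  have "(\<lambda>x. (t, x)) \<in> borel \<rightarrow>\<^sub>M borel \<Otimes>\<^sub>M borel" by measurable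
  from measurable_comp[OF this U_measurable[of k]] show ?thesis by (simp add: o_def)
qed

lemma U_energy:
  assumes "m \<le> k"
  shows "(\<integral>\<^sup>+t\<in>{0..1}. (\<integral>\<^sup>+x. \<phi>n m (U k x t) \<partial>\<gamma>) \<partial>lborel) \<le> ennreal ((1 + 1 / (real k + 1)) * A)"
  unfolding U_def by (rule sc.U_energy_integral) (use \<phi>n_mono[OF assms] in auto)

lemma U_energy_P: "(\<integral>\<^sup>+z. \<phi>n 0 (U k (snd z) (fst z)) \<partial>P) \<le> ennreal (2 * A)"
proof -
  have "(\<integral>\<^sup>+z. \<phi>n 0 (U k (snd z) (fst z)) \<partial>P) = (\<integral>\<^sup>+t. \<integral>\<^sup>+x. \<phi>n 0 (U k x t) \<partial>\<gamma>w \<partial>\<tau>)"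
    unfolding P_def using \<gamma>w.nn_integral_fst[of "\<lambda>z. \<phi>n 0 (U k (snd z) (fst z))" \<tau>]
    by (simp add: measurable_cong_sets[OF sets_P[unfolded P_def] refl])
  also have "\<dots> \<le> (\<integral>\<^sup>+t. \<integral>\<^sup>+x. \<phi>n 0 (U k x t) \<partial>\<gamma> \<partial>\<tau>)"
  proof (rule nn_integral_mono)
    fix t
    have "(\<integral>\<^sup>+x. \<phi>n 0 (U k x t) \<partial>\<gamma>w) = (\<integral>\<^sup>+x. ennreal (wt x) * \<phi>n 0 (U k x t) \<partial>\<gamma>)"
      by (rule nn_integral_\<gamma>w) measurable
    also have "\<dots> \<le> (\<integral>\<^sup>+x. 1 * \<phi>n 0 (U k x t) \<partial>\<gamma>)"
      using wt(3) by (intro nn_integral_mono mult_right_mono) (simp_all add: ennreal_le_1)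
    finally show "(\<integral>\<^sup>+x. \<phi>n 0 (U k x t) \<partial>\<gamma>w) \<le> (\<integral>\<^sup>+x. \<phi>n 0 (U k x t) \<partial>\<gamma>)" by simp
  qed
  also have "\<dots> = (\<integral>\<^sup>+t\<in>{0..1}. (\<integral>\<^sup>+x. \<phi>n 0 (U k x t) \<partial>\<gamma>) \<partial>lborel)"
  proof (rule nn_integral_\<tau>)
    interpret \<gamma>: sigma_finite_measure \<gamma> by (rule pos_radon_sigma_finite[OF \<gamma>])
    show "(\<lambda>t. \<integral>\<^sup>+x. \<phi>n 0 (U k x t) \<partial>\<gamma>) \<in> borel_measurable borel"
      using \<gamma>.borel_measurable_nn_integral_fst[of "\<lambda>z. \<phi>n 0 (U k (snd z) (fst z))" borel] by simp
  qed
  also have "\<dots> \<le> ennreal ((1 + 1 / (real k + 1)) * A)" by (rule U_energy) simp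
  also have "\<dots> \<le> ennreal (2 * A)"
    using sc.A0 by (intro ennreal_leI mult_right_mono) (simp_all add: divide_le_eq)
  finally show ?thesis .
qed

lemma U_integrable: "integrable P (\<lambda>z. U k (snd z) (fst z))"
proof -
  interpret finite_measure P by (rule finite_P)
  obtain K where K: "0 \<le> K" "\<And>z. ennreal (norm z) \<le> ennreal 1 * \<phi>n 0 z + ennreal K"
    using superlinear[of 1] by auto
  have "(\<integral>\<^sup>+z. ennreal (norm (U k (snd z) (fst z))) \<partial>P) \<le> (\<integral>\<^sup>+z. \<phi>n 0 (U k (snd z) (fst z)) + ennreal K \<partial>P)"
    using K(2) by (intro nn_integral_mono) simp
  also have "\<dots> = (\<integral>\<^sup>+z. \<phi>n 0 (U k (snd z) (fst z)) \<partial>P) + ennreal K * emeasure P (space P)"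
    by (subst nn_integral_add) auto
  also have "\<dots> < \<infinity>"
    using U_energy_P[of k] by (simp add: emeasure_eq_measure ennreal_mult_less_top le_less_trans)
  finally show ?thesis by (intro integrableI_bounded) auto
qed

definition V :: "(nat \<Rightarrow> (nat \<Rightarrow> real) \<times> nat) \<Rightarrow> nat \<Rightarrow> real \<times> 'a \<Rightarrow> real \<times> 'a" where
  "V c k z = combine (c k) (\<lambda>i. U i (snd z) (fst z))"

lemma V_measurable [measurable]: "V c k \<in> borel_measurable (borel \<Otimes>\<^sub>M borel)"
  unfolding V_def combine_def by (intro borel_measurable_sum borel_measurable_scaleR U_measurable) auto

lemma V_integrable: "integrable P (V c k)"
  unfolding V_def combine_def by (intro Bochner_Integration.integrable_sum integrable_scaleR_right U_integrable)

text \<open>L1 convergence on the product space gives L1 convergence of the slices at almost every t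
  only along a further subsequence, and a subsequence of forward combinations is again
  forward.\<close>

lemma combinations_exist:
  "\<exists>c v. (\<forall>k. c k \<in> forward_weights k) \<and> v \<in> borel_measurable (borel \<Otimes>\<^sub>M borel) \<and> integrable P v \<and>
    (AE z in P. (\<lambda>k. V c k z) \<longlonglongrightarrow> v z) \<and> (\<lambda>k. \<integral>z. norm (V c k z - v z) \<partial>P) \<longlonglongrightarrow> 0 \<and>
    (AE t in \<tau>. (\<lambda>k. \<integral>x. norm (V c k (t, x) - v (t, x)) \<partial>\<gamma>w) \<longlonglongrightarrow> 0)"
proof -
  have "\<exists>c v. (\<forall>k. c k \<in> forward_weights k) \<and> integrable P v \<and>
    (\<forall>k. integrable P (\<lambda>z. combine (c k) (\<lambda>i. U i (snd z) (fst z)))) \<and>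
    (AE z in P. (\<lambda>k. combine (c k) (\<lambda>i. U i (snd z) (fst z))) \<longlonglongrightarrow> v z) \<and>
    (\<lambda>k. \<integral>z. norm (combine (c k) (\<lambda>i. U i (snd z) (fst z)) - v z) \<partial>P) \<longlonglongrightarrow> 0"
  proof (rule forward_convex_combinations[OF finite_P])
    show "convex_fun (\<phi>n 0)" by (rule admissible_onD(2)[OF sc.adm])
    show "\<exists>K\<ge>0. \<forall>z. ennreal (norm z) \<le> ennreal e * \<phi>n 0 z + ennreal K" if "0 < e" for e
      using superlinear[OF that] by blast
    show "0 \<le> 2 * A" using sc.A0 by simp
  qed (use U_energy_P in auto)
  then obtain c v where c: "\<And>k. c k \<in> forward_weights k" and v: "integrable P v"
    "AE z in P. (\<lambda>k. V c k z) \<longlonglongrightarrow> v z" "(\<lambda>k. \<integral>z. norm (V c k z - v z) \<partial>P) \<longlonglongrightarrow> 0"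
    unfolding V_def by blast
  define T where "T k t = (\<integral>x. norm (V c k (t, x) - v (t, x)) \<partial>\<gamma>w)" for k t
  have d: "integrable (\<tau> \<Otimes>\<^sub>M \<gamma>w) (\<lambda>z. norm (V c k z - v z))" for k
    using V_integrable v(1) unfolding P_def by auto
  have Ti: "integrable \<tau> (T k)" for k
    using P.integrable_fst'[OF d[of k]] unfolding T_def .
  have "(\<integral>t. T k t \<partial>\<tau>) = (\<integral>z. norm (V c k z - v z) \<partial>P)" for k
    unfolding T_def P_def by (rule P.integral_fst'[OF d])
  then have "(\<lambda>k. \<integral>t. norm (T k t) \<partial>\<tau>) \<longlonglongrightarrow> 0"
    using v(3) by (simp add: T_def)
  from tendsto_L1_AE_subseq[OF Ti this]
  obtain r where r: "strict_mono r" "AE t in \<tau>. (\<lambda>k. T (r k) t) \<longlonglongrightarrow> 0" by blast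
  define c' where "c' k = c (r k)" for k
  have V': "V c' k = V c (r k)" for k by (simp add: V_def c'_def fun_eq_iff)
  show ?thesis
  proof (intro exI[of _ c'] exI[of _ v] conjI allI)
    show "c' k \<in> forward_weights k" for k
      using c[of "r k"] forward_weights_mono[OF seq_suble[OF r(1), of k]] by (auto simp: c'_def)
    show "v \<in> borel_measurable (borel \<Otimes>\<^sub>M borel)"
      using borel_measurable_integrable[OF v(1)] by (simp add: measurable_cong_sets[OF sets_P refl])
    show "AE z in P. (\<lambda>k. V c' k z) \<longlonglongrightarrow> v z"
      using v(2)
    proof eventually_elim
      case (elim z)
      show ?case using LIMSEQ_subseq_LIMSEQ[OF elim r(1)] by (simp add: o_def V')
    qed
    show "(\<lambda>k. \<integral>z. norm (V c' k z - v z) \<partial>P) \<longlonglongrightarrow> 0"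
      using LIMSEQ_subseq_LIMSEQ[OF v(3) r(1)] by (simp add: o_def V')
    show "AE t in \<tau>. (\<lambda>k. \<integral>x. norm (V c' k (t, x) - v (t, x)) \<partial>\<gamma>w) \<longlonglongrightarrow> 0"
      using r(2) by (simp add: T_def V')
  qed (rule v(1))
qed

text \<open>The growth constant and the mass bound are both uniform in k, so
  \<open>increment\<close> becomes one modulus of continuity for all curves.\<close>

lemma modulus:
  assumes f: "C1 R f g" and e: "0 < \<epsilon>"
  shows "\<exists>\<delta>>0. \<forall>k s t. 0 \<le> s \<longrightarrow> s \<le> t \<longrightarrow> t \<le> 1 \<longrightarrow> t - s \<le> \<delta> \<longrightarrow>
    \<bar>signed_integral (\<mu> k t) f - signed_integral (\<mu> k s) f\<bar> \<le> \<epsilon>"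
proof -
  obtain M' where M': "0 \<le> M'" "\<And>x. norm (g x) \<le> M'" using cc_bounded[OF C1_cc(2)[OF f]] by metis
  define M where "M = M' + 1"
  have M: "0 < M" "\<And>x. norm (g x) \<le> M" using M' by (auto simp: M_def intro: add_increasing2)
  \<comment> \<open>Fixed before K and \<delta>: the part \<open>M * e * A\<close> of
    \<open>increment\<close> does not shrink with t - s and uses the first half of
    \<epsilon>.\<close>
  define e where "e = (\<epsilon> / (2 * M)) / (A + 1)"
  have A0: "0 \<le> A" by (rule sc.A0)
  have e0: "0 < e" using M e A0 by (simp add: e_def)
  obtain K where K: "0 \<le> K" "\<And>z k. ennreal (norm z) \<le> ennreal e * \<phi>n k z + ennreal K"
    using superlinear[OF e0] by blast
  obtain B where B: "\<And>k. measure (\<gamma>n k) (cball 0 R) \<le> B" using mass[of R] by blast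
  have B0: "0 \<le> B" using B[of 0] by (rule order.trans[rotated]) simp
  define \<delta> where "\<delta> = (\<epsilon> / 2) / (M * K * B + 1)"
  have MKB: "0 < M * K * B + 1" using M K B0 by (simp add: add_nonneg_pos)
  show ?thesis
  proof (intro exI[of _ \<delta>] conjI allI impI)
    show "0 < \<delta>" using e MKB unfolding \<delta>_def by (intro divide_pos_pos) auto
    fix k s t assume st: "0 \<le> s" "s \<le> t" "t \<le> 1" "t - s \<le> \<delta>"
    have "\<bar>signed_integral (\<mu> k t) f - signed_integral (\<mu> k s) f\<bar>
      \<le> M * e * A + M * K * measure (\<gamma>n k) (cball 0 R) * (t - s)"
      using f M e0 K st unfolding C1_def by (intro sc.increment[where g = g] C1_cc(1)[OF f]) auto
    also have "\<dots> \<le> M * e * A + (M * K * B + 1) * \<delta>"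
    proof (intro add_left_mono mult_mono)
      have "M * K * measure (\<gamma>n k) (cball 0 R) \<le> M * K * B" using M K B by (intro mult_left_mono) auto
      then show "M * K * measure (\<gamma>n k) (cball 0 R) \<le> M * K * B + 1" by simp
    qed (use st MKB in auto)
    also have "(M * K * B + 1) * \<delta> = \<epsilon> / 2" by (metis \<delta>_def MKB nonzero_eq_divide_eq less_irrefl mult.commute)
    also have "M * e * A \<le> M * e * (A + 1)" using M e0 by (intro mult_left_mono) auto
    also have "e * (A + 1) = \<epsilon> / (2 * M)"
      using A0 by (intro iffD1[OF nonzero_eq_divide_eq _, OF _ e_def]) simp
    then have "M * e * (A + 1) = \<epsilon> / 2" using M by (simp add: mult.assoc)
    finally show "\<bar>signed_integral (\<mu> k t) f - signed_integral (\<mu> k s) f\<bar> \<le> \<epsilon>" by simp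
  qed
qed

section \<open>Smoothing errors along the sequence\<close>

lemma inverse_Suc_tendsto: "(\<lambda>k. 1 / (real k + 1)) \<longlonglongrightarrow> 0" by real_asymp

lemma measure_cball_bounded:
  "\<exists>B\<ge>0. \<forall>k. measure (\<gamma>n k) (cball 0 (R + 2 * (1 / (real k + 1)))) \<le> B"
proof -
  obtain B where B: "\<And>k. measure (\<gamma>n k) (cball 0 (R + 2)) \<le> B" using mass[of "R + 2"] by blast
  have "measure (\<gamma>n k) (cball 0 (R + 2 * (1 / (real k + 1)))) \<le> B" for k
  proof -
    have "2 * (1 / (real k + 1)) \<le> 2" by (simp add: divide_le_eq)
    then have "cball (0::'a) (R + 2 * (1 / (real k + 1))) \<subseteq> cball 0 (R + 2)" by auto
    then have "measure (\<gamma>n k) (cball 0 (R + 2 * (1 / (real k + 1)))) \<le> measure (\<gamma>n k) (cball 0 (R + 2))"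
      using pos_radonD(3)[OF sc.\<gamma>, of "cball 0 (R + 2)" k]
      by (intro measure_mono_fmeasurable fmeasurableI) (auto simp: pos_radonD(1)[OF sc.\<gamma>])
    then show ?thesis using B order.trans by blast
  qed
  moreover have "0 \<le> B" using B[of 0] by (rule order.trans[rotated]) simp
  ultimately show ?thesis by blast
qed

lemma eventually_oscillation:
  fixes F :: "'b::euclidean_space \<Rightarrow> 'c::real_normed_vector"
  assumes "cc F" "0 < \<delta>"
  shows "eventually (\<lambda>k. \<forall>x y. dist x y < 1 / (real k + 1) \<longrightarrow> norm (F x - F y) \<le> \<delta>) sequentially"
proof -
  obtain d where d: "d > 0" "\<forall>x y. dist x y < d \<longrightarrow> norm (F x - F y) \<le> \<delta>"
    using cc_uniform[OF assms] by blast
  have "eventually (\<lambda>k. 1 / (real k + 1) < d) sequentially"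
    using order_tendstoD(2)[OF inverse_Suc_tendsto d(1)] .
  then show ?thesis by eventually_elim (use d(2) in auto)
qed

lemma error_fst:
  assumes f: "cc f" and \<epsilon>: "0 < \<epsilon>"
  shows "eventually (\<lambda>k. \<forall>t\<in>{0..1}. \<bar>signed_integral (\<mu> k t) f - (\<integral>x. f x * fst (U k x t) \<partial>\<gamma>)\<bar> \<le> \<epsilon>) sequentially"
proof -
  obtain M where M: "0 \<le> M" "\<And>x. norm (f x) \<le> M" using cc_bounded[OF f] by metis
  obtain R where R: "\<And>x. R < norm x \<Longrightarrow> f x = 0" using f by (auto simp: cc_def)
  obtain B where B: "0 \<le> B" "\<And>k. measure (\<gamma>n k) (cball 0 (R + 2 * (1 / (real k + 1)))) \<le> B"
    using measure_cball_bounded by blast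
  define C where "C = max \<bar>a\<bar> \<bar>b\<bar>"
  have C0: "0 \<le> C" by (simp add: C_def)
  \<comment> \<open>With this \<delta> the part of the error that does not vanish with the mesh is
    at most \<epsilon>/2.\<close>
  define \<delta> where "\<delta> = (\<epsilon> / 6) / (C * B + 1)"
  have CB: "0 < C * B + 1" using C0 B by (simp add: add_nonneg_pos)
  have \<delta>: "0 < \<delta>" using \<epsilon> CB unfolding \<delta>_def by (intro divide_pos_pos) auto
  have "(\<lambda>k. C * ((3 * \<delta> + M * (1 / (real k + 1))) * B + M * (1 / (real k + 1)))) \<longlonglongrightarrow> C * ((3 * \<delta> + M * 0) * B + M * 0)"
    by (intro tendsto_intros inverse_Suc_tendsto)
  moreover have "C * ((3 * \<delta> + M * 0) * B + M * 0) < \<epsilon>"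
  proof -
    have "3 * \<delta> * (C * B) \<le> 3 * \<delta> * (C * B + 1)" using \<delta> by (intro mult_left_mono) auto
    also have "\<delta> * (C * B + 1) = \<epsilon> / 6" by (metis \<delta>_def CB nonzero_eq_divide_eq less_irrefl)
    then have "3 * \<delta> * (C * B + 1) = \<epsilon> / 2" by simp
    finally show ?thesis using \<epsilon> by (simp add: algebra_simps)
  qed
  ultimately have "eventually (\<lambda>k. C * ((3 * \<delta> + M * (1 / (real k + 1))) * B + M * (1 / (real k + 1))) < \<epsilon>) sequentially"
    by (rule order_tendstoD(2))
  moreover have "eventually (\<lambda>k. R \<le> real k) sequentially"
    using filterlim_real_sequentially unfolding filterlim_at_top by blast
  ultimately show ?thesis
    using eventually_oscillation[OF f \<delta>]
  proof eventually_elim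
    case (elim k)
    show ?case
    proof
      fix t :: real assume t: "t \<in> {0..1}"
      have "\<bar>signed_integral (\<mu> k t) f - (\<integral>x. f x * fst (U k x t) \<partial>\<gamma>)\<bar>
        \<le> C * ((3 * \<delta> + M * (1 / (real k + 1))) * measure (\<gamma>n k) (cball 0 (R + 2 * (1 / (real k + 1)))) + M * (\<Sum>j\<in>J k - J1 k. \<integral>x. \<theta> k j x \<partial>\<gamma>n k))"
        unfolding U_def C_def sc.C\<rho>_def[symmetric] 
        using M R elim \<delta> t by (intro sc.U_error_fst f) auto
      also have "\<dots> \<le> C * ((3 * \<delta> + M * (1 / (real k + 1))) * B + M * (1 / (real k + 1)))"
        using C0 \<delta> M(1) by (intro mult_left_mono add_mono B null) auto
      also have "\<dots> \<le> \<epsilon>" using elim by simp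
      finally show "\<bar>signed_integral (\<mu> k t) f - (\<integral>x. f x * fst (U k x t) \<partial>\<gamma>)\<bar> \<le> \<epsilon>" .
    qed
  qed
qed

lemma error_integral:
  fixes F :: "'a \<times> real \<Rightarrow> real \<times> 'a"
  assumes F: "cc F" and \<epsilon>: "0 < \<epsilon>"
  shows "eventually (\<lambda>k. (\<integral>\<^sup>+t\<in>{0..1}. ennreal \<bar>pairing (\<mu> k t) (\<nu> k t) (\<lambda>x. F (x, t)) - (\<integral>x. F (x, t) \<bullet> U k x t \<partial>\<gamma>)\<bar> \<partial>lborel)
    \<le> ennreal \<epsilon>) sequentially"
proof -
  obtain M' where M': "0 \<le> M'" "\<And>z. norm (F z) \<le> M'" using cc_bounded[OF F] by metis
  define M where "M = M' + 1"
  have M: "0 < M" "\<And>z. norm (F z) \<le> M" using M' by (auto simp: M_def intro: add_increasing2)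
  obtain R where R: "\<And>z. R < norm z \<Longrightarrow> F z = 0" using F by (auto simp: cc_def)
  have R': "F (x, t) = 0" if "R < norm x" for x t using R[of "(x, t)"] that norm_fst_le[of x t] by simp
  obtain B where B: "0 \<le> B" "\<And>k. measure (\<gamma>n k) (cball 0 (R + 2 * (1 / (real k + 1)))) \<le> B"
    using measure_cball_bounded by blast
  have A0: "0 \<le> A" by (rule sc.A0)
  obtain K1 where K1: "0 \<le> K1" "\<And>z k. ennreal (norm z) \<le> \<phi>n k z + ennreal K1" using superlinear[of 1] by auto
  define e where "e = (\<epsilon> / (4 * M)) / (A + 1)"
  have e0: "0 < e" using M \<epsilon> A0 by (simp add: e_def)
  obtain K where K: "0 \<le> K" "\<And>z k. ennreal (norm z) \<le> ennreal e * \<phi>n k z + ennreal K"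
    using superlinear[OF e0] by blast
  define \<delta> where "\<delta> = (\<epsilon> / 12) / (A + K1 * B + 1)"
  have AKB: "0 < A + K1 * B + 1" using A0 K1 B by (simp add: add_nonneg_pos)
  have \<delta>: "0 < \<delta>" using \<epsilon> AKB unfolding \<delta>_def by (intro divide_pos_pos) auto
  \<comment> \<open>The error bound as a function of the mesh h. At h = 0 the terms with \<delta>
    and the term with e remain, and the choices above leave at most \<epsilon>/4 for each
    group.\<close>
  define E where "E h = (3 * \<delta> + M * h + M * e) * A + ((3 * \<delta> + M * h) * K1 * B + M * K * h)" for h
  have "(\<lambda>k. E (1 / (real k + 1))) \<longlonglongrightarrow> E 0" unfolding E_def by (intro tendsto_intros inverse_Suc_tendsto)
  moreover have "E 0 < \<epsilon>"
  proof -
    have "3 * \<delta> * (A + K1 * B) \<le> 3 * \<delta> * (A + K1 * B + 1)" using \<delta> by (intro mult_left_mono) auto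
    also have "\<delta> * (A + K1 * B + 1) = \<epsilon> / 12" by (metis \<delta>_def AKB nonzero_eq_divide_eq less_irrefl)
    then have "3 * \<delta> * (A + K1 * B + 1) = \<epsilon> / 4" by simp
    finally have 1: "3 * \<delta> * (A + K1 * B) \<le> \<epsilon> / 4" .
    have "M * e * A \<le> M * e * (A + 1)" using M e0 by (intro mult_left_mono) auto
    also have "e * (A + 1) = \<epsilon> / (4 * M)"
      using A0 by (intro iffD1[OF nonzero_eq_divide_eq _, OF _ e_def]) simp
    then have "M * e * (A + 1) = \<epsilon> / 4" using M by (simp add: mult.assoc)
    finally show ?thesis using 1 \<epsilon> by (simp add: E_def algebra_simps)
  qed
  ultimately have "eventually (\<lambda>k. E (1 / (real k + 1)) < \<epsilon>) sequentially" by (rule order_tendstoD(2))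
  moreover have "eventually (\<lambda>k. R \<le> real k) sequentially"
    using filterlim_real_sequentially unfolding filterlim_at_top by blast
  ultimately show ?thesis
    using eventually_oscillation[OF F \<delta>]
  proof eventually_elim
    case (elim k)
    have osc: "norm (F (x, t) - F (y, t)) \<le> \<delta>" if "dist x y < 1 / (real k + 1)" for x y t
      using elim(3) that by (simp add: dist_Pair_Pair)
    have "(\<integral>\<^sup>+t\<in>{0..1}. ennreal \<bar>pairing (\<mu> k t) (\<nu> k t) (\<lambda>x. F (x, t)) - (\<integral>x. F (x, t) \<bullet> U k x t \<partial>\<gamma>)\<bar> \<partial>lborel)
      \<le> ennreal ((3 * \<delta> + M * (1 / (real k + 1)) + M * e) * A
        + ((3 * \<delta> + M * (1 / (real k + 1))) * K1 * measure (\<gamma>n k) (cball 0 (R + 2 * (1 / (real k + 1)))) + M * K * (\<Sum>j\<in>J k - J1 k. \<integral>x. \<theta> k j x \<partial>\<gamma>n k)))"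
      unfolding U_def using \<delta> M K K1 e0 elim by (intro sc.U_error_integral(2) F R' osc) auto
    also have "\<dots> \<le> ennreal (E (1 / (real k + 1)))"
      unfolding E_def using \<delta> M(1) K K1 by (intro ennreal_leI add_left_mono add_mono mult_left_mono B null) auto
    also have "\<dots> \<le> ennreal \<epsilon>" using elim by (intro ennreal_leI) simp
    finally show ?case .
  qed
qed

end

section \<open>The limit density and its time slices\<close>

locale limit_curve = limit_setup +
  fixes c :: "nat \<Rightarrow> (nat \<Rightarrow> real) \<times> nat" and v :: "real \<times> 'a::euclidean_space \<Rightarrow> real \<times> 'a"
  assumes c: "\<And>k. c k \<in> forward_weights k" and vm [measurable]: "v \<in> borel_measurable (borel \<Otimes>\<^sub>M borel)"
    and vi: "integrable P v" and vae: "AE z in P. (\<lambda>k. V c k z) \<longlonglongrightarrow> v z"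
    and vL1: "(\<lambda>k. \<integral>z. norm (V c k z - v z) \<partial>P) \<longlonglongrightarrow> 0"
    and vt: "AE t in \<tau>. (\<lambda>k. \<integral>x. norm (V c k (t, x) - v (t, x)) \<partial>\<gamma>w) \<longlonglongrightarrow> 0"
begin

definition C :: real where "C = max \<bar>a\<bar> \<bar>b\<bar>"

text \<open>v altered on a null set of times so that every slice, and not only almost every one, is
  integrable; \<open>\<nu>s t\<close> is then a Radon measure for each t, as \<open>CE\<close>
  demands.\<close>

definition w :: "real \<times> 'a \<Rightarrow> real \<times> 'a" where
  "w z = (if (\<integral>\<^sup>+x. ennreal (norm (v (fst z, x))) \<partial>\<gamma>w) < \<infinity> then v z else 0)"

text \<open>The times at which all limits may be taken slice by slice. They have full measure in
  [0, 1], hence are dense.\<close>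

definition good :: "real \<Rightarrow> bool" where
  "good t \<longleftrightarrow> t \<in> {0..1} \<and> (\<forall>i. integrable \<gamma>w (\<lambda>x. U i x t)) \<and> (\<integral>\<^sup>+x. ennreal (norm (v (t, x))) \<partial>\<gamma>w) < \<infinity> \<and>
    (\<lambda>k. \<integral>x. norm (V c k (t, x) - v (t, x)) \<partial>\<gamma>w) \<longlonglongrightarrow> 0 \<and> (AE x in \<gamma>. \<bar>fst (v (t, x))\<bar> \<le> C)"

lemma w_measurable [measurable]: "w \<in> borel_measurable (borel \<Otimes>\<^sub>M borel)"
proof -
  have "(\<lambda>t. \<integral>\<^sup>+x. ennreal (norm (v (t, x))) \<partial>\<gamma>w) \<in> borel_measurable borel"
    using \<gamma>w.borel_measurable_nn_integral_fst[of "\<lambda>z. ennreal (norm (v z))" borel] by simp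
  then show ?thesis unfolding w_def by measurable
qed

lemma w_measurable_x [measurable]: "(\<lambda>x. w (t, x)) \<in> borel_measurable borel"
  using measurable_comp[OF measurable_Pair1'[of t borel borel] w_measurable] by (simp add: o_def)

lemma v_measurable_x [measurable]: "(\<lambda>x. v (t, x)) \<in> borel_measurable borel"
  using measurable_comp[OF measurable_Pair1'[of t borel borel] vm] by (simp add: o_def)

lemma w_good: "good t \<Longrightarrow> w (t, x) = v (t, x)"
  by (simp add: good_def w_def)

lemma w_integrable: "integrable \<gamma>w (\<lambda>x. w (t, x))"
proof (cases "(\<integral>\<^sup>+x. ennreal (norm (v (t, x))) \<partial>\<gamma>w) < \<infinity>")
  case True
  then show ?thesis by (intro integrableI_bounded) (auto simp: w_def)
qed (simp add: w_def)

lemma AE_good: "AE t in \<tau>. good t"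
proof -
  have 1: "AE t in \<tau>. t \<in> {0..1}" unfolding AE_\<tau> by simp
  have 2: "AE t in \<tau>. \<forall>i. integrable \<gamma>w (\<lambda>x. U i x t)"
    unfolding AE_all_countable
  proof
    fix i
    show "AE t in \<tau>. integrable \<gamma>w (\<lambda>x. U i x t)"
      using P.AE_integrable_fst'[OF U_integrable[of i, unfolded P_def]] by simp
  qed
  have 3: "AE t in \<tau>. (\<integral>\<^sup>+x. ennreal (norm (v (t, x))) \<partial>\<gamma>w) < \<infinity>"
    using P.AE_integrable_fst'[OF vi[unfolded P_def]]
    by eventually_elim (simp add: integrable_iff_bounded)
  have "AE z in \<tau> \<Otimes>\<^sub>M \<gamma>w. \<bar>fst (v z)\<bar> \<le> C"
    using vae[unfolded P_def]
  proof eventually_elim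
    fix z assume l: "(\<lambda>k. V c k z) \<longlonglongrightarrow> v z"
    have "\<bar>fst (V c k z)\<bar> \<le> C" for k
    proof -
      have "norm (combine (c k) (\<lambda>i. fst (U i (snd z) (fst z)))) \<le> C"
        using sc.fst_U_bound by (intro norm_combine_le[OF c]) (simp add: C_def U_def sc.C\<rho>_def)
      then show ?thesis by (simp add: V_def combine_linear[OF bounded_linear_fst])
    qed
    then show "\<bar>fst (v z)\<bar> \<le> C"
      using l by (intro LIMSEQ_le_const2[of "\<lambda>k. \<bar>fst (V c k z)\<bar>"] tendsto_intros) auto
  qed
  then have 4: "AE t in \<tau>. AE x in \<gamma>w. \<bar>fst (v (t, x))\<bar> \<le> C" by (rule P.AE_pair)
  show ?thesis using 1 2 3 4 vt by eventually_elim (simp add: good_def AE_\<gamma>w)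
qed

lemma good_dense:
  assumes t: "t \<in> {0..1}" and d: "0 < d"
  shows "\<exists>s. good s \<and> s \<in> {0<..<1} \<and> \<bar>s - t\<bar> < d"
proof (rule ccontr)
  assume neg: "\<not> ?thesis"
  define l u where "l = max 0 (t - d)" and "u = min 1 (t + d)"
  have lu: "l < u" using t d by (auto simp: l_def u_def)
  have "AE s in lborel. s \<in> {0..1} \<longrightarrow> good s" using AE_good unfolding AE_\<tau> .
  then have "AE s in lborel. s \<notin> {l<..<u}"
  proof eventually_elim
    fix s assume s: "s \<in> {0..1} \<longrightarrow> good s"
    show "s \<notin> {l<..<u}"
    proof
      assume "s \<in> {l<..<u}"
      then have "s \<in> {0<..<1}" "\<bar>s - t\<bar> < d" by (auto simp: l_def u_def)
      moreover from this have "good s" using s by simp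
      ultimately show False using neg by blast
    qed
  qed
  then have "emeasure lborel {l<..<u} = 0"
    by (subst (asm) AE_iff_measurable[of "{l<..<u}"]) auto
  then show False using lu by simp
qed

lemma locally_integrable_\<gamma>w:
  fixes f :: "'a \<Rightarrow> 'b::euclidean_space"
  assumes f[measurable]: "f \<in> borel_measurable borel" and i: "integrable \<gamma>w f"
  shows "locally_integrable \<gamma> f"
  unfolding locally_integrable_def set_integrable_def
proof (intro conjI allI impI f)
  fix K :: "'a set" assume K: "compact K"
  then obtain R where R: "K \<subseteq> cball 0 R" using bounded_subset_cball0 compact_imp_bounded by blast
  obtain e where e: "e > 0" "\<And>x. norm x \<le> R \<Longrightarrow> e \<le> wt x" using wt(5)[of R] by blast
  have "integrable \<gamma> (\<lambda>x. wt x *\<^sub>R f x)"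
    using i wt(2) unfolding \<gamma>w_def by (subst (asm) integrable_density) (auto intro: less_imp_le)
  then have "integrable \<gamma> (\<lambda>x. (1 / e) *\<^sub>R (wt x *\<^sub>R f x))" by (rule integrable_scaleR_right)
  then show "integrable \<gamma> (\<lambda>x. indicator K x *\<^sub>R f x)"
  proof (rule Bochner_Integration.integrable_bound)
    have "K \<in> sets borel" using K by (rule borel_compact)
    then show "(\<lambda>x. indicator K x *\<^sub>R f x) \<in> borel_measurable \<gamma>" by measurable
    show "AE x in \<gamma>. norm (indicator K x *\<^sub>R f x) \<le> norm ((1 / e) *\<^sub>R (wt x *\<^sub>R f x))"
    proof (rule AE_I2)
      fix x
      show "norm (indicator K x *\<^sub>R f x) \<le> norm ((1 / e) *\<^sub>R (wt x *\<^sub>R f x))"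
      proof (cases "x \<in> K")
        case True
        then have "1 \<le> wt x / e" using R e by (auto simp: pos_le_divide_eq)
        then have "1 * norm (f x) \<le> wt x / e * norm (f x)" by (rule mult_right_mono) simp
        then show ?thesis using True e wt(2)[of x] by (simp add: less_imp_le)
      qed simp
    qed
  qed
qed

lemma w_locally_integrable:
  "locally_integrable \<gamma> (\<lambda>x. w (t, x))" "locally_integrable \<gamma> (\<lambda>x. fst (w (t, x)))" "locally_integrable \<gamma> (\<lambda>x. snd (w (t, x)))"
proof -
  show *: "locally_integrable \<gamma> (\<lambda>x. w (t, x))" by (rule locally_integrable_\<gamma>w[OF w_measurable_x w_integrable])
  show "locally_integrable \<gamma> (\<lambda>x. fst (w (t, x)))" by (rule locally_integrable_linear[OF * bounded_linear_fst \<gamma>])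
  show "locally_integrable \<gamma> (\<lambda>x. snd (w (t, x)))" by (rule locally_integrable_linear[OF * bounded_linear_snd \<gamma>])
qed

lemma weighted_integral:
  fixes F f :: "'a \<Rightarrow> 'b::euclidean_space"
  assumes F[measurable]: "F \<in> borel_measurable borel" and f[measurable]: "f \<in> borel_measurable borel"
  shows "(\<integral>x. F x \<bullet> f x \<partial>\<gamma>) = (\<integral>x. (1 / wt x) *\<^sub>R F x \<bullet> f x \<partial>\<gamma>w)"
proof -
  have "(\<integral>x. (1 / wt x) *\<^sub>R F x \<bullet> f x \<partial>\<gamma>w) = (\<integral>x. wt x *\<^sub>R ((1 / wt x) *\<^sub>R F x \<bullet> f x) \<partial>\<gamma>)"
    unfolding \<gamma>w_def using wt(2) by (intro integral_density) (auto intro: less_imp_le)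
  also have "\<dots> = (\<integral>x. F x \<bullet> f x \<partial>\<gamma>)"
    using wt(2) by (intro Bochner_Integration.integral_cong refl) (simp add: less_imp_neq[symmetric])
  finally show ?thesis by simp
qed

lemma weight_bound:
  fixes F :: "'a \<times> real \<Rightarrow> 'b::euclidean_space"
  assumes "cc F"
  shows "\<exists>B\<ge>0. \<forall>x t. norm ((1 / wt x) *\<^sub>R F (x, t)) \<le> B"
proof -
  obtain M where M: "0 \<le> M" "\<And>z. norm (F z) \<le> M" using cc_bounded[OF assms] by metis
  obtain R where R: "\<And>z. R < norm z \<Longrightarrow> F z = 0" using assms by (auto simp: cc_def)
  obtain e where e: "e > 0" "\<And>x. norm x \<le> R \<Longrightarrow> e \<le> wt x" using wt(5)[of R] by blast
  have "norm ((1 / wt x) *\<^sub>R F (x, t)) \<le> M / e" for x t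
  proof (cases "norm x \<le> R")
    case True
    have "norm ((1 / wt x) *\<^sub>R F (x, t)) = norm (F (x, t)) / wt x" using wt(2)[of x] by simp
    also have "\<dots> \<le> M / e" using M e True by (intro frac_le) auto
    finally show ?thesis .
  next
    case False
    then have "F (x, t) = 0" using R[of "(x, t)"] norm_fst_le[of x t] by simp
    then show ?thesis using M e by simp
  qed
  then show ?thesis using M e by (intro exI[of _ "M / e"]) auto
qed

lemma weighted_integral_bound:
  fixes F f :: "'a \<Rightarrow> 'b::euclidean_space"
  assumes F[measurable]: "F \<in> borel_measurable borel" and B: "\<And>x. norm ((1 / wt x) *\<^sub>R F x) \<le> B"
    and i: "integrable \<gamma>w f" and f[measurable]: "f \<in> borel_measurable borel"
  shows "\<bar>\<integral>x. F x \<bullet> f x \<partial>\<gamma>\<bar> \<le> B * (\<integral>x. norm (f x) \<partial>\<gamma>w)"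
proof -
  have le: "\<bar>(1 / wt x) *\<^sub>R F x \<bullet> f x\<bar> \<le> B * norm (f x)" for x
    by (rule order.trans[OF Cauchy_Schwarz_ineq2 mult_right_mono[OF B]]) simp
  have "\<bar>\<integral>x. F x \<bullet> f x \<partial>\<gamma>\<bar> \<le> (\<integral>x. \<bar>(1 / wt x) *\<^sub>R F x \<bullet> f x\<bar> \<partial>\<gamma>w)"
    unfolding weighted_integral[OF F f] by (rule integral_abs_bound)
  also have "\<dots> \<le> (\<integral>x. B * norm (f x) \<partial>\<gamma>w)"
  proof (rule integral_mono)
    show r: "integrable \<gamma>w (\<lambda>x. B * norm (f x))" using i by auto
    have B0: "0 \<le> B" using B[of 0] norm_ge_zero order.trans by blast
    show "integrable \<gamma>w (\<lambda>x. \<bar>(1 / wt x) *\<^sub>R F x \<bullet> f x\<bar>)"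
      by (rule Bochner_Integration.integrable_bound[OF r]) (use le B0 in \<open>auto simp: abs_mult intro!: AE_I2\<close>)
  qed (rule le)
  finally show ?thesis by simp
qed

definition slice :: "('a \<Rightarrow> real) \<Rightarrow> real \<Rightarrow> real" where "slice f t = (\<integral>x. f x * fst (w (t, x)) \<partial>\<gamma>)"

lemma cc_weight_bound:
  fixes f :: "'a \<Rightarrow> real"
  assumes "cc f"
  shows "\<exists>B\<ge>0. \<forall>x. norm ((1 / wt x) *\<^sub>R f x) \<le> B"
proof -
  obtain M where M: "0 \<le> M" "\<And>z. norm (f z) \<le> M" using cc_bounded[OF assms] by metis
  obtain R where R: "\<And>z. R < norm z \<Longrightarrow> f z = 0" using assms by (auto simp: cc_def)
  obtain e where e: "e > 0" "\<And>x. norm x \<le> R \<Longrightarrow> e \<le> wt x" using wt(5)[of R] by blast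
  have "norm ((1 / wt x) *\<^sub>R f x) \<le> M / e" for x
  proof (cases "norm x \<le> R")
    case True
    have "norm ((1 / wt x) *\<^sub>R f x) = norm (f x) / wt x" using wt(2)[of x] by simp
    also have "\<dots> \<le> M / e" using M e True by (intro frac_le) auto
    finally show ?thesis .
  qed (use R M e in simp)
  then show ?thesis using M e by (intro exI[of _ "M / e"]) auto
qed

text \<open>At a good time the slices of \<open>V c k\<close> converge in L1, and division of f by
  the weight is harmless on its bounded support. \<open>error_fst\<close> then exchanges the
  smoothed slices for the measures, because combinations of a null sequence form a null
  sequence.\<close>

lemma good_limit:
  assumes t: "good t" and f: "cc f"
  shows "(\<lambda>k. combine (c k) (\<lambda>i. signed_integral (\<mu> i t) f)) \<longlonglongrightarrow> slice f t"
proof -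
  have fm[measurable]: "f \<in> borel_measurable borel" using cc_bbs[OF f] by (simp add: bbs_def)
  obtain B where B: "0 \<le> B" "\<And>x. norm ((1 / wt x) *\<^sub>R f x) \<le> B" using cc_weight_bound[OF f] by blast
  have Ui: "integrable \<gamma>w (\<lambda>x. U i x t)" for i using t by (simp add: good_def)
  have Vi: "integrable \<gamma>w (\<lambda>x. V c k (t, x))" for k
    unfolding V_def combine_def by (intro Bochner_Integration.integrable_sum integrable_scaleR_right) (simp add: Ui)
  have Vm[measurable]: "(\<lambda>x. V c k (t, x)) \<in> borel_measurable borel" for k
    using measurable_comp[OF measurable_Pair1'[of t borel borel] V_measurable] by (simp add: o_def)
  have intf: "integrable \<gamma> (\<lambda>x. f x * fst (q x))" if "integrable \<gamma>w q" "q \<in> borel_measurable borel" for q :: "'a \<Rightarrow> real \<times> 'a"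
    using integrable_bbs_scaleR[OF \<gamma> locally_integrable_linear[OF locally_integrable_\<gamma>w[OF that(2,1)] bounded_linear_fst \<gamma>] cc_bbs[OF f]] by simp
  have comb: "combine (c k) (\<lambda>i. \<integral>x. f x * fst (U i x t) \<partial>\<gamma>) = (\<integral>x. f x * fst (V c k (t, x)) \<partial>\<gamma>)" for k
  proof -
    have "(\<integral>x. f x * fst (V c k (t, x)) \<partial>\<gamma>) = (\<integral>x. (\<Sum>i\<le>snd (c k). fst (c k) i *\<^sub>R (f x * fst (U i x t))) \<partial>\<gamma>)"
      by (intro Bochner_Integration.integral_cong refl)
        (simp add: V_def combine_def fst_sum sum_distrib_left algebra_simps)
    also have "\<dots> = combine (c k) (\<lambda>i. \<integral>x. f x * fst (U i x t) \<partial>\<gamma>)"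
      unfolding combine_def using intf[OF Ui U_measurable_x]
      by (subst Bochner_Integration.integral_sum) auto
    finally show ?thesis by simp
  qed
  have "(\<lambda>k. (\<integral>x. f x * fst (V c k (t, x)) \<partial>\<gamma>) - slice f t) \<longlonglongrightarrow> 0"
  proof (rule Lim_null_comparison[OF always_eventually[OF allI]])
    show "(\<lambda>k. B * (\<integral>x. norm (V c k (t, x) - v (t, x)) \<partial>\<gamma>w)) \<longlonglongrightarrow> 0"
      using t unfolding good_def by (intro tendsto_mult_right_zero) blast
    fix k
    let ?q = "\<lambda>x. fst (V c k (t, x) - w (t, x))"
    have qi: "integrable \<gamma>w (\<lambda>x. V c k (t, x) - w (t, x))" using Vi w_integrable by (rule Bochner_Integration.integrable_diff)
    have q1: "integrable \<gamma>w ?q" by (rule integrable_bounded_linear[OF bounded_linear_fst qi])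
    have qm: "?q \<in> borel_measurable borel"
      by (rule borel_measurable_continuous_onI[THEN measurable_compose[rotated]])
        (auto intro!: continuous_intros borel_measurable_diff Vm w_measurable_x)
    have "(\<integral>x. f x * fst (V c k (t, x)) \<partial>\<gamma>) - slice f t = (\<integral>x. f x \<bullet> ?q x \<partial>\<gamma>)"
      unfolding slice_def using intf[OF Vi Vm] intf[OF w_integrable w_measurable_x]
      by (subst Bochner_Integration.integral_diff[symmetric]) (auto simp: algebra_simps)
    then have "\<bar>(\<integral>x. f x * fst (V c k (t, x)) \<partial>\<gamma>) - slice f t\<bar> \<le> B * (\<integral>x. norm (?q x) \<partial>\<gamma>w)"
      using weighted_integral_bound[OF fm B(2) q1 qm] by simp
    also have "\<dots> \<le> B * (\<integral>x. norm (V c k (t, x) - w (t, x)) \<partial>\<gamma>w)"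
    proof (intro mult_left_mono integral_mono B)
      show "norm (?q x) \<le> norm (V c k (t, x) - w (t, x))" for x by (metis norm_fst_le prod.collapse)
    qed (use q1 qi in \<open>auto intro: integrable_norm\<close>)
    finally show "norm ((\<integral>x. f x * fst (V c k (t, x)) \<partial>\<gamma>) - slice f t) \<le> B * (\<integral>x. norm (V c k (t, x) - v (t, x)) \<partial>\<gamma>w)"
      by (simp add: w_good[OF t])
  qed
  then have 1: "(\<lambda>k. combine (c k) (\<lambda>i. \<integral>x. f x * fst (U i x t) \<partial>\<gamma>)) \<longlonglongrightarrow> slice f t"
    unfolding comb by (rule LIM_zero_cancel)
  have "(\<lambda>i. signed_integral (\<mu> i t) f - (\<integral>x. f x * fst (U i x t) \<partial>\<gamma>)) \<longlonglongrightarrow> 0"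
    unfolding tendsto_iff dist_real_def diff_0_right
  proof (intro allI impI)
    fix e :: real assume e: "0 < e"
    have "t \<in> {0..1}" using t by (simp add: good_def)
    then show "eventually (\<lambda>i. \<bar>signed_integral (\<mu> i t) f - (\<integral>x. f x * fst (U i x t) \<partial>\<gamma>)\<bar> < e) sequentially"
      using eventually_mono[OF error_fst[OF f, of "e / 2"], of "\<lambda>i. \<bar>signed_integral (\<mu> i t) f - (\<integral>x. f x * fst (U i x t) \<partial>\<gamma>)\<bar> < e"] e
      by fastforce
  qed
  from combine_tendsto[OF c this]
  have "(\<lambda>k. combine (c k) (\<lambda>i. signed_integral (\<mu> i t) f) - combine (c k) (\<lambda>i. \<integral>x. f x * fst (U i x t) \<partial>\<gamma>)) \<longlonglongrightarrow> 0"
    by (simp add: combine_diff)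
  from tendsto_add[OF this 1] show ?thesis by simp
qed

text \<open>A non-strict inequality for one pair (\<epsilon>, \<delta>), uniform over all curves: in
  this form it passes to convex combinations and to limits.\<close>

definition modulus_of :: "('a \<Rightarrow> real) \<Rightarrow> real \<Rightarrow> real \<Rightarrow> bool" where
  "modulus_of f \<epsilon> \<delta> \<longleftrightarrow> (\<forall>k s t. 0 \<le> s \<longrightarrow> s \<le> t \<longrightarrow> t \<le> 1 \<longrightarrow> t - s \<le> \<delta> \<longrightarrow>
    \<bar>signed_integral (\<mu> k t) f - signed_integral (\<mu> k s) f\<bar> \<le> \<epsilon>)"

lemma modulus_limit:
  assumes m: "modulus_of f \<epsilon> \<delta>" and st: "s \<in> {0..1}" "t \<in> {0..1}" "\<bar>s - t\<bar> \<le> \<delta>"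
    and l: "(\<lambda>k. combine (c k) (\<lambda>i. signed_integral (\<mu> i s) f)) \<longlonglongrightarrow> x"
      "(\<lambda>k. combine (c k) (\<lambda>i. signed_integral (\<mu> i t) f)) \<longlonglongrightarrow> y"
  shows "\<bar>x - y\<bar> \<le> \<epsilon>"
proof -
  have d: "\<bar>signed_integral (\<mu> k s) f - signed_integral (\<mu> k t) f\<bar> \<le> \<epsilon>" for k
  proof (cases "s \<le> t")
    case True
    then show ?thesis using m[unfolded modulus_of_def, rule_format, of s t k] st by (simp add: abs_minus_commute)
  next
    case False
    then show ?thesis using m[unfolded modulus_of_def, rule_format, of t s k] st by simp
  qed
  have "(\<lambda>k. \<bar>combine (c k) (\<lambda>i. signed_integral (\<mu> i s) f) - combine (c k) (\<lambda>i. signed_integral (\<mu> i t) f)\<bar>) \<longlonglongrightarrow> \<bar>x - y\<bar>"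
    by (intro tendsto_intros l)
  moreover have "\<bar>combine (c k) (\<lambda>i. signed_integral (\<mu> i s) f) - combine (c k) (\<lambda>i. signed_integral (\<mu> i t) f)\<bar> \<le> \<epsilon>" for k
    using norm_combine_le[OF c[of k], of "\<lambda>i. signed_integral (\<mu> i s) f - signed_integral (\<mu> i t) f" \<epsilon>] d
    by (simp add: combine_diff)
  ultimately show ?thesis by (meson LIMSEQ_le_const2)
qed

section \<open>Representatives of the limit at every time\<close>

lemma good_unit: "good t \<Longrightarrow> t \<in> {0..1}" by (simp add: good_def)

text \<open>Says that m is a possible value of the curve at time t without naming a limit: m
  respects every modulus shared by the approximating curves. Strictness of
  \<open>\<bar>s - t\<bar> < \<delta>\<close> leaves room to approach t by good times. Any choice of
  compatible measures with a uniform mass bound is weakly* continuous.\<close>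

definition compatible :: "real \<Rightarrow> ('a set \<Rightarrow> real) \<Rightarrow> bool" where
  "compatible t m \<longleftrightarrow> radon m \<and> (\<forall>R f g \<epsilon> \<delta> s. C1 R f g \<longrightarrow> modulus_of f \<epsilon> \<delta> \<longrightarrow> good s \<longrightarrow> \<bar>s - t\<bar> < \<delta> \<longrightarrow>
    \<bar>signed_integral m f - slice f s\<bar> \<le> \<epsilon>)"

lemma compatible_good:
  assumes t: "good t"
  shows "compatible t (radon_density \<gamma> (\<lambda>x. fst (w (t, x))))"
  unfolding compatible_def
proof (intro conjI allI impI)
  show "radon (radon_density \<gamma> (\<lambda>x. fst (w (t, x))))" by (rule radon_radon_density[OF \<gamma> w_locally_integrable(2)])
  fix R f g \<epsilon> \<delta> s assume f: "C1 R f g" and m: "modulus_of f \<epsilon> \<delta>" and s: "good s" "\<bar>s - t\<bar> < \<delta>"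
  have "signed_integral (radon_density \<gamma> (\<lambda>x. fst (w (t, x)))) f = slice f t"
    unfolding slice_def by (rule signed_integral_density[OF \<gamma> w_locally_integrable(2) cc_bbs[OF C1_cc(1)[OF f]]])
  then show "\<bar>signed_integral (radon_density \<gamma> (\<lambda>x. fst (w (t, x)))) f - slice f s\<bar> \<le> \<epsilon>"
    using modulus_limit[OF m good_unit[OF t] good_unit[OF s(1)] _ good_limit[OF t C1_cc(1)[OF f]] good_limit[OF s(1) C1_cc(1)[OF f]]] s(2)
    by (simp add: abs_minus_commute)
qed

text \<open>The weak* convergence given at the end points replaces \<open>good_limit\<close>, so 0
  and 1 may be bad times.\<close>

lemma compatible_endpoint:
  assumes t: "t \<in> {0..1}" and m: "radon m" and l: "\<And>f. cc f \<Longrightarrow> (\<lambda>k. signed_integral (\<mu> k t) f) \<longlonglongrightarrow> signed_integral m f"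
  shows "compatible t m"
  unfolding compatible_def
proof (intro conjI allI impI m)
  fix R f g \<epsilon> \<delta> s assume f: "C1 R f g" and mo: "modulus_of f \<epsilon> \<delta>" and s: "good s" "\<bar>s - t\<bar> < \<delta>"
  note f' = C1_cc(1)[OF f]
  show "\<bar>signed_integral m f - slice f s\<bar> \<le> \<epsilon>"
    using modulus_limit[OF mo t good_unit[OF s(1)] _ combine_tendsto[OF c l[OF f']] good_limit[OF s(1) f']] s(2)
    by (simp add: abs_minus_commute)
qed

text \<open>Good times approach t and their densities are bounded by C, hence square integrable for
  \<open>\<gamma>w\<close>, so convex combinations of them converge strongly. Each inequality in
  \<open>compatible\<close> is convex in the measure and survives combination and limit.\<close>

lemma compatible_exists:
  assumes t: "t \<in> {0..1}"
  shows "\<exists>\<rho>. locally_integrable \<gamma> \<rho> \<and> (AE x in \<gamma>. \<bar>\<rho> x\<bar> \<le> C) \<and> compatible t (radon_density \<gamma> \<rho>)"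
proof -
  have "\<exists>s. good s \<and> \<bar>s - t\<bar> < 1 / (real i + 1)" for i :: nat using good_dense[OF t, of "1 / (real i + 1)"] by auto
  then obtain s where s: "\<And>i. good (s i)" "\<And>i. \<bar>s i - t\<bar> < 1 / (real i + 1)" by metis
  define q where "q i x = fst (w (s i, x))" for i x
  have qm[measurable]: "q i \<in> borel_measurable borel" for i
    using w_locally_integrable(2)[of "s i"] unfolding q_def[abs_def] by (simp add: locally_integrable_def)
  have qC: "AE x in \<gamma>w. \<bar>q i x\<bar> \<le> C" for i
    using s(1)[of i] w_good[OF s(1)] unfolding good_def AE_\<gamma>w q_def by simp
  have "\<exists>d \<rho>. (\<forall>k. d k \<in> forward_weights k) \<and> integrable \<gamma>w \<rho> \<and> (\<forall>k. integrable \<gamma>w (\<lambda>x. combine (d k) (\<lambda>i. q i x))) \<and>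
    (AE x in \<gamma>w. (\<lambda>k. combine (d k) (\<lambda>i. q i x)) \<longlonglongrightarrow> \<rho> x) \<and>
    (\<lambda>k. \<integral>x. norm (combine (d k) (\<lambda>i. q i x) - \<rho> x) \<partial>\<gamma>w) \<longlonglongrightarrow> 0"
  proof (rule forward_convex_combinations[OF finite_\<gamma>w])
    show "convex_fun (\<lambda>z::real. ennreal (z\<^sup>2))" by (rule convex_fun_square)
    show "\<exists>K\<ge>0. \<forall>z::real. ennreal (norm z) \<le> ennreal e * ennreal (z\<^sup>2) + ennreal K" if "0 < e" for e
      by (rule square_superlinear[OF that])
    show "(\<integral>\<^sup>+x. ennreal ((q i x)\<^sup>2) \<partial>\<gamma>w) \<le> ennreal (C\<^sup>2 * measure \<gamma>w (space \<gamma>w))" for i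
    proof -
      have "(\<integral>\<^sup>+x. ennreal ((q i x)\<^sup>2) \<partial>\<gamma>w) \<le> (\<integral>\<^sup>+x. ennreal (C\<^sup>2) \<partial>\<gamma>w)"
      proof (intro nn_integral_mono_AE, use qC[of i] in eventually_elim)
        fix x assume "\<bar>q i x\<bar> \<le> C"
        then show "ennreal ((q i x)\<^sup>2) \<le> ennreal (C\<^sup>2)"
          using abs_le_square_iff[of "q i x" C] by (intro ennreal_leI) simp
      qed
      then show ?thesis by (simp add: \<gamma>w.emeasure_eq_measure ennreal_mult)
    qed
  qed auto
  then obtain d \<rho>' where d: "\<And>k. d k \<in> forward_weights k" and \<rho>': "integrable \<gamma>w \<rho>'"
    "\<And>k. integrable \<gamma>w (\<lambda>x. combine (d k) (\<lambda>i. q i x))"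
    "AE x in \<gamma>w. (\<lambda>k. combine (d k) (\<lambda>i. q i x)) \<longlonglongrightarrow> \<rho>' x"
    "(\<lambda>k. \<integral>x. norm (combine (d k) (\<lambda>i. q i x) - \<rho>' x) \<partial>\<gamma>w) \<longlonglongrightarrow> 0" by blast
  have \<rho>m[measurable]: "\<rho>' \<in> borel_measurable borel"
    using borel_measurable_integrable[OF \<rho>'(1)] by (simp add: measurable_cong_sets[OF sets_\<gamma>w refl])
  have li: "locally_integrable \<gamma> \<rho>'" by (rule locally_integrable_\<gamma>w[OF \<rho>m \<rho>'(1)])
  have "AE x in \<gamma>w. \<forall>i. \<bar>q i x\<bar> \<le> C" unfolding AE_all_countable using qC by blast
  then have "AE x in \<gamma>w. \<bar>\<rho>' x\<bar> \<le> C"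
    using \<rho>'(3)
  proof eventually_elim
    case (elim x)
    have "\<bar>combine (d k) (\<lambda>i. q i x)\<bar> \<le> C" for k
      using norm_combine_le[OF d[of k], of "\<lambda>i. q i x" C] elim(1) by simp
    then show ?case using elim(2) by (intro LIMSEQ_le_const2[of "\<lambda>k. \<bar>combine (d k) (\<lambda>i. q i x)\<bar>"] tendsto_intros) auto
  qed
  then have bd: "AE x in \<gamma>. \<bar>\<rho>' x\<bar> \<le> C" unfolding AE_\<gamma>w .
  have conv: "(\<lambda>k. combine (d k) (\<lambda>i. slice f (s i))) \<longlonglongrightarrow> signed_integral (radon_density \<gamma> \<rho>') f" if f: "cc f" for f
  proof -
    have fm[measurable]: "f \<in> borel_measurable borel" using cc_bbs[OF f] by (simp add: bbs_def)
    obtain B where B: "0 \<le> B" "\<And>x. norm ((1 / wt x) *\<^sub>R f x) \<le> B" using cc_weight_bound[OF f] by blast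
    define Q where "Q k x = combine (d k) (\<lambda>i. q i x)" for k x
    have Qm[measurable]: "Q k \<in> borel_measurable borel" for k unfolding Q_def combine_def by measurable
    have Qi: "integrable \<gamma>w (Q k)" for k using \<rho>'(2) by (simp add: Q_def[abs_def])
    have fi: "integrable \<gamma> (\<lambda>x. f x * h x)" if "locally_integrable \<gamma> h" for h :: "'a \<Rightarrow> real"
      using integrable_bbs_scaleR[OF \<gamma> that cc_bbs[OF f]] by simp
    have qi: "locally_integrable \<gamma> (q i)" for i using w_locally_integrable(2)[of "s i"] by (simp add: q_def[abs_def])
    have "combine (d k) (\<lambda>i. slice f (s i)) = (\<integral>x. f x * Q k x \<partial>\<gamma>)" for k
    proof -
      have "(\<integral>x. f x * Q k x \<partial>\<gamma>) = (\<integral>x. (\<Sum>i\<le>snd (d k). fst (d k) i *\<^sub>R (f x * q i x)) \<partial>\<gamma>)"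
        by (intro Bochner_Integration.integral_cong refl) (simp add: Q_def combine_def sum_distrib_left algebra_simps)
      also have "\<dots> = combine (d k) (\<lambda>i. \<integral>x. f x * q i x \<partial>\<gamma>)"
        unfolding combine_def using fi[OF qi] by (subst Bochner_Integration.integral_sum) auto
      finally show ?thesis by (simp add: slice_def q_def)
    qed
    moreover have "(\<lambda>k. (\<integral>x. f x * Q k x \<partial>\<gamma>) - (\<integral>x. f x * \<rho>' x \<partial>\<gamma>)) \<longlonglongrightarrow> 0"
    proof (rule Lim_null_comparison[OF always_eventually[OF allI]])
      show "(\<lambda>k. B * (\<integral>x. norm (Q k x - \<rho>' x) \<partial>\<gamma>w)) \<longlonglongrightarrow> 0"
        using \<rho>'(4) unfolding Q_def by (rule tendsto_mult_right_zero)
      fix k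
      have "(\<integral>x. f x * Q k x \<partial>\<gamma>) - (\<integral>x. f x * \<rho>' x \<partial>\<gamma>) = (\<integral>x. f x \<bullet> (Q k x - \<rho>' x) \<partial>\<gamma>)"
        using fi[OF locally_integrable_\<gamma>w[OF Qm Qi]] fi[OF li]
        by (subst Bochner_Integration.integral_diff[symmetric]) (auto simp: algebra_simps)
      then show "norm ((\<integral>x. f x * Q k x \<partial>\<gamma>) - (\<integral>x. f x * \<rho>' x \<partial>\<gamma>)) \<le> B * (\<integral>x. norm (Q k x - \<rho>' x) \<partial>\<gamma>w)"
        using weighted_integral_bound[OF fm B(2) Bochner_Integration.integrable_diff[OF Qi \<rho>'(1)], of k] by simp
    qed
    ultimately show ?thesis
      using signed_integral_density[OF \<gamma> li cc_bbs[OF f]] LIM_zero_cancel by fastforce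
  qed
  have "compatible t (radon_density \<gamma> \<rho>')"
    unfolding compatible_def
  proof (intro conjI allI impI radon_radon_density[OF \<gamma> li])
    fix R f g \<epsilon> \<delta> r assume f: "C1 R f g" and mo: "modulus_of f \<epsilon> \<delta>" and r: "good r" "\<bar>r - t\<bar> < \<delta>"
    note f' = C1_cc(1)[OF f]
    \<comment> \<open>Because r is strictly within \<delta> of t, the times \<open>s i\<close>
      tending to t are eventually within \<delta> of r.\<close>
    have "eventually (\<lambda>i. 1 / (real i + 1) < \<delta> - \<bar>r - t\<bar>) sequentially"
      using order_tendstoD(2)[OF inverse_Suc_tendsto] r by simp
    then obtain N where N: "\<And>i. N \<le> i \<Longrightarrow> 1 / (real i + 1) < \<delta> - \<bar>r - t\<bar>" by (auto simp: eventually_sequentially)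
    have near: "\<bar>slice f (s i) - slice f r\<bar> \<le> \<epsilon>" if "N \<le> i" for i
    proof (rule modulus_limit[OF mo good_unit[OF s(1)] good_unit[OF r(1)] _ good_limit[OF s(1) f'] good_limit[OF r(1) f']])
      show "\<bar>s i - r\<bar> \<le> \<delta>" using N[OF that] s(2)[of i] by linarith
    qed
    have "\<bar>combine (d k) (\<lambda>i. slice f (s i)) - slice f r\<bar> \<le> \<epsilon>" if "N \<le> k" for k
    proof -
      have "combine (d k) (\<lambda>i. slice f (s i)) - slice f r = combine (d k) (\<lambda>i. slice f (s i) - slice f r)"
        by (simp add: combine_diff combine_const[OF d])
      then show ?thesis using norm_combine_le[OF d[of k], of "\<lambda>i. slice f (s i) - slice f r" \<epsilon>] near that by simp
    qed
    moreover have "(\<lambda>k. \<bar>combine (d k) (\<lambda>i. slice f (s i)) - slice f r\<bar>) \<longlonglongrightarrow> \<bar>signed_integral (radon_density \<gamma> \<rho>') f - slice f r\<bar>"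
      by (intro tendsto_intros conv f')
    ultimately show "\<bar>signed_integral (radon_density \<gamma> \<rho>') f - slice f r\<bar> \<le> \<epsilon>" by (meson LIMSEQ_le_const2)
  qed
  then show ?thesis using li bd by blast
qed

text \<open>At good times the slice of w is kept, which ties the curve to the energy bound; at the
  remaining null set of times any bounded compatible density will do.\<close>

definition \<rho>s :: "real \<Rightarrow> 'a \<Rightarrow> real" where
  "\<rho>s t = (if good t then (\<lambda>x. fst (w (t, x)))
    else (SOME \<rho>. locally_integrable \<gamma> \<rho> \<and> (AE x in \<gamma>. \<bar>\<rho> x\<bar> \<le> C) \<and> compatible t (radon_density \<gamma> \<rho>)))"

text \<open>The prescribed end measures are inserted directly, since the limit density is determined
  only at almost every time; they fit with the other times because they are compatible too.\<close>

definition \<mu>s :: "real \<Rightarrow> 'a set \<Rightarrow> real" where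
  "\<mu>s t = (if t = 0 then \<mu>0 else if t = 1 then \<mu>1 else radon_density \<gamma> (\<rho>s t))"

definition \<nu>s :: "real \<Rightarrow> 'a set \<Rightarrow> 'a" where "\<nu>s t = radon_density \<gamma> (\<lambda>x. snd (w (t, x)))"

lemma \<rho>s_props:
  assumes t: "t \<in> {0..1}"
  shows "locally_integrable \<gamma> (\<rho>s t)" "AE x in \<gamma>. \<bar>\<rho>s t x\<bar> \<le> C" "compatible t (radon_density \<gamma> (\<rho>s t))"
proof -
  have "locally_integrable \<gamma> (\<rho>s t) \<and> (AE x in \<gamma>. \<bar>\<rho>s t x\<bar> \<le> C) \<and> compatible t (radon_density \<gamma> (\<rho>s t))"
  proof (cases "good t")
    case True
    have "AE x in \<gamma>. \<bar>fst (w (t, x))\<bar> \<le> C" unfolding w_good[OF True] using True by (simp add: good_def)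
    then show ?thesis using True w_locally_integrable(2) compatible_good by (simp add: \<rho>s_def)
  next
    case False
    show ?thesis unfolding \<rho>s_def if_not_P[OF False] by (rule someI_ex[OF compatible_exists[OF t]])
  qed
  then show "locally_integrable \<gamma> (\<rho>s t)" "AE x in \<gamma>. \<bar>\<rho>s t x\<bar> \<le> C" "compatible t (radon_density \<gamma> (\<rho>s t))" by blast+
qed

lemma compatible_\<mu>s:
  assumes "t \<in> {0..1}"
  shows "compatible t (\<mu>s t)"
proof -
  have "compatible 0 \<mu>0" "compatible 1 \<mu>1"
    by (intro compatible_endpoint rad_ends ends; simp)+
  then show ?thesis using \<rho>s_props(3)[OF assms] by (auto simp: \<mu>s_def)
qed

lemma radon_\<mu>s: "t \<in> {0..1} \<Longrightarrow> radon (\<mu>s t)"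
  using compatible_\<mu>s by (simp add: compatible_def)

lemma radon_\<nu>s: "radon (\<nu>s t)"
  unfolding \<nu>s_def by (rule radon_radon_density[OF \<gamma> w_locally_integrable(3)])

text \<open>One bound for all times: the end measures contribute their own constants, every other
  time the bound C of the density times the mass of the ball.\<close>

lemma \<mu>s_bound:
  "\<exists>B\<ge>0. \<forall>t\<in>{0..1}. \<forall>f M. f \<in> borel_measurable borel \<longrightarrow> (\<forall>x. \<bar>f x\<bar> \<le> M) \<longrightarrow> (\<forall>x. R < norm x \<longrightarrow> f x = 0) \<longrightarrow>
    \<bar>signed_integral (\<mu>s t) f\<bar> \<le> B * M"
proof -
  obtain B0 where B0: "B0 \<ge> 0" "\<And>f M. f \<in> borel_measurable borel \<Longrightarrow> (\<And>x. \<bar>f x\<bar> \<le> M) \<Longrightarrow> (\<And>x. R < norm x \<Longrightarrow> f x = 0) \<Longrightarrow>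
      \<bar>signed_integral \<mu>0 f\<bar> \<le> B0 * M" using signed_integral_bound[OF rad_ends(1), of R] by metis
  obtain B1 where B1: "B1 \<ge> 0" "\<And>f M. f \<in> borel_measurable borel \<Longrightarrow> (\<And>x. \<bar>f x\<bar> \<le> M) \<Longrightarrow> (\<And>x. R < norm x \<Longrightarrow> f x = 0) \<Longrightarrow>
      \<bar>signed_integral \<mu>1 f\<bar> \<le> B1 * M" using signed_integral_bound[OF rad_ends(2), of R] by metis
  have C0: "0 \<le> C" by (simp add: C_def)
  define B2 where "B2 = C * measure \<gamma> (cball 0 R)"
  have B2: "0 \<le> B2" using C0 by (simp add: B2_def)
  show ?thesis
  proof (intro exI[of _ "B0 + B1 + B2"] conjI ballI allI impI)
    fix t :: real and f :: "'a \<Rightarrow> real" and M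
    assume t: "t \<in> {0..1}" and f: "f \<in> borel_measurable borel" "\<forall>x. \<bar>f x\<bar> \<le> M" "\<forall>x. R < norm x \<longrightarrow> f x = 0"
    have M0: "0 \<le> M" using f(2) abs_ge_zero order.trans by blast
    have bf: "bbs f" using f by (intro bbsI[where M = M and R = R]) auto
    have inner: "\<bar>signed_integral (radon_density \<gamma> (\<rho>s t)) f\<bar> \<le> B2 * M"
    proof -
      have "\<bar>signed_integral (radon_density \<gamma> (\<rho>s t)) f\<bar> \<le> (\<integral>x. \<bar>f x * \<rho>s t x\<bar> \<partial>\<gamma>)"
        unfolding signed_integral_density[OF \<gamma> \<rho>s_props(1)[OF t] bf] by (rule integral_abs_bound)
      also have "\<dots> \<le> (\<integral>x. (C * M) * indicator (cball 0 R) x \<partial>\<gamma>)"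
      proof (rule integral_mono_AE)
        show "integrable \<gamma> (\<lambda>x. \<bar>f x * \<rho>s t x\<bar>)"
          using integrable_bbs_scaleR[OF \<gamma> \<rho>s_props(1)[OF t] bf] by auto
        show "integrable \<gamma> (\<lambda>x. (C * M) * indicator (cball 0 R) x)"
          using integrable_bbs[OF \<gamma> bbs_indicator[of "cball 0 R"]] by auto
        show "AE x in \<gamma>. \<bar>f x * \<rho>s t x\<bar> \<le> (C * M) * indicator (cball 0 R) x"
          using \<rho>s_props(2)[OF t]
        proof eventually_elim
          case (elim x)
          have "\<bar>f x\<bar> * \<bar>\<rho>s t x\<bar> \<le> M * C" using f(2) elim M0 by (intro mult_mono) auto
          then show ?case using f(3) by (cases "R < norm x") (auto simp: abs_mult mult.commute)
        qed
      qed
      also have "\<dots> = B2 * M" by (simp add: B2_def pos_radonD(2)[OF \<gamma>])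
      finally show ?thesis .
    qed
    have "\<bar>signed_integral (\<mu>s t) f\<bar> \<le> max (B0 * M) (max (B1 * M) (B2 * M))"
      unfolding \<mu>s_def using inner B0(2)[of f M] B1(2)[of f M] f by (auto simp: le_max_iff_disj)
    also have "\<dots> \<le> (B0 + B1 + B2) * M"
    proof -
      have "0 \<le> B0 * M" "0 \<le> B1 * M" "0 \<le> B2 * M" using M0 B0(1) B1(1) B2 by auto
      then show ?thesis by (simp add: distrib_right)
    qed
    finally show "\<bar>signed_integral (\<mu>s t) f\<bar> \<le> (B0 + B1 + B2) * M" .
  qed (use B0 B1 B2 in simp)
qed

text \<open>f is exchanged for a C1 function, which has a modulus common to all curves, and two
  times are compared through one good time close to both.\<close>

lemma continuous_\<mu>s:
  assumes f: "cc f"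
  shows "continuous_on {0..1} (\<lambda>t. signed_integral (\<mu>s t) f)"
  unfolding continuous_on_iff dist_real_def
proof (intro ballI allI impI)
  fix t \<epsilon> :: real assume t: "t \<in> {0..1}" and \<epsilon>: "0 < \<epsilon>"
  obtain R' where R': "\<And>x. R' < norm x \<Longrightarrow> f x = 0" using f by (auto simp: cc_def)
  define R where "R = max 0 R'"
  have R: "0 \<le> R" "\<And>x. R < norm x \<Longrightarrow> f x = 0" using R' by (auto simp: R_def)
  obtain B where B: "B \<ge> 0" "\<And>t f M. t \<in> {0..1} \<Longrightarrow> f \<in> borel_measurable borel \<Longrightarrow> (\<And>x. \<bar>f x\<bar> \<le> M) \<Longrightarrow>
    (\<And>x. R + 1 < norm x \<Longrightarrow> f x = 0) \<Longrightarrow> \<bar>signed_integral (\<mu>s t) f\<bar> \<le> B * M"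
    using \<mu>s_bound[of "R + 1"] by metis
  \<comment> \<open>Sized so that exchanging f for its C1 approximation costs at most \<epsilon>/8
    at each time; two exchanges and two comparisons then add up to \<epsilon>/2.\<close>
  define e where "e = (\<epsilon> / 8) / (B + 1)"
  have Be: "B * e \<le> \<epsilon> / 8" "0 < e"
  proof -
    show "0 < e" using \<epsilon> B by (simp add: e_def add_nonneg_pos)
    have "e * (B + 1) = \<epsilon> / 8" using B(1) by (intro iffD1[OF nonzero_eq_divide_eq _, OF _ e_def]) simp
    then show "B * e \<le> \<epsilon> / 8" using \<open>0 < e\<close> by (simp add: algebra_simps)
  qed
  obtain f' g where f': "C1 (R + 1) f' g" "\<And>x. \<bar>f x - f' x\<bar> \<le> e" using C1_dense[OF f R Be(2)] by blast
  note cf' = C1_cc(1)[OF f'(1)]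
  have e8: "0 < \<epsilon> / 8" using \<epsilon> by simp
  obtain \<delta> where \<delta>: "0 < \<delta>" "modulus_of f' (\<epsilon> / 8) \<delta>"
    using modulus[OF f'(1) e8] unfolding modulus_of_def by blast
  have near: "\<bar>signed_integral (\<mu>s s) f - signed_integral (\<mu>s s) f'\<bar> \<le> \<epsilon> / 8" if s: "s \<in> {0..1}" for s
  proof -
    have "signed_integral (\<mu>s s) f - signed_integral (\<mu>s s) f' = signed_integral (\<mu>s s) (\<lambda>x. f x - f' x)"
      using signed_integral_add[OF radon_\<mu>s[OF s] cc_bbs[OF f] bbs_scaleR[OF cc_bbs[OF cf'], of "-1"]]
        signed_integral_cmult[OF radon_\<mu>s[OF s], of "-1" f'] by simp
    moreover have "\<bar>signed_integral (\<mu>s s) (\<lambda>x. f x - f' x)\<bar> \<le> B * e"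
    proof (rule B(2)[OF s _ f'(2)])
      show "(\<lambda>x. f x - f' x) \<in> borel_measurable borel"
        using cc_bbs[OF f] cc_bbs[OF cf'] unfolding bbs_def by (intro borel_measurable_diff) auto
      show "f x - f' x = 0" if "R + 1 < norm x" for x using R(2)[of x] f'(1) that by (simp add: C1_def)
    qed
    ultimately show ?thesis using Be(1) by simp
  qed
  show "\<exists>d>0. \<forall>s\<in>{0..1}. \<bar>s - t\<bar> < d \<longrightarrow> \<bar>signed_integral (\<mu>s s) f - signed_integral (\<mu>s t) f\<bar> < \<epsilon>"
  proof (intro exI[of _ \<delta>] conjI ballI impI \<delta>)
    fix s assume s: "s \<in> {0..1}" "\<bar>s - t\<bar> < \<delta>"
    \<comment> \<open>The radius \<delta> - |s - t| around t places r within \<delta> of both s and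
      t.\<close>
    obtain r where r: "good r" "\<bar>r - t\<bar> < \<delta> - \<bar>s - t\<bar>" using good_dense[OF t, of "\<delta> - \<bar>s - t\<bar>"] s(2) by auto
    then have rt: "\<bar>r - t\<bar> < \<delta>" by linarith
    have "\<bar>signed_integral (\<mu>s t) f' - slice f' r\<bar> \<le> \<epsilon> / 8"
      using compatible_\<mu>s[OF t] f'(1) \<delta>(2) r(1) rt unfolding compatible_def by blast
    moreover have "\<bar>r - s\<bar> < \<delta>" using r(2) by linarith
    then have "\<bar>signed_integral (\<mu>s s) f' - slice f' r\<bar> \<le> \<epsilon> / 8"
      using compatible_\<mu>s[OF s(1)] f'(1) \<delta>(2) r(1) unfolding compatible_def by blast
    ultimately show "\<bar>signed_integral (\<mu>s s) f - signed_integral (\<mu>s t) f\<bar> < \<epsilon>"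
      using near[OF s(1)] near[OF t] \<epsilon> by linarith
  qed
qed

lemma w_integrable_P: "integrable P w"
proof (rule Bochner_Integration.integrable_bound[OF vi])
  show "w \<in> borel_measurable P" by (simp add: measurable_cong_sets[OF sets_P refl])
qed (auto simp: w_def)

lemma borel_family_\<nu>s: "borel_family 1 \<nu>s"
  unfolding borel_family_def
proof (intro allI impI)
  fix X :: "'a set" assume X: "bdd_borel X"
  interpret \<gamma>: sigma_finite_measure \<gamma> by (rule pos_radon_sigma_finite[OF \<gamma>])
  have [measurable]: "X \<in> sets borel" using X by simp
  have sm: "(\<lambda>z. snd (w z)) \<in> borel_measurable (borel \<Otimes>\<^sub>M borel)"
    by (rule measurable_compose[OF w_measurable borel_measurable_continuous_onI]) (intro continuous_intros)
  have "(\<lambda>t. \<integral>x. indicator X x *\<^sub>R snd (w (t, x)) \<partial>\<gamma>) \<in> borel_measurable borel"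
  proof (rule \<gamma>.borel_measurable_lebesgue_integral)
    have "(\<lambda>z. indicator X (snd z) *\<^sub>R snd (w z)) \<in> borel_measurable (borel \<Otimes>\<^sub>M \<gamma>)"
      using sm by measurable
    then show "(\<lambda>(t, x). indicator X x *\<^sub>R snd (w (t, x))) \<in> borel_measurable (borel \<Otimes>\<^sub>M \<gamma>)"
      by (simp add: split_beta')
  qed
  then have "(\<lambda>t. \<nu>s t X) \<in> borel_measurable borel"
    using X by (simp add: \<nu>s_def radon_density_def set_lebesgue_integral_def)
  then show "(\<lambda>t. \<nu>s t X) \<in> borel_measurable (restrict_space borel {0..1})" by (rule measurable_restrict_space1)
qed

section \<open>The limit solves the continuity equation\<close>

lemma AE_interior: "AE t in lborel. t \<in> {0..1} \<longrightarrow> t \<in> {0<..<1} \<and> good t"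
proof -
  have "AE t in lborel. t \<noteq> (0::real)" "AE t in lborel. t \<noteq> (1::real)"
    by (rule AE_lborel_singleton)+
  then show ?thesis using AE_good[unfolded AE_\<tau>] by eventually_elim auto
qed

lemma \<mu>s_interior: "t \<in> {0<..<1} \<Longrightarrow> \<mu>s t = radon_density \<gamma> (\<rho>s t)"
  by (auto simp: \<mu>s_def)

lemma variation_\<mu>s: "(\<integral>\<^sup>+t\<in>{0..1}. emeasure (total_variation (\<mu>s t)) (ball 0 R) \<partial>lborel) < \<infinity>"
proof -
  have le: "emeasure (total_variation (\<mu>s t)) (ball 0 R) \<le> ennreal C * emeasure \<gamma> (ball 0 R)"
    if t: "t \<in> {0<..<1}" for t
  proof -
    have t': "t \<in> {0..1}" using t by auto
    have "emeasure (total_variation (\<mu>s t)) (ball 0 R) \<le> (\<integral>\<^sup>+x. ennreal (norm (\<rho>s t x)) * indicator (ball 0 R) x \<partial>\<gamma>)"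
      unfolding \<mu>s_interior[OF t] by (rule total_variation_density_le[OF \<gamma> \<rho>s_props(1)[OF t']]) simp
    also have "\<dots> \<le> (\<integral>\<^sup>+x. ennreal C * indicator (ball 0 R) x \<partial>\<gamma>)"
      by (intro nn_integral_mono_AE, use \<rho>s_props(2)[OF t'] in eventually_elim)
        (auto simp: indicator_def intro!: ennreal_leI)
    also have "\<dots> = ennreal C * emeasure \<gamma> (ball 0 R)" by (intro nn_integral_cmult_indicator) simp
    finally show ?thesis .
  qed
  have "(\<integral>\<^sup>+t\<in>{0..1}. emeasure (total_variation (\<mu>s t)) (ball 0 R) \<partial>lborel)
      \<le> (\<integral>\<^sup>+t. (ennreal C * emeasure \<gamma> (ball 0 R)) * indicator {0..1} t \<partial>(lborel :: real measure))"
    by (intro nn_integral_mono_AE, use AE_interior in eventually_elim) (auto simp: indicator_def le)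
  also have "\<dots> < \<infinity>" using pos_radonD(3)[OF \<gamma>, of "ball 0 R"] by (simp add: nn_integral_cmult ennreal_mult_less_top)
  finally show ?thesis .
qed

text \<open>On the ball the weight is at least e, so the variation is dominated by the
  \<open>\<gamma>w\<close>-integral of w, and this is integrable in time because w is integrable for
  P.\<close>

lemma variation_\<nu>s: "(\<integral>\<^sup>+t\<in>{0..1}. emeasure (total_variation (\<nu>s t)) (ball 0 R) \<partial>lborel) < \<infinity>"
proof -
  obtain e where e: "e > 0" "\<And>x. norm x \<le> R \<Longrightarrow> e \<le> wt x" using wt(5)[of R] by blast
  have le: "emeasure (total_variation (\<nu>s t)) (ball 0 R) \<le> ennreal (1 / e) * (\<integral>\<^sup>+x. ennreal (norm (w (t, x))) \<partial>\<gamma>w)" for t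
  proof -
    have "emeasure (total_variation (\<nu>s t)) (ball 0 R) \<le> (\<integral>\<^sup>+x. ennreal (norm (snd (w (t, x)))) * indicator (ball 0 R) x \<partial>\<gamma>)"
      unfolding \<nu>s_def by (rule total_variation_density_le[OF \<gamma> w_locally_integrable(3)]) simp
    also have "\<dots> \<le> (\<integral>\<^sup>+x. ennreal (1 / e) * (ennreal (wt x) * ennreal (norm (w (t, x)))) \<partial>\<gamma>)"
    proof (rule nn_integral_mono)
      fix x
      show "ennreal (norm (snd (w (t, x)))) * indicator (ball 0 R) x \<le> ennreal (1 / e) * (ennreal (wt x) * ennreal (norm (w (t, x))))"
      proof (cases "x \<in> ball 0 R")
        case True
        then have "1 \<le> wt x / e" using e by (auto simp: pos_le_divide_eq)
        then have "1 * norm (snd (w (t, x))) \<le> wt x / e * norm (w (t, x))"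
          using norm_snd_le[of "snd (w (t, x))" "fst (w (t, x))"] by (intro mult_mono) auto
        then show ?thesis using True e wt(2)[of x] by (simp add: ennreal_mult[symmetric] less_imp_le ennreal_leI)
      qed simp
    qed
    also have "\<dots> = ennreal (1 / e) * (\<integral>\<^sup>+x. ennreal (norm (w (t, x))) \<partial>\<gamma>w)"
      by (subst nn_integral_\<gamma>w) (auto simp: nn_integral_cmult)
    finally show ?thesis .
  qed
  have m: "(\<lambda>t. \<integral>\<^sup>+x. ennreal (norm (w (t, x))) \<partial>\<gamma>w) \<in> borel_measurable borel"
    using \<gamma>w.borel_measurable_nn_integral_fst[of "\<lambda>z. ennreal (norm (w z))" borel] by simp
  have "(\<integral>\<^sup>+t\<in>{0..1}. emeasure (total_variation (\<nu>s t)) (ball 0 R) \<partial>lborel)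
      \<le> (\<integral>\<^sup>+t\<in>{0..1}. ennreal (1 / e) * (\<integral>\<^sup>+x. ennreal (norm (w (t, x))) \<partial>\<gamma>w) \<partial>lborel)"
    by (intro nn_integral_mono mult_right_mono le) simp
  also have "\<dots> = (\<integral>\<^sup>+t. ennreal (1 / e) * (\<integral>\<^sup>+x. ennreal (norm (w (t, x))) \<partial>\<gamma>w) \<partial>\<tau>)"
    by (rule nn_integral_\<tau>[symmetric]) (use m in measurable)
  also have "\<dots> = ennreal (1 / e) * (\<integral>\<^sup>+z. ennreal (norm (w z)) \<partial>P)"
    using m \<gamma>w.nn_integral_fst[of "\<lambda>z. ennreal (norm (w z))" \<tau>] unfolding P_def
    by (subst nn_integral_cmult) (auto simp: measurable_cong_sets[OF sets_P[unfolded P_def] refl])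
  also have "\<dots> < \<infinity>" using w_integrable_P by (simp add: integrable_iff_bounded ennreal_mult_less_top)
  finally show ?thesis .
qed

text \<open>Three replacements: each curve by its smoothing, with vanishing error; the combination
  of smoothings by one integral of \<open>V c k\<close> over P; and \<open>V c k\<close> by v in L1.
  At almost every time the result is the pairing with \<open>\<mu>s\<close> and
  \<open>\<nu>s\<close>, which have density w there.\<close>

lemma pairing_limit:
  assumes F: "cc F"
  shows "(\<lambda>k. combine (c k) (\<lambda>i. LINT t:{0..1}|lborel. pairing (\<mu> i t) (\<nu> i t) (\<lambda>x. F (x, t))))
    \<longlonglongrightarrow> (LINT t:{0..1}|lborel. pairing (\<mu>s t) (\<nu>s t) (\<lambda>x. F (x, t)))"
proof -
  have Fm[measurable]: "F \<in> borel_measurable (borel \<Otimes>\<^sub>M borel)" using cc_bbs[OF F] by (simp add: bbs_def borel_prod)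
  have Fs[measurable]: "(\<lambda>x. F (x, t)) \<in> borel_measurable borel" for t using cc_bbs[OF cc_section[OF F]] by (simp add: bbs_def)
  obtain B where B: "0 \<le> B" "\<And>x t. norm ((1 / wt x) *\<^sub>R F (x, t)) \<le> B" using weight_bound[OF F] by blast
  \<comment> \<open>Division by the weight turns integrals against \<open>\<gamma>\<close> into
    integrals against \<open>\<gamma>w\<close>. H is bounded, since F has bounded support and the
    weight is bounded below there.\<close>
  define H where "H z = (1 / wt (snd z)) *\<^sub>R F (snd z, fst z)" for z
  have Hm[measurable]: "H \<in> borel_measurable (borel \<Otimes>\<^sub>M borel)" unfolding H_def by measurable
  have HB: "norm (H z) \<le> B" for z unfolding H_def by (rule B)
  have Hi: "integrable P (\<lambda>z. H z \<bullet> f z)" if f: "integrable P f" for f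
  proof (rule Bochner_Integration.integrable_bound)
    show "integrable P (\<lambda>z. B *\<^sub>R norm (f z))" using f by auto
    have "f \<in> borel_measurable P" using f by auto
    then show "(\<lambda>z. H z \<bullet> f z) \<in> borel_measurable P" by (intro borel_measurable_inner) (simp_all add: measurable_cong_sets[OF sets_P refl])
    have "\<bar>H z \<bullet> f z\<bar> \<le> B * norm (f z)" for z
      by (rule order.trans[OF Cauchy_Schwarz_ineq2 mult_right_mono[OF HB]]) simp
    then show "AE z in P. norm (H z \<bullet> f z) \<le> norm (B *\<^sub>R norm (f z))" using B(1) by (simp add: abs_mult)
  qed
  define S where "S f t = (\<integral>x. F (x, t) \<bullet> f (t, x) \<partial>\<gamma>)" for f :: "real \<times> 'a \<Rightarrow> real \<times> 'a" and t
  have fub: "integrable \<tau> (S f)" "(\<integral>t. S f t \<partial>\<tau>) = (\<integral>z. H z \<bullet> f z \<partial>P)" "S f \<in> borel_measurable borel"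
    if f: "integrable P f" and fm[measurable]: "f \<in> borel_measurable (borel \<Otimes>\<^sub>M borel)" for f
  proof -
    have fx: "(\<lambda>x. f (t, x)) \<in> borel_measurable borel" for t
      using measurable_comp[OF measurable_Pair1'[of t borel borel] fm] by (simp add: o_def)
    have S: "S f = (\<lambda>t. \<integral>x. H (t, x) \<bullet> f (t, x) \<partial>\<gamma>w)"
      unfolding S_def H_def using weighted_integral[OF Fs fx] by (simp add: fun_eq_iff)
    show i: "integrable \<tau> (S f)" unfolding S using P.integrable_fst'[OF Hi[OF f, unfolded P_def]] by simp
    show "(\<integral>t. S f t \<partial>\<tau>) = (\<integral>z. H z \<bullet> f z \<partial>P)"
      unfolding S using P.integral_fst'[OF Hi[OF f, unfolded P_def]] by (simp add: P_def)
    show "S f \<in> borel_measurable borel"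
      using borel_measurable_integrable[OF i] by (simp add: measurable_cong_sets[OF sets_\<tau> refl])
  qed
  define u where "u i z = U i (snd z) (fst z)" for i and z :: "real \<times> 'a"
  have u: "integrable P (u i)" "u i \<in> borel_measurable (borel \<Otimes>\<^sub>M borel)" for i
    using U_integrable U_measurable by (simp_all add: u_def[abs_def])
  define I where "I i = (\<integral>t. S (u i) t \<partial>\<tau>)" for i
  define L where "L i t = pairing (\<mu> i t) (\<nu> i t) (\<lambda>x. F (x, t))" for i t
  have D: "(\<lambda>i. (LINT t:{0..1}|lborel. L i t) - I i) \<longlonglongrightarrow> 0"
    unfolding tendsto_iff dist_real_def diff_0_right
  proof (intro allI impI)
    fix e :: real assume e: "0 < e"
    then have e2: "0 < e / 2" by simp
    show "eventually (\<lambda>i. \<bar>(LINT t:{0..1}|lborel. L i t) - I i\<bar> < e) sequentially"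
      using error_integral[OF F e2]
    proof eventually_elim
      case (elim i)
      have SL: "L i t - S (u i) t = pairing (\<mu> i t) (\<nu> i t) (\<lambda>x. F (x, t)) - (\<integral>x. F (x, t) \<bullet> U i x t \<partial>\<gamma>)" for t
        by (simp add: L_def S_def u_def)
      have m: "(\<lambda>t. indicator {0..1} t *\<^sub>R (L i t - S (u i) t)) \<in> borel_measurable borel"
      proof -
        have "(\<lambda>t. if t \<in> {0..1} then L i t else 0) \<in> borel_measurable borel"
          unfolding L_def by (rule CE_pairing_measurable[OF sc.CE F])
        then have "(\<lambda>t. (if t \<in> {0..1} then L i t else 0) - indicator {0..1} t * S (u i) t) \<in> borel_measurable borel"
          using fub(3)[OF u] by (intro borel_measurable_diff borel_measurable_times) auto
        then show ?thesis by (rule measurable_cong[THEN iffD1, rotated]) auto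
      qed
      have n: "(\<integral>\<^sup>+t. ennreal (norm (indicator {0..1} t *\<^sub>R (L i t - S (u i) t))) \<partial>lborel) \<le> ennreal (e / 2)"
      proof -
        have "(\<integral>\<^sup>+t. ennreal (norm (indicator {0..1} t *\<^sub>R (L i t - S (u i) t))) \<partial>lborel)
            = (\<integral>\<^sup>+t\<in>{0..1}. ennreal \<bar>pairing (\<mu> i t) (\<nu> i t) (\<lambda>x. F (x, t)) - (\<integral>x. F (x, t) \<bullet> U i x t \<partial>\<gamma>)\<bar> \<partial>lborel)"
          unfolding SL by (intro nn_integral_cong) (auto simp: indicator_def)
        then show ?thesis using elim by simp
      qed
      \<comment> \<open>Integrability of \<open>L i\<close> comes out of the error estimate:
        \<open>L i\<close> is the sum of this difference and of the integrable
        \<open>S (u i)\<close>.\<close>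
      have di: "set_integrable lborel {0..1} (\<lambda>t. L i t - S (u i) t)"
        unfolding set_integrable_def using m n by (intro integrableI_bounded) (auto intro: le_less_trans)
      have Si: "set_integrable lborel {0..1} (S (u i))"
        using fub(1)[OF u] fub(3)[OF u] unfolding \<tau>_def set_integrable_def
        by (subst (asm) integrable_density) auto
      have "set_integrable lborel {0..1} (\<lambda>t. (L i t - S (u i) t) + S (u i) t)"
        by (rule set_integral_add(1)[OF di Si])
      then have Li: "set_integrable lborel {0..1} (L i)" by simp
      have "I i = (LINT t:{0..1}|lborel. S (u i) t)" unfolding I_def by (rule integral_\<tau>[OF fub(3)[OF u]])
      then have "(LINT t:{0..1}|lborel. L i t) - I i = (LINT t:{0..1}|lborel. L i t - S (u i) t)"
        using set_integral_diff(2)[OF Li Si] by simp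
      also have "ennreal \<bar>\<dots>\<bar> \<le> ennreal (e / 2)"
        using integral_norm_bound_ennreal[OF di[unfolded set_integrable_def]] n
        unfolding set_lebesgue_integral_def by simp
      finally have "\<bar>(LINT t:{0..1}|lborel. L i t) - I i\<bar> \<le> e / 2" using e by (simp add: ennreal_le_iff)
      then show ?case using e by simp
    qed
  qed
  have comb: "combine (c k) I = (\<integral>z. H z \<bullet> V c k z \<partial>P)" for k
  proof -
    have "(\<integral>z. H z \<bullet> V c k z \<partial>P) = (\<integral>z. (\<Sum>i\<le>snd (c k). fst (c k) i *\<^sub>R (H z \<bullet> u i z)) \<partial>P)"
      by (intro Bochner_Integration.integral_cong refl) (simp add: V_def combine_def u_def inner_sum_right)
    also have "\<dots> = combine (c k) (\<lambda>i. \<integral>z. H z \<bullet> u i z \<partial>P)"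
      unfolding combine_def using Hi[OF u(1)] by (subst Bochner_Integration.integral_sum) auto
    moreover have "I = (\<lambda>i. \<integral>z. H z \<bullet> u i z \<partial>P)" unfolding I_def using fub(2)[OF u] by (simp add: fun_eq_iff)
    ultimately show ?thesis by simp
  qed
  have "(\<lambda>k. (\<integral>z. H z \<bullet> V c k z \<partial>P) - (\<integral>z. H z \<bullet> v z \<partial>P)) \<longlonglongrightarrow> 0"
  proof (rule Lim_null_comparison[OF always_eventually[OF allI]])
    show "(\<lambda>k. B * (\<integral>z. norm (V c k z - v z) \<partial>P)) \<longlonglongrightarrow> 0" by (rule tendsto_mult_right_zero[OF vL1])
    fix k
    have d: "integrable P (\<lambda>z. V c k z - v z)" using V_integrable vi by (rule Bochner_Integration.integrable_diff)
    have "(\<integral>z. H z \<bullet> V c k z \<partial>P) - (\<integral>z. H z \<bullet> v z \<partial>P) = (\<integral>z. H z \<bullet> (V c k z - v z) \<partial>P)"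
      using Hi[OF V_integrable] Hi[OF vi] by (simp add: inner_diff_right)
    also have "norm \<dots> \<le> (\<integral>z. norm (H z \<bullet> (V c k z - v z)) \<partial>P)" by (rule integral_norm_bound)
    also have "\<dots> \<le> (\<integral>z. B * norm (V c k z - v z) \<partial>P)"
    proof (rule integral_mono)
      show "norm (H z \<bullet> (V c k z - v z)) \<le> B * norm (V c k z - v z)" for z
        unfolding real_norm_def by (rule order.trans[OF Cauchy_Schwarz_ineq2 mult_right_mono[OF HB]]) simp
    qed (use Hi[OF d] d in \<open>auto intro: integrable_norm\<close>)
    finally show "norm ((\<integral>z. H z \<bullet> V c k z \<partial>P) - (\<integral>z. H z \<bullet> v z \<partial>P)) \<le> B * (\<integral>z. norm (V c k z - v z) \<partial>P)" by simp
  qed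
  then have "(\<lambda>k. combine (c k) I) \<longlonglongrightarrow> (\<integral>z. H z \<bullet> v z \<partial>P)" unfolding comb by (rule LIM_zero_cancel)
  moreover have "(\<lambda>k. combine (c k) (\<lambda>i. LINT t:{0..1}|lborel. L i t) - combine (c k) I) \<longlonglongrightarrow> 0"
    using combine_tendsto[OF c D] by (simp add: combine_diff)
  ultimately have "(\<lambda>k. combine (c k) (\<lambda>i. LINT t:{0..1}|lborel. L i t)) \<longlonglongrightarrow> (\<integral>z. H z \<bullet> v z \<partial>P)"
    using tendsto_add by fastforce
  moreover have "(\<integral>z. H z \<bullet> v z \<partial>P) = (LINT t:{0..1}|lborel. pairing (\<mu>s t) (\<nu>s t) (\<lambda>x. F (x, t)))"
  proof -
    have "(\<integral>z. H z \<bullet> v z \<partial>P) = (LINT t:{0..1}|lborel. S v t)"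
      unfolding fub(2)[OF vi vm, symmetric] by (rule integral_\<tau>[OF fub(3)[OF vi vm]])
    also have "\<dots> = (LINT t|lborel. indicator {0..1} t *\<^sub>R S v t)" by (simp add: set_lebesgue_integral_def)
    also have "\<dots> = (LINT t|lborel. indicator {0..1} t *\<^sub>R pairing (\<mu>s t) (\<nu>s t) (\<lambda>x. F (x, t)))"
    proof (rule integral_cong_AE)
      show ae: "AE t in lborel. indicator {0..1} t *\<^sub>R S v t = indicator {0..1} t *\<^sub>R pairing (\<mu>s t) (\<nu>s t) (\<lambda>x. F (x, t))"
        using AE_interior
      proof eventually_elim
        case (elim t)
        show ?case
        proof (cases "t \<in> {0..1}")
          case True
          then have t: "t \<in> {0<..<1}" "good t" using elim by auto
          have "pairing (\<mu>s t) (\<nu>s t) (\<lambda>x. F (x, t)) = (\<integral>x. F (x, t) \<bullet> (fst (w (t, x)), snd (w (t, x))) \<partial>\<gamma>)"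
            unfolding \<mu>s_interior[OF t(1)] \<nu>s_def \<rho>s_def if_P[OF t(2)]
            by (rule pairing_density[OF \<gamma> w_locally_integrable(2,3) cc_bbs[OF cc_section[OF F]]])
          then show ?thesis by (simp add: S_def w_good[OF t(2)])
        qed simp
      qed
      show "(\<lambda>t. indicator {0..1} t *\<^sub>R S v t) \<in> borel_measurable lborel"
        using fub(3)[OF vi vm] by auto
      show "(\<lambda>t. indicator {0..1} t *\<^sub>R pairing (\<mu>s t) (\<nu>s t) (\<lambda>x. F (x, t))) \<in> borel_measurable lborel"
        unfolding measurable_lborel2
        by (rule measurable_cong[THEN iffD1, rotated,
            OF pairing_curve_measurable[OF radon_\<mu>s radon_\<nu>s continuous_\<mu>s borel_family_\<nu>s F]]) auto
    qed
    finally show ?thesis by (simp add: set_lebesgue_integral_def)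
  qed
  ultimately show ?thesis by (simp add: L_def)
qed

end

text \<open>\<open>C1c_test\<close> restricts only the support of \<zeta>. On the open complement of
  its closure \<zeta> is constantly 0, so uniqueness of the derivative forces g and h to vanish
  there.\<close>

lemma C1c_test_cc:
  assumes "C1c_test T \<zeta> g h"
  shows "cc (\<lambda>z. (h z, 0 :: 'a::euclidean_space))" "cc (\<lambda>z. (0 :: real, g z :: 'a))"
proof -
  have D: "\<And>z. (\<zeta> has_derivative (\<lambda>(y, s). g z \<bullet> y + h z * s)) (at z)" "continuous_on UNIV g" "continuous_on UNIV h"
    "compact (closure {z. \<zeta> z \<noteq> 0})"
    using assms unfolding C1c_test_def by auto
  obtain R where R: "closure {z. \<zeta> z \<noteq> 0} \<subseteq> cball 0 R"
    using bounded_subset_cball0[OF compact_imp_bounded[OF D(4)]] by blast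
  have van: "h z = 0 \<and> g z = 0" if "R < norm z" for z
  proof -
    have z: "z \<in> - closure {z. \<zeta> z \<noteq> 0}" using R that by auto
    have "((\<lambda>_. 0) has_derivative (\<lambda>_. 0)) (at z)" by (rule has_derivative_const)
    then have "(\<zeta> has_derivative (\<lambda>_. 0)) (at z)"
    proof (rule has_derivative_transform_within_open[OF _ _ z])
      show "open (- closure {z. \<zeta> z \<noteq> 0})" by (simp add: open_Compl)
      show "0 = \<zeta> x" if "x \<in> - closure {z. \<zeta> z \<noteq> 0}" for x
      proof (rule ccontr)
        assume "0 \<noteq> \<zeta> x"
        then have "x \<in> {z. \<zeta> z \<noteq> 0}" by simp
        then show False using that closure_subset[of "{z. \<zeta> z \<noteq> 0}"] by blast
      qed
    qed
    then have "(\<lambda>(y, s). g z \<bullet> y + h z * s) = (\<lambda>_. 0)"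
      by (rule has_derivative_unique[OF D(1)])
    note eq = fun_cong[OF this]
    have "h z = 0" using eq[of "(0, 1)"] by simp
    moreover have "g z \<bullet> g z = 0" using eq[of "(g z, 0)"] by simp
    ultimately show ?thesis by simp
  qed
  have "continuous_on UNIV (\<lambda>z. (h z, 0 :: 'a))" "continuous_on UNIV (\<lambda>z. (0 :: real, g z))"
    by (rule continuous_on_Pair[OF D(3) continuous_on_const], rule continuous_on_Pair[OF continuous_on_const D(2)])
  then show "cc (\<lambda>z. (h z, 0 :: 'a))" "cc (\<lambda>z. (0 :: real, g z))"
    unfolding cc_def by (intro conjI exI[of _ R] allI impI; simp add: van zero_prod_def)+
qed

lemma pairing_components:
  "pairing \<mu> \<nu> (\<lambda>x. (f x, 0)) = signed_integral \<mu> f" "pairing \<mu> \<nu> (\<lambda>x. (0, g x)) = vector_integral \<nu> g"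
  by (simp_all add: pairing_def vector_integral_def signed_integral_def)

context limit_curve
begin

text \<open>The two terms are pairings with (h, 0) and (0, g). Their sum is 0 for each curve, hence
  for each combination, and both terms converge.\<close>

lemma continuity_equation_limit:
  assumes T: "C1c_test 1 \<zeta> g h"
  shows "(LINT t:{0..1}|lborel. signed_integral (\<mu>s t) (\<lambda>x. h (x, t))) +
    (LINT t:{0..1}|lborel. vector_integral (\<nu>s t) (\<lambda>x. g (x, t))) = 0"
proof -
  note l = pairing_limit[OF C1c_test_cc(1)[OF T], unfolded pairing_components]
    pairing_limit[OF C1c_test_cc(2)[OF T], unfolded pairing_components]
  have "combine (c k) (\<lambda>i. LINT t:{0..1}|lborel. signed_integral (\<mu> i t) (\<lambda>x. h (x, t))) +
      combine (c k) (\<lambda>i. LINT t:{0..1}|lborel. vector_integral (\<nu> i t) (\<lambda>x. g (x, t))) = 0" for k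
    using CE_D(5)[OF sc.CE T]
    unfolding combine_def sum.distrib[symmetric] scaleR_add_right[symmetric] by simp
  then show ?thesis using tendsto_add[OF l] by (simp add: LIMSEQ_const_iff)
qed

lemma limit_CE: "(\<mu>s, \<nu>s) \<in> CE 1"
  unfolding CE_def mem_Collect_eq prod.case
  using radon_\<mu>s radon_\<nu>s continuous_\<mu>s borel_family_\<nu>s variation_\<mu>s variation_\<nu>s continuity_equation_limit
  by (auto simp: cc_Cc)

lemma supports_AE: "AE t in lborel. t \<in> {0..1} \<longrightarrow>
    msupp (total_variation (\<mu>s t)) \<subseteq> msupp \<gamma> \<and> msupp (total_variation (\<nu>s t)) \<subseteq> msupp \<gamma>"
  using AE_interior
proof eventually_elim
  case (elim t)
  show ?case
  proof
    assume t: "t \<in> {0..1}"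
    have "msupp (total_variation (\<mu>s t)) \<subseteq> msupp \<gamma>"
      using elim t msupp_total_variation_density[OF \<gamma> \<rho>s_props(1)[OF t]] by (simp add: \<mu>s_interior)
    then show "msupp (total_variation (\<mu>s t)) \<subseteq> msupp \<gamma> \<and> msupp (total_variation (\<nu>s t)) \<subseteq> msupp \<gamma>"
      unfolding \<nu>s_def using msupp_total_variation_density[OF \<gamma> w_locally_integrable(3)] by blast
  qed
qed

section \<open>Energy of the limit\<close>

lemma energy_measurable:
  assumes [measurable]: "\<psi> \<in> borel_measurable borel" "q \<in> borel_measurable (borel \<Otimes>\<^sub>M borel)"
  shows "(\<lambda>t. \<integral>\<^sup>+x. (\<psi> (q (t, x)) :: ennreal) \<partial>\<gamma>) \<in> borel_measurable borel" "(\<lambda>x. \<psi> (q (t, x))) \<in> borel_measurable \<gamma>"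
proof -
  interpret \<gamma>: sigma_finite_measure \<gamma> by (rule pos_radon_sigma_finite[OF \<gamma>])
  have m: "(\<lambda>z. \<psi> (q z)) \<in> borel_measurable (borel \<Otimes>\<^sub>M \<gamma>)" by measurable
  show "(\<lambda>t. \<integral>\<^sup>+x. \<psi> (q (t, x)) \<partial>\<gamma>) \<in> borel_measurable borel"
    using \<gamma>.borel_measurable_nn_integral_fst[OF m] by simp
  show "(\<lambda>x. \<psi> (q (t, x))) \<in> borel_measurable \<gamma>"
    using measurable_comp[OF measurable_Pair1'[of t borel \<gamma>] m] by (simp add: o_def)
qed

text \<open>Only smoothings of index i \<ge> k carry weight, and m \<le> k \<le> i gives
  \<open>\<phi>n m \<le> \<phi>n i\<close>, whose energy along the i-th curve is bounded.\<close>

lemma V_energy: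
  assumes "m \<le> k"
  shows "(\<integral>\<^sup>+t. \<integral>\<^sup>+x. \<phi>n m (V c k (t, x)) \<partial>\<gamma> \<partial>\<tau>) \<le> ennreal ((1 + 1 / (real k + 1)) * A)"
proof -
  define l where "l = fst (c k)"
  define N where "N = snd (c k)"
  have l: "\<And>i. 0 \<le> l i" "\<And>i. i < k \<Longrightarrow> l i = 0" "(\<Sum>i\<le>N. l i) = 1"
    using c[of k] by (auto simp: forward_weights_def l_def N_def split: prod.splits)
  define u where "u i z = U i (snd z) (fst z)" for i and z :: "real \<times> 'a"
  have um[measurable]: "u i \<in> borel_measurable (borel \<Otimes>\<^sub>M borel)" for i
    unfolding u_def[abs_def] by (rule U_measurable)
  have um': "(\<lambda>x. \<phi>n m (U i x t)) \<in> borel_measurable \<gamma>" "(\<lambda>t. \<integral>\<^sup>+x. \<phi>n m (U i x t) \<partial>\<gamma>) \<in> borel_measurable borel" for i t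
    using energy_measurable[OF \<phi>n_measurable[of m] um[of i]] by (simp_all add: u_def)
  have V: "V c k (t, x) = (\<Sum>i\<le>N. l i *\<^sub>R U i x t)" for t x by (simp add: V_def combine_def l_def N_def)
  have "\<phi>n m (V c k (t, x)) \<le> (\<Sum>i\<le>N. ennreal (l i) * \<phi>n m (U i x t))" for t x
    unfolding V by (rule convex_fun_sum[OF admissible_onD(2)[OF sc.adm]]) (use l in auto)
  then have "(\<integral>\<^sup>+t. \<integral>\<^sup>+x. \<phi>n m (V c k (t, x)) \<partial>\<gamma> \<partial>\<tau>)
      \<le> (\<integral>\<^sup>+t. \<integral>\<^sup>+x. (\<Sum>i\<le>N. ennreal (l i) * \<phi>n m (U i x t)) \<partial>\<gamma> \<partial>\<tau>)"
    by (intro nn_integral_mono)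
  also have "\<dots> = (\<integral>\<^sup>+t. (\<Sum>i\<le>N. ennreal (l i) * (\<integral>\<^sup>+x. \<phi>n m (U i x t) \<partial>\<gamma>)) \<partial>\<tau>)"
    using um'(1) by (simp add: nn_integral_sum nn_integral_cmult)
  also have "\<dots> = (\<Sum>i\<le>N. ennreal (l i) * (\<integral>\<^sup>+t. \<integral>\<^sup>+x. \<phi>n m (U i x t) \<partial>\<gamma> \<partial>\<tau>))"
    using um'(2) by (simp add: nn_integral_sum nn_integral_cmult measurable_cong_sets[OF sets_\<tau> refl])
  also have "\<dots> \<le> (\<Sum>i\<le>N. ennreal (l i) * ennreal ((1 + 1 / (real k + 1)) * A))"
  proof (intro sum_mono)
    fix i
    show "ennreal (l i) * (\<integral>\<^sup>+t. \<integral>\<^sup>+x. \<phi>n m (U i x t) \<partial>\<gamma> \<partial>\<tau>) \<le> ennreal (l i) * ennreal ((1 + 1 / (real k + 1)) * A)"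
    proof (cases "i < k")
      case False
      have "(\<integral>\<^sup>+t. \<integral>\<^sup>+x. \<phi>n m (U i x t) \<partial>\<gamma> \<partial>\<tau>) \<le> ennreal ((1 + 1 / (real i + 1)) * A)"
        unfolding nn_integral_\<tau>[OF um'(2)] using False assms by (intro U_energy) simp
      also have "\<dots> \<le> ennreal ((1 + 1 / (real k + 1)) * A)"
        using False sc.A0 by (intro ennreal_leI mult_right_mono add_left_mono divide_left_mono) auto
      finally show ?thesis by (intro mult_left_mono) auto
    qed (simp add: l)
  qed
  also have "\<dots> = ennreal ((1 + 1 / (real k + 1)) * A)"
    using l by (simp add: sum_distrib_right[symmetric])
  finally show ?thesis .
qed

text \<open>Lower semicontinuity of one fixed \<open>\<phi>n m\<close> and Fatou, first in x at
  almost every t, then in t. Keeping m fixed lets k tend to infinity within the range m \<le> k of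
  \<open>V_energy\<close>.\<close>

lemma w_energy_n: "(\<integral>\<^sup>+t. \<integral>\<^sup>+x. \<phi>n m (w (t, x)) \<partial>\<gamma> \<partial>\<tau>) \<le> ennreal A"
proof -
  note Vm = energy_measurable[OF \<phi>n_measurable[of m] V_measurable]
  have "AE t in \<tau>. AE x in \<gamma>w. (\<lambda>k. V c k (t, x)) \<longlonglongrightarrow> v (t, x)"
    by (rule P.AE_pair[OF vae[unfolded P_def]])
  then have "AE t in \<tau>. (\<integral>\<^sup>+x. \<phi>n m (w (t, x)) \<partial>\<gamma>) \<le> liminf (\<lambda>k. \<integral>\<^sup>+x. \<phi>n m (V c k (t, x)) \<partial>\<gamma>)"
    using AE_good
  proof eventually_elim
    case (elim t)
    have "(\<integral>\<^sup>+x. \<phi>n m (w (t, x)) \<partial>\<gamma>) \<le> (\<integral>\<^sup>+x. liminf (\<lambda>k. \<phi>n m (V c k (t, x))) \<partial>\<gamma>)"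
    proof (intro nn_integral_mono_AE, use elim(1)[unfolded AE_\<gamma>w] in eventually_elim)
      fix x assume "(\<lambda>k. V c k (t, x)) \<longlonglongrightarrow> v (t, x)"
      then show "\<phi>n m (w (t, x)) \<le> liminf (\<lambda>k. \<phi>n m (V c k (t, x)))"
        unfolding w_good[OF elim(2)] by (rule lsc_liminf[OF admissible_onD(1)[OF sc.adm]])
    qed
    also have "\<dots> \<le> liminf (\<lambda>k. \<integral>\<^sup>+x. \<phi>n m (V c k (t, x)) \<partial>\<gamma>)"
      by (rule nn_integral_liminf) (rule Vm(2))
    finally show ?case .
  qed
  then have "(\<integral>\<^sup>+t. \<integral>\<^sup>+x. \<phi>n m (w (t, x)) \<partial>\<gamma> \<partial>\<tau>) \<le> (\<integral>\<^sup>+t. liminf (\<lambda>k. \<integral>\<^sup>+x. \<phi>n m (V c k (t, x)) \<partial>\<gamma>) \<partial>\<tau>)"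
    by (rule nn_integral_mono_AE)
  also have "\<dots> \<le> liminf (\<lambda>k. \<integral>\<^sup>+t. \<integral>\<^sup>+x. \<phi>n m (V c k (t, x)) \<partial>\<gamma> \<partial>\<tau>)"
    by (rule nn_integral_liminf) (use Vm(1) in \<open>simp add: measurable_cong_sets[OF sets_\<tau> refl]\<close>)
  also have "\<dots> \<le> liminf (\<lambda>k. ennreal ((1 + 1 / (real k + 1)) * A))"
    by (intro Liminf_mono) (use V_energy in \<open>auto simp: eventually_sequentially\<close>)
  also have "\<dots> = ennreal A"
  proof (rule lim_imp_Liminf)
    have "(\<lambda>k. (1 + 1 / (real k + 1)) * A) \<longlonglongrightarrow> (1 + 0) * A"
      by (intro tendsto_mult tendsto_add tendsto_const inverse_Suc_tendsto)
    then show "(\<lambda>k. ennreal ((1 + 1 / (real k + 1)) * A)) \<longlonglongrightarrow> ennreal A" using tendsto_ennrealI by fastforce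
  qed simp
  finally show ?thesis .
qed

text \<open>\<open>\<phi>\<close> is the supremum of the increasing \<open>\<phi>n m\<close>, so
  monotone convergence in x and then in t transfers a bound that does not depend on m.\<close>

lemma w_energy: "(\<integral>\<^sup>+t. \<integral>\<^sup>+x. \<phi> (w (t, x)) \<partial>\<gamma> \<partial>\<tau>) \<le> ennreal A"
proof -
  note wm = energy_measurable[OF \<phi>n_measurable w_measurable]
  have inc: "incseq (\<lambda>m. \<phi>n m z)" for z using mono by (rule incseq_SucI)
  have "\<phi> z = (SUP m. \<phi>n m z)" for z by (rule LIMSEQ_unique[OF lim LIMSEQ_SUP[OF inc]])
  then have "(\<integral>\<^sup>+t. \<integral>\<^sup>+x. \<phi> (w (t, x)) \<partial>\<gamma> \<partial>\<tau>) = (\<integral>\<^sup>+t. (\<integral>\<^sup>+x. (SUP m. \<phi>n m (w (t, x))) \<partial>\<gamma>) \<partial>\<tau>)" by simp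
  also have "\<dots> = (\<integral>\<^sup>+t. (SUP m. \<integral>\<^sup>+x. \<phi>n m (w (t, x)) \<partial>\<gamma>) \<partial>\<tau>)"
  proof (intro nn_integral_cong nn_integral_monotone_convergence_SUP wm(2))
    show "incseq (\<lambda>m x. \<phi>n m (w (t, x)))" for t using inc by (auto simp: incseq_def le_fun_def)
  qed
  also have "\<dots> = (SUP m. \<integral>\<^sup>+t. \<integral>\<^sup>+x. \<phi>n m (w (t, x)) \<partial>\<gamma> \<partial>\<tau>)"
  proof (rule nn_integral_monotone_convergence_SUP)
    show "incseq (\<lambda>m t. \<integral>\<^sup>+x. \<phi>n m (w (t, x)) \<partial>\<gamma>)"
      unfolding incseq_def le_fun_def by (intro allI impI nn_integral_mono \<phi>n_mono)
  qed (use wm(1) in \<open>simp add: measurable_cong_sets[OF sets_\<tau> refl]\<close>)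
  also have "\<dots> \<le> ennreal A" by (rule SUP_least) (rule w_energy_n)
  finally show ?thesis .
qed

lemma limit_action: "(\<integral>\<^sup>+t\<in>{0..1}. action \<phi> (\<mu>s t) (\<nu>s t) \<gamma> \<partial>lborel) \<le> ennreal A"
proof -
  have "(\<integral>\<^sup>+t\<in>{0..1}. action \<phi> (\<mu>s t) (\<nu>s t) \<gamma> \<partial>lborel) \<le> (\<integral>\<^sup>+t\<in>{0..1}. (\<integral>\<^sup>+x. \<phi> (w (t, x)) \<partial>\<gamma>) \<partial>lborel)"
  proof (intro nn_integral_mono_AE, use AE_interior in eventually_elim)
    fix t :: real assume t: "t \<in> {0..1} \<longrightarrow> t \<in> {0<..<1} \<and> good t"
    show "action \<phi> (\<mu>s t) (\<nu>s t) \<gamma> * indicator {0..1} t \<le> (\<integral>\<^sup>+x. \<phi> (w (t, x)) \<partial>\<gamma>) * indicator {0..1} t"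
    proof (cases "t \<in> {0..1}")
      case True
      then have t': "t \<in> {0<..<1}" "good t" using t by auto
      have "action \<phi> (\<mu>s t) (\<nu>s t) \<gamma> \<le> (\<integral>\<^sup>+x. \<phi> (w (t, x)) \<partial>\<gamma>)"
        unfolding \<mu>s_interior[OF t'(1)] \<nu>s_def \<rho>s_def if_P[OF t'(2)]
        using action_density_le[OF adm sc.p sc.ab \<gamma> w_locally_integrable(2,3)[of t]] by simp
      then show ?thesis by (rule mult_right_mono) simp
    qed simp
  qed
  also have "\<dots> = (\<integral>\<^sup>+t. \<integral>\<^sup>+x. \<phi> (w (t, x)) \<partial>\<gamma> \<partial>\<tau>)"
    by (intro nn_integral_\<tau>[symmetric] energy_measurable(1) w_measurable lsc_borel_measurable admissible_onD(1)[OF adm])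
  also have "\<dots> \<le> ennreal A" by (rule w_energy)
  finally show ?thesis .
qed

lemma limit_CE_act: "(\<mu>s, \<nu>s) \<in> CE_act \<phi> \<gamma> \<mu>0 \<mu>1"
  unfolding CE_act_def using limit_CE supports_AE limit_action
  by (auto simp: \<mu>s_def intro: le_less_trans)

end

section \<open>From limits of curves to the distances\<close>

lemma (in limit_setup) limit_exists:
  "\<exists>(\<mu>', \<nu>')\<in>CE_act \<phi> \<gamma> \<mu>0 \<mu>1. (\<integral>\<^sup>+t\<in>{0..1}. action \<phi> (\<mu>' t) (\<nu>' t) \<gamma> \<partial>lborel) \<le> ennreal A"
proof -
  obtain c v where cv: "\<forall>k. c k \<in> forward_weights k" "v \<in> borel_measurable (borel \<Otimes>\<^sub>M borel)" "integrable P v"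
    "AE z in P. (\<lambda>k. V c k z) \<longlonglongrightarrow> v z" "(\<lambda>k. \<integral>z. norm (V c k z - v z) \<partial>P) \<longlonglongrightarrow> 0"
    "AE t in \<tau>. (\<lambda>k. \<integral>x. norm (V c k (t, x) - v (t, x)) \<partial>\<gamma>w) \<longlonglongrightarrow> 0"
    using combinations_exist by blast
  interpret limit_curve p a b A r1 \<phi>n \<phi> \<gamma>n \<gamma> \<mu> \<nu> J J1 \<theta> \<mu>0 \<mu>1 wt c v
    by unfold_locales (use cv in auto)
  show ?thesis using limit_CE_act limit_action by blast
qed

text \<open>A continuous function equal to 1 on the ball and of bounded support has convergent,
  hence bounded, integrals.\<close>

lemma mass_bounded:
  fixes \<gamma>n :: "nat \<Rightarrow> 'a::euclidean_space measure"
  assumes \<gamma>n: "\<And>n. pos_radon (\<gamma>n n)" and w: "weak_star_pos \<gamma>n \<gamma>"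
  shows "\<exists>B. \<forall>n. measure (\<gamma>n n) (cball 0 R) \<le> B"
proof -
  define f :: "'a \<Rightarrow> real" where "f x = max 0 (min 1 (R + 1 - norm x))" for x
  have f: "cc f" unfolding cc_def f_def by (intro conjI exI[of _ "R + 1"] continuous_intros) auto
  have "convergent (\<lambda>n. \<integral>x. f x \<partial>\<gamma>n n)"
    using w f unfolding weak_star_pos_def cc_Cc[symmetric] convergent_def by blast
  then obtain B where B: "\<And>n. \<bar>\<integral>x. f x \<partial>\<gamma>n n\<bar> \<le> B"
    using Bseq_def convergent_imp_Bseq by (metis real_norm_def)
  have "measure (\<gamma>n n) (cball 0 R) \<le> B" for n
  proof -
    have "measure (\<gamma>n n) (cball 0 R) = (\<integral>x. indicator (cball 0 R) x \<partial>\<gamma>n n)"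
      by (simp add: pos_radonD(1,2)[OF \<gamma>n])
    also have "\<dots> \<le> (\<integral>x. f x \<partial>\<gamma>n n)"
    proof (rule integral_mono)
      show "integrable (\<gamma>n n) (indicator (cball 0 R) :: 'a \<Rightarrow> real)"
        by (rule integrable_bbs[OF \<gamma>n bbs_indicator]) auto
      show "integrable (\<gamma>n n) f" by (rule integrable_bbs[OF \<gamma>n cc_bbs[OF f]])
    qed (auto simp: f_def indicator_def)
    also have "\<dots> \<le> B" using B[of n] by linarith
    finally show ?thesis .
  qed
  then show ?thesis by blast
qed

text \<open>There are finitely many cells. Where the limit mass is positive, convergence of the
  masses is also relative convergence; the remaining cells have limit mass 0, so their total mass
  becomes small.\<close>

lemma bump_eventually:
  fixes \<gamma>n :: "nat \<Rightarrow> 'a::euclidean_space measure"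
  assumes \<theta>: "bump_family h R J \<theta>" and w: "weak_star_pos \<gamma>n \<gamma>" and \<eta>: "0 < \<eta>"
  shows "eventually (\<lambda>n. (\<forall>j\<in>{j\<in>J. 0 < (\<integral>x. \<theta> j x \<partial>\<gamma>)}. 0 < (\<integral>x. \<theta> j x \<partial>\<gamma>n n) \<and>
      \<bar>(\<integral>x. \<theta> j x \<partial>\<gamma>) - (\<integral>x. \<theta> j x \<partial>\<gamma>n n)\<bar> \<le> \<eta> * (\<integral>x. \<theta> j x \<partial>\<gamma>n n)) \<and>
    (\<Sum>j\<in>J - {j\<in>J. 0 < (\<integral>x. \<theta> j x \<partial>\<gamma>)}. \<integral>x. \<theta> j x \<partial>\<gamma>n n) \<le> \<eta>) sequentially"
proof (intro eventually_conj eventually_ball_finite ballI)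
  have l: "(\<lambda>n. \<integral>x. \<theta> j x \<partial>\<gamma>n n) \<longlonglongrightarrow> (\<integral>x. \<theta> j x \<partial>\<gamma>)" if "j \<in> J" for j
    using w bump_cc[OF \<theta> that] unfolding weak_star_pos_def cc_Cc[symmetric] by blast
  show "finite {j \<in> J. 0 < (\<integral>x. \<theta> j x \<partial>\<gamma>)}" using bump_familyD(1)[OF \<theta>] by simp
  fix j assume "j \<in> {j\<in>J. 0 < (\<integral>x. \<theta> j x \<partial>\<gamma>)}"
  then have j: "j \<in> J" "0 < (\<integral>x. \<theta> j x \<partial>\<gamma>)" by auto
  show "eventually (\<lambda>n. 0 < (\<integral>x. \<theta> j x \<partial>\<gamma>n n)) sequentially" by (rule order_tendstoD(1)[OF l[OF j(1)] j(2)])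
  have "(\<lambda>n. \<eta> * (\<integral>x. \<theta> j x \<partial>\<gamma>n n) - \<bar>(\<integral>x. \<theta> j x \<partial>\<gamma>) - (\<integral>x. \<theta> j x \<partial>\<gamma>n n)\<bar>)
      \<longlonglongrightarrow> \<eta> * (\<integral>x. \<theta> j x \<partial>\<gamma>) - \<bar>(\<integral>x. \<theta> j x \<partial>\<gamma>) - (\<integral>x. \<theta> j x \<partial>\<gamma>)\<bar>"
    by (intro tendsto_intros l j)
  moreover have "0 < \<eta> * (\<integral>x. \<theta> j x \<partial>\<gamma>) - \<bar>(\<integral>x. \<theta> j x \<partial>\<gamma>) - (\<integral>x. \<theta> j x \<partial>\<gamma>)\<bar>" using \<eta> j by simp
  ultimately show "eventually (\<lambda>n. \<bar>(\<integral>x. \<theta> j x \<partial>\<gamma>) - (\<integral>x. \<theta> j x \<partial>\<gamma>n n)\<bar> \<le> \<eta> * (\<integral>x. \<theta> j x \<partial>\<gamma>n n)) sequentially"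
    by (rule eventually_mono[OF order_tendstoD(1)]) simp
next
  let ?N = "J - {j\<in>J. 0 < (\<integral>x. \<theta> j x \<partial>\<gamma>)}"
  have z: "(\<integral>x. \<theta> j x \<partial>\<gamma>) = 0" if "j \<in> ?N" for j
    using that bump_familyD(3)[OF \<theta>] by (intro antisym integral_nonneg_AE) auto
  have "(\<lambda>n. \<Sum>j\<in>?N. \<integral>x. \<theta> j x \<partial>\<gamma>n n) \<longlonglongrightarrow> (\<Sum>j\<in>?N. \<integral>x. \<theta> j x \<partial>\<gamma>)"
    using w bump_cc[OF \<theta>] unfolding weak_star_pos_def cc_Cc[symmetric] by (intro tendsto_sum) auto
  moreover have "(\<Sum>j\<in>?N. \<integral>x. \<theta> j x \<partial>\<gamma>) < \<eta>" using \<eta> z by simp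
  ultimately show "eventually (\<lambda>n. (\<Sum>j\<in>?N. \<integral>x. \<theta> j x \<partial>\<gamma>n n) \<le> \<eta>) sequentially"
    by (rule eventually_mono[OF order_tendstoD(2)]) simp
qed

text \<open>Beyond any index P and a given \<open>Q k\<close> occur together, so indices can be
  chosen one after the other; the tolerance \<open>Q k\<close> may change with the stage.\<close>

lemma frequently_subsequence:
  assumes P: "\<exists>\<^sub>F n in sequentially. P n" and Q: "\<And>k. eventually (Q k) sequentially"
  shows "\<exists>n. strict_mono n \<and> (\<forall>k::nat. P (n k) \<and> Q k (n k))"
proof -
  have ex: "\<exists>n>m. P n \<and> Q k n" for m k
  proof -
    have "eventually (\<lambda>n. m < n \<and> Q k n) sequentially" using eventually_gt_at_top Q by (rule eventually_conj)
    from frequently_ex[OF frequently_eventually_frequently[OF P this]] show ?thesis by blast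
  qed
  have "\<exists>n. \<forall>k. (P (n k) \<and> Q k (n k)) \<and> n k < n (Suc k)"
  proof (rule dependent_nat_choice)
    show "\<exists>n. P n \<and> Q 0 n" using ex by blast
    show "\<exists>n'. (P n' \<and> Q (Suc k) n') \<and> n < n'" for n k using ex[of n "Suc k"] by blast
  qed
  then show ?thesis using strict_mono_Suc_iff by blast
qed

text \<open>Trades the p-th root in \<open>W_dist\<close> for an action bound y^p, in both
  directions. The root is taken of \<open>enn2real\<close>, so recovering the integral from it uses
  the finiteness built into \<open>CE_act\<close>.\<close>

lemma W_dist_bound:
  assumes p: "1 < p" and y: "0 \<le> y"
  shows "W_dist p \<phi> \<gamma> \<mu>0 \<mu>1 < ennreal y \<Longrightarrow>
      \<exists>(\<mu>, \<nu>)\<in>CE_act \<phi> \<gamma> \<mu>0 \<mu>1. (\<integral>\<^sup>+t\<in>{0..1}. action \<phi> (\<mu> t) (\<nu> t) \<gamma> \<partial>lborel) \<le> ennreal (y powr p)"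
    and "\<exists>(\<mu>, \<nu>)\<in>CE_act \<phi> \<gamma> \<mu>0 \<mu>1. (\<integral>\<^sup>+t\<in>{0..1}. action \<phi> (\<mu> t) (\<nu> t) \<gamma> \<partial>lborel) \<le> ennreal (y powr p) \<Longrightarrow>
      W_dist p \<phi> \<gamma> \<mu>0 \<mu>1 \<le> ennreal y"
proof -
  assume "W_dist p \<phi> \<gamma> \<mu>0 \<mu>1 < ennreal y"
  then obtain \<mu> \<nu> where m: "(\<mu>, \<nu>) \<in> CE_act \<phi> \<gamma> \<mu>0 \<mu>1"
    and l: "ennreal (enn2real (\<integral>\<^sup>+t\<in>{0..1}. action \<phi> (\<mu> t) (\<nu> t) \<gamma> \<partial>lborel) powr (1 / p)) < ennreal y"
    unfolding W_dist_def INF_less_iff by auto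
  define E where "E = (\<integral>\<^sup>+t\<in>{0..1}. action \<phi> (\<mu> t) (\<nu> t) \<gamma> \<partial>lborel)"
  have "E < \<infinity>" using m by (simp add: CE_act_def E_def)
  then have "E = ennreal (enn2real E)" by simp
  also have "enn2real E = (enn2real E powr (1 / p)) powr p" using p by (simp add: powr_powr)
  also have "\<dots> \<le> y powr p"
  proof (rule powr_mono2)
    show "enn2real E powr (1 / p) \<le> y" using l y unfolding E_def[symmetric] by (simp add: ennreal_less_iff)
  qed (use p in auto)
  finally have "E \<le> ennreal (y powr p)" by (simp add: ennreal_leI)
  then show "\<exists>(\<mu>, \<nu>)\<in>CE_act \<phi> \<gamma> \<mu>0 \<mu>1. (\<integral>\<^sup>+t\<in>{0..1}. action \<phi> (\<mu> t) (\<nu> t) \<gamma> \<partial>lborel) \<le> ennreal (y powr p)"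
    using m unfolding E_def by blast
next
  assume "\<exists>(\<mu>, \<nu>)\<in>CE_act \<phi> \<gamma> \<mu>0 \<mu>1. (\<integral>\<^sup>+t\<in>{0..1}. action \<phi> (\<mu> t) (\<nu> t) \<gamma> \<partial>lborel) \<le> ennreal (y powr p)"
  then obtain \<mu> \<nu> where m: "(\<mu>, \<nu>) \<in> CE_act \<phi> \<gamma> \<mu>0 \<mu>1"
    and l: "(\<integral>\<^sup>+t\<in>{0..1}. action \<phi> (\<mu> t) (\<nu> t) \<gamma> \<partial>lborel) \<le> ennreal (y powr p)" by blast
  define E where "E = (\<integral>\<^sup>+t\<in>{0..1}. action \<phi> (\<mu> t) (\<nu> t) \<gamma> \<partial>lborel)"
  have "W_dist p \<phi> \<gamma> \<mu>0 \<mu>1 \<le> ennreal (enn2real E powr (1 / p))"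
    unfolding W_dist_def E_def using m by (intro INF_lower2[of "(\<mu>, \<nu>)"]) auto
  also have "enn2real E powr (1 / p) \<le> (y powr p) powr (1 / p)"
    using l p unfolding E_def[symmetric] by (intro powr_mono2 enn2real_leI) auto
  also have "\<dots> = y" using p y by (simp add: powr_powr)
  finally show "W_dist p \<phi> \<gamma> \<mu>0 \<mu>1 \<le> ennreal y" by (simp add: ennreal_leI)
qed

text \<open>At stage k the partition is fixed first, from \<open>\<gamma>\<close> alone; then
  \<open>n k\<close> is taken so large that the masses of its finitely many cells are accurate,
  among the infinitely many indices whose distance is below y.\<close>

lemma W_dist_limit_le:
  fixes p a b :: real
    and \<gamma>n :: "nat \<Rightarrow> 'a::euclidean_space measure" and \<gamma> :: "'a measure"
    and \<mu>0n \<mu>1n :: "nat \<Rightarrow> 'a set \<Rightarrow> real" and \<mu>0 \<mu>1 :: "'a set \<Rightarrow> real"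
    and \<phi>n :: "nat \<Rightarrow> real \<times> 'a \<Rightarrow> ennreal" and \<phi> :: "real \<times> 'a \<Rightarrow> ennreal"
  assumes p: "1 < p" and ab: "a < b"
    and \<gamma>n: "\<And>n. pos_radon (\<gamma>n n)" and \<gamma>: "pos_radon \<gamma>" and w\<gamma>: "weak_star_pos \<gamma>n \<gamma>"
    and \<mu>0: "radon \<mu>0" "weak_star \<mu>0n \<mu>0" and \<mu>1: "radon \<mu>1" "weak_star \<mu>1n \<mu>1"
    and \<phi>n: "\<And>n. \<phi>n n \<in> admissible_on p a b" and \<phi>: "\<phi> \<in> admissible_on p a b"
    and mono: "\<And>n x. \<phi>n n x \<le> \<phi>n (Suc n) x" and lim: "\<And>x. (\<lambda>n. \<phi>n n x) \<longlonglongrightarrow> \<phi> x"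
    and y: "0 \<le> y" and freq: "\<exists>\<^sub>F n in sequentially. W_dist p (\<phi>n n) (\<gamma>n n) (\<mu>0n n) (\<mu>1n n) < ennreal y"
  shows "W_dist p \<phi> \<gamma> \<mu>0 \<mu>1 \<le> ennreal y"
proof -
  have "\<exists>J \<theta>. bump_family (1 / (real k + 1)) (real k) (J :: 'a set) \<theta>" for k
    by (rule bump_family_exists) simp
  then obtain J \<theta> where \<theta>: "\<And>k. bump_family (1 / (real k + 1)) (real k) (J k :: 'a set) (\<theta> k)" by metis
  \<comment> \<open>Cells charged by the limit measure; only for these do the cell masses have a
    ratio tending to 1.\<close>
  define J1 where "J1 k = {j\<in>J k. 0 < (\<integral>x. \<theta> k j x \<partial>\<gamma>)}" for k
  define ok where "ok k n \<longleftrightarrow> (\<forall>j\<in>J1 k. 0 < (\<integral>x. \<theta> k j x \<partial>\<gamma>n n) \<and>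
      \<bar>(\<integral>x. \<theta> k j x \<partial>\<gamma>) - (\<integral>x. \<theta> k j x \<partial>\<gamma>n n)\<bar> \<le> 1 / (real k + 1) * (\<integral>x. \<theta> k j x \<partial>\<gamma>n n)) \<and>
    (\<Sum>j\<in>J k - J1 k. \<integral>x. \<theta> k j x \<partial>\<gamma>n n) \<le> 1 / (real k + 1)" for k n
  have ev: "eventually (ok k) sequentially" for k
    unfolding ok_def[abs_def] J1_def by (rule bump_eventually[OF \<theta> w\<gamma>]) simp
  obtain n where n: "strict_mono n"
    "\<And>k. W_dist p (\<phi>n (n k)) (\<gamma>n (n k)) (\<mu>0n (n k)) (\<mu>1n (n k)) < ennreal y" "\<And>k. ok k (n k)"
    using frequently_subsequence[of _ ok, OF freq ev] by blast
  have "\<forall>k. \<exists>q. q \<in> CE_act (\<phi>n (n k)) (\<gamma>n (n k)) (\<mu>0n (n k)) (\<mu>1n (n k)) \<and>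
      (\<integral>\<^sup>+t\<in>{0..1}. action (\<phi>n (n k)) (fst q t) (snd q t) (\<gamma>n (n k)) \<partial>lborel) \<le> ennreal (y powr p)"
    using W_dist_bound(1)[OF p y n(2)] by (simp add: case_prod_beta Bex_def)
  from choice[OF this] obtain q where
    q: "\<forall>k. q k \<in> CE_act (\<phi>n (n k)) (\<gamma>n (n k)) (\<mu>0n (n k)) (\<mu>1n (n k)) \<and>
      (\<integral>\<^sup>+t\<in>{0..1}. action (\<phi>n (n k)) (fst (q k) t) (snd (q k) t) (\<gamma>n (n k)) \<partial>lborel) \<le> ennreal (y powr p)" ..
  define \<mu> where "\<mu> k = fst (q k)" for k
  define \<nu> where "\<nu> k = snd (q k)" for k
  have \<mu>\<nu>: "(\<mu> k, \<nu> k) \<in> CE_act (\<phi>n (n k)) (\<gamma>n (n k)) (\<mu>0n (n k)) (\<mu>1n (n k))"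
      "(\<integral>\<^sup>+t\<in>{0..1}. action (\<phi>n (n k)) (\<mu> k t) (\<nu> k t) (\<gamma>n (n k)) \<partial>lborel) \<le> ennreal (y powr p)" for k
    using q by (simp_all add: \<mu>_def \<nu>_def)
  have CE: "(\<mu> k, \<nu> k) \<in> CE 1" "\<mu> k 0 = \<mu>0n (n k)" "\<mu> k 1 = \<mu>1n (n k)" for k
    using \<mu>\<nu>(1)[of k] by (auto simp: CE_act_def)
  obtain wt where wt: "wt \<in> borel_measurable borel" "\<And>x. 0 < wt x" "\<And>x. wt x \<le> 1"
      "(\<integral>\<^sup>+x. ennreal (wt x) \<partial>\<gamma>) < \<infinity>" "\<And>R. \<exists>c>0. \<forall>x. norm x \<le> R \<longrightarrow> c \<le> wt x"
    using weight_exists[OF \<gamma>] by blast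
  have "limit_setup p a b (y powr p) ((a + b) / 2) (\<lambda>k. \<phi>n (n k)) \<phi> (\<lambda>k. \<gamma>n (n k)) \<gamma> \<mu> \<nu> J J1 \<theta> \<mu>0 \<mu>1 wt"
  proof (rule limit_setup.intro)
    show "smoothed_curve p a b (y powr p) (\<phi>n (n k)) (\<gamma>n (n k)) (\<mu> k) (\<nu> k) \<gamma> (J k) (J1 k) (\<theta> k)
        (1 / (real k + 1)) (real k) (1 / (real k + 1)) ((a + b) / 2)" for k
    proof (intro smoothed_curve.intro action_curve.intro smoothed_curve_axioms.intro \<phi>n p ab \<gamma>n \<gamma> CE(1) \<mu>\<nu>(2) \<theta>)
      show "(\<integral>x. \<theta> k j x \<partial>\<gamma>) = 0" if "j \<in> J k" "j \<notin> J1 k" for j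
        using that bump_familyD(3)[OF \<theta>] by (intro antisym integral_nonneg_AE) (auto simp: J1_def)
    qed (use ab n(3)[of k] in \<open>auto simp: ok_def\<close>)
    show "(\<Sum>j\<in>J k - J1 k. \<integral>x. \<theta> k j x \<partial>\<gamma>n (n k)) \<le> 1 / (real k + 1)" for k
      using n(3)[of k] by (simp add: ok_def)
    show "\<phi>n (n k) z \<le> \<phi>n (n (Suc k)) z" for k z
      by (rule lift_Suc_mono_le[of "\<lambda>i. \<phi>n i z"]) (use mono n(1) in \<open>auto simp: strict_mono_Suc_iff less_imp_le\<close>)
    show "(\<lambda>k. \<phi>n (n k) z) \<longlonglongrightarrow> \<phi> z" for z
      using LIMSEQ_subseq_LIMSEQ[OF lim n(1)] by (simp add: o_def)
    show "\<exists>B. \<forall>k. measure (\<gamma>n (n k)) (cball 0 R) \<le> B" for R using mass_bounded[OF \<gamma>n w\<gamma>, of R] by blast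
    show "(\<lambda>k. signed_integral (\<mu> k 0) f) \<longlonglongrightarrow> signed_integral \<mu>0 f" "(\<lambda>k. signed_integral (\<mu> k 1) f) \<longlonglongrightarrow> signed_integral \<mu>1 f"
      if "cc f" for f
      using \<mu>0(2) \<mu>1(2) that LIMSEQ_subseq_LIMSEQ[OF _ n(1), of "\<lambda>i. signed_integral (\<mu>0n i) f"]
        LIMSEQ_subseq_LIMSEQ[OF _ n(1), of "\<lambda>i. signed_integral (\<mu>1n i) f"]
      unfolding weak_star_def cc_Cc[symmetric] CE by (auto simp: o_def cc_Cc)
  qed (intro \<phi> \<mu>0 \<mu>1 wt)+
  then show ?thesis by (intro W_dist_bound(2)[OF p y] limit_setup.limit_exists)
qed

theorem proposition3p3:
  fixes p a b :: real
    and \<gamma>n :: "nat \<Rightarrow> 'a::euclidean_space measure" and \<gamma> :: "'a measure"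
    and \<mu>0n \<mu>1n :: "nat \<Rightarrow> 'a set \<Rightarrow> real" and \<mu>0 \<mu>1 :: "'a set \<Rightarrow> real"
    and \<phi>n :: "nat \<Rightarrow> real \<times> 'a \<Rightarrow> ennreal" and \<phi> :: "real \<times> 'a \<Rightarrow> ennreal"
  assumes "1 < p" and "a < b"
    and "\<And>n. pos_radon (\<gamma>n n)" and "pos_radon \<gamma>" and "weak_star_pos \<gamma>n \<gamma>"
    and "\<And>n. radon (\<mu>0n n)" and "radon \<mu>0" and "weak_star \<mu>0n \<mu>0"
    and "\<And>n. radon (\<mu>1n n)" and "radon \<mu>1" and "weak_star \<mu>1n \<mu>1"
    and "\<And>n. \<phi>n n \<in> admissible_on p a b" and "\<phi> \<in> admissible_on p a b"
    and "\<And>n x. \<phi>n n x \<le> \<phi>n (Suc n) x"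
    and "\<And>x. (\<lambda>n. \<phi>n n x) \<longlonglongrightarrow> \<phi> x"
  shows "liminf (\<lambda>n. W_dist p (\<phi>n n) (\<gamma>n n) (\<mu>0n n) (\<mu>1n n)) \<ge> W_dist p \<phi> \<gamma> \<mu>0 \<mu>1"
proof (rule ccontr)
  assume "\<not> ?thesis"
  then have "liminf (\<lambda>n. W_dist p (\<phi>n n) (\<gamma>n n) (\<mu>0n n) (\<mu>1n n)) < W_dist p \<phi> \<gamma> \<mu>0 \<mu>1" by simp
  then obtain c where c: "liminf (\<lambda>n. W_dist p (\<phi>n n) (\<gamma>n n) (\<mu>0n n) (\<mu>1n n)) < c" "c < W_dist p \<phi> \<gamma> \<mu>0 \<mu>1"
    using dense by blast
  \<comment> \<open>c is finite because it lies strictly below another value, so it comes from a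
    real level y.\<close>
  then obtain y where y: "0 \<le> y" "c = ennreal y" by (cases c) auto
  have "\<exists>\<^sub>F n in sequentially. W_dist p (\<phi>n n) (\<gamma>n n) (\<mu>0n n) (\<mu>1n n) < ennreal y"
  proof (rule ccontr)
    assume "\<not> ?thesis"
    then have "eventually (\<lambda>n. ennreal y \<le> W_dist p (\<phi>n n) (\<gamma>n n) (\<mu>0n n) (\<mu>1n n)) sequentially"
      by (simp add: not_frequently not_less)
    then have "ennreal y \<le> liminf (\<lambda>n. W_dist p (\<phi>n n) (\<gamma>n n) (\<mu>0n n) (\<mu>1n n))" by (rule Liminf_bounded)
    then show False using c y by simp
  qed
  then have "W_dist p \<phi> \<gamma> \<mu>0 \<mu>1 \<le> ennreal y"
    by (rule W_dist_limit_le[OF assms(1-5,7,8,10-15) y(1)])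
  then show False using c y by simp
qed

end
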